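(* Suppose $E$ is a Neumann interior weight on $\Omega$ and $t\in\mathbb{R}$, $t\neq\frac12$. Then $$\int_\Omega E^{2t}|\nabla u|_A^2\,dx+\left(\tfrac12-t\right)\int_\Omega E^{2t}u^2\,dx\ \ge\ \left(t-\tfrac12\right)^2\int_\Omega E^{2t-2}|\nabla E|_A^2u^2\,dx\qquad\text{for all }u\in Y_t.$$ Moreover the constants are optimal (if $(t-\frac12)^2$ is kept fixed then $\frac12-t$ cannot be replaced by a smaller constant, and if $\frac12-t$ is kept fixed then $(t-\frac12)^2$ cannot be replaced by a larger constant) and not attained (equality does not hold for any nonzero $u\in Y_t$).
   Context: $\Omega\subset\mathbb{R}^n$ is a bounded connected domain with smooth boundary. $A(x)=(a^{i,j}(x))$ is an $n\times n$ symmetric, uniformly positive definite matrix with $a^{i,j}\in C^\infty(\overline\Omega)$. For $\xi\in\mathbb{R}^n$, $|\xi|_A^2:=A(x)\xi\cdot\xi$, and $\mathcal L_A(E):=-\mathrm{div}(A\nabla E)$ (in the distributional sense). $E$ is called a Neumann interior weight on $\Omega$ if there exists some compact $K\subset\Omega$ with $\dim_{box}(K)<n-2$ such that $E\in C^\infty(\overline\Omega\setminus K)$, $\inf_\Omega E>0$, $\mathcal L_A(E)+E$ is a nonnegative nonzero measure $\mu$ whose support is $K$, $E=\infty$ on $K$, and $A\nabla E\cdot\nu=0$ on $\partial\Omega$, where $\nu(x)$ denotes the outward normal vector at $x\in\partial\Omega$. For compact $K\subset\mathbb{R}^n$, $\dim_{box}(K):=n-\lim_{r\searrow0}\frac{\log(\mathcal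 H^n(K_r))}{\log r}$ provided the limit exists, where $K_r:=\{x\in\Omega:\mathrm{dist}(x,K)<r\}$ and $\mathcal H^n$ is $n$-dimensional Hausdorff measure. For $t\neq\frac12$, $Y_t$ is the completion of $C_c^{0,1}(\overline\Omega\setminus K)$ (Lipschitz functions with compact support in $\overline\Omega\setminus K$, not required to vanish on $\partial\Omega$) with respect to the norm $\|\cdot\|_t$ given by $\|u\|_t^2:=\int_\Omega E^{2t}|\nabla u|^2\,dx+\int_\Omega E^{2t}u^2\,dx$ if $t<\frac12$, and $\|u\|_t^2:=\int_\Omega E^{2t}|\nabla u|^2\,dx$ if $t>\frac12$. *)

theory Defs
  imports "HOL-Analysis.Analysis"
begin

section \<open>Smooth functions\<close>

text \<open>\<open>Ck_on k f S\<close> and \<open>smooth_on f S\<close> are used for open \<open>S\<close> only.\<close>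

primrec Ck_on :: "nat \<Rightarrow> ('a::euclidean_space \<Rightarrow> real) \<Rightarrow> 'a set \<Rightarrow> bool" where
  "Ck_on 0 f S \<longleftrightarrow> continuous_on S f"
| "Ck_on (Suc k) f S \<longleftrightarrow> f differentiable_on S \<and>
     (\<forall>i\<in>Basis. Ck_on k (\<lambda>x. frechet_derivative f (at x) i) S)"

definition smooth_on :: "('a::euclidean_space \<Rightarrow> real) \<Rightarrow> 'a set \<Rightarrow> bool" where
  "smooth_on f S \<longleftrightarrow> (\<forall>k. Ck_on k f S)"

text \<open>
  \<open>f \<in> C\<^sup>\<infinity>(S)\<close> for a set \<open>S\<close> that need not be open, such as \<open>closure \<Omega> - K\<close>: \<open>f\<close> is the
  restriction to \<open>S\<close> of a smooth function defined on an open neighbourhood of \<open>S\<close>. The values of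
  \<open>f\<close> off \<open>S\<close> play no role.
\<close>

definition smooth_upto :: "('a::euclidean_space \<Rightarrow> real) \<Rightarrow> 'a set \<Rightarrow> bool" where
  "smooth_upto f S \<longleftrightarrow> (\<exists>U g. open U \<and> S \<subseteq> U \<and> smooth_on g U \<and> (\<forall>x\<in>S. g x = f x))"

definition grad :: "(real^'n \<Rightarrow> real) \<Rightarrow> real^'n \<Rightarrow> real^'n" where
  "grad f x = (\<chi> i. frechet_derivative f (at x) (axis i 1))"

definition divergence :: "(real^'n \<Rightarrow> real^'n) \<Rightarrow> real^'n \<Rightarrow> real" where
  "divergence F x = (\<Sum>i\<in>UNIV. frechet_derivative (\<lambda>y. F y $ i) (at x) (axis i 1))"

text \<open>\<open>C\<^sub>c\<^sup>\<infinity>(S)\<close> for open \<open>S\<close>; the elements are extended by zero.\<close>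

definition test_functions :: "(real^'n) set \<Rightarrow> (real^'n \<Rightarrow> real) set" where
  "test_functions S =
     {\<phi>. smooth_on \<phi> UNIV \<and> (\<exists>C. compact C \<and> C \<subseteq> S \<and> (\<forall>x. x \<notin> C \<longrightarrow> \<phi> x = 0))}"

section \<open>The domain and the coefficient matrix\<close>

text \<open>\<open>\<phi>\<close> is a defining function on \<open>U\<close> for the side of the boundary on which \<open>\<Omega>\<close> lies.\<close>

definition local_defining_function ::
    "(real^'n) set \<Rightarrow> (real^'n) set \<Rightarrow> (real^'n \<Rightarrow> real) \<Rightarrow> bool" where
  "local_defining_function \<Omega> U \<phi> \<longleftrightarrow>
     open U \<and> smooth_on \<phi> U \<and> (\<forall>y\<in>U. grad \<phi> y \<noteq> 0) \<and> \<Omega> \<inter> U = {y\<in>U. \<phi> y < 0}"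

definition smooth_boundary :: "(real^'n) set \<Rightarrow> bool" where
  "smooth_boundary \<Omega> \<longleftrightarrow> (\<forall>x\<in>frontier \<Omega>. \<exists>U \<phi>. x \<in> U \<and> local_defining_function \<Omega> U \<phi>)"

definition outward_normal :: "(real^'n) set \<Rightarrow> real^'n \<Rightarrow> real^'n \<Rightarrow> bool" where
  "outward_normal \<Omega> x \<nu> \<longleftrightarrow>
     (\<exists>U \<phi>. x \<in> U \<and> local_defining_function \<Omega> U \<phi> \<and> \<nu> = grad \<phi> x /\<^sub>R norm (grad \<phi> x))"

definition smooth_bounded_domain :: "(real^'n) set \<Rightarrow> bool" where
  "smooth_bounded_domain \<Omega> \<longleftrightarrow>
     open \<Omega> \<and> \<Omega> \<noteq> {} \<and> connected \<Omega> \<and> bounded \<Omega> \<and> smooth_boundary \<Omega>"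

definition sq_norm_wrt :: "real^'n^'n \<Rightarrow> real^'n \<Rightarrow> real" where
  "sq_norm_wrt M \<xi> = (M *v \<xi>) \<bullet> \<xi>"

definition smooth_elliptic_matrix :: "(real^'n) set \<Rightarrow> (real^'n \<Rightarrow> real^'n^'n) \<Rightarrow> bool" where
  "smooth_elliptic_matrix \<Omega> A \<longleftrightarrow>
     (\<forall>i j. smooth_upto (\<lambda>x. A x $ i $ j) (closure \<Omega>)) \<and>
     (\<forall>x\<in>closure \<Omega>. transpose (A x) = A x) \<and>
     (\<exists>c>0. \<forall>x\<in>closure \<Omega>. \<forall>\<xi>. sq_norm_wrt (A x) \<xi> \<ge> c * (norm \<xi>)\<^sup>2)"

section \<open>Neumann interior weights\<close>

definition has_box_dim :: "(real^'n) set \<Rightarrow> (real^'n) set \<Rightarrow> real \<Rightarrow> bool" where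
  "has_box_dim \<Omega> K d \<longleftrightarrow>
     ((\<lambda>r. ln (measure lebesgue {x\<in>\<Omega>. infdist x K < r}) / ln r)
        \<longlongrightarrow> real CARD('n) - d) (at_right 0)"

definition measure_support :: "'a::topological_space measure \<Rightarrow> 'a set" where
  "measure_support \<mu> = {x. \<forall>U. open U \<and> x \<in> U \<longrightarrow> emeasure \<mu> U \<noteq> 0}"

definition locally_integrable :: "('a::euclidean_space) set \<Rightarrow> ('a \<Rightarrow> 'b::euclidean_space) \<Rightarrow> bool"
  where "locally_integrable S f \<longleftrightarrow> (\<forall>C. compact C \<and> C \<subseteq> S \<longrightarrow> f absolutely_integrable_on C)"

text \<open>
  \<open>- div (A \<nabla>E) + E = \<mu>\<close> in the sense of distributions on \<open>\<Omega>\<close>. As \<open>A\<close> is smooth and symmetric,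
  \<open>- div (A \<nabla>E)\<close> applied to \<open>\<phi>\<close> is the integral of \<open>- E div (A \<nabla>\<phi>)\<close>. A Radon measure on \<open>\<Omega>\<close> with
  compact support is represented by its extension by zero to a Borel measure on the whole space.
\<close>

definition distributional_equation ::
    "(real^'n) set \<Rightarrow> (real^'n \<Rightarrow> real^'n^'n) \<Rightarrow> (real^'n \<Rightarrow> real) \<Rightarrow> (real^'n) measure \<Rightarrow> bool" where
  "distributional_equation \<Omega> A E \<mu> \<longleftrightarrow>
     locally_integrable \<Omega> E \<and>
     (\<forall>\<phi>\<in>test_functions \<Omega>.
        (LINT x:\<Omega>|lebesgue. E x * (- divergence (\<lambda>y. A y *v grad \<phi> y) x))
          + (LINT x:\<Omega>|lebesgue. E x * \<phi> x)
        = (LINT x|\<mu>. \<phi> x))"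

text \<open>
  The weight is a function with values in \<open>(0, \<infinity>]\<close> which is infinite exactly on \<open>K\<close>. Here \<open>E\<close> is
  real-valued, its values on the null set \<open>K\<close> are irrelevant, and \<open>E = \<infinity>\<close> on \<open>K\<close> says that \<open>E\<close>
  tends to infinity at each point of \<open>K\<close>; this is what \<open>E = \<infinity>\<close> means for the lower
  semicontinuous representative of a supersolution, or for \<open>E\<close> as a continuous map into \<open>(0, \<infinity>]\<close>.
  At a boundary point, \<open>A \<nabla>E\<close> is the limit of its values in \<open>\<Omega>\<close>.
\<close>

definition neumann_interior_weight ::
    "(real^'n) set \<Rightarrow> (real^'n \<Rightarrow> real^'n^'n) \<Rightarrow> (real^'n) set \<Rightarrow> (real^'n \<Rightarrow> real) \<Rightarrow> bool" where
  "neumann_interior_weight \<Omega> A K E \<longleftrightarrow>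
     compact K \<and> K \<subseteq> \<Omega> \<and>
     (\<exists>d. has_box_dim \<Omega> K d \<and> d < real CARD('n) - 2) \<and>
     smooth_upto E (closure \<Omega> - K) \<and>
     (\<exists>c>0. \<forall>x\<in>\<Omega> - K. c \<le> E x) \<and>
     (\<exists>\<mu>. sets \<mu> = sets borel \<and> (\<forall>C. compact C \<longrightarrow> emeasure \<mu> C < \<infinity>) \<and>
          emeasure \<mu> UNIV \<noteq> 0 \<and> measure_support \<mu> = K \<and> distributional_equation \<Omega> A E \<mu>) \<and>
     (\<forall>x\<in>K. filterlim E at_top (at x within \<Omega> - K)) \<and>
     (\<forall>x\<in>frontier \<Omega>. \<forall>\<nu>. outward_normal \<Omega> x \<nu> \<longrightarrow>
        ((\<lambda>y. (A y *v grad E y) \<bullet> \<nu>) \<longlongrightarrow> 0) (at x within \<Omega>))"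

section \<open>The spaces \<open>Y\<^sub>t\<close>\<close>

definition weak_gradient :: "(real^'n) set \<Rightarrow> (real^'n \<Rightarrow> real) \<Rightarrow> (real^'n \<Rightarrow> real^'n) \<Rightarrow> bool" where
  "weak_gradient S u p \<longleftrightarrow>
     locally_integrable S u \<and> locally_integrable S p \<and>
     (\<forall>\<phi>\<in>test_functions S.
        (LINT x:S|lebesgue. u x *\<^sub>R grad \<phi> x) = - (LINT x:S|lebesgue. \<phi> x *\<^sub>R p x))"

text \<open>The weak gradient, determined up to a null set; meaningful only if one exists.\<close>

definition wgrad :: "(real^'n) set \<Rightarrow> (real^'n \<Rightarrow> real) \<Rightarrow> real^'n \<Rightarrow> real^'n" where
  "wgrad S u = (SOME p. weak_gradient S u p)"

text \<open>\<open>C\<^sub>c\<^sup>0\<^sup>,\<^sup>1(closure \<Omega> - K)\<close>, each element being extended by zero to \<open>K\<close>.\<close>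

definition lipschitz_compact_support :: "(real^'n) set \<Rightarrow> (real^'n) set \<Rightarrow> (real^'n \<Rightarrow> real) set" where
  "lipschitz_compact_support \<Omega> K =
     {u. (\<exists>L. L-lipschitz_on (closure \<Omega>) u) \<and>
         (\<exists>C. compact C \<and> C \<subseteq> closure \<Omega> - K \<and> (\<forall>x\<in>closure \<Omega> - C. u x = 0))}"

text \<open>
  \<open>K\<close> is a null set, so gradients are taken in \<open>\<Omega> - K\<close>, where \<open>E\<close> is locally bounded. (In \<open>\<Omega>\<close> an
  element of \<open>Y\<^sub>t\<close> need not be locally integrable when \<open>t < 0\<close>.)
\<close>

definition Y_norm ::
    "(real^'n) set \<Rightarrow> (real^'n) set \<Rightarrow> (real^'n \<Rightarrow> real) \<Rightarrow> real \<Rightarrow> (real^'n \<Rightarrow> real) \<Rightarrow> real" where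
  "Y_norm \<Omega> K E t u = sqrt
     ((LINT x:\<Omega>|lebesgue. E x powr (2 * t) * (norm (wgrad (\<Omega> - K) u x))\<^sup>2)
      + (if t < 1/2 then LINT x:\<Omega>|lebesgue. E x powr (2 * t) * (u x)\<^sup>2 else 0))"

text \<open>
  The completion, realised as a space of functions: its elements are the almost everywhere limits
  of Cauchy sequences. This represents the abstract completion, also for \<open>t > 1/2\<close>: by the weighted
  inequality for Lipschitz functions of compact support, a Cauchy sequence is Cauchy in the weighted
  \<open>L\<^sup>2\<close> space with weight \<open>E powr (2 * t)\<close> as well, so it has an almost everywhere convergent
  subsequence, and its limit vanishes only if the sequence tends to zero in the norm.
\<close>

definition Y_space ::
    "(real^'n) set \<Rightarrow> (real^'n) set \<Rightarrow> (real^'n \<Rightarrow> real) \<Rightarrow> real \<Rightarrow> (real^'n \<Rightarrow> real) set" where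
  "Y_space \<Omega> K E t =
     {u. \<exists>v::nat \<Rightarrow> real^'n \<Rightarrow> real.
           (\<forall>k. v k \<in> lipschitz_compact_support \<Omega> K) \<and>
           (\<forall>e>0. \<exists>N. \<forall>j\<ge>N. \<forall>k\<ge>N. Y_norm \<Omega> K E t (\<lambda>x. v j x - v k x) < e) \<and>
           (AE x in lebesgue_on \<Omega>. (\<lambda>k. v k x) \<longlonglongrightarrow> u x)}"

section \<open>The three integrands of the inequality\<close>

definition gradient_term ::
    "(real^'n) set \<Rightarrow> (real^'n \<Rightarrow> real^'n^'n) \<Rightarrow> (real^'n) set \<Rightarrow> (real^'n \<Rightarrow> real) \<Rightarrow> real
      \<Rightarrow> (real^'n \<Rightarrow> real) \<Rightarrow> real^'n \<Rightarrow> real" where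
  "gradient_term \<Omega> A K E t u x = E x powr (2 * t) * sq_norm_wrt (A x) (wgrad (\<Omega> - K) u x)"

definition mass_term :: "(real^'n \<Rightarrow> real) \<Rightarrow> real \<Rightarrow> (real^'n \<Rightarrow> real) \<Rightarrow> real^'n \<Rightarrow> real" where
  "mass_term E t u x = E x powr (2 * t) * (u x)\<^sup>2"

definition hardy_term ::
    "(real^'n \<Rightarrow> real^'n^'n) \<Rightarrow> (real^'n \<Rightarrow> real) \<Rightarrow> real \<Rightarrow> (real^'n \<Rightarrow> real) \<Rightarrow> real^'n \<Rightarrow> real" where
  "hardy_term A E t u x = E x powr (2 * t - 2) * sq_norm_wrt (A x) (grad E x) * (u x)\<^sup>2"

end

theory Submission
  imports Defs
begin

text \<open>
  On \<open>\<Omega> - K\<close> the function \<open>E\<close> is smooth with \<open>div (A \<nabla>E) = E\<close>, it satisfies the Neumann condition,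
  and \<open>K\<close> is a null set; nothing else about \<open>\<mu>\<close> matters. Writing \<open>u = E\<^sup>1\<^sup>/\<^sup>2\<^sup>-\<^sup>t z\<close> and testing the equation
  with \<open>z\<^sup>2\<close>, the difference of the two sides becomes the integral of \<open>E |\<nabla>z|\<^sub>A\<^sup>2\<close>, which is nonnegative
  and passes to limits in \<open>Y\<^sub>t\<close>. Logarithmic cutoffs \<open>z = \<chi>(E)\<close> make this energy arbitrarily small, while
  the mass and the Hardy integral stay away from zero, so both constants are optimal. In the case of
  equality, the energies of approximating functions \<open>z\<close> tend to zero, and testing the equation with
  \<open>\<chi>(E) z\<^sup>2\<close> then shows that the integral of \<open>E \<chi>(E) z\<^sup>2\<close> vanishes.
\<close>

section \<open>Calculus of smooth functions\<close>

text \<open>The equation is given only against test functions with compact support in \<Omega>,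
  while z^2 reaches the boundary and is merely Lipschitz. Most of the work is therefore the passage
  to such functions: the Neumann condition is made uniform in a thin boundary layer, and no trace or
  surface integral is formed. The substitution by z is never carried out. The density of its energy
  is written in terms of u and its gradient (\<open>Qd\<close>), and the power of E goes into the
  function that tests the equation. For t > 1/2 the norm has no mass term. The identity for
  Lipschitz functions must then first bound the mass and the Hardy integral by the gradient, before
  limits in the completion can be taken. The cutoffs are logarithmic because E |\<chi>'(E)| is then
  at most b/k. In the energy E \<chi>'(E)^2 |\<nabla>E|^2 this takes care of one factor \<chi>'; the
  other is integrated by the equation itself, since the integral of - \<chi>'(E) |\<nabla>E|^2
  equals that of E \<chi>(E), which is at most that of E. This replaces any growth estimate for E or
  \<nabla>E near K.\<close>

lemma Ck_on_SucI_cong: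
  assumes "open S" "\<And>x. x \<in> S \<Longrightarrow> (f has_derivative f' x) (at x)"
    and "\<And>i. i \<in> Basis \<Longrightarrow> Ck_on k (\<lambda>x. f' x i) S"
    and cong: "\<And>g h. (\<And>x. x \<in> S \<Longrightarrow> g x = h x) \<Longrightarrow> Ck_on k g S \<Longrightarrow> Ck_on k h S"
  shows "Ck_on (Suc k) f S"
proof -
  have "frechet_derivative f (at x) = f' x" if "x \<in> S" for x
    using assms(2)[OF that] frechet_derivative_at by metis
  then show ?thesis
    using assms by (auto simp: differentiable_on_def differentiable_def intro: has_derivative_at_withinI
        intro!: cong[OF _ assms(3)])
qed

lemma Ck_on_SucD:
  assumes "open S" "Ck_on (Suc k) f S" "x \<in> S"
  shows "(f has_derivative frechet_derivative f (at x)) (at x)"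
  using assms at_within_open[OF assms(3,1)]
  by (auto simp: differentiable_on_def frechet_derivative_works[symmetric])

text \<open>The partial derivatives of \<open>g\<close> are known only after \<open>g\<close> is
  shown to be differentiable, so the induction runs through \<open>Ck_on_SucI_cong\<close>, whose
  hypothesis \<open>cong\<close> is supplied by the induction hypothesis.\<close>

lemma Ck_on_cong:
  assumes "open S" "\<And>x. x \<in> S \<Longrightarrow> f x = g x" "Ck_on k f S"
  shows "Ck_on k g S"
  using assms(2,3)
proof (induction k arbitrary: f g)
  case 0
  then show ?case by (auto elim: continuous_on_eq)
next
  case (Suc k)
  have "(g has_derivative frechet_derivative f (at x)) (at x)" if "x \<in> S" for x
    using has_derivative_transform_within_open[OF Ck_on_SucD[OF assms(1) Suc.prems(2) that] assms(1) that] Suc.prems(1)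
    by auto
  then show ?case
    using Suc by (intro Ck_on_SucI_cong[OF assms(1)]) auto
qed

lemma Ck_on_SucI:
  assumes "open S" "\<And>x. x \<in> S \<Longrightarrow> (f has_derivative f' x) (at x)"
    and "\<And>i. i \<in> Basis \<Longrightarrow> Ck_on k (\<lambda>x. f' x i) S"
  shows "Ck_on (Suc k) f S"
  by (rule Ck_on_SucI_cong[OF assms]) (auto intro: Ck_on_cong[OF assms(1)])

lemma Ck_on_lower:
  assumes "open S" "Ck_on (Suc k) f S"
  shows "Ck_on k f S"
  using assms(2)
proof (induction k arbitrary: f)
  case 0
  then show ?case by (auto simp: differentiable_imp_continuous_on)
next
  case (Suc k)
  show ?case
    using Suc.prems Suc.IH by (intro Ck_on_SucI[OF assms(1) Ck_on_SucD[OF assms(1) Suc.prems]]) auto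
qed

lemma Ck_on_subset:
  assumes "open S" "open T" "T \<subseteq> S" "Ck_on k f S"
  shows "Ck_on k f T"
  using assms(4)
  by (induction k arbitrary: f)
     (use assms(3) in \<open>auto intro: continuous_on_subset differentiable_on_subset\<close>)

lemma Ck_on_Un:
  assumes "open S" "open T" "Ck_on k f S" "Ck_on k f T"
  shows "Ck_on k f (S \<union> T)"
  using assms(3,4)
proof (induction k arbitrary: f)
  case 0
  then show ?case by (auto intro: continuous_on_open_Un assms)
next
  case (Suc k)
  have "(f has_derivative frechet_derivative f (at x)) (at x)" if "x \<in> S \<union> T" for x
    using Ck_on_SucD Suc.prems that assms by blast
  then show ?case
    using Suc assms by (intro Ck_on_SucI[where S="S \<union> T"]) auto
qed

lemma Ck_on_const [simp]: "open S \<Longrightarrow> Ck_on k (\<lambda>x. c) S"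
  by (induction k arbitrary: c) auto

lemma Ck_on_linear:
  assumes "open S" "bounded_linear f"
  shows "Ck_on k f S"
proof (cases k)
  case 0
  then show ?thesis using assms by (auto intro: linear_continuous_on)
next
  case (Suc m)
  show ?thesis unfolding Suc
    using assms by (intro Ck_on_SucI[where f'="\<lambda>x. f"]) (auto intro: bounded_linear_imp_has_derivative)
qed

lemma Ck_on_add:
  assumes "open S" "Ck_on k f S" "Ck_on k g S"
  shows "Ck_on k (\<lambda>x. f x + g x) S"
  using assms(2,3)
proof (induction k arbitrary: f g)
  case (Suc k)
  show ?case
    using Suc assms(1)
    by (intro Ck_on_SucI[OF assms(1) has_derivative_add[OF Ck_on_SucD[OF assms(1) Suc.prems(1)] Ck_on_SucD[OF assms(1) Suc.prems(2)]]])
       auto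
qed (auto intro: continuous_intros)

lemma Ck_on_mult:
  assumes "open S" "Ck_on k f S" "Ck_on k g S"
  shows "Ck_on k (\<lambda>x. f x * g x) S"
  using assms(2,3)
proof (induction k arbitrary: f g)
  case (Suc k)
  have "Ck_on k f S" "Ck_on k g S" using Suc.prems Ck_on_lower assms(1) by blast+
  then show ?case
    using Suc assms(1)
    by (intro Ck_on_SucI[OF assms(1) has_derivative_mult[OF Ck_on_SucD[OF assms(1) Suc.prems(1)] Ck_on_SucD[OF assms(1) Suc.prems(2)]]])
       (auto intro!: Ck_on_add)
qed (auto intro: continuous_intros)

lemma Ck_on_compose:
  fixes f :: "real \<Rightarrow> real"
  assumes "open S" "open T" "\<And>x. x \<in> S \<Longrightarrow> g x \<in> T" "Ck_on k f T" "Ck_on k g S"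
  shows "Ck_on k (\<lambda>x. f (g x)) S"
  using assms(4,5)
proof (induction k arbitrary: f)
  case 0
  then show ?case
    using continuous_on_compose2[of T f S g] assms(3) by auto
next
  case (Suc k)
  have "Ck_on k g S" using Suc.prems Ck_on_lower assms(1) by blast
  have D: "((\<lambda>x. f (g x)) has_derivative (\<lambda>h. frechet_derivative f (at (g x)) 1 * frechet_derivative g (at x) h)) (at x)"
    if "x \<in> S" for x
  proof -
    have f: "(f has_derivative frechet_derivative f (at (g x))) (at (g x))"
      using Ck_on_SucD[OF assms(2) Suc.prems(1)] assms(3)[OF that] by auto
    \<comment> \<open>A linear map on the reals is multiplication by its value at 1; this turns the
      chain rule into a product, to which \<open>Ck_on_mult\<close> applies.\<close>
    have lin: "frechet_derivative f (at (g x)) y = frechet_derivative f (at (g x)) 1 * y" for y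
      using linear_scale[OF has_derivative_linear[OF f], of y 1] by (simp add: mult.commute)
    have "(\<lambda>h. frechet_derivative f (at (g x)) (frechet_derivative g (at x) h)) =
        (\<lambda>h. frechet_derivative f (at (g x)) 1 * frechet_derivative g (at x) h)"
      by (rule ext) (rule lin)
    with has_derivative_compose[OF Ck_on_SucD[OF assms(1) Suc.prems(2) that] f] show ?thesis
      by (simp only:)
  qed
  show ?case
  proof (rule Ck_on_SucI[OF assms(1) D])
    fix i :: 'a assume i: "i \<in> Basis"
    have "Ck_on k (\<lambda>x. frechet_derivative f (at x) 1) T" "Ck_on k (\<lambda>x. frechet_derivative g (at x) i) S"
      using Suc.prems i by auto
    with \<open>Ck_on k g S\<close>
    show "Ck_on k (\<lambda>x. frechet_derivative f (at (g x)) 1 * frechet_derivative g (at x) i) S"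
      by (intro Ck_on_mult[OF assms(1)] Suc.IH[of "\<lambda>x. frechet_derivative f (at x) 1"])
  qed
qed

lemma smooth_on_cong:
  assumes "open S" "\<And>x. x \<in> S \<Longrightarrow> f x = g x" "smooth_on f S"
  shows "smooth_on g S"
  using assms Ck_on_cong unfolding smooth_on_def by blast

lemma smooth_on_subset:
  "open S \<Longrightarrow> open T \<Longrightarrow> T \<subseteq> S \<Longrightarrow> smooth_on f S \<Longrightarrow> smooth_on f T"
  using Ck_on_subset unfolding smooth_on_def by blast

lemma smooth_on_Un:
  "open S \<Longrightarrow> open T \<Longrightarrow> smooth_on f S \<Longrightarrow> smooth_on f T \<Longrightarrow> smooth_on f (S \<union> T)"
  using Ck_on_Un unfolding smooth_on_def by blast

lemma smooth_on_const [simp]: "open S \<Longrightarrow> smooth_on (\<lambda>x. c) S"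
  unfolding smooth_on_def by simp

lemma smooth_on_linear: "open S \<Longrightarrow> bounded_linear f \<Longrightarrow> smooth_on f S"
  unfolding smooth_on_def by (simp add: Ck_on_linear)

lemma smooth_on_ident: "open S \<Longrightarrow> smooth_on (\<lambda>x::real. x) S"
  by (rule smooth_on_linear[OF _ bounded_linear_ident])

lemma smooth_on_inner: "open S \<Longrightarrow> smooth_on (\<lambda>x. x \<bullet> i) S"
  by (rule smooth_on_linear[OF _ bounded_linear_inner_left])

lemma smooth_on_add: "open S \<Longrightarrow> smooth_on f S \<Longrightarrow> smooth_on g S \<Longrightarrow> smooth_on (\<lambda>x. f x + g x) S"
  unfolding smooth_on_def by (simp add: Ck_on_add)

lemma smooth_on_mult: "open S \<Longrightarrow> smooth_on f S \<Longrightarrow> smooth_on g S \<Longrightarrow> smooth_on (\<lambda>x. f x * g x) S"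
  unfolding smooth_on_def by (simp add: Ck_on_mult)

lemma smooth_on_diff: "open S \<Longrightarrow> smooth_on f S \<Longrightarrow> smooth_on g S \<Longrightarrow> smooth_on (\<lambda>x. f x - g x) S"
  using smooth_on_add[of S f "\<lambda>x. (-1) * g x"] smooth_on_mult[of S "\<lambda>x. -1" g] by simp

lemma smooth_on_sum:
  "open S \<Longrightarrow> (\<And>i. i \<in> I \<Longrightarrow> smooth_on (f i) S) \<Longrightarrow> smooth_on (\<lambda>x. \<Sum>i\<in>I. f i x) S"
  by (induction I rule: infinite_finite_induct) (auto intro: smooth_on_add)

lemma smooth_on_prod:
  "open S \<Longrightarrow> (\<And>i. i \<in> I \<Longrightarrow> smooth_on (f i) S) \<Longrightarrow> smooth_on (\<lambda>x. \<Prod>i\<in>I. f i x) S"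
  by (induction I rule: infinite_finite_induct) (auto intro: smooth_on_mult)

lemma smooth_on_compose:
  fixes f :: "real \<Rightarrow> real"
  assumes "open S" "open T" "\<And>x. x \<in> S \<Longrightarrow> g x \<in> T" "smooth_on f T" "smooth_on g S"
  shows "smooth_on (\<lambda>x. f (g x)) S"
  using assms Ck_on_compose unfolding smooth_on_def by blast

lemma smooth_on_imp_continuous_on: "smooth_on f S \<Longrightarrow> continuous_on S f"
  unfolding smooth_on_def by (metis Ck_on.simps(1))

lemma smooth_on_has_derivative:
  "open S \<Longrightarrow> smooth_on f S \<Longrightarrow> x \<in> S \<Longrightarrow> (f has_derivative frechet_derivative f (at x)) (at x)"
  unfolding smooth_on_def by (metis Ck_on_SucD)

lemma smooth_on_partial:
  "smooth_on f S \<Longrightarrow> i \<in> Basis \<Longrightarrow> smooth_on (\<lambda>x. frechet_derivative f (at x) i) S"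
  unfolding smooth_on_def by (metis Ck_on.simps(2))

lemma smooth_on_realI:
  fixes f :: "real \<Rightarrow> real"
  assumes "open S" "\<And>x. x \<in> S \<Longrightarrow> (f has_real_derivative f' x) (at x)" "smooth_on f' S"
  shows "smooth_on f S"
proof -
  have "Ck_on (Suc k) f S" for k
    using assms
    by (intro Ck_on_SucI[where f'="\<lambda>x h. f' x * h"]) (auto simp: smooth_on_def has_field_derivative_def)
  then show ?thesis unfolding smooth_on_def using Ck_on_lower[OF assms(1)] by blast
qed

text \<open>Differentiation lowers the exponent and produces a factor, so the induction is over all
  exponents and carries a constant \<open>c\<close>.\<close>

lemma smooth_on_powr: "smooth_on (\<lambda>s::real. s powr a) {0<..}"
proof -
  have "Ck_on k (\<lambda>s::real. c * s powr a) {0<..}" for k c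
  proof (induction k arbitrary: a c)
    case 0
    then show ?case by (auto intro!: continuous_intros)
  next
    case (Suc k)
    show ?case
    proof (rule Ck_on_SucI[where f'="\<lambda>s h. (c * a) * s powr (a - 1) * h"])
      fix s :: real assume s: "s \<in> {0<..}"
      have "((\<lambda>s. c * s powr a) has_real_derivative (c * a) * s powr (a - 1)) (at s)"
        using s by (auto intro!: derivative_eq_intros simp: powr_diff)
      then show "((\<lambda>s. c * s powr a) has_derivative (\<lambda>h. (c * a) * s powr (a - 1) * h)) (at s)"
        by (simp add: has_field_derivative_def)
    qed (use Suc in auto)
  qed
  from this[of _ 1] show ?thesis unfolding smooth_on_def by simp
qed

lemma smooth_on_ln: "smooth_on (ln :: real \<Rightarrow> real) {0<..}"
proof (rule smooth_on_realI[OF _ _ smooth_on_powr[of "-1"]])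
  show "(ln has_real_derivative x powr - 1) (at x)" if "x \<in> {0<..}" for x :: real
    using that by (auto intro!: derivative_eq_intros simp: powr_minus field_simps)
qed simp

section \<open>Flat exponentials, smooth steps and cutoffs\<close>

definition exp_flat :: "real \<Rightarrow> real" where
  "exp_flat s = (if s > 0 then exp (- (1 / s)) else 0)"

text \<open>With x = 1/h this is the decay of a polynomial times exp(-x) at infinity; the division
  by \<open>h\<close> is one more factor x, hence \<open>pCons 0 p\<close>.\<close>

lemma exp_flat_aux_tendsto: "((\<lambda>h. poly p (1 / h) * exp (- (1 / h)) / h) \<longlongrightarrow> 0) (at_right (0::real))"
proof -
  have *: "((\<lambda>x. poly q x / exp x) \<longlongrightarrow> 0) at_top" for q :: "real poly"
  proof (induction q)
    case (pCons a q)
    have "((\<lambda>x. a / exp x + x * poly q x / exp x) \<longlongrightarrow> 0 + 0) at_top"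
    proof (intro tendsto_add)
      show "((\<lambda>x. a / exp x) \<longlongrightarrow> 0) at_top"
        by (intro tendsto_divide_0[OF tendsto_const] filterlim_at_top_imp_at_infinity exp_at_top)
    next
      have "((\<lambda>x. \<Sum>i\<le>degree q. coeff q i * (x ^ Suc i / exp x)) \<longlongrightarrow> (\<Sum>i\<le>degree q. coeff q i * 0)) at_top"
        by (intro tendsto_intros tendsto_power_div_exp_0)
      then show "((\<lambda>x. x * poly q x / exp x) \<longlongrightarrow> 0) at_top"
        by (simp add: poly_altdef sum_distrib_left sum_divide_distrib algebra_simps)
    qed
    then show ?case by (simp add: add_divide_distrib)
  qed auto
  have "((\<lambda>x. poly (pCons 0 p) x / exp x) \<longlongrightarrow> 0) at_top" by (rule *)
  then have "((\<lambda>h. poly (pCons 0 p) (inverse h) / exp (inverse h)) \<longlongrightarrow> 0) (at_right (0::real))"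
    by (rule filterlim_compose[OF _ filterlim_inverse_at_top_right])
  then show ?thesis
    by (simp add: field_simps exp_minus)
qed

text \<open>The functions p(1/s) exp(-1/s), extended by 0, are closed under differentiation: the
  derivative belongs to the polynomial x^2 (p - p'). At s = 0 it vanishes by
  \<open>exp_flat_aux_tendsto\<close>. Iteration yields smoothness of \<open>exp_flat\<close>, which
  is the case p = 1.\<close>

lemma exp_flat_poly_deriv:
  fixes s :: real
  defines "g \<equiv> \<lambda>p s. if s > 0 then poly p (1 / s) * exp (- (1 / s)) else (0::real)"
  shows "(g p has_real_derivative g ([:0, 0, 1:] * (p - pderiv p)) s) (at s)"
proof -
  consider "s > 0" | "s < 0" | "s = 0" by linarith
  then show ?thesis
  proof cases
    case 1
    have "((\<lambda>s. poly p (1 / s) * exp (- (1 / s))) has_real_derivative g ([:0, 0, 1:] * (p - pderiv p)) s) (at s)"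
      using 1 unfolding g_def
      by (auto intro!: derivative_eq_intros DERIV_chain'[OF _ poly_DERIV] simp: field_simps power2_eq_square)
    then show ?thesis
      by (rule has_field_derivative_transform_within_open[where S="{0<..}"]) (use 1 in \<open>auto simp: g_def\<close>)
  next
    case 2
    have "((\<lambda>s. 0) has_real_derivative g ([:0, 0, 1:] * (p - pderiv p)) s) (at s)"
      using 2 unfolding g_def by auto
    then show ?thesis
      by (rule has_field_derivative_transform_within_open[where S="{..<0}"]) (use 2 in \<open>auto simp: g_def\<close>)
  next
    case 3
    have "((\<lambda>h. (g p h - g p 0) / h) \<longlongrightarrow> 0) (at_left 0)"
      by (rule tendsto_eventually) (auto simp: g_def eventually_at_filter)
    moreover have "((\<lambda>h. (g p h - g p 0) / h) \<longlongrightarrow> 0) (at_right 0)"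
      by (rule Lim_transform_eventually[OF exp_flat_aux_tendsto[of p]])
         (auto simp: g_def eventually_at_filter)
    ultimately have "((\<lambda>h. (g p h - g p 0) / h) \<longlongrightarrow> 0) (at 0)"
      by (rule filterlim_split_at)
    then have "(g p has_real_derivative 0) (at 0)"
      by (simp add: has_field_derivative_iff)
    then show ?thesis using 3 by (simp add: g_def)
  qed
qed

lemma smooth_on_exp_flat: "smooth_on exp_flat UNIV"
proof -
  define g where "g = (\<lambda>p s. if s > 0 then poly p (1 / s) * exp (- (1 / s)) else (0::real))"
  have D: "(g p has_real_derivative g ([:0, 0, 1:] * (p - pderiv p)) s) (at s)" for p s
    unfolding g_def by (rule exp_flat_poly_deriv)
  have "Ck_on k (g p) UNIV" for k p
  proof (induction k arbitrary: p)
    case 0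
    show ?case using D[of p] by (auto intro!: DERIV_isCont continuous_at_imp_continuous_on)
  next
    case (Suc k)
    show ?case
      using D[of p] Suc by (intro Ck_on_SucI[where f'="\<lambda>s h. g ([:0, 0, 1:] * (p - pderiv p)) s * h"])
        (auto simp: has_field_derivative_def)
  qed
  moreover have "g 1 = exp_flat" by (auto simp: g_def exp_flat_def)
  ultimately show ?thesis
    unfolding smooth_on_def by metis
qed

lemma exp_flat_deriv:
  obtains h' where "\<And>s. (exp_flat has_real_derivative h' s) (at s)" "\<And>s. 0 \<le> h' s" "\<And>s. h' s \<le> 1"
proof
  define h' where "h' = (\<lambda>s. if s > 0 then poly [:0,0,1:] (1 / s) * exp (- (1 / s)) else (0::real))"
  have "exp_flat = (\<lambda>s. if s > 0 then poly 1 (1 / s) * exp (- (1 / s)) else 0)"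
    by (auto simp: exp_flat_def)
  then show "(exp_flat has_real_derivative h' s) (at s)" for s
    using exp_flat_poly_deriv[of 1 s] by (simp only: h'_def pderiv_1 diff_0_right mult_1_right)
  show "0 \<le> h' s" for s by (simp add: h'_def)
  show "h' s \<le> 1" for s
  proof (cases "s > 0")
    case True
    have "(1/s)\<^sup>2 \<le> exp (1/s)"
    proof -
      \<comment> \<open>For y = 1/s the claim y^2 <= exp y follows from the fourth power of 1 + y/4
        <= exp (y/4) together with y <= (1 + y/4)^2.\<close>
      have "1 + (1/s)/4 \<le> exp ((1/s)/4)" by (rule exp_ge_add_one_self)
      then have "(1 + (1/s)/4)^4 \<le> exp ((1/s)/4)^4" using True by (intro power_mono) auto
      moreover have "exp ((1/s)/4)^4 = exp (1/s)" by (simp add: flip: exp_of_nat_mult)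
      ultimately have B: "(1 + (1/s)/4)^4 \<le> exp (1/s)" by simp
      define y where "y = 1/s"
      have y: "y > 0" using True by (simp add: y_def)
      have "y^2 \<le> (1 + y/4)^4"
      proof -
        have "0 \<le> (1 - y/4)^2" by simp
        then have "y \<le> (1+y/4)^2" by (simp add: power2_eq_square algebra_simps)
        then have "y^2 \<le> ((1+y/4)^2)^2" using y by (intro power_mono) auto
        then show ?thesis by simp
      qed
      then show ?thesis using B by (simp add: y_def)
    qed
    then show ?thesis using True
      by (simp add: h'_def exp_minus field_simps power2_eq_square)
  qed (simp add: h'_def)
qed

lemma exp_flat_nonneg: "exp_flat s \<ge> 0"
  and exp_flat_le_1: "exp_flat s \<le> 1"
  and exp_flat_0: "s \<le> 0 \<Longrightarrow> exp_flat s = 0"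
  by (auto simp: exp_flat_def)

lemma exp_flat_mono: "s \<le> t \<Longrightarrow> exp_flat s \<le> exp_flat t"
  by (auto simp: exp_flat_def frac_le)

text \<open>The inner argument is nonpositive for \<open>s \<le> 0\<close>, and constant for \<open>s \<ge> 1\<close>; so no quotient is
  needed in order to obtain a smooth function that is locally constant outside \<open>[0,1]\<close>.\<close>

definition smooth_step :: "real \<Rightarrow> real" where
  "smooth_step s = exp (exp 1) * exp_flat (exp (-1) - exp_flat (1 - s))"

lemma smooth_on_smooth_step: "smooth_on smooth_step UNIV"
proof -
  have "smooth_on (\<lambda>s. exp_flat (1 - s)) UNIV"
    by (rule smooth_on_compose[OF _ _ _ smooth_on_exp_flat])
       (auto intro!: smooth_on_diff smooth_on_ident)
  then have "smooth_on (\<lambda>s. exp_flat (exp (-1) - exp_flat (1 - s))) UNIV"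
    by (intro smooth_on_compose[OF _ _ _ smooth_on_exp_flat] smooth_on_diff smooth_on_ident) auto
  then show ?thesis unfolding smooth_step_def[abs_def] by (intro smooth_on_mult) auto
qed

lemma smooth_step_0: "s \<le> 0 \<Longrightarrow> smooth_step s = 0"
proof -
  assume "s \<le> 0"
  then have "exp_flat 1 \<le> exp_flat (1 - s)" by (intro exp_flat_mono) auto
  then show ?thesis unfolding smooth_step_def by (intro mult_eq_0_iff[THEN iffD2] disjI2 exp_flat_0) (simp add: exp_flat_def)
qed

text \<open>The inner \<open>exp_flat (1 - s)\<close> vanishes, and
  \<open>exp_flat (exp (-1))\<close> is exp(-e), which the prefactor \<open>exp (exp 1)\<close>
  cancels.\<close>

lemma smooth_step_1: "s \<ge> 1 \<Longrightarrow> smooth_step s = 1"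
  unfolding smooth_step_def by (simp add: exp_flat_0) (simp add: exp_flat_def exp_minus field_simps)

text \<open>By the chain rule the derivative is the prefactor times two values of \<open>h'\<close>,
  both in [0,1], so the prefactor itself serves as the bound \<open>B\<close>. Outside [0,1] the
  step is locally constant.\<close>

lemma smooth_step_deriv:
  obtains \<theta> B where "\<And>s. (smooth_step has_real_derivative \<theta> s) (at s)" "\<And>s. 0 \<le> \<theta> s" "\<And>s. \<theta> s \<le> B"
    "\<And>s. s \<notin> {0..1} \<Longrightarrow> \<theta> s = 0" "B > 0"
proof -
  obtain h' where h': "\<And>s. (exp_flat has_real_derivative h' s) (at s)" "\<And>s. 0 \<le> h' s" "\<And>s. h' s \<le> 1"
    using exp_flat_deriv by metis
  define \<theta> where "\<theta> = (\<lambda>s. exp (exp 1) * (h' (exp (-1) - exp_flat (1 - s)) * h' (1 - s)))"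
  have D: "(smooth_step has_real_derivative \<theta> s) (at s)" for s
    unfolding smooth_step_def[abs_def] \<theta>_def
    by (rule derivative_eq_intros DERIV_chain'[OF _ h'(1)] refl | simp)+
  have Z: "\<theta> s = 0" if "s \<notin> {0..1}" for s
  proof -
    have "s < 0 \<or> 1 < s" using that by auto
    then have "(smooth_step has_real_derivative 0) (at s)"
    proof
      assume 1: "s < 0"
      show ?thesis
        by (rule has_field_derivative_transform_within_open[where S="{..<0}" and f="\<lambda>_. 0"])
           (use 1 in \<open>auto simp: smooth_step_0\<close>)
    next
      assume 2: "1 < s"
      show ?thesis
        by (rule has_field_derivative_transform_within_open[where S="{1<..}" and f="\<lambda>_. 1"])
           (use 2 in \<open>auto simp: smooth_step_1\<close>)
    qed
    then show ?thesis using D[of s] DERIV_unique by blast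
  qed
  show thesis
  proof (rule that[OF D])
    show "0 \<le> \<theta> s" for s using h' by (simp add: \<theta>_def)
    show "\<theta> s \<le> exp (exp 1)" for s
      unfolding \<theta>_def using h' by (simp add: mult_le_one)
  qed (use Z in auto)
qed

lemma smooth_step_mono: "s \<le> t \<Longrightarrow> smooth_step s \<le> smooth_step t"
  unfolding smooth_step_def by (auto intro!: exp_flat_mono)

lemma smooth_step_nonneg: "0 \<le> smooth_step s"
  by (simp add: smooth_step_def exp_flat_nonneg)

lemma smooth_step_le_1: "smooth_step s \<le> 1"
  using smooth_step_mono[of s "max 1 s"] smooth_step_1[of "max 1 s"] by simp

lemma smooth_cutoff:
  fixes x :: "'a::euclidean_space"
  assumes "r > 0"
  obtains \<theta> \<delta> where "smooth_on \<theta> UNIV" "\<And>y. y \<notin> cball x r \<Longrightarrow> \<theta> y = 0" "\<delta> > 0"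
    "\<And>y. y \<in> ball x \<delta> \<Longrightarrow> \<theta> y = 1" "\<And>y. 0 \<le> \<theta> y" "\<And>y. \<theta> y \<le> (1::real)"
proof -
  define q where "q = (\<lambda>y. \<Sum>i\<in>Basis. (y \<bullet> i - x \<bullet> i) * (y \<bullet> i - x \<bullet> i))"
  have q: "q y = (dist x y)\<^sup>2" for y
    unfolding q_def dist_norm norm_minus_commute[of x] power2_norm_eq_inner
    by (subst euclidean_inner) (simp add: inner_diff_left)
  \<comment> \<open>The argument is at least 1 where |y - x|^2 <= r^2/2, in particular on
    \<open>ball x (r/2)\<close>, and at most 0 where |y - x| >= r. The squared distance
    \<open>q\<close> is a polynomial in the coordinates, hence smooth also at
    \<open>x\<close>.\<close>
  define \<theta> where "\<theta> = (\<lambda>y. smooth_step (2 - (2 / r\<^sup>2) * q y))"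
  have "smooth_on q UNIV" unfolding q_def
    by (intro smooth_on_sum smooth_on_mult smooth_on_diff smooth_on_inner) auto
  then have 1: "smooth_on \<theta> UNIV" unfolding \<theta>_def
    by (intro smooth_on_compose[OF _ _ _ smooth_on_smooth_step] smooth_on_diff smooth_on_mult) auto
  have 2: "\<theta> y = 0" if "y \<notin> cball x r" for y
  proof -
    have "r\<^sup>2 \<le> q y" unfolding q using that assms by (intro power_mono) auto
    then show ?thesis unfolding \<theta>_def using assms by (intro smooth_step_0) (simp add: field_simps)
  qed
  have 3: "\<theta> y = 1" if "y \<in> ball x (r/2)" for y
  proof -
    have "q y \<le> (r/2)\<^sup>2" unfolding q using that assms by (intro power_mono) auto
    moreover have "0 \<le> q y" by (simp add: q)
    moreover have "(r/2)\<^sup>2 = r\<^sup>2 / 4" by (simp add: power_divide)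
    ultimately have "2 * q y \<le> r\<^sup>2" by linarith
    then show ?thesis unfolding \<theta>_def using assms by (intro smooth_step_1) (simp add: field_simps)
  qed
  show thesis
    by (rule that[of \<theta> "r/2", OF 1 2 _ 3]) (use assms in \<open>auto simp: \<theta>_def smooth_step_nonneg smooth_step_le_1\<close>)
qed

text \<open>\<open>U\<close> and the complement of \<open>C\<close> are open and cover the space. On
  the second set the product is identically zero, whatever \<open>f\<close> is there.\<close>

lemma smooth_on_mult_cutoff:
  assumes "open U" "smooth_on f U" "smooth_on g UNIV" "closed C" "C \<subseteq> U" "\<And>x. x \<notin> C \<Longrightarrow> g x = 0"
  shows "smooth_on (\<lambda>x. g x * f x) UNIV"
proof -
  have "smooth_on (\<lambda>x. g x * f x) U"
    using assms by (intro smooth_on_mult smooth_on_subset[OF open_UNIV _ _ assms(3)]) auto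
  moreover have "smooth_on (\<lambda>x. g x * f x) (-C)"
    using assms by (intro smooth_on_cong[OF _ _ smooth_on_const[of "-C" 0]]) auto
  ultimately have "smooth_on (\<lambda>x. g x * f x) (U \<union> - C)"
    using assms by (intro smooth_on_Un) auto
  moreover have "U \<union> - C = UNIV" using assms by auto
  ultimately show ?thesis by simp
qed

section \<open>Square integrable functions\<close>

lemma norm_add_square_le:
  fixes a b :: "'a::real_normed_vector"
  shows "(norm (a + b))\<^sup>2 \<le> 2 * (norm a)\<^sup>2 + 2 * (norm b)\<^sup>2"
proof -
  have "(norm (a + b))\<^sup>2 \<le> (norm a + norm b)\<^sup>2" by (intro power_mono norm_triangle_ineq) auto
  also have "\<dots> \<le> 2 * (norm a)\<^sup>2 + 2 * (norm b)\<^sup>2"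
    using zero_le_power2[of "norm a - norm b"] by (simp add: power2_eq_square algebra_simps)
  finally show ?thesis .
qed

lemma norm_diff_square_le:
  fixes a b :: "'a::real_normed_vector"
  shows "(norm (a - b))\<^sup>2 \<le> 2 * (norm a)\<^sup>2 + 2 * (norm b)\<^sup>2"
  using norm_add_square_le[of a "- b"] by simp

lemma integrable_mult_square:
  fixes f g :: "'a \<Rightarrow> real"
  assumes [measurable]: "f \<in> borel_measurable M" "g \<in> borel_measurable M"
    and "integrable M (\<lambda>x. (f x)\<^sup>2)" "integrable M (\<lambda>x. (g x)\<^sup>2)"
  shows "integrable M (\<lambda>x. f x * g x)"
proof (rule Bochner_Integration.integrable_bound[OF Bochner_Integration.integrable_add[OF assms(3,4)]])
  have "\<bar>a * b\<bar> \<le> \<bar>a\<^sup>2 + b\<^sup>2\<bar>" for a b :: real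
  proof -
    have "0 \<le> (\<bar>a\<bar> - \<bar>b\<bar>)\<^sup>2" by simp
    then have "2 * (\<bar>a\<bar> * \<bar>b\<bar>) \<le> a\<^sup>2 + b\<^sup>2" by (simp add: power2_eq_square algebra_simps)
    moreover have "0 \<le> \<bar>a\<bar> * \<bar>b\<bar>" by simp
    ultimately have "\<bar>a\<bar> * \<bar>b\<bar> \<le> a\<^sup>2 + b\<^sup>2" by linarith
    then show ?thesis by (simp add: abs_mult)
  qed
  then show "AE x in M. norm (f x * g x) \<le> norm ((f x)\<^sup>2 + (g x)\<^sup>2)" by simp
qed measurable

lemma integral_Cauchy_Schwarz:
  fixes f g :: "'a \<Rightarrow> real"
  assumes [measurable]: "f \<in> borel_measurable M" "g \<in> borel_measurable M"
    and F: "integrable M (\<lambda>x. (f x)\<^sup>2)" and G: "integrable M (\<lambda>x. (g x)\<^sup>2)"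
  shows "\<bar>\<integral>x. f x * g x \<partial>M\<bar> \<le> sqrt (\<integral>x. (f x)\<^sup>2 \<partial>M) * sqrt (\<integral>x. (g x)\<^sup>2 \<partial>M)"
proof -
  define X where "X = (\<integral>x. f x * g x \<partial>M)"
  define a where "a = (\<integral>x. (f x)\<^sup>2 \<partial>M)"
  define b where "b = (\<integral>x. (g x)\<^sup>2 \<partial>M)"
  have fg: "integrable M (\<lambda>x. f x * g x)" by (rule integrable_mult_square) (use F G in auto)
  have ab: "0 \<le> a" "0 \<le> b" by (auto simp: a_def b_def)
  have *: "0 \<le> a + 2 * l * X + l\<^sup>2 * b" for l
  proof -
    have "0 \<le> (\<integral>x. (f x + l * g x)\<^sup>2 \<partial>M)" by simp
    also have "\<dots> = (\<integral>x. (f x)\<^sup>2 + 2 * l * (f x * g x) + l\<^sup>2 * (g x)\<^sup>2 \<partial>M)"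
      by (intro Bochner_Integration.integral_cong) (auto simp: power2_eq_square algebra_simps)
    also have "\<dots> = a + 2 * l * X + l\<^sup>2 * b"
      using fg F G by (simp add: X_def a_def b_def)
    finally show ?thesis .
  qed
  have "X\<^sup>2 \<le> a * b"
  \<comment> \<open>The quadratic polynomial in \<open>*\<close> is evaluated at its minimum
    \<open>- X / b\<close>. For \<open>b = 0\<close> it is affine in \<open>l\<close>, and the
    chosen \<open>l\<close> would give it the value -1.\<close>
  proof (cases "b = 0")
    case True
    show ?thesis
    proof (rule ccontr)
      assume "\<not> ?thesis"
      then have "X \<noteq> 0" using True by auto
      have "0 \<le> a + 2 * (- (a + 1) / (2 * X)) * X" using *[of "- (a + 1) / (2 * X)"] True by simp
      also have "\<dots> = -1" using \<open>X \<noteq> 0\<close> by (simp add: field_simps)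
      finally show False by simp
    qed
  next
    case False
    then have "b > 0" using ab by simp
    then have "0 \<le> b * (a + 2 * (- X / b) * X + (- X / b)\<^sup>2 * b)" using *[of "- X / b"] by (intro mult_nonneg_nonneg) auto
    also have "\<dots> = a * b - X\<^sup>2" using \<open>b > 0\<close> by (simp add: field_simps power2_eq_square)
    finally show ?thesis by simp
  qed
  then have "sqrt (X\<^sup>2) \<le> sqrt (a * b)" by (rule real_sqrt_le_mono)
  then show ?thesis by (simp add: X_def[symmetric] a_def[symmetric] b_def[symmetric] real_sqrt_mult)
qed

section \<open>Completeness and weak limits in L^2\<close>

lemma L2_Fatou:
  fixes f :: "nat \<Rightarrow> 'a \<Rightarrow> 'b::{banach, second_countable_topology}"
  assumes [measurable]: "\<And>k. f k \<in> borel_measurable M" "g \<in> borel_measurable M"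
    and int: "\<And>k. k \<ge> N \<Longrightarrow> integrable M (\<lambda>x. (norm (f k x))\<^sup>2)"
    and le: "\<And>k. k \<ge> N \<Longrightarrow> (\<integral>x. (norm (f k x))\<^sup>2 \<partial>M) \<le> C"
    and lim: "AE x in M. (\<lambda>k. f k x) \<longlonglongrightarrow> g x"
  shows "integrable M (\<lambda>x. (norm (g x))\<^sup>2)" and "(\<integral>x. (norm (g x))\<^sup>2 \<partial>M) \<le> C"
proof -
  have C: "0 \<le> C" using le[of N] by (rule order_trans[rotated]) auto
  have "(\<integral>\<^sup>+x. ennreal ((norm (g x))\<^sup>2) \<partial>M) = (\<integral>\<^sup>+x. liminf (\<lambda>k. ennreal ((norm (f k x))\<^sup>2)) \<partial>M)"
    using lim
  proof (intro nn_integral_cong_AE, eventually_elim)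
    case (elim x)
    then have "(\<lambda>k. ennreal ((norm (f k x))\<^sup>2)) \<longlonglongrightarrow> ennreal ((norm (g x))\<^sup>2)"
      by (intro tendsto_intros)
    then show ?case using lim_imp_Liminf[OF sequentially_bot] by metis
  qed
  also have "\<dots> \<le> liminf (\<lambda>k. \<integral>\<^sup>+x. ennreal ((norm (f k x))\<^sup>2) \<partial>M)"
    by (rule nn_integral_liminf) measurable
  also have "\<dots> \<le> liminf (\<lambda>k. ennreal C)"
  proof (rule Liminf_mono, rule eventually_sequentiallyI[of N])
    fix k assume "N \<le> k"
    then show "(\<integral>\<^sup>+x. ennreal ((norm (f k x))\<^sup>2) \<partial>M) \<le> ennreal C"
      using int le C by (subst nn_integral_eq_integral) auto
  qed
  finally have *: "(\<integral>\<^sup>+x. ennreal ((norm (g x))\<^sup>2) \<partial>M) \<le> ennreal C" by (simp add: Liminf_const)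
  show I: "integrable M (\<lambda>x. (norm (g x))\<^sup>2)"
    by (rule integrableI_bounded) (use * in \<open>auto simp: less_top[symmetric] top_unique\<close>)
  show "(\<integral>x. (norm (g x))\<^sup>2 \<partial>M) \<le> C"
    using * C by (subst (asm) nn_integral_eq_integral[OF I]) auto
qed

lemma L2_diff_integrable:
  fixes f g :: "'a \<Rightarrow> 'b::{banach, second_countable_topology}"
  assumes [measurable]: "f \<in> borel_measurable M" "g \<in> borel_measurable M"
    and "integrable M (\<lambda>x. (norm (f x))\<^sup>2)" "integrable M (\<lambda>x. (norm (g x))\<^sup>2)"
  shows "integrable M (\<lambda>x. (norm (f x - g x))\<^sup>2)"
  by (rule Bochner_Integration.integrable_bound[where f="\<lambda>x. 2 * (norm (f x))\<^sup>2 + 2 * (norm (g x))\<^sup>2"])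
     (use assms norm_diff_square_le in auto)

text \<open>Fatou's lemma is applied in \<open>k\<close> to f_j - f_(r k): the Cauchy bound passes
  to f_j - g. Thus an almost everywhere limit along a subsequence is the L^2 limit of the whole
  sequence.\<close>

lemma L2_Cauchy_AE_limit:
  fixes f :: "nat \<Rightarrow> 'a \<Rightarrow> 'b::{banach, second_countable_topology}"
  assumes meas[measurable]: "\<And>k. f k \<in> borel_measurable M" "g \<in> borel_measurable M"
    and int: "\<And>k. integrable M (\<lambda>x. (norm (f k x))\<^sup>2)"
    and Cauchy: "\<And>e. e > 0 \<Longrightarrow> \<exists>N. \<forall>j\<ge>N. \<forall>k\<ge>N. (\<integral>x. (norm (f j x - f k x))\<^sup>2 \<partial>M) < e"
    and r: "strict_mono r" and lim: "AE x in M. (\<lambda>k. f (r k) x) \<longlonglongrightarrow> g x"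
  shows "integrable M (\<lambda>x. (norm (g x))\<^sup>2)"
    and "(\<lambda>k. \<integral>x. (norm (f k x - g x))\<^sup>2 \<partial>M) \<longlonglongrightarrow> 0"
proof -
  have *: "\<exists>N. \<forall>j\<ge>N. integrable M (\<lambda>x. (norm (f j x - g x))\<^sup>2) \<and> (\<integral>x. (norm (f j x - g x))\<^sup>2 \<partial>M) \<le> e"
    if "e > 0" for e
  proof -
    obtain N where N: "\<And>j k. j \<ge> N \<Longrightarrow> k \<ge> N \<Longrightarrow> (\<integral>x. (norm (f j x - f k x))\<^sup>2 \<partial>M) < e"
      using Cauchy[OF \<open>e > 0\<close>] by blast
    have lim': "AE x in M. (\<lambda>k. f j x - f (r k) x) \<longlonglongrightarrow> f j x - g x" for j
      using lim by eventually_elim (intro tendsto_intros)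
    have "integrable M (\<lambda>x. (norm (f j x - g x))\<^sup>2) \<and> (\<integral>x. (norm (f j x - g x))\<^sup>2 \<partial>M) \<le> e" if "j \<ge> N" for j
    proof -
      have i: "integrable M (\<lambda>x. (norm (f j x - f (r k) x))\<^sup>2)" for k
        by (intro L2_diff_integrable int) auto
      have l: "(\<integral>x. (norm (f j x - f (r k) x))\<^sup>2 \<partial>M) \<le> e" if "k \<ge> N" for k
        using N[OF \<open>j \<ge> N\<close>, of "r k"] seq_suble[OF r, of k] that by simp
      show ?thesis
        using L2_Fatou[of "\<lambda>k x. f j x - f (r k) x" M "\<lambda>x. f j x - g x" N e, OF _ _ i l lim'] by simp
    qed
    then show ?thesis by blast
  qed
  obtain j where j: "integrable M (\<lambda>x. (norm (f j x - g x))\<^sup>2)" using *[of 1] by auto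
  show "integrable M (\<lambda>x. (norm (g x))\<^sup>2)"
    using L2_diff_integrable[OF _ _ int[of j] j] by simp
  show "(\<lambda>k. \<integral>x. (norm (f k x - g x))\<^sup>2 \<partial>M) \<longlonglongrightarrow> 0"
  proof (rule LIMSEQ_I)
    fix e :: real assume "e > 0"
    then obtain N where N: "\<And>j. j \<ge> N \<Longrightarrow> (\<integral>x. (norm (f j x - g x))\<^sup>2 \<partial>M) \<le> e/2" using *[of "e/2"] by auto
    have "norm ((\<integral>x. (norm (f n x - g x))\<^sup>2 \<partial>M) - 0) < e" if "n \<ge> N" for n
      using N[OF that] \<open>e > 0\<close> by simp
    then show "\<exists>N. \<forall>n\<ge>N. norm ((\<integral>x. (norm (f n x - g x))\<^sup>2 \<partial>M) - 0) < e" by blast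
  qed
qed

text \<open>The theorem of Riesz and Fischer: a subsequence with summable increments converges
  almost everywhere, and \<open>L2_Cauchy_AE_limit\<close> identifies its limit.\<close>

lemma L2_complete:
  fixes f :: "nat \<Rightarrow> 'a \<Rightarrow> 'b::{banach, second_countable_topology}"
  assumes meas[measurable]: "\<And>k. f k \<in> borel_measurable M"
    and int: "\<And>k. integrable M (\<lambda>x. (norm (f k x))\<^sup>2)"
    and Cauchy: "\<And>e. e > 0 \<Longrightarrow> \<exists>N. \<forall>j\<ge>N. \<forall>k\<ge>N. (\<integral>x. (norm (f j x - f k x))\<^sup>2 \<partial>M) < e"
  shows "\<exists>g. g \<in> borel_measurable M \<and> integrable M (\<lambda>x. (norm (g x))\<^sup>2) \<and>
    (\<lambda>k. \<integral>x. (norm (f k x - g x))\<^sup>2 \<partial>M) \<longlonglongrightarrow> 0"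
proof -
  have "\<exists>N. \<forall>j\<ge>N. \<forall>k\<ge>N. (\<integral>x. (norm (f j x - f k x))\<^sup>2 \<partial>M) < (1/4)^n" for n
    by (rule Cauchy) auto
  then obtain N where N: "\<And>n j k. j \<ge> N n \<Longrightarrow> k \<ge> N n \<Longrightarrow> (\<integral>x. (norm (f j x - f k x))\<^sup>2 \<partial>M) < (1/4)^n"
    by metis
  define r where "r = rec_nat (N 0) (\<lambda>n m. max (Suc m) (N (Suc n)))"
  have r: "strict_mono r" by (rule strict_monoI_Suc) (simp add: r_def less_max_iff_disj)
  have rN: "r n \<ge> N n" for n by (cases n) (auto simp: r_def)
  have d_le: "(\<integral>x. (norm (f (r (Suc n)) x - f (r n) x))\<^sup>2 \<partial>M) < (1/4)^n" for n
    using rN[of n] strict_monoD[OF r, of n "Suc n"] by (intro N) auto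
  \<comment> \<open>The square integrals of the increments are below 4^(-n), so the weight 2^n still
    leaves a convergent series.\<close>
  define d where "d = (\<lambda>n x. 2^n * (norm (f (r (Suc n)) x - f (r n) x))\<^sup>2)"
  have [measurable]: "d n \<in> borel_measurable M" for n unfolding d_def by measurable
  have d0: "0 \<le> d n x" for n x by (simp add: d_def)
  have "(\<integral>\<^sup>+x. (\<Sum>n. ennreal (d n x)) \<partial>M) = (\<Sum>n. \<integral>\<^sup>+x. ennreal (d n x) \<partial>M)"
    by (rule nn_integral_suminf) measurable
  also have "\<dots> \<le> (\<Sum>n. ennreal ((1/2)^n))"
  proof (intro suminf_le)
    fix n
    have "(\<integral>\<^sup>+x. ennreal (d n x) \<partial>M) = ennreal (\<integral>x. d n x \<partial>M)"
      by (rule nn_integral_eq_integral) (auto simp: d_def intro!: L2_diff_integrable int)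
    also have "\<dots> \<le> ennreal ((1/2)^n)"
    proof (rule ennreal_leI)
      have "(\<integral>x. d n x \<partial>M) \<le> 2^n * (1/4)^n" unfolding d_def using d_le[of n] by simp
      also have "\<dots> = (1/2)^n" by (simp add: power_mult_distrib[symmetric])
      finally show "(\<integral>x. d n x \<partial>M) \<le> (1/2)^n" .
    qed
    finally show "(\<integral>\<^sup>+x. ennreal (d n x) \<partial>M) \<le> ennreal ((1/2)^n)" .
  qed auto
  also have "\<dots> = ennreal (\<Sum>n. (1/2)^n)"
    by (rule suminf_ennreal2) (auto intro: summable_geometric)
  also have "\<dots> < \<infinity>" by simp
  finally have "(\<integral>\<^sup>+x. (\<Sum>n. ennreal (d n x)) \<partial>M) \<noteq> \<infinity>" by simp
  then have "AE x in M. (\<Sum>n. ennreal (d n x)) \<noteq> \<infinity>"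
    by (intro nn_integral_PInf_AE) auto
  then have conv: "AE x in M. convergent (\<lambda>n. f (r n) x)"
  proof eventually_elim
    case (elim x)
    have "summable (\<lambda>n. d n x)"
      using elim d0 by (intro summable_suminf_not_top) (auto simp: top_unique)
    then have "summable (\<lambda>n. (d n x + (1/2)^n) / 2)"
      by (intro summable_divide summable_add summable_geometric) auto
    then have "summable (\<lambda>n. norm (f (r (Suc n)) x - f (r n) x))"
    proof (rule summable_comparison_test'[where N=0])
      fix n
      \<comment> \<open>The inequality between arithmetic and geometric means, a <= (2^n a^2 +
        2^(-n)) / 2, passes from weighted squares to the increments themselves.\<close>
      define a where "a = norm (f (r (Suc n)) x - f (r n) x)"
      have "0 \<le> (2^n * a - 1)\<^sup>2" by simp
      then have "2 * 2^n * a \<le> 2^n * (2^n * a\<^sup>2) + 1" by (simp add: power2_eq_square algebra_simps)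
      then have "2 * a \<le> 2^n * a\<^sup>2 + (1/2)^n" by (simp add: field_simps)
      then show "norm (norm (f (r (Suc n)) x - f (r n) x)) \<le> (d n x + (1/2)^n) / 2"
        by (simp add: d_def a_def)
    qed
    then have "summable (\<lambda>n. f (r (Suc n)) x - f (r n) x)" by (rule summable_norm_cancel)
    then have "convergent (\<lambda>n. \<Sum>i<n. f (r (Suc i)) x - f (r i) x)"
      by (simp add: summable_iff_convergent)
    then have "convergent (\<lambda>n. f (r n) x - f (r 0) x)"
      by (simp add: sum_lessThan_telescope[where f="\<lambda>i. f (r i) x"])
    then show ?case
      using convergent_add[OF _ convergent_const, of "\<lambda>n. f (r n) x - f (r 0) x" "f (r 0) x"] by simp
  qed
  define g where "g = (\<lambda>x. lim (\<lambda>n. f (r n) x))"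
  have g[measurable]: "g \<in> borel_measurable M" unfolding g_def by measurable
  have "AE x in M. (\<lambda>n. f (r n) x) \<longlonglongrightarrow> g x"
    using conv by eventually_elim (simp add: g_def convergent_LIMSEQ_iff)
  from L2_Cauchy_AE_limit[OF meas g int Cauchy r this] g show ?thesis by blast
qed

lemma L2_inner_tendsto:
  fixes f :: "nat \<Rightarrow> 'a \<Rightarrow> real"
  assumes [measurable]: "\<And>k. f k \<in> borel_measurable M" "g \<in> borel_measurable M" "\<psi> \<in> borel_measurable M"
    and f: "\<And>k. integrable M (\<lambda>x. (f k x)\<^sup>2)" and g: "integrable M (\<lambda>x. (g x)\<^sup>2)" and \<psi>: "integrable M (\<lambda>x. (\<psi> x)\<^sup>2)"
    and lim: "(\<lambda>k. \<integral>x. (f k x - g x)\<^sup>2 \<partial>M) \<longlonglongrightarrow> 0"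
  shows "(\<lambda>k. \<integral>x. f k x * \<psi> x \<partial>M) \<longlonglongrightarrow> (\<integral>x. g x * \<psi> x \<partial>M)"
proof (rule LIM_zero_cancel)
  have d: "integrable M (\<lambda>x. (f k x - g x)\<^sup>2)" for k
    using L2_diff_integrable[of "f k" M g] f g by simp
  show "(\<lambda>k. (\<integral>x. f k x * \<psi> x \<partial>M) - (\<integral>x. g x * \<psi> x \<partial>M)) \<longlonglongrightarrow> 0"
  proof (rule Lim_null_comparison)
    show "\<forall>\<^sub>F k in sequentially. norm ((\<integral>x. f k x * \<psi> x \<partial>M) - (\<integral>x. g x * \<psi> x \<partial>M))
       \<le> sqrt (\<integral>x. (f k x - g x)\<^sup>2 \<partial>M) * sqrt (\<integral>x. (\<psi> x)\<^sup>2 \<partial>M)"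
    proof (rule always_eventually, rule allI)
      fix k
      have "(\<integral>x. f k x * \<psi> x \<partial>M) - (\<integral>x. g x * \<psi> x \<partial>M) = (\<integral>x. (f k x - g x) * \<psi> x \<partial>M)"
        using f g \<psi> by (simp add: left_diff_distrib integrable_mult_square)
      then show "norm ((\<integral>x. f k x * \<psi> x \<partial>M) - (\<integral>x. g x * \<psi> x \<partial>M))
         \<le> sqrt (\<integral>x. (f k x - g x)\<^sup>2 \<partial>M) * sqrt (\<integral>x. (\<psi> x)\<^sup>2 \<partial>M)"
        using integral_Cauchy_Schwarz[OF _ _ d \<psi>, of k] by simp
    qed
    show "(\<lambda>k. sqrt (\<integral>x. (f k x - g x)\<^sup>2 \<partial>M) * sqrt (\<integral>x. (\<psi> x)\<^sup>2 \<partial>M)) \<longlonglongrightarrow> 0"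
      using tendsto_mult[OF tendsto_real_sqrt[OF lim] tendsto_const] by simp
  qed
qed

text \<open>Mazur's argument: almost minimal elements of the convex sets \<open>C N\<close>, which contain the tails
  of the sequence, form a Cauchy sequence by the parallelogram law.\<close>

lemma L2_weak_limit:
  fixes g :: "nat \<Rightarrow> 'a \<Rightarrow> real"
  assumes meas[measurable]: "\<And>k. g k \<in> borel_measurable M"
    and int: "\<And>k. integrable M (\<lambda>x. (g k x)\<^sup>2)" and le: "\<And>k. (\<integral>x. (g k x)\<^sup>2 \<partial>M) \<le> B"
    and W: "\<And>\<psi>. \<psi> \<in> W \<Longrightarrow> \<psi> \<in> borel_measurable M" "\<And>\<psi>. \<psi> \<in> W \<Longrightarrow> integrable M (\<lambda>x. (\<psi> x)\<^sup>2)"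
    and lim: "\<And>\<psi>. \<psi> \<in> W \<Longrightarrow> (\<lambda>k. \<integral>x. g k x * \<psi> x \<partial>M) \<longlonglongrightarrow> l \<psi>"
  shows "\<exists>p. p \<in> borel_measurable M \<and> integrable M (\<lambda>x. (p x)\<^sup>2) \<and> (\<forall>\<psi>\<in>W. (\<integral>x. p x * \<psi> x \<partial>M) = l \<psi>)"
proof -
  \<comment> \<open>In place of the convex hull of a tail, \<open>C N\<close> collects all functions
    that obey every bound on the pairing errors that is common to the g_k with k >= N. This
    condition survives midpoints, which is the convexity that the parallelogram law asks for, and it
    makes the limit satisfy the desired pairings.\<close>
  define C where "C = (\<lambda>N. {q. q \<in> borel_measurable M \<and> integrable M (\<lambda>x. (q x)\<^sup>2) \<and>
     (\<forall>\<psi>\<in>W. \<forall>e. (\<forall>k\<ge>N. \<bar>(\<integral>x. g k x * \<psi> x \<partial>M) - l \<psi>\<bar> \<le> e) \<longrightarrow> \<bar>(\<integral>x. q x * \<psi> x \<partial>M) - l \<psi>\<bar> \<le> e)})"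
  have CD: "q \<in> borel_measurable M" "integrable M (\<lambda>x. (q x)\<^sup>2)" if "q \<in> C N" for q N
    using that by (auto simp: C_def)
  have gC: "g k \<in> C N" if "k \<ge> N" for k N using that int by (auto simp: C_def)
  have Cmono: "C m \<subseteq> C N" if "N \<le> m" for N m using that by (auto simp: C_def)
  have mid: "(\<lambda>x. (q x + q' x) / 2) \<in> C N" if q: "q \<in> C N" "q' \<in> C N" for q q' N
  proof -
    note [measurable] = CD(1)[OF q(1)] CD(1)[OF q(2)]
    have "integrable M (\<lambda>x. ((q x + q' x) / 2)\<^sup>2)"
      using integrable_divide[OF L2_diff_integrable[of q M "\<lambda>x. - q' x"], of 4] CD q by (simp add: power_divide)
    moreover have "\<bar>(\<integral>x. (q x + q' x) / 2 * \<psi> x \<partial>M) - l \<psi>\<bar> \<le> e"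
      if \<psi>: "\<psi> \<in> W" and e: "\<forall>k\<ge>N. \<bar>(\<integral>x. g k x * \<psi> x \<partial>M) - l \<psi>\<bar> \<le> e" for \<psi> e
    proof -
      have "integrable M (\<lambda>x. q x * \<psi> x)" "integrable M (\<lambda>x. q' x * \<psi> x)"
        using CD[OF q(1)] CD[OF q(2)] W[OF \<psi>] by (auto intro: integrable_mult_square)
      then have "(\<integral>x. (q x + q' x) / 2 * \<psi> x \<partial>M) = ((\<integral>x. q x * \<psi> x \<partial>M) + (\<integral>x. q' x * \<psi> x \<partial>M)) / 2"
        by (simp add: add_divide_distrib distrib_right)
      moreover have "\<bar>(\<integral>x. q x * \<psi> x \<partial>M) - l \<psi>\<bar> \<le> e" "\<bar>(\<integral>x. q' x * \<psi> x \<partial>M) - l \<psi>\<bar> \<le> e"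
        using q \<psi> e by (auto simp: C_def)
      ultimately show ?thesis by (simp add: abs_le_iff field_simps)
    qed
    ultimately show ?thesis by (auto simp: C_def)
  qed
  define n where "n = (\<lambda>q::'a \<Rightarrow> real. \<integral>x. (q x)\<^sup>2 \<partial>M)"
  have n0: "0 \<le> n q" for q by (simp add: n_def)
  define d where "d = (\<lambda>N. Inf (n ` C N))"
  have bdd: "bdd_below (n ` C N)" for N using n0 by (intro bdd_belowI[of _ 0]) auto
  have d_le: "d N \<le> n q" if "q \<in> C N" for q N
    unfolding d_def using bdd that by (intro cInf_lower) auto
  have "\<exists>q\<in>C N. n q < d N + 1 / real (Suc N)" for N
    using cInf_lessD[of "n ` C N" "d N + 1 / real (Suc N)"] gC[of N N] by (auto simp: d_def)
  then obtain f where f: "\<And>N. f N \<in> C N" "\<And>N. n (f N) < d N + 1 / real (Suc N)" by metis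
  have dmono: "d N \<le> d m" if "N \<le> m" for N m
    unfolding d_def using Cmono[OF that] gC[of m m] by (intro cInf_superset_mono bdd image_mono) auto
  have dB: "d N \<le> B" for N using d_le[OF gC[of N N]] le[of N] by (simp add: n_def)
  have "convergent d"
    using incseq_convergent[of d B] dmono dB by (metis convergent_def incseq_def)
  then have dC: "Cauchy d" by (rule convergent_Cauchy)
  have fm[measurable]: "f N \<in> borel_measurable M" and fi: "integrable M (\<lambda>x. (f N x)\<^sup>2)" for N
    using CD[OF f(1)[of N]] .
  \<comment> \<open>The midpoint of \<open>f N\<close> and \<open>f m\<close> lies in
    \<open>C N\<close>, so its square integral is at least \<open>d N\<close>; the parallelogram law
    turns this into a bound on the difference. Since \<open>d\<close> is monotone and bounded by
    \<open>B\<close>, the right side becomes small.\<close>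
  have diff: "(\<integral>x. (f N x - f m x)\<^sup>2 \<partial>M) \<le> 2 * (d m - d N) + 4 / real (Suc N)" if "N \<le> m" for N m
  proof -
    have fmC: "f m \<in> C N" using f Cmono[OF that] by auto
    have "(\<integral>x. (f N x - f m x)\<^sup>2 \<partial>M) = (\<integral>x. 2 * (f N x)\<^sup>2 + 2 * (f m x)\<^sup>2 - 4 * ((f N x + f m x) / 2)\<^sup>2 \<partial>M)"
      by (intro Bochner_Integration.integral_cong) (auto simp: power2_eq_square algebra_simps)
    also have "\<dots> = 2 * n (f N) + 2 * n (f m) - 4 * n (\<lambda>x. (f N x + f m x) / 2)"
      unfolding n_def using CD(2)[OF mid[OF f(1)[of N] fmC]] fi by simp
    also have "\<dots> \<le> 2 * (d N + 1 / real (Suc N)) + 2 * (d m + 1 / real (Suc m)) - 4 * d N"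
      using f(2)[of N] f(2)[of m] d_le[OF mid[OF f(1)[of N] fmC]] by simp
    also have "\<dots> \<le> 2 * (d m - d N) + 4 / real (Suc N)"
    proof -
      have "1 / real (Suc m) \<le> 1 / real (Suc N)" using that by (simp add: frac_le)
      then show ?thesis by simp
    qed
    finally show ?thesis .
  qed
  have Cauchy: "\<exists>N. \<forall>j\<ge>N. \<forall>k\<ge>N. (\<integral>x. (norm (f j x - f k x))\<^sup>2 \<partial>M) < e" if "e > 0" for e
  proof -
    obtain N1 where N1: "\<And>j k. j \<ge> N1 \<Longrightarrow> k \<ge> N1 \<Longrightarrow> \<bar>d j - d k\<bar> < e / 4"
      using CauchyD[OF dC, of "e/4"] \<open>e > 0\<close> by auto
    obtain N2 where N2: "4 / real (Suc N2) < e / 2"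
      using reals_Archimedean[of "e/8"] \<open>e > 0\<close> by (auto simp: field_simps inverse_eq_divide)
    have main: "(\<integral>x. (f j x - f k x)\<^sup>2 \<partial>M) < e" if "j \<ge> max N1 N2" "j \<le> k" for j k
    proof -
      have "4 / real (Suc j) \<le> 4 / real (Suc N2)" using that by (intro divide_left_mono) auto
      moreover have "\<bar>d k - d j\<bar> < e / 4" using that by (intro N1) auto
      moreover have "X < e" if "u \<le> v" "\<bar>y\<bar> < e / 4" "X \<le> 2 * y + u" "v < e / 2" for X u v y :: real
        using that by linarith
      ultimately show ?thesis using diff[OF that(2)] N2 by blast
    qed
    have "(\<integral>x. (norm (f j x - f k x))\<^sup>2 \<partial>M) < e" if "j \<ge> max N1 N2" "k \<ge> max N1 N2" for j k
    proof (cases "j \<le> k")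
      case True
      then show ?thesis using main that by simp
    next
      case False
      then show ?thesis using main[of k j] that by (simp add: power2_commute)
    qed
    then show ?thesis by blast
  qed
  obtain p where p: "p \<in> borel_measurable M" "integrable M (\<lambda>x. (norm (p x))\<^sup>2)"
      "(\<lambda>k. \<integral>x. (norm (f k x - p x))\<^sup>2 \<partial>M) \<longlonglongrightarrow> 0"
    using L2_complete[of f M, OF fm _ Cauchy] fi by auto
  have "(\<integral>x. p x * \<psi> x \<partial>M) = l \<psi>" if \<psi>: "\<psi> \<in> W" for \<psi>
  proof (rule LIMSEQ_unique)
    show "(\<lambda>k. \<integral>x. f k x * \<psi> x \<partial>M) \<longlonglongrightarrow> (\<integral>x. p x * \<psi> x \<partial>M)"
      using p fi W[OF \<psi>] by (intro L2_inner_tendsto) auto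
    show "(\<lambda>k. \<integral>x. f k x * \<psi> x \<partial>M) \<longlonglongrightarrow> l \<psi>"
    proof (rule LIMSEQ_I)
      fix e :: real assume "e > 0"
      obtain N where N: "\<And>k. k \<ge> N \<Longrightarrow> \<bar>(\<integral>x. g k x * \<psi> x \<partial>M) - l \<psi>\<bar> < e/2"
        using LIMSEQ_D[OF lim[OF \<psi>], of "e/2"] \<open>e > 0\<close> by auto
      have "\<bar>(\<integral>x. f k x * \<psi> x \<partial>M) - l \<psi>\<bar> \<le> e/2" if "k \<ge> N" for k
      proof -
        have "f k \<in> C N" using f Cmono[OF that] by auto
        moreover have "\<forall>k\<ge>N. \<bar>(\<integral>x. g k x * \<psi> x \<partial>M) - l \<psi>\<bar> \<le> e/2" using N less_imp_le by blast
        ultimately show ?thesis using \<psi> unfolding C_def by blast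
      qed
      moreover have "e/2 < e" using \<open>e > 0\<close> by simp
      ultimately show "\<exists>N. \<forall>n\<ge>N. norm ((\<integral>x. f n x * \<psi> x \<partial>M) - l \<psi>) < e"
        unfolding real_norm_def using le_less_trans by blast
    qed
  qed
  then show ?thesis using p by auto
qed

section \<open>Integration by parts and the fundamental lemma\<close>

lemma compact_supp_bounded:
  fixes f :: "'a::euclidean_space \<Rightarrow> real"
  assumes "continuous_on UNIV f" "compact C" "\<And>x. x \<notin> C \<Longrightarrow> f x = 0"
  obtains B where "B > 0" "\<And>x. \<bar>f x\<bar> \<le> B"
proof -
  have "compact (f ` C)"
    using assms by (intro compact_continuous_image continuous_on_subset[OF assms(1)]) auto
  then obtain B where B: "B > 0" "\<And>x. x \<in> C \<Longrightarrow> \<bar>f x\<bar> \<le> B"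
    using bounded_pos[of "f ` C"] compact_imp_bounded by (metis imageI real_norm_def)
  have "\<bar>f x\<bar> \<le> B" for x using B assms(3)[of x] by (cases "x \<in> C") auto
  then show thesis using B that by blast
qed

lemma compact_supp_integrable:
  fixes f :: "'a::euclidean_space \<Rightarrow> real"
  assumes "continuous_on C f" "compact C" "\<And>x. x \<notin> C \<Longrightarrow> f x = 0"
  shows "integrable lborel f"
proof -
  have "(\<lambda>x. indicator C x *\<^sub>R f x) = f" using assms(3) by (intro ext) (auto simp: indicator_def)
  then show ?thesis using borel_integrable_compact[OF assms(2,1)] by simp
qed

lemma lborel_integral_translation:
  fixes f :: "'a::euclidean_space \<Rightarrow> real"
  assumes "f \<in> borel_measurable borel"
  shows "(\<integral>x. f (a + x) \<partial>lborel) = (\<integral>x. f x \<partial>lborel)"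
  by (subst (2) lborel_distr_plus[of a, symmetric], subst integral_distr) (use assms in auto)

lemma partial_derivative_eq_0:
  fixes f :: "'a::euclidean_space \<Rightarrow> real"
  assumes "closed C" "\<And>x. x \<notin> C \<Longrightarrow> f x = 0" "x \<notin> C"
  shows "frechet_derivative f (at x) v = 0"
proof -
  have "(f has_derivative (\<lambda>_. 0)) (at x)"
    by (rule has_derivative_transform_within_open[of "\<lambda>_. 0" _ x UNIV "- C"]) (use assms in auto)
  then show ?thesis using frechet_derivative_at by metis
qed

lemma partial_derivative_DERIV:
  fixes f :: "'a::euclidean_space \<Rightarrow> real"
  assumes "(f has_derivative f') (at (x + s *\<^sub>R v))"
  shows "((\<lambda>s. f (x + s *\<^sub>R v)) has_real_derivative f' v) (at s)"
proof -
  have "((\<lambda>s. x + s *\<^sub>R v) has_derivative (\<lambda>h. h *\<^sub>R v)) (at s)"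
    by (auto intro!: derivative_eq_intros)
  from has_derivative_compose[OF this assms]
  have "((\<lambda>s. f (x + s *\<^sub>R v)) has_derivative (\<lambda>h. f' (h *\<^sub>R v))) (at s)" .
  moreover have "f' (h *\<^sub>R v) = f' v * h" for h
    using linear_scale[OF has_derivative_linear[OF assms]] by (simp add: mult.commute)
  ultimately show ?thesis by (simp add: has_field_derivative_def)
qed

text \<open>Translation invariance moves the difference quotient from \<open>f\<close>, which is
  merely continuous, to the smooth \<phi>, where dominated convergence applies. This discrete
  integration by parts is the source of every weak derivative below.\<close>

lemma diff_quotient_integral_tendsto:
  fixes f \<phi> :: "'a::euclidean_space \<Rightarrow> real"
  assumes f: "continuous_on UNIV f" and \<phi>: "smooth_on \<phi> UNIV"
    and C: "compact C" "\<And>x. x \<notin> C \<Longrightarrow> \<phi> x = 0" and i: "i \<in> Basis"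
  shows "(\<lambda>k. \<integral>x. (f (x + inverse (real (Suc k)) *\<^sub>R i) - f x) / inverse (real (Suc k)) * \<phi> x \<partial>lborel)
    \<longlonglongrightarrow> - (\<integral>x. f x * frechet_derivative \<phi> (at x) i \<partial>lborel)"
proof -
  define h where "h k = inverse (real (Suc k))" for k
  have h: "h k > 0" "h k \<le> 1" for k by (auto simp: h_def inverse_le_1_iff)
  define d where "d = (\<lambda>x. frechet_derivative \<phi> (at x) i)"
  have D: "(\<phi> has_derivative frechet_derivative \<phi> (at x)) (at x)" for x
    using smooth_on_has_derivative[OF open_UNIV \<phi>] by simp
  have dc: "continuous_on UNIV d" unfolding d_def
    by (rule smooth_on_imp_continuous_on[OF smooth_on_partial[OF \<phi> i]])
  have \<phi>c: "continuous_on UNIV \<phi>" by (rule smooth_on_imp_continuous_on[OF \<phi>])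
  have d0: "d x = 0" if "x \<notin> C" for x
    unfolding d_def by (rule partial_derivative_eq_0[OF compact_imp_closed[OF C(1)] C(2) that])
  obtain B where B: "B > 0" "\<And>x. \<bar>d x\<bar> \<le> B" by (rule compact_supp_bounded[OF dc C(1) d0]) auto
  have fb: "f \<in> borel_measurable borel" and \<phi>b: "\<phi> \<in> borel_measurable borel" and db: "d \<in> borel_measurable borel"
    using f \<phi>c dc by (auto intro: borel_measurable_continuous_onI)
  note [measurable] = fb \<phi>b db
  \<comment> \<open>The region swept out by \<open>C\<close> under translations of length at most 1
    along \<open>i\<close>. It is compact and contains the supports of all the shifted test
    functions, hence carries the dominating function.\<close>
  define C' where "C' = (\<lambda>(x, s). x + s *\<^sub>R i) ` (C \<times> {0..1})"
  have C': "compact C'" unfolding C'_def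
    by (intro compact_continuous_image compact_Times C) (auto intro!: continuous_intros simp: case_prod_beta)
  have CC': "C \<subseteq> C'"
  proof
    fix x assume "x \<in> C"
    then show "x \<in> C'" unfolding C'_def by (intro image_eqI[of _ _ "(x, 0)"]) auto
  qed
  have out: "\<phi> (x - h k *\<^sub>R i) = 0" if "x \<notin> C'" for x k
  proof (rule C(2))
    show "x - h k *\<^sub>R i \<notin> C"
    proof
      assume "x - h k *\<^sub>R i \<in> C"
      then have "x \<in> C'" unfolding C'_def using h[of k]
        by (intro image_eqI[of _ _ "(x - h k *\<^sub>R i, h k)"]) auto
      then show False using that by simp
    qed
  qed
  have eq: "(\<integral>x. (f (x + h k *\<^sub>R i) - f x) / h k * \<phi> x \<partial>lborel) = (\<integral>x. f x * ((\<phi> (x - h k *\<^sub>R i) - \<phi> x) / h k) \<partial>lborel)" for k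
  proof -
    have c1: "continuous_on UNIV (\<lambda>x. f (x + h k *\<^sub>R i) * \<phi> x)"
      by (intro continuous_intros continuous_on_compose2[OF f] \<phi>c) auto
    have i1: "integrable lborel (\<lambda>x. f (x + h k *\<^sub>R i) * \<phi> x)"
      by (rule compact_supp_integrable[OF continuous_on_subset[OF c1] C(1)]) (auto simp: C(2))
    have c2: "continuous_on UNIV (\<lambda>x. f x * \<phi> x)" by (intro continuous_intros f \<phi>c)
    have i2: "integrable lborel (\<lambda>x. f x * \<phi> x)"
      by (rule compact_supp_integrable[OF continuous_on_subset[OF c2] C(1)]) (auto simp: C(2))
    have c3: "continuous_on UNIV (\<lambda>x. f x * \<phi> (x - h k *\<^sub>R i))"
      by (intro continuous_intros f continuous_on_compose2[OF \<phi>c]) auto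
    have i3: "integrable lborel (\<lambda>x. f x * \<phi> (x - h k *\<^sub>R i))"
      by (rule compact_supp_integrable[OF continuous_on_subset[OF c3] C']) (auto simp: out)
    have "(\<integral>x. f (x + h k *\<^sub>R i) * \<phi> x \<partial>lborel) = (\<integral>x. f x * \<phi> (x - h k *\<^sub>R i) \<partial>lborel)"
      using lborel_integral_translation[of "\<lambda>x. f x * \<phi> (x - h k *\<^sub>R i)" "h k *\<^sub>R i"] c3
      by (simp add: borel_measurable_continuous_onI add.commute)
    moreover have "(\<integral>x. (f (x + h k *\<^sub>R i) - f x) / h k * \<phi> x \<partial>lborel) =
        ((\<integral>x. f (x + h k *\<^sub>R i) * \<phi> x \<partial>lborel) - (\<integral>x. f x * \<phi> x \<partial>lborel)) / h k"
      using i1 i2 by (simp add: left_diff_distrib diff_divide_distrib)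
    moreover have "(\<integral>x. f x * ((\<phi> (x - h k *\<^sub>R i) - \<phi> x) / h k) \<partial>lborel) =
        ((\<integral>x. f x * \<phi> (x - h k *\<^sub>R i) \<partial>lborel) - (\<integral>x. f x * \<phi> x \<partial>lborel)) / h k"
      using i3 i2 by (simp add: right_diff_distrib diff_divide_distrib)
    ultimately show ?thesis by (simp only:)
  qed
  have "(\<lambda>k. \<integral>x. f x * ((\<phi> (x - h k *\<^sub>R i) - \<phi> x) / h k) \<partial>lborel) \<longlonglongrightarrow> (\<integral>x. f x * (- d x) \<partial>lborel)"
  proof (rule integral_dominated_convergence)
    show "integrable lborel (\<lambda>x. indicator C' x *\<^sub>R (\<bar>f x\<bar> * B))"
      by (rule borel_integrable_compact[OF C']) (intro continuous_intros continuous_on_subset[OF f], auto)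
    show "(\<lambda>x. f x * (- d x)) \<in> borel_measurable lborel" using fb db by simp
    show "(\<lambda>x. f x * ((\<phi> (x - h k *\<^sub>R i) - \<phi> x) / h k)) \<in> borel_measurable lborel" for k
      by measurable
    show "AE x in lborel. (\<lambda>k. f x * ((\<phi> (x - h k *\<^sub>R i) - \<phi> x) / h k)) \<longlonglongrightarrow> f x * (- d x)"
    proof (rule AE_I2)
      fix x
      have "((\<lambda>s. \<phi> (x + s *\<^sub>R (- i))) has_real_derivative frechet_derivative \<phi> (at x) (- i)) (at 0)"
        by (rule partial_derivative_DERIV) (simp add: D)
      moreover have "frechet_derivative \<phi> (at x) (- i) = - d x"
        unfolding d_def by (rule linear_neg[OF has_derivative_linear[OF D]])
      ultimately have "((\<lambda>s. (\<phi> (x - s *\<^sub>R i) - \<phi> x) / s) \<longlongrightarrow> - d x) (at 0)"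
        by (simp add: has_field_derivative_iff)
      moreover have "filterlim h (at 0) sequentially"
        unfolding filterlim_at using h LIMSEQ_inverse_real_of_nat by (auto simp: h_def[abs_def])
      ultimately have "(\<lambda>k. (\<phi> (x - h k *\<^sub>R i) - \<phi> x) / h k) \<longlonglongrightarrow> - d x"
        by (rule filterlim_compose)
      then show "(\<lambda>k. f x * ((\<phi> (x - h k *\<^sub>R i) - \<phi> x) / h k)) \<longlonglongrightarrow> f x * (- d x)"
        by (intro tendsto_intros)
    qed
    show "AE x in lborel. norm (f x * ((\<phi> (x - h k *\<^sub>R i) - \<phi> x) / h k)) \<le> indicator C' x *\<^sub>R (\<bar>f x\<bar> * B)" for k
    proof (rule AE_I2)
      fix x
      show "norm (f x * ((\<phi> (x - h k *\<^sub>R i) - \<phi> x) / h k)) \<le> indicator C' x *\<^sub>R (\<bar>f x\<bar> * B)"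
      proof (cases "x \<in> C'")
        case True
        have DD: "((\<lambda>s. \<phi> (x + s *\<^sub>R (- i))) has_real_derivative frechet_derivative \<phi> (at (x + s *\<^sub>R (- i))) (- i)) (at s)" for s
          by (rule partial_derivative_DERIV) (rule D)
        obtain s where "\<phi> (x + h k *\<^sub>R (- i)) - \<phi> (x + 0 *\<^sub>R (- i)) = (h k - 0) * frechet_derivative \<phi> (at (x + s *\<^sub>R (- i))) (- i)"
          using MVT2[of 0 "h k", OF h(1) DD] by blast
        moreover have "frechet_derivative \<phi> (at y) (- i) = - d y" for y
          unfolding d_def by (rule linear_neg[OF has_derivative_linear[OF D]])
        ultimately have "(\<phi> (x - h k *\<^sub>R i) - \<phi> x) / h k = - d (x + s *\<^sub>R (- i))"
          using h(1)[of k] by (simp add: field_simps)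
        then have "\<bar>(\<phi> (x - h k *\<^sub>R i) - \<phi> x) / h k\<bar> \<le> B" using B(2) by simp
        from mult_left_mono[OF this abs_ge_zero[of "f x"]] True show ?thesis
          by (simp only: abs_mult real_norm_def indicator_simps scaleR_one)
      next
        case False
        then show ?thesis using out[OF False] C(2)[of x] CC' by auto
      qed
    qed
  qed
  then show ?thesis unfolding eq[symmetric] by (simp add: d_def h_def)
qed

text \<open>For the constant function 1 the difference quotients vanish, and with them their
  limit.\<close>

lemma integral_partial_derivative_eq_0:
  fixes \<phi> :: "'a::euclidean_space \<Rightarrow> real"
  assumes "smooth_on \<phi> UNIV" "compact C" "\<And>x. x \<notin> C \<Longrightarrow> \<phi> x = 0" "i \<in> Basis"
  shows "(\<integral>x. frechet_derivative \<phi> (at x) i \<partial>lborel) = 0"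
  using diff_quotient_integral_tendsto[of "\<lambda>_. 1" \<phi> C i] assms LIMSEQ_unique[OF _ tendsto_const] by fastforce

section \<open>Functions that are orthogonal to all test functions\<close>

text \<open>Open boxes form an intersection-stable generator of the Borel sets, and the sets over
  which \<open>f\<close> integrates to 0 form a Dynkin system; the vanishing of the total integral
  accounts for complements.\<close>

lemma AE_0_of_box_integrals:
  fixes f :: "'a::euclidean_space \<Rightarrow> real"
  assumes f: "integrable lborel f" and 0: "(\<integral>x. f x \<partial>lborel) = 0"
    and box: "\<And>a b. (\<integral>x. indicator (box a b) x * f x \<partial>lborel) = 0"
  shows "AE x in lborel. f x = 0"
proof (rule sigma_finite_measure.density_zero[OF sigma_finite_lborel f])
  have [measurable]: "f \<in> borel_measurable borel" using borel_measurable_integrable[OF f] by simp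
  have fi: "integrable lborel (\<lambda>x. indicator A x * f x)" if "A \<in> sets borel" for A
    using integrable_mult_indicator[OF _ f, of A] that by simp
  fix A :: "'a set" assume "A \<in> sets lborel"
  then have A: "A \<in> sigma_sets UNIV (range (\<lambda>(a, b). box a b))"
    by (simp add: borel_eq_box)
  have stable: "Int_stable (range (\<lambda>(a, b). box a b :: 'a set))"
    by (auto simp: Int_stable_def box_Int_box)
  have "range (\<lambda>(a, b). box a b) \<subseteq> Pow (UNIV :: 'a set)" by simp
  from stable this A
  have "(\<integral>x. indicator A x * f x \<partial>lborel) = 0"
  proof (induction rule: sigma_sets_induct_disjoint)
    case (basic A)
    then show ?case using box by auto
  next
    case empty
    then show ?case by simp
  next
    case (compl A)
    then have "A \<in> sets borel" by (simp add: borel_eq_box)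
    have "(\<lambda>x. indicator (UNIV - A) x * f x) = (\<lambda>x. f x - indicator A x * f x)"
      by (auto simp: indicator_def)
    then show ?case using compl fi[OF \<open>A \<in> sets borel\<close>] f 0 by simp
  next
    case (union A)
    then have A: "A i \<in> sets borel" for i by (auto simp: borel_eq_box)
    have "set_lebesgue_integral lborel (\<Union>i. A i) f = (\<Sum>i. set_lebesgue_integral lborel (A i) f)"
      using A union f
      by (intro lebesgue_integral_countable_add) (auto simp: disjoint_family_on_def set_integrable_def intro!: fi)
    then show ?case using union by (simp add: set_lebesgue_integral_def)
  qed
  then show "set_lebesgue_integral lborel A f = 0" by (simp add: set_lebesgue_integral_def)
qed

text \<open>A product of flat exponentials at the two ends of every side. As \<open>k\<close> grows,
  these smooth functions approximate the indicator of the open box from below.\<close>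

definition box_bump :: "'a::euclidean_space \<Rightarrow> 'a \<Rightarrow> nat \<Rightarrow> 'a \<Rightarrow> real" where
  "box_bump a b k x = (\<Prod>i\<in>Basis. exp_flat (real k * (x \<bullet> i - a \<bullet> i)) * exp_flat (real k * (b \<bullet> i - x \<bullet> i)))"

lemma smooth_on_box_bump: "smooth_on (box_bump a b k) UNIV"
proof -
  have "smooth_on (\<lambda>x. exp_flat (real k * (x \<bullet> i - a \<bullet> i))) UNIV" for i :: 'a
    by (rule smooth_on_compose[OF _ _ _ smooth_on_exp_flat])
       (auto intro!: smooth_on_mult smooth_on_diff smooth_on_inner)
  moreover have "smooth_on (\<lambda>x. exp_flat (real k * (b \<bullet> i - x \<bullet> i))) UNIV" for i :: 'a
    by (rule smooth_on_compose[OF _ _ _ smooth_on_exp_flat])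
       (auto intro!: smooth_on_mult smooth_on_diff smooth_on_inner)
  ultimately show ?thesis unfolding box_bump_def[abs_def]
    by (intro smooth_on_prod smooth_on_mult) auto
qed

lemma box_bump_bounds: "0 \<le> box_bump a b k x" "box_bump a b k x \<le> 1"
  unfolding box_bump_def by (auto intro!: prod_nonneg prod_le_1 mult_le_one simp: exp_flat_nonneg exp_flat_le_1)

lemma box_bump_eq_0: "x \<notin> box a b \<Longrightarrow> box_bump a b k x = 0"
proof -
  assume "x \<notin> box a b"
  then obtain i where i: "i \<in> Basis" "x \<bullet> i \<le> a \<bullet> i \<or> b \<bullet> i \<le> x \<bullet> i" by (auto simp: mem_box not_less)
  then have "real k * (x \<bullet> i - a \<bullet> i) \<le> 0 \<or> real k * (b \<bullet> i - x \<bullet> i) \<le> 0"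
    by (auto simp: mult_nonneg_nonpos)
  then show ?thesis unfolding box_bump_def using i(1) by (intro prod_zero bexI[of _ i]) (auto simp: exp_flat_0)
qed

lemma box_bump_tendsto: "(\<lambda>k. box_bump a b k x) \<longlonglongrightarrow> indicator (box a b) x"
proof (cases "x \<in> box a b")
  case True
  have *: "(\<lambda>k. exp_flat (real k * c)) \<longlonglongrightarrow> 1" if "c > 0" for c
  proof -
    have "filterlim (\<lambda>k. real k * c) at_top sequentially"
      using that by (intro filterlim_at_top_mult_tendsto_pos[OF tendsto_const] filterlim_real_sequentially) auto
    then have "(\<lambda>k. inverse (real k * c)) \<longlonglongrightarrow> 0"
      by (rule tendsto_inverse_0_at_top)
    then have "(\<lambda>k. exp (- inverse (real k * c))) \<longlonglongrightarrow> exp (- 0)"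
      by (intro tendsto_intros)
    then have "(\<lambda>k. exp (- inverse (real k * c))) \<longlonglongrightarrow> 1" by simp
    then show ?thesis
      by (rule Lim_transform_eventually)
         (use that in \<open>auto simp: exp_flat_def inverse_eq_divide intro!: eventually_sequentiallyI[of 1]\<close>)
  qed
  have "(\<lambda>k. box_bump a b k x) \<longlonglongrightarrow> (\<Prod>i\<in>(Basis::'a set). 1 * 1)"
    unfolding box_bump_def using True
    by (intro tendsto_prod tendsto_mult *) (auto simp: mem_box)
  then show ?thesis using True by simp
qed (simp add: box_bump_eq_0)

text \<open>Smooth bumps converge to the indicators of boxes whose closure lies in \<open>S\<close>,
  so all integrals of \<open>p\<close> over such boxes vanish; a box with closure in
  \<open>S\<close> then carries only the zero function.\<close>

lemma fundamental_lemma_calculus_variations: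
  fixes p :: "real^'n \<Rightarrow> real"
  assumes S: "open S" and p: "\<And>C. compact C \<Longrightarrow> C \<subseteq> S \<Longrightarrow> integrable (lebesgue_on C) p"
    and 0: "\<And>\<phi>. \<phi> \<in> test_functions S \<Longrightarrow> (\<integral>x. \<phi> x * p x \<partial>lebesgue_on S) = 0"
  shows "AE x in lebesgue_on S. p x = 0"
proof -
  have box0: "(\<integral>x. indicator (box a b) x * p x \<partial>lebesgue) = 0" if ab: "cbox a b \<subseteq> S" for a b
  proof -
    have int: "integrable lebesgue (\<lambda>x. indicator (cbox a b) x * p x)"
      using p[OF compact_cbox ab] by (simp add: integrable_restrict_space)
    have "box_bump a b k x = 0" if "x \<notin> cbox a b" for k x
      using that box_bump_eq_0 box_subset_cbox by blast
    then have "box_bump a b k \<in> test_functions S" for k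
      unfolding test_functions_def
      using smooth_on_box_bump ab by (auto intro!: exI[of _ "cbox a b"])
    then have Z: "(\<integral>x. box_bump a b k x * p x \<partial>lebesgue_on S) = 0" for k using 0 by blast
    have "(\<integral>x. box_bump a b k x * p x \<partial>lebesgue_on S) = (\<integral>x. box_bump a b k x * (indicator (cbox a b) x * p x) \<partial>lebesgue)" for k
    proof -
      have *: "indicator S x * (box_bump a b k x * p x) = box_bump a b k x * (indicator (cbox a b) x * p x)" for x
      proof (cases "x \<in> box a b")
        case True
        then have "x \<in> cbox a b" "x \<in> S" using ab box_subset_cbox by blast+
        then show ?thesis by simp
      qed (simp add: box_bump_eq_0)
      show ?thesis using S by (subst integral_restrict_space) (simp_all only: real_scaleR_def *, simp)
    qed
    with Z have Z': "(\<integral>x. box_bump a b k x * (indicator (cbox a b) x * p x) \<partial>lebesgue) = 0" for k by simp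
    have m: "(\<lambda>x. indicator (cbox a b) x * p x) \<in> borel_measurable lebesgue"
      using int by (rule borel_measurable_integrable)
    have bm: "box_bump a b k \<in> borel_measurable lebesgue" for k
      using smooth_on_imp_continuous_on[OF smooth_on_box_bump]
      by (intro measurable_completion) (auto intro: borel_measurable_continuous_onI)
    have "(\<lambda>k. \<integral>x. box_bump a b k x * (indicator (cbox a b) x * p x) \<partial>lebesgue) \<longlonglongrightarrow>
          (\<integral>x. indicator (box a b) x * (indicator (cbox a b) x * p x) \<partial>lebesgue)"
    proof (rule integral_dominated_convergence[OF _ _ integrable_norm[OF int]])
      show "(\<lambda>x. indicator (box a b) x * (indicator (cbox a b) x * p x)) \<in> borel_measurable lebesgue"
        by (rule borel_measurable_times[OF borel_measurable_indicator m]) simp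
      show "(\<lambda>x. box_bump a b k x * (indicator (cbox a b) x * p x)) \<in> borel_measurable lebesgue" for k
        by (rule borel_measurable_times[OF bm m])
      show "AE x in lebesgue. (\<lambda>k. box_bump a b k x * (indicator (cbox a b) x * p x)) \<longlonglongrightarrow>
          indicator (box a b) x * (indicator (cbox a b) x * p x)"
        by (intro AE_I2 tendsto_intros box_bump_tendsto)
      show "AE x in lebesgue. norm (box_bump a b k x * (indicator (cbox a b) x * p x)) \<le> norm (indicator (cbox a b) x * p x)" for k
        using box_bump_bounds[of a b k] by (intro AE_I2) (simp add: norm_mult mult_left_le_one_le abs_mult)
    qed
    then have "(\<integral>x. indicator (box a b) x * (indicator (cbox a b) x * p x) \<partial>lebesgue) = 0"
      unfolding Z' using LIMSEQ_unique tendsto_const by blast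
    moreover have "indicator (box a b) x * (indicator (cbox a b) x * p x) = indicator (box a b) x * p x" for x
      using box_subset_cbox[of a b] by (auto simp: indicator_def)
    ultimately show ?thesis by simp
  qed
  have local: "AE x in lebesgue. x \<in> box a b \<longrightarrow> p x = 0" if ab: "cbox a b \<subseteq> S" for a b
  proof -
    define f where "f = (\<lambda>x. indicator (box a b) x * p x)"
    have int: "integrable lebesgue f"
    proof -
      have "integrable lebesgue (\<lambda>x. indicator (box a b) x *\<^sub>R (indicator (cbox a b) x * p x))"
        using p[OF compact_cbox ab] by (intro integrable_mult_indicator) (simp_all add: integrable_restrict_space)
      moreover have "indicator (box a b) x *\<^sub>R (indicator (cbox a b) x * p x) = f x" for x
        using box_subset_cbox[of a b] by (auto simp: indicator_def f_def)
      ultimately show ?thesis by simp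
    qed
    \<comment> \<open>The generator argument needs Borel sets and \<open>lborel\<close>, while
      \<open>p\<close> is only Lebesgue measurable; a Borel representative bridges the two.\<close>
    obtain g where g: "g \<in> borel_measurable lborel" "AE x in lborel. f x = g x"
      using completion_ex_borel_measurable_real[OF borel_measurable_integrable[OF int]] by blast
    have g': "AE x in lebesgue. f x = g x" using g(2) by (rule AE_completion)
    have gm: "g \<in> borel_measurable lebesgue" using g(1) by (rule measurable_completion)
    have "integrable lebesgue g" using integrable_cong_AE_imp[OF int gm] g' by simp
    then have gi: "integrable lborel g" using g(1) by (simp add: integrable_completion)
    have gbox: "(\<integral>x. indicator B x * g x \<partial>lborel) = (\<integral>x. indicator B x * f x \<partial>lebesgue)" if "B \<in> sets borel" for B
    proof -
      have "(\<integral>x. indicator B x * g x \<partial>lborel) = (\<integral>x. indicator B x * g x \<partial>lebesgue)"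
        using g(1) that by (intro integral_completion[symmetric]) simp
      also have "\<dots> = (\<integral>x. indicator B x * f x \<partial>lebesgue)"
      proof (rule integral_cong_AE)
        have [measurable]: "B \<in> sets lebesgue" using that by simp
        show "(\<lambda>x. indicator B x * g x) \<in> borel_measurable lebesgue" using gm by simp
        show "(\<lambda>x. indicator B x * f x) \<in> borel_measurable lebesgue" using borel_measurable_integrable[OF int] by simp
        show "AE x in lebesgue. indicator B x * g x = indicator B x * f x" using g' by eventually_elim simp
      qed
      finally show ?thesis .
    qed
    have "AE x in lborel. g x = 0"
    proof (rule AE_0_of_box_integrals[OF gi])
      show "(\<integral>x. g x \<partial>lborel) = 0"
        using gbox[of UNIV] box0[OF ab] by (simp add: f_def)
      fix c d
      obtain u v where uv: "box c d \<inter> box a b = box u v" using box_Int_box[of c d a b] by blast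
      have "(\<integral>x. indicator (box u v) x * p x \<partial>lebesgue) = 0"
      proof (cases "box u v = {}")
        case False
        have "box u v \<subseteq> cbox a b" using uv box_subset_cbox by blast
        then have "closure (box u v) \<subseteq> cbox a b" by (rule closure_minimal) (rule closed_cbox)
        then have "cbox u v \<subseteq> S" using closure_box[OF False] ab by auto
        then show ?thesis by (rule box0)
      qed simp
      moreover have "indicator (box c d) x * f x = indicator (box u v) x * p x" for x
        unfolding f_def uv[symmetric] by (auto simp: indicator_def)
      ultimately show "(\<integral>x. indicator (box c d) x * g x \<partial>lborel) = 0"
        by (simp add: gbox)
    qed
    then have "AE x in lebesgue. g x = 0" by (rule AE_completion)
    with g' show ?thesis by eventually_elim (auto simp: f_def)
  qed
  \<comment> \<open>By Lindelof's theorem countably many of these boxes cover \<open>S\<close>, so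
    the exceptional null sets can be united.\<close>
  define F where "F = {box a b |a b. cbox a b \<subseteq> S}"
  have "open X" if "X \<in> F" for X using that by (auto simp: F_def)
  then obtain F' where F': "F' \<subseteq> F" "countable F'" "\<Union>F' = \<Union>F"
    using Lindelof[of F] by blast
  have SF: "S \<subseteq> \<Union>F"
  proof
    fix x assume "x \<in> S"
    then obtain a b where "cbox a b \<subseteq> S" "x \<in> box a b" "\<forall>i\<in>Basis. a \<bullet> i < b \<bullet> i"
      by (rule open_contains_cbox[OF S])
    then show "x \<in> \<Union>F" by (auto simp: F_def)
  qed
  have "AE x in lebesgue. x \<in> X \<longrightarrow> p x = 0" if "X \<in> F'" for X
    using F'(1) that local unfolding F_def by blast
  then have "AE x in lebesgue. \<forall>X\<in>F'. x \<in> X \<longrightarrow> p x = 0"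
    unfolding AE_ball_countable[OF F'(2)] by blast
  then have "AE x in lebesgue. x \<in> S \<longrightarrow> p x = 0"
    by eventually_elim (use SF F' in blast)
  then show ?thesis using S by (simp add: AE_restrict_space_iff)
qed

section \<open>Weak gradients\<close>

lemma set_integrable_continuous_compact:
  fixes f :: "'a::euclidean_space \<Rightarrow> real"
  assumes "compact C" "continuous_on C f"
  shows "set_integrable lebesgue C f"
proof -
  have "integrable lborel (\<lambda>x. indicator C x *\<^sub>R f x)" by (rule borel_integrable_compact[OF assms])
  then show ?thesis unfolding set_integrable_def
    by (subst integrable_completion) (auto dest: borel_measurable_integrable)
qed

lemma compact_sets_lebesgue: "compact C \<Longrightarrow> C \<in> sets lebesgue"
  using lmeasurable_compact by (auto simp: fmeasurable_def)

lemma set_integrable_iff_lebesgue_on: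
  fixes f :: "'a::euclidean_space \<Rightarrow> 'b::{banach, second_countable_topology}"
  shows "S \<in> sets lebesgue \<Longrightarrow> set_integrable lebesgue S f \<longleftrightarrow> integrable (lebesgue_on S) f"
  by (simp add: integrable_restrict_space set_integrable_def)

lemma set_integral_eq_lebesgue_on:
  fixes f :: "'a::euclidean_space \<Rightarrow> 'b::{banach, second_countable_topology}"
  shows "S \<in> sets lebesgue \<Longrightarrow> set_lebesgue_integral lebesgue S f = integral\<^sup>L (lebesgue_on S) f"
  by (simp add: integral_restrict_space set_lebesgue_integral_def)

lemma integral_lebesgue_on_eq_lborel:
  fixes f :: "'a::euclidean_space \<Rightarrow> real"
  assumes "S \<in> sets lebesgue" "f \<in> borel_measurable borel" "\<And>x. x \<notin> S \<Longrightarrow> f x = 0"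
  shows "(\<integral>x. f x \<partial>lebesgue_on S) = (\<integral>x. f x \<partial>lborel)"
proof -
  have *: "indicator S x *\<^sub>R f x = f x" for x using assms(3) by (cases "x \<in> S") auto
  have "(\<integral>x. f x \<partial>lebesgue_on S) = (\<integral>x. f x \<partial>lebesgue)"
    using assms(1) by (subst integral_restrict_space) (simp_all only: *, simp)
  then show ?thesis using assms by (simp add: integral_completion)
qed

lemma locally_integrable_mult:
  fixes f g :: "'a::euclidean_space \<Rightarrow> real"
  assumes "locally_integrable S f" "continuous_on S g"
  shows "locally_integrable S (\<lambda>x. g x * f x)"
  unfolding locally_integrable_def
proof (intro allI impI)
  fix C assume C: "compact C \<and> C \<subseteq> S"
  then have g: "continuous_on C g" using assms(2) continuous_on_subset by blast
  show "set_integrable lebesgue C (\<lambda>x. g x * f x)"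
  proof (rule absolutely_integrable_bounded_measurable_product[OF bilinear_times])
    show "bounded (g ` C)" using C g by (auto intro: compact_imp_bounded compact_continuous_image)
    show "C \<in> sets lebesgue" using C by (auto intro: compact_sets_lebesgue)
    then show "g \<in> borel_measurable (lebesgue_on C)"
      by (rule continuous_imp_measurable_on_sets_lebesgue[OF g])
    show "set_integrable lebesgue C f" using assms(1) C by (auto simp: locally_integrable_def)
  qed
qed

lemma locally_integrable_continuous:
  fixes f :: "'a::euclidean_space \<Rightarrow> real"
  assumes "continuous_on S f"
  shows "locally_integrable S f"
  unfolding locally_integrable_def
  using assms by (auto intro: set_integrable_continuous_compact continuous_on_subset)

lemma locally_integrable_square_integrable:
  fixes f :: "'a::euclidean_space \<Rightarrow> real"
  assumes "S \<in> lmeasurable" "f \<in> borel_measurable (lebesgue_on S)" "integrable (lebesgue_on S) (\<lambda>x. (f x)\<^sup>2)"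
  shows "integrable (lebesgue_on S) f" "locally_integrable S f"
proof -
  interpret finite_measure "lebesgue_on S" by (rule finite_measure_lebesgue_on[OF assms(1)])
  show *: "integrable (lebesgue_on S) f" by (rule square_integrable_imp_integrable[OF assms(2,3)])
  have S: "S \<in> sets lebesgue" using assms(1) by auto
  show "locally_integrable S f"
    unfolding locally_integrable_def
    using * S by (auto simp: set_integrable_iff_lebesgue_on[symmetric] intro: set_integrable_subset compact_sets_lebesgue)
qed

lemma compact_supp_lebesgue_on_integrable:
  fixes f g :: "'a::euclidean_space \<Rightarrow> real"
  assumes S: "S \<in> sets lebesgue" and f: "locally_integrable S f" and g: "continuous_on S g"
    and C: "compact C" "C \<subseteq> S" and 0: "\<And>x. x \<in> S \<Longrightarrow> x \<notin> C \<Longrightarrow> g x = 0"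
  shows "integrable (lebesgue_on S) (\<lambda>x. g x * f x)"
proof -
  have "set_integrable lebesgue C (\<lambda>x. g x * f x)"
    using locally_integrable_mult[OF f g] C by (auto simp: locally_integrable_def)
  moreover have "indicator C x *\<^sub>R (g x * f x) = indicator S x *\<^sub>R (g x * f x)" for x
    using 0[of x] C by (cases "x \<in> C"; cases "x \<in> S") auto
  ultimately have "set_integrable lebesgue S (\<lambda>x. g x * f x)"
    unfolding set_integrable_def by (simp only:)
  then show ?thesis using S by (simp add: set_integrable_iff_lebesgue_on)
qed

lemma locally_integrable_component:
  fixes p :: "'a::euclidean_space \<Rightarrow> real^'n"
  shows "locally_integrable S p \<longleftrightarrow> (\<forall>i. locally_integrable S (\<lambda>x. p x $ i))"
proof -
  have "p absolutely_integrable_on C \<longleftrightarrow> (\<forall>i. (\<lambda>x. p x $ i) absolutely_integrable_on C)" for C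
    by (subst absolutely_integrable_componentwise_iff) (auto simp: Basis_vec_def inner_axis)
  then show ?thesis unfolding locally_integrable_def by blast
qed

lemma test_functionsE:
  assumes "\<phi> \<in> test_functions S"
  obtains C where "smooth_on \<phi> UNIV" "compact C" "C \<subseteq> S" "\<And>x. x \<notin> C \<Longrightarrow> \<phi> x = 0"
  using assms unfolding test_functions_def by blast

lemma test_functionsI:
  assumes "smooth_on \<phi> UNIV" "compact C" "C \<subseteq> S" "\<And>x. x \<notin> C \<Longrightarrow> \<phi> x = 0"
  shows "\<phi> \<in> test_functions S"
  using assms unfolding test_functions_def by blast

lemma test_functions_mono: "S \<subseteq> T \<Longrightarrow> test_functions S \<subseteq> test_functions T"
  unfolding test_functions_def by blast

section \<open>Gradients of smooth functions and products with test functions\<close>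

lemma grad_component: "grad f x $ i = frechet_derivative f (at x) (axis i 1)"
  by (simp add: grad_def)

lemma smooth_on_grad:
  assumes "smooth_on f S"
  shows "smooth_on (\<lambda>x. grad f x $ i) S"
  unfolding grad_component using assms by (rule smooth_on_partial) (simp add: axis_in_Basis_iff)

lemma has_derivative_grad:
  assumes "open S" "smooth_on f S" "x \<in> S"
  shows "(f has_derivative (\<lambda>h. grad f x \<bullet> h)) (at x)"
proof -
  have D: "(f has_derivative frechet_derivative f (at x)) (at x)" by (rule smooth_on_has_derivative[OF assms])
  have "frechet_derivative f (at x) h = grad f x \<bullet> h" for h
  proof -
    interpret linear "frechet_derivative f (at x)" by (rule has_derivative_linear[OF D])
    have "h = (\<Sum>i\<in>UNIV. (h $ i) *\<^sub>R axis i 1)"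
      by (simp add: vec_eq_iff axis_def if_distrib cong: if_cong)
    then have "frechet_derivative f (at x) h = frechet_derivative f (at x) (\<Sum>i\<in>UNIV. (h $ i) *\<^sub>R axis i 1)"
      by (rule arg_cong)
    also have "\<dots> = (\<Sum>i\<in>UNIV. h $ i * frechet_derivative f (at x) (axis i 1))"
      by (simp add: sum scale)
    finally have "frechet_derivative f (at x) h = (\<Sum>i\<in>UNIV. h $ i * frechet_derivative f (at x) (axis i 1))" .
    then show ?thesis by (simp add: inner_vec_def grad_component mult.commute)
  qed
  then have "frechet_derivative f (at x) = (\<lambda>h. grad f x \<bullet> h)" by (rule ext)
  with D show ?thesis by (simp only:)
qed

lemma grad_unique:
  assumes "(f has_derivative (\<lambda>h. v \<bullet> h)) (at x)"
  shows "grad f x = v"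
proof -
  have "frechet_derivative f (at x) (axis i 1) = v $ i" for i
    using fun_cong[OF frechet_derivative_at[OF assms], of "axis i 1"] by (simp add: inner_axis)
  then show ?thesis by (simp add: vec_eq_iff grad_component)
qed

lemma grad_mult:
  assumes "open S" "smooth_on f S" "smooth_on g S" "x \<in> S"
  shows "grad (\<lambda>x. f x * g x) x = f x *\<^sub>R grad g x + g x *\<^sub>R grad f x"
  by (rule grad_unique)
     (auto intro!: derivative_eq_intros has_derivative_grad assms simp: inner_add_left algebra_simps)

lemma grad_compose:
  assumes "open S" "smooth_on g S" "x \<in> S" "(f has_real_derivative f') (at (g x))"
  shows "grad (\<lambda>x. f (g x)) x = f' *\<^sub>R grad g x"
proof (rule grad_unique)
  have "(f has_derivative (\<lambda>h. f' * h)) (at (g x))" using assms(4) by (simp add: has_field_derivative_def)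
  from has_derivative_compose[OF has_derivative_grad[OF assms(1-3)] this]
  show "((\<lambda>x. f (g x)) has_derivative (\<lambda>h. f' *\<^sub>R grad g x \<bullet> h)) (at x)" by simp
qed

lemma grad_cong:
  assumes "open S" "x \<in> S" "\<And>y. y \<in> S \<Longrightarrow> f y = g y" "smooth_on f S"
  shows "grad g x = grad f x"
  by (rule grad_unique)
     (rule has_derivative_transform_within_open[OF has_derivative_grad[OF assms(1,4,2)] assms(1,2,3)])

lemma grad_eq_0: "closed C \<Longrightarrow> (\<And>x. x \<notin> C \<Longrightarrow> f x = 0) \<Longrightarrow> x \<notin> C \<Longrightarrow> grad f x = 0"
  by (simp add: vec_eq_iff grad_component partial_derivative_eq_0)

lemma test_functions_mult:
  assumes S: "open S" and g: "smooth_on g S" and \<phi>: "\<phi> \<in> test_functions S"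
  shows "(\<lambda>x. \<phi> x * g x) \<in> test_functions S"
proof -
  obtain C where C: "smooth_on \<phi> UNIV" "compact C" "C \<subseteq> S" "\<And>x. x \<notin> C \<Longrightarrow> \<phi> x = 0"
    using test_functionsE[OF \<phi>] by metis
  show ?thesis
    by (rule test_functionsI[OF smooth_on_mult_cutoff[OF S g C(1) compact_imp_closed[OF C(2)] C(3,4)] C(2,3)])
       (simp_all add: C(4))
qed

lemma test_functions_integrable:
  assumes S: "open S" and \<phi>: "\<phi> \<in> test_functions S" and f: "locally_integrable S f"
  shows "integrable (lebesgue_on S) (\<lambda>x. \<phi> x * f x)"
    "integrable (lebesgue_on S) (\<lambda>x. f x * grad \<phi> x $ i)"
proof -
  obtain C where C: "smooth_on \<phi> UNIV" "compact C" "C \<subseteq> S" "\<And>x. x \<notin> C \<Longrightarrow> \<phi> x = 0"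
    using test_functionsE[OF \<phi>] by metis
  show "integrable (lebesgue_on S) (\<lambda>x. \<phi> x * f x)"
    using smooth_on_imp_continuous_on[OF C(1)] S C
    by (intro compact_supp_lebesgue_on_integrable[OF _ f _ C(2,3)]) (auto intro: continuous_on_subset)
  have "integrable (lebesgue_on S) (\<lambda>x. grad \<phi> x $ i * f x)"
    using smooth_on_imp_continuous_on[OF smooth_on_grad[OF C(1)], of i] S C grad_eq_0[of C \<phi>] compact_imp_closed[OF C(2)]
    by (intro compact_supp_lebesgue_on_integrable[OF _ f _ C(2,3)]) (auto intro: continuous_on_subset)
  then show "integrable (lebesgue_on S) (\<lambda>x. f x * grad \<phi> x $ i)" by (simp add: mult.commute)
qed

lemma integral_component:
  fixes f :: "'a \<Rightarrow> real^'n"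
  assumes "integrable M f"
  shows "(\<integral>x. f x \<partial>M) $ i = (\<integral>x. f x $ i \<partial>M)"
  using integral_inner_left[of "axis i 1" M f] assms by (simp add: inner_axis)

lemma integrable_component_iff:
  fixes f :: "'a::euclidean_space \<Rightarrow> real^'n"
  assumes "S \<in> sets lebesgue"
  shows "integrable (lebesgue_on S) f \<longleftrightarrow> (\<forall>i. integrable (lebesgue_on S) (\<lambda>x. f x $ i))"
  unfolding set_integrable_iff_lebesgue_on[OF assms, symmetric]
  by (subst absolutely_integrable_componentwise_iff) (auto simp: Basis_vec_def inner_axis)

text \<open>A vector-valued integral can be read off by components once it exists. Local
  integrability of \<open>u\<close> and \<open>p\<close> guarantees this for every test function, so
  both definitions agree.\<close>

lemma weak_gradient_iff:
  fixes u :: "real^'n \<Rightarrow> real"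
  assumes S: "open S"
  shows "weak_gradient S u p \<longleftrightarrow> locally_integrable S u \<and> (\<forall>i. locally_integrable S (\<lambda>x. p x $ i)) \<and>
    (\<forall>\<phi>\<in>test_functions S. \<forall>i. (\<integral>x. u x * grad \<phi> x $ i \<partial>lebesgue_on S) = - (\<integral>x. \<phi> x * p x $ i \<partial>lebesgue_on S))"
proof -
  have "(LINT x:S|lebesgue. u x *\<^sub>R grad \<phi> x) = - (LINT x:S|lebesgue. \<phi> x *\<^sub>R p x) \<longleftrightarrow>
      (\<forall>i. (\<integral>x. u x * grad \<phi> x $ i \<partial>lebesgue_on S) = - (\<integral>x. \<phi> x * p x $ i \<partial>lebesgue_on S))"
    if \<phi>: "\<phi> \<in> test_functions S" and u: "locally_integrable S u" and p: "locally_integrable S p" for \<phi>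
  proof -
    have "integrable (lebesgue_on S) (\<lambda>x. u x *\<^sub>R grad \<phi> x)"
      using test_functions_integrable(2)[OF S \<phi> u] S by (subst integrable_component_iff) auto
    moreover have "integrable (lebesgue_on S) (\<lambda>x. \<phi> x *\<^sub>R p x)"
      using test_functions_integrable(1)[OF S \<phi>] p S by (subst integrable_component_iff) (auto simp: locally_integrable_component)
    ultimately show ?thesis
      using S by (simp add: set_integral_eq_lebesgue_on vec_eq_iff integral_component)
  qed
  then show ?thesis unfolding weak_gradient_def locally_integrable_component[symmetric] by blast
qed

lemma weak_gradient_unique:
  fixes u :: "real^'n \<Rightarrow> real"
  assumes S: "open S" and p: "weak_gradient S u p" and q: "weak_gradient S u q"
  shows "AE x in lebesgue_on S. p x = q x"
proof -
  have "AE x in lebesgue_on S. p x $ i - q x $ i = 0" for i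
  proof (rule fundamental_lemma_calculus_variations[OF S])
    have pi: "locally_integrable S (\<lambda>x. p x $ i)" and qi: "locally_integrable S (\<lambda>x. q x $ i)"
      using p q by (auto simp: weak_gradient_iff[OF S])
    show "integrable (lebesgue_on C) (\<lambda>x. p x $ i - q x $ i)" if "compact C" "C \<subseteq> S" for C
    proof -
      have "C \<in> sets lebesgue" using that by (auto intro: compact_sets_lebesgue)
      then show ?thesis
        using pi qi that by (auto simp: locally_integrable_def set_integrable_iff_lebesgue_on[symmetric])
    qed
    show "(\<integral>x. \<phi> x * (p x $ i - q x $ i) \<partial>lebesgue_on S) = 0" if \<phi>: "\<phi> \<in> test_functions S" for \<phi>
      using p q \<phi> test_functions_integrable(1)[OF S \<phi> pi] test_functions_integrable(1)[OF S \<phi> qi]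
      by (auto simp: weak_gradient_iff[OF S] right_diff_distrib)
  qed
  then have "AE x in lebesgue_on S. \<forall>i. p x $ i - q x $ i = 0" by (simp add: AE_all_countable)
  then show ?thesis by eventually_elim (simp add: vec_eq_iff)
qed

lemma weak_gradient_wgrad: "weak_gradient S u p \<Longrightarrow> weak_gradient S u (wgrad S u)"
  unfolding wgrad_def using someI[of "weak_gradient S u" p] by simp

lemma wgrad_AE_eq:
  assumes "open S" "weak_gradient S u p"
  shows "AE x in lebesgue_on S. wgrad S u x = p x"
  by (rule weak_gradient_unique[OF assms(1) weak_gradient_wgrad[OF assms(2)] assms(2)])

lemma locally_integrable_cong:
  fixes u v :: "'a::euclidean_space \<Rightarrow> real"
  assumes "\<And>x. x \<in> S \<Longrightarrow> u x = v x" and u: "locally_integrable S u"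
  shows "locally_integrable S v"
  unfolding locally_integrable_def
proof (intro allI impI)
  fix C assume C: "compact C \<and> C \<subseteq> S"
  then have "set_integrable lebesgue C u" using u by (auto simp: locally_integrable_def)
  moreover have "indicator C x *\<^sub>R u x = indicator C x *\<^sub>R v x" for x using assms(1) C by (auto simp: indicator_def)
  ultimately show "set_integrable lebesgue C v" unfolding set_integrable_def by (simp only:)
qed

lemma weak_gradient_cong:
  assumes S: "open S" and "\<And>x. x \<in> S \<Longrightarrow> u x = v x" "weak_gradient S u p"
  shows "weak_gradient S v p"
proof -
  have "(\<integral>x. u x * grad \<phi> x $ i \<partial>lebesgue_on S) = (\<integral>x. v x * grad \<phi> x $ i \<partial>lebesgue_on S)" for \<phi> i
    by (rule Bochner_Integration.integral_cong) (auto simp: assms(2))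
  moreover have "locally_integrable S u \<Longrightarrow> locally_integrable S v"
    by (rule locally_integrable_cong) (simp_all add: assms(2))
  ultimately show ?thesis using assms(3) unfolding weak_gradient_iff[OF S] by simp
qed

lemma weak_gradient_diff:
  fixes u v :: "real^'n \<Rightarrow> real"
  assumes S: "open S" and "weak_gradient S u p" "weak_gradient S v q"
  shows "weak_gradient S (\<lambda>x. u x - v x) (\<lambda>x. p x - q x)"
  unfolding weak_gradient_iff[OF S]
proof (intro conjI ballI allI)
  have loc: "locally_integrable S u" "locally_integrable S v"
    "\<And>i. locally_integrable S (\<lambda>x. p x $ i)" "\<And>i. locally_integrable S (\<lambda>x. q x $ i)"
    using assms by (auto simp: weak_gradient_iff[OF S])
  then show "locally_integrable S (\<lambda>x. u x - v x)" "\<And>i. locally_integrable S (\<lambda>x. (p x - q x) $ i)"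
    by (auto simp: locally_integrable_def)
  fix \<phi> :: "real^'n \<Rightarrow> real" and i assume \<phi>: "\<phi> \<in> test_functions S"
  note I = test_functions_integrable[OF S \<phi>]
  show "(\<integral>x. (u x - v x) * grad \<phi> x $ i \<partial>lebesgue_on S) = - (\<integral>x. \<phi> x * (p x - q x) $ i \<partial>lebesgue_on S)"
    using I(2)[OF loc(1)] I(2)[OF loc(2)] I(1)[OF loc(3)] I(1)[OF loc(4)] \<phi> assms
    by (simp add: left_diff_distrib right_diff_distrib weak_gradient_iff[OF S])
qed

text \<open>The product \<phi> g is again a test function in \<open>S\<close>, even if
  \<open>g\<close> is smooth on \<open>S\<close> only; testing \<open>u\<close> with it and
  expanding the gradient gives the product rule.\<close>

lemma weak_gradient_mult_smooth:
  fixes u :: "real^'n \<Rightarrow> real"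
  assumes S: "open S" and g: "smooth_on g S" and u: "weak_gradient S u p"
  shows "weak_gradient S (\<lambda>x. g x * u x) (\<lambda>x. g x *\<^sub>R p x + u x *\<^sub>R grad g x)"
  unfolding weak_gradient_iff[OF S]
proof (intro conjI ballI allI)
  have loc: "locally_integrable S u" "\<And>i. locally_integrable S (\<lambda>x. p x $ i)"
    using u by (auto simp: weak_gradient_iff[OF S])
  have gc: "continuous_on S g" "\<And>i. continuous_on S (\<lambda>x. grad g x $ i)"
    using g smooth_on_grad[OF g] by (auto intro: smooth_on_imp_continuous_on)
  show gu: "locally_integrable S (\<lambda>x. g x * u x)" by (rule locally_integrable_mult[OF loc(1) gc(1)])
  have gp: "locally_integrable S (\<lambda>x. g x * p x $ i)" for i by (rule locally_integrable_mult[OF loc(2) gc(1)])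
  have ug: "locally_integrable S (\<lambda>x. grad g x $ i * u x)" for i by (rule locally_integrable_mult[OF loc(1) gc(2)])
  show "locally_integrable S (\<lambda>x. (g x *\<^sub>R p x + u x *\<^sub>R grad g x) $ i)" for i
    using gp[of i] ug[of i] by (auto simp: locally_integrable_def mult.commute)
  fix \<phi> :: "real^'n \<Rightarrow> real" and i assume \<phi>: "\<phi> \<in> test_functions S"
  have \<phi>S: "smooth_on \<phi> S" using \<phi> S by (auto elim!: test_functionsE intro: smooth_on_subset[OF open_UNIV])
  have \<phi>g: "(\<lambda>x. \<phi> x * g x) \<in> test_functions S" by (rule test_functions_mult[OF S g \<phi>])
  have "(\<integral>x. u x * grad (\<lambda>x. \<phi> x * g x) x $ i \<partial>lebesgue_on S) = - (\<integral>x. (\<phi> x * g x) * p x $ i \<partial>lebesgue_on S)"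
    using u \<phi>g unfolding weak_gradient_iff[OF S] by blast
  moreover have "(\<integral>x. u x * grad (\<lambda>x. \<phi> x * g x) x $ i \<partial>lebesgue_on S) =
      (\<integral>x. \<phi> x * (grad g x $ i * u x) + (g x * u x) * grad \<phi> x $ i \<partial>lebesgue_on S)"
    using grad_mult[OF S \<phi>S g] by (intro Bochner_Integration.integral_cong) (auto simp: algebra_simps)
  moreover note I = test_functions_integrable[OF S \<phi>]
  ultimately show "(\<integral>x. (g x * u x) * grad \<phi> x $ i \<partial>lebesgue_on S) =
      - (\<integral>x. \<phi> x * (g x *\<^sub>R p x + u x *\<^sub>R grad g x) $ i \<partial>lebesgue_on S)"
    using I(2)[OF gu, of i] I(1)[OF gp, of i] I(1)[OF ug, of i]
    by (simp add: distrib_left algebra_simps)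
qed

text \<open>The constant 1 has weak gradient 0 because partial derivatives of test functions
  integrate to zero. The product rule with factor \<open>g\<close> does the rest.\<close>

lemma weak_gradient_smooth:
  fixes g :: "real^'n \<Rightarrow> real"
  assumes S: "open S" and g: "smooth_on g S"
  shows "weak_gradient S g (grad g)"
proof -
  have "weak_gradient S (\<lambda>x. 1) (\<lambda>x. 0 :: real^'n)"
    unfolding weak_gradient_iff[OF S]
  proof (intro conjI ballI allI)
    fix \<phi> :: "real^'n \<Rightarrow> real" and i assume "\<phi> \<in> test_functions S"
    then obtain C where C: "smooth_on \<phi> UNIV" "compact C" "C \<subseteq> S" "\<And>x. x \<notin> C \<Longrightarrow> \<phi> x = 0"
      using test_functionsE by metis
    have gr0: "grad \<phi> x $ i = 0" if "x \<notin> S" for x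
    proof -
      have "x \<notin> C" using that C(3) by auto
      then show ?thesis using grad_eq_0[of C \<phi> x] compact_imp_closed[OF C(2)] C(4) by simp
    qed
    have "(\<integral>x. grad \<phi> x $ i \<partial>lebesgue_on S) = (\<integral>x. grad \<phi> x $ i \<partial>lborel)"
      using S gr0
      by (intro integral_lebesgue_on_eq_lborel borel_measurable_continuous_onI
          smooth_on_imp_continuous_on[OF smooth_on_grad[OF C(1)]]) auto
    also have "\<dots> = 0" unfolding grad_component
      by (rule integral_partial_derivative_eq_0[OF C(1,2,4)]) (simp_all add: axis_in_Basis_iff)
    finally show "(\<integral>x. 1 * grad \<phi> x $ i \<partial>lebesgue_on S) = - (\<integral>x. \<phi> x * (0::real^'n) $ i \<partial>lebesgue_on S)"
      by simp
  qed (auto intro: locally_integrable_continuous)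
  from weak_gradient_mult_smooth[OF S g this] show ?thesis by simp
qed

text \<open>Weak gradients are local: test functions supported off \<open>C\<close> see only the
  zero function, and the fundamental lemma applies in \<open>S - C\<close>.\<close>

lemma weak_gradient_AE_0:
  fixes u :: "real^'n \<Rightarrow> real"
  assumes S: "open S" and u: "weak_gradient S u p" and C: "closed C" "\<And>x. x \<in> S - C \<Longrightarrow> u x = 0"
  shows "AE x in lebesgue_on S. x \<notin> C \<longrightarrow> p x = 0"
proof -
  have o: "open (S - C)" using S C by auto
  have "AE x in lebesgue_on (S - C). p x $ i = 0" for i
  proof (rule fundamental_lemma_calculus_variations[OF o])
    have loc: "locally_integrable S (\<lambda>x. p x $ i)" using u by (auto simp: weak_gradient_iff[OF S])
    show "integrable (lebesgue_on D) (\<lambda>x. p x $ i)" if "compact D" "D \<subseteq> S - C" for D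
    proof -
      have "D \<in> sets lebesgue" using that by (auto intro: compact_sets_lebesgue)
      then show ?thesis using loc that by (auto simp: locally_integrable_def set_integrable_iff_lebesgue_on[symmetric])
    qed
    fix \<phi> assume \<phi>': "\<phi> \<in> test_functions (S - C)"
    then have \<phi>: "\<phi> \<in> test_functions S" using test_functions_mono[of "S - C" S] by auto
    obtain D where D: "smooth_on \<phi> UNIV" "compact D" "D \<subseteq> S - C" "\<And>x. x \<notin> D \<Longrightarrow> \<phi> x = 0"
      using test_functionsE[OF \<phi>'] by metis
    have "(\<integral>x. u x * grad \<phi> x $ i \<partial>lebesgue_on S) = (\<integral>x. 0 \<partial>lebesgue_on S)"
    proof (rule Bochner_Integration.integral_cong[OF refl])
      fix x assume "x \<in> space (lebesgue_on S)"
      then show "u x * grad \<phi> x $ i = 0"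
        using C(2)[of x] grad_eq_0[of D \<phi> x] compact_imp_closed[OF D(2)] D(4) D(3) by (cases "x \<in> D") auto
    qed
    then have *: "(\<integral>x. \<phi> x * p x $ i \<partial>lebesgue_on S) = 0" using u \<phi> by (simp add: weak_gradient_iff[OF S])
    have "indicator (S - C) x *\<^sub>R (\<phi> x * p x $ i) = indicator S x *\<^sub>R (\<phi> x * p x $ i)" for x
      using D by (cases "x \<in> D") (auto simp: indicator_def)
    then have "set_lebesgue_integral lebesgue (S - C) (\<lambda>x. \<phi> x * p x $ i) = set_lebesgue_integral lebesgue S (\<lambda>x. \<phi> x * p x $ i)"
      unfolding set_lebesgue_integral_def by (simp only:)
    moreover have "S - C \<in> sets lebesgue" "S \<in> sets lebesgue" using o S by auto
    ultimately show "(\<integral>x. \<phi> x * p x $ i \<partial>lebesgue_on (S - C)) = 0"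
      using * by (simp only: set_integral_eq_lebesgue_on)
  qed
  then have "AE x in lebesgue_on (S - C). \<forall>i. p x $ i = 0" by (simp add: AE_all_countable)
  then show ?thesis using S o by (auto simp: AE_restrict_space_iff vec_eq_iff elim!: eventually_mono)
qed

section \<open>Weak gradients of Lipschitz functions\<close>

text \<open>McShane's formula, the infimum over \<open>y\<close> of f(y) + L d(x,y), keeps the
  Lipschitz constant. It makes difference quotients meaningful for shifted points that leave the
  set.\<close>

lemma lipschitz_extension_real:
  fixes f :: "'a::metric_space \<Rightarrow> real"
  assumes f: "L-lipschitz_on X f" and X: "X \<noteq> {}"
  obtains g where "L-lipschitz_on UNIV g" "\<And>x. x \<in> X \<Longrightarrow> g x = f x"
proof -
  have L: "L \<ge> 0" by (rule lipschitz_on_nonneg[OF f])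
  define g where "g = (\<lambda>x. INF y\<in>X. f y + L * dist x y)"
  have lower: "f z - L * dist x z \<le> f y + L * dist x y" if "z \<in> X" "y \<in> X" for x y z
  proof -
    have "f z - f y \<le> L * dist z y" using lipschitz_onD[OF f that] by (simp add: dist_real_def abs_le_iff)
    also have "\<dots> \<le> L * (dist x z + dist x y)"
      using L dist_triangle[of z y x] by (intro mult_left_mono) (auto simp: dist_commute)
    finally show ?thesis by (simp add: algebra_simps)
  qed
  have bdd: "bdd_below ((\<lambda>y. f y + L * dist x y) ` X)" for x
  proof -
    obtain z where "z \<in> X" using X by blast
    then show ?thesis using lower by (intro bdd_belowI2[of X "f z - L * dist x z"])
  qed
  have gl: "g x \<le> g y + L * dist x y" for x y
  proof -
    have "g x - L * dist x y \<le> f z + L * dist y z" if "z \<in> X" for z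
    proof -
      have "g x \<le> f z + L * dist x z" unfolding g_def using bdd that by (intro cINF_lower)
      also have "\<dots> \<le> f z + L * (dist x y + dist y z)" using L by (intro add_left_mono mult_left_mono dist_triangle)
      finally show ?thesis by (simp add: algebra_simps)
    qed
    then have "g x - L * dist x y \<le> g y" unfolding g_def[of] using X by (intro cINF_greatest) (auto simp: g_def)
    then show ?thesis by simp
  qed
  have "L-lipschitz_on UNIV g"
  proof (rule lipschitz_onI[OF _ L])
    fix x y show "dist (g x) (g y) \<le> L * dist x y"
      using gl[of x y] gl[of y x] by (simp add: dist_real_def abs_le_iff dist_commute)
  qed
  moreover have "g x = f x" if "x \<in> X" for x
  proof (rule antisym)
    show "g x \<le> f x" unfolding g_def using cINF_lower[OF bdd that, of x] by simp
    show "f x \<le> g x" unfolding g_def using lower[OF that, of _ x] X by (intro cINF_greatest) auto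
  qed
  ultimately show thesis using that by blast
qed

lemma weak_gradient_lipschitz:
  fixes f :: "real^'n \<Rightarrow> real"
  assumes S: "open S" "bounded S" and f: "L-lipschitz_on X f" "S \<subseteq> X"
  shows "\<exists>p. weak_gradient S f p \<and> weak_gradient S (\<lambda>x. (f x)\<^sup>2) (\<lambda>x. (2 * f x) *\<^sub>R p x) \<and>
    (\<forall>i. (\<lambda>x. p x $ i) \<in> borel_measurable (lebesgue_on S)) \<and> (\<forall>i. integrable (lebesgue_on S) (\<lambda>x. (p x $ i)\<^sup>2))"
proof (cases "S = {}")
  case True
  have "test_functions S = {\<lambda>_. 0}"
    unfolding test_functions_def True by (auto intro!: exI[of _ "{}"])
  then show ?thesis
    by (intro exI[of _ "\<lambda>_. 0"]) (auto simp: True weak_gradient_def locally_integrable_def set_lebesgue_integral_def)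
next
  case False
  then have "X \<noteq> {}" using f by auto
  obtain g where g: "L-lipschitz_on UNIV g" "\<And>x. x \<in> X \<Longrightarrow> g x = f x"
    by (rule lipschitz_extension_real[OF f(1) \<open>X \<noteq> {}\<close>]) auto
  have L: "L \<ge> 0" by (rule lipschitz_on_nonneg[OF f(1)])
  have gc: "continuous_on UNIV g" by (rule lipschitz_on_continuous_on[OF g(1)])
  then have gb[measurable]: "g \<in> borel_measurable borel" by (rule borel_measurable_continuous_onI)
  have Sl: "S \<in> lmeasurable" using S by (rule lmeasurable_open[rotated])
  then have Ss: "S \<in> sets lebesgue" by auto
  define N where "N = lebesgue_on S"
  interpret N: finite_measure N unfolding N_def by (rule finite_measure_lebesgue_on[OF Sl])
  have bN: "q \<in> borel_measurable N" if "q \<in> borel_measurable borel" for q :: "real^'n \<Rightarrow> real"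
    unfolding N_def using that by (intro measurable_restrict_space1 measurable_completion) simp
  define h where "h k = inverse (real (Suc k))" for k
  have h: "h k > 0" for k by (simp add: h_def)
  have h0: "h \<longlonglongrightarrow> 0" unfolding h_def[abs_def] by (rule LIMSEQ_inverse_real_of_nat)
  define D where "D i k x = (g (x + h k *\<^sub>R axis i 1) - g x) / h k" for i k x
  have Db[measurable]: "D i k \<in> borel_measurable borel" for i k
  proof -
    have "continuous_on UNIV (D i k)" unfolding D_def
      using h[of k] by (intro continuous_intros continuous_on_compose2[OF gc]) auto
    then show ?thesis by (rule borel_measurable_continuous_onI)
  qed
  have DL: "\<bar>D i k x\<bar> \<le> L" for i k x
  proof -
    have "\<bar>g (x + h k *\<^sub>R axis i 1) - g x\<bar> \<le> L * norm (h k *\<^sub>R (axis i 1 :: real^'n))"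
      using lipschitz_onD[OF g(1), of "x + h k *\<^sub>R axis i 1" x] by (simp add: dist_real_def dist_norm)
    also have "\<dots> = L * h k" using h[of k] by simp
    finally show ?thesis using h[of k] by (simp add: D_def field_simps)
  qed
  have DL2: "(D i k x)\<^sup>2 \<le> L\<^sup>2" for i k x
    using DL[of i k x] power_mono[of "\<bar>D i k x\<bar>" L 2] by simp
  have Dint: "integrable N (\<lambda>x. (D i k x)\<^sup>2)" for i k
    by (rule N.integrable_const_bound[of _ "L\<^sup>2"]) (use DL2 in \<open>auto intro!: bN\<close>)
  have Dle: "(\<integral>x. (D i k x)\<^sup>2 \<partial>N) \<le> L\<^sup>2 * measure N (space N)" for i k
  proof -
    have "(\<integral>x. (D i k x)\<^sup>2 \<partial>N) \<le> (\<integral>x. L\<^sup>2 \<partial>N)"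
      by (rule integral_mono) (use Dint DL2 in auto)
    then show ?thesis by (simp add: mult.commute)
  qed
  have A: "(\<lambda>k. \<integral>x. D i k x * \<phi> x \<partial>N) \<longlonglongrightarrow> - (\<integral>x. g x * grad \<phi> x $ i \<partial>N)"
    and B: "(\<lambda>k. \<integral>x. D i k x * (2 * g x * \<phi> x) \<partial>N) \<longlonglongrightarrow> - (\<integral>x. (g x)\<^sup>2 * grad \<phi> x $ i \<partial>N)"
    and Wm: "\<phi> \<in> borel_measurable borel" and W2: "integrable N (\<lambda>x. (\<phi> x)\<^sup>2)" "integrable N (\<lambda>x. (2 * g x * \<phi> x)\<^sup>2)"
    if \<phi>: "\<phi> \<in> test_functions S" for \<phi> i
  proof -
    obtain C where C: "smooth_on \<phi> UNIV" "compact C" "C \<subseteq> S" "\<And>x. x \<notin> C \<Longrightarrow> \<phi> x = 0"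
      using test_functionsE[OF \<phi>] by metis
    have \<phi>c: "continuous_on UNIV \<phi>" by (rule smooth_on_imp_continuous_on[OF C(1)])
    then show \<phi>b[measurable]: "\<phi> \<in> borel_measurable borel" by (rule borel_measurable_continuous_onI)
    have gr[measurable]: "(\<lambda>x. grad \<phi> x $ i) \<in> borel_measurable borel"
      by (rule borel_measurable_continuous_onI[OF smooth_on_imp_continuous_on[OF smooth_on_grad[OF C(1)]]])
    have gr0: "grad \<phi> x $ i = 0" if "x \<notin> S" for x
    proof -
      have "x \<notin> C" using that C(3) by auto
      then show ?thesis using grad_eq_0[of C \<phi> x] compact_imp_closed[OF C(2)] C(4) by simp
    qed
    have lb: "(\<integral>x. q x * \<phi> x \<partial>N) = (\<integral>x. q x * \<phi> x \<partial>lborel)" if [measurable]: "q \<in> borel_measurable borel" for q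
      unfolding N_def using C(3,4) by (intro integral_lebesgue_on_eq_lborel[OF Ss]) auto
    have lg: "(\<integral>x. q x * grad \<phi> x $ i \<partial>N) = (\<integral>x. q x * grad \<phi> x $ i \<partial>lborel)" if [measurable]: "q \<in> borel_measurable borel" for q
      unfolding N_def using gr0 by (intro integral_lebesgue_on_eq_lborel[OF Ss]) auto
    have i: "axis i (1::real) \<in> Basis" by (simp add: axis_in_Basis_iff)
    show A: "(\<lambda>k. \<integral>x. D i k x * \<phi> x \<partial>N) \<longlonglongrightarrow> - (\<integral>x. g x * grad \<phi> x $ i \<partial>N)"
      unfolding lb[OF Db] lg[OF gb] unfolding D_def h_def grad_component
      by (rule diff_quotient_integral_tendsto[OF gc C(1,2,4) i])
    obtain B where B: "\<And>x. \<bar>\<phi> x\<bar> \<le> B" using compact_supp_bounded[OF \<phi>c C(2,4)] by metis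
    obtain B' where B': "\<And>x. \<bar>2 * g x * \<phi> x\<bar> \<le> B'"
    proof -
      have c: "continuous_on UNIV (\<lambda>x. 2 * g x * \<phi> x)" by (intro continuous_intros gc \<phi>c)
      have z: "2 * g x * \<phi> x = 0" if "x \<notin> C" for x using C(4)[OF that] by simp
      show thesis using compact_supp_bounded[OF c C(2) z] that by metis
    qed
    have bd: "integrable N q" if "q \<in> borel_measurable borel" "\<And>x. \<bar>q x\<bar> \<le> c" for q :: "real^'n \<Rightarrow> real" and c
      by (rule N.integrable_const_bound[of _ c]) (use that in \<open>auto intro!: bN\<close>)
    have sq: "y\<^sup>2 \<le> c\<^sup>2" if "\<bar>y\<bar> \<le> c" for y c :: real using that power_mono[of "\<bar>y\<bar>" c 2] by simp
    show "integrable N (\<lambda>x. (\<phi> x)\<^sup>2)" by (rule bd[of _ "B\<^sup>2"]) (use sq[OF B] in auto)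
    show "integrable N (\<lambda>x. (2 * g x * \<phi> x)\<^sup>2)" by (rule bd[of _ "B'\<^sup>2"]) (use sq[OF B'] in auto)
    \<comment> \<open>The last summand is the discrete error of the chain rule. As \<open>D\<close>
      is bounded by \<open>L\<close>, it disappears in the limit together with
      \<open>h k\<close>.\<close>
    have D2: "((g (x + h k *\<^sub>R axis i 1))\<^sup>2 - (g x)\<^sup>2) / h k = D i k x * (2 * g x) + h k * (D i k x)\<^sup>2" for k x
      using h[of k] by (simp add: D_def field_simps power2_eq_square)
    have iD: "integrable N (\<lambda>x. D i k x * (2 * g x * \<phi> x))" "integrable N (\<lambda>x. h k * (D i k x)\<^sup>2 * \<phi> x)" for k
    proof -
      show "integrable N (\<lambda>x. D i k x * (2 * g x * \<phi> x))"
        by (rule bd[of _ "L * B'"]) (auto simp: abs_mult[of "D i k _"] intro!: mult_mono DL B' L)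
      have "\<bar>h k * (D i k x)\<^sup>2 * \<phi> x\<bar> \<le> h k * L\<^sup>2 * B" for x
        unfolding abs_mult using h[of k] DL2[of i k x] B[of x] by (intro mult_mono) auto
      then show "integrable N (\<lambda>x. h k * (D i k x)\<^sup>2 * \<phi> x)" by (intro bd) auto
    qed
    have "(\<lambda>k. \<integral>x. ((g (x + h k *\<^sub>R axis i 1))\<^sup>2 - (g x)\<^sup>2) / h k * \<phi> x \<partial>N) \<longlonglongrightarrow> - (\<integral>x. (g x)\<^sup>2 * grad \<phi> x $ i \<partial>N)"
    proof -
      have mm: "(\<lambda>x. D i k x * (2 * g x) + h k * (D i k x)\<^sup>2) \<in> borel_measurable borel" for k by measurable
      have g2: "(\<lambda>x. (g x)\<^sup>2) \<in> borel_measurable borel" by measurable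
      show ?thesis
        unfolding D2 lb[OF mm] lg[OF g2]
        unfolding D2[symmetric] unfolding h_def grad_component
        by (rule diff_quotient_integral_tendsto[OF continuous_on_power[OF gc, of 2] C(1,2,4) i])
    qed
    moreover have "(\<lambda>k. \<integral>x. h k * (D i k x)\<^sup>2 * \<phi> x \<partial>N) \<longlonglongrightarrow> 0"
    proof (rule Lim_null_comparison)
      show "\<forall>\<^sub>F k in sequentially. norm (\<integral>x. h k * (D i k x)\<^sup>2 * \<phi> x \<partial>N) \<le> h k * (L\<^sup>2 * B * measure N (space N))"
      proof (rule always_eventually, rule allI)
        fix k
        have "norm (\<integral>x. h k * (D i k x)\<^sup>2 * \<phi> x \<partial>N) \<le> (\<integral>x. norm (h k * (D i k x)\<^sup>2 * \<phi> x) \<partial>N)"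
          by (rule integral_norm_bound)
        also have "\<dots> \<le> (\<integral>x. h k * (L\<^sup>2 * B) \<partial>N)"
        proof (rule integral_mono)
          show "norm (h k * (D i k x)\<^sup>2 * \<phi> x) \<le> h k * (L\<^sup>2 * B)" for x
            unfolding norm_mult using h[of k] DL2[of i k x] B[of x] by (auto simp: mult.assoc intro!: mult_mono)
        qed (use iD(2) in auto)
        finally show "norm (\<integral>x. h k * (D i k x)\<^sup>2 * \<phi> x \<partial>N) \<le> h k * (L\<^sup>2 * B * measure N (space N))"
          by (simp add: mult_ac)
      qed
      show "(\<lambda>k. h k * (L\<^sup>2 * B * measure N (space N))) \<longlonglongrightarrow> 0"
        using tendsto_mult_right[OF h0, of "L\<^sup>2 * B * measure N (space N)"] by simp
    qed
    ultimately have "(\<lambda>k. (\<integral>x. ((g (x + h k *\<^sub>R axis i 1))\<^sup>2 - (g x)\<^sup>2) / h k * \<phi> x \<partial>N) - (\<integral>x. h k * (D i k x)\<^sup>2 * \<phi> x \<partial>N))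
        \<longlonglongrightarrow> - (\<integral>x. (g x)\<^sup>2 * grad \<phi> x $ i \<partial>N) - 0"
      by (rule tendsto_diff)
    moreover have "(\<integral>x. ((g (x + h k *\<^sub>R axis i 1))\<^sup>2 - (g x)\<^sup>2) / h k * \<phi> x \<partial>N) - (\<integral>x. h k * (D i k x)\<^sup>2 * \<phi> x \<partial>N)
        = (\<integral>x. D i k x * (2 * g x * \<phi> x) \<partial>N)" for k
    proof -
      have "(\<integral>x. ((g (x + h k *\<^sub>R axis i 1))\<^sup>2 - (g x)\<^sup>2) / h k * \<phi> x \<partial>N) =
          (\<integral>x. D i k x * (2 * g x * \<phi> x) + h k * (D i k x)\<^sup>2 * \<phi> x \<partial>N)"
        unfolding D2 by (intro Bochner_Integration.integral_cong) (auto simp: algebra_simps)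
      then show ?thesis using iD[of k] by simp
    qed
    ultimately show "(\<lambda>k. \<integral>x. D i k x * (2 * g x * \<phi> x) \<partial>N) \<longlonglongrightarrow> - (\<integral>x. (g x)\<^sup>2 * grad \<phi> x $ i \<partial>N)"
      by simp
  qed
  define Q where "Q i p \<longleftrightarrow> p \<in> borel_measurable N \<and> integrable N (\<lambda>x. (p x)\<^sup>2) \<and> (\<forall>\<phi>\<in>test_functions S.
      (\<integral>x. p x * \<phi> x \<partial>N) = - (\<integral>x. g x * grad \<phi> x $ i \<partial>N) \<and>
      (\<integral>x. p x * (2 * g x * \<phi> x) \<partial>N) = - (\<integral>x. (g x)\<^sup>2 * grad \<phi> x $ i \<partial>N))" for i p
  have "\<exists>p. Q i p" for i
  proof -
    \<comment> \<open>Both kinds of partners enter one weak limit, so that a single function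
      \<open>p\<close> serves for the gradient of \<open>g\<close> and for that of its
      square.\<close>
    define W where "W = test_functions S \<union> (\<lambda>\<phi> x. 2 * g x * \<phi> x) ` test_functions S"
    have conv: "(\<lambda>k. \<integral>x. D i k x * \<psi> x \<partial>N) \<longlonglongrightarrow> lim (\<lambda>k. \<integral>x. D i k x * \<psi> x \<partial>N)" if "\<psi> \<in> W" for \<psi>
      unfolding convergent_LIMSEQ_iff[symmetric] using that A[of _ i] B[of _ i] unfolding W_def convergent_def by blast
    have W: "\<psi> \<in> borel_measurable N" "integrable N (\<lambda>x. (\<psi> x)\<^sup>2)" if "\<psi> \<in> W" for \<psi>
      using that Wm W2 unfolding W_def by (auto intro!: bN)
    have "\<exists>p. p \<in> borel_measurable N \<and> integrable N (\<lambda>x. (p x)\<^sup>2) \<and>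
        (\<forall>\<psi>\<in>W. (\<integral>x. p x * \<psi> x \<partial>N) = lim (\<lambda>k. \<integral>x. D i k x * \<psi> x \<partial>N))"
      by (rule L2_weak_limit[OF bN[OF Db] Dint Dle]) (fact W conv)+
    then obtain p where p: "p \<in> borel_measurable N" "integrable N (\<lambda>x. (p x)\<^sup>2)"
      "\<And>\<psi>. \<psi> \<in> W \<Longrightarrow> (\<integral>x. p x * \<psi> x \<partial>N) = lim (\<lambda>k. \<integral>x. D i k x * \<psi> x \<partial>N)"
      by blast
    show ?thesis unfolding Q_def
    proof (intro exI[of _ p] conjI ballI p(1,2))
      fix \<phi> assume \<phi>: "\<phi> \<in> test_functions S"
      show "(\<integral>x. p x * \<phi> x \<partial>N) = - (\<integral>x. g x * grad \<phi> x $ i \<partial>N)"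
        using p(3)[of \<phi>] limI[OF A[OF \<phi>, of i]] \<phi> by (simp add: W_def)
      show "(\<integral>x. p x * (2 * g x * \<phi> x) \<partial>N) = - (\<integral>x. (g x)\<^sup>2 * grad \<phi> x $ i \<partial>N)"
        using p(3)[of "\<lambda>x. 2 * g x * \<phi> x"] limI[OF B[OF \<phi>, of i]] \<phi> by (simp add: W_def)
    qed
  qed
  then have "\<forall>i. \<exists>p. Q i p" by blast
  from choice[OF this] obtain P where PQ: "\<forall>i. Q i (P i)" ..
  have P: "\<And>i. P i \<in> borel_measurable N" "\<And>i. integrable N (\<lambda>x. (P i x)\<^sup>2)"
    "\<And>i \<phi>. \<phi> \<in> test_functions S \<Longrightarrow> (\<integral>x. P i x * \<phi> x \<partial>N) = - (\<integral>x. g x * grad \<phi> x $ i \<partial>N)"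
    "\<And>i \<phi>. \<phi> \<in> test_functions S \<Longrightarrow> (\<integral>x. P i x * (2 * g x * \<phi> x) \<partial>N) = - (\<integral>x. (g x)\<^sup>2 * grad \<phi> x $ i \<partial>N)"
    using PQ unfolding Q_def by blast+
  define p where "p = (\<lambda>x. \<chi> i. P i x)"
  have pl: "locally_integrable S (P i)" for i
    using locally_integrable_square_integrable[OF Sl] P(1,2) unfolding N_def by blast
  have w1: "weak_gradient S g p"
    unfolding weak_gradient_iff[OF S(1)]
    using P(3) pl locally_integrable_continuous[OF continuous_on_subset[OF gc]]
    by (auto simp: p_def N_def mult.commute)
  have w2: "weak_gradient S (\<lambda>x. (g x)\<^sup>2) (\<lambda>x. (2 * g x) *\<^sub>R p x)"
    unfolding weak_gradient_iff[OF S(1)]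
  proof (intro conjI allI ballI)
    show "locally_integrable S (\<lambda>x. (g x)\<^sup>2)"
      by (intro locally_integrable_continuous continuous_intros continuous_on_subset[OF gc]) auto
    show "locally_integrable S (\<lambda>x. ((2 * g x) *\<^sub>R p x) $ i)" for i
      using locally_integrable_mult[OF pl[of i] continuous_on_mult[OF continuous_on_const continuous_on_subset[OF gc]]]
      by (simp add: p_def)
    show "(\<integral>x. (g x)\<^sup>2 * grad \<phi> x $ i \<partial>lebesgue_on S) = - (\<integral>x. \<phi> x * ((2 * g x) *\<^sub>R p x) $ i \<partial>lebesgue_on S)"
      if "\<phi> \<in> test_functions S" for \<phi> i
      using P(4)[OF that, of i] by (simp add: p_def N_def mult_ac)
  qed
  have eq: "g x = f x" if "x \<in> S" for x using g(2) f(2) that by auto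
  show ?thesis
  proof (intro exI[of _ p] conjI)
    show "weak_gradient S f p" by (rule weak_gradient_cong[OF S(1) eq w1])
    have "weak_gradient S (\<lambda>x. (f x)\<^sup>2) (\<lambda>x. (2 * g x) *\<^sub>R p x)"
      by (rule weak_gradient_cong[OF S(1) _ w2]) (simp add: eq)
    moreover have "(\<integral>x. \<phi> x * ((2 * g x) *\<^sub>R p x) $ i \<partial>lebesgue_on S) = (\<integral>x. \<phi> x * ((2 * f x) *\<^sub>R p x) $ i \<partial>lebesgue_on S)" for \<phi> i
      by (rule Bochner_Integration.integral_cong) (auto simp: eq)
    moreover have "locally_integrable S (\<lambda>x. ((2 * f x) *\<^sub>R p x) $ i)" for i
      using locally_integrable_mult[OF pl[of i] continuous_on_mult[OF continuous_on_const
            lipschitz_on_continuous_on[OF lipschitz_on_subset[OF f]]]]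
      by (simp add: p_def)
    ultimately show "weak_gradient S (\<lambda>x. (f x)\<^sup>2) (\<lambda>x. (2 * f x) *\<^sub>R p x)"
      unfolding weak_gradient_iff[OF S(1)] by simp
  qed (use P in \<open>auto simp: p_def N_def\<close>)
qed

section \<open>The weak formulation up to the boundary\<close>

text \<open>\<open>G\<close> and \<open>B\<close> are smooth extensions of the weight and of the coefficient matrix across the
  boundary of \<open>\<Omega>\<close>.\<close>

locale weight =
  fixes \<Omega> K U :: "(real^'n) set" and B :: "real^'n \<Rightarrow> real^'n^'n" and G :: "real^'n \<Rightarrow> real" and c\<^sub>0 c\<^sub>1 :: real
  assumes open_\<Omega>: "open \<Omega>" and bounded_\<Omega>: "bounded \<Omega>" and nonempty: "\<Omega> \<noteq> {}" and boundary: "smooth_boundary \<Omega>"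
    and compact_K: "compact K" and K_subset: "K \<subseteq> \<Omega>" and K_null: "K \<in> null_sets lebesgue"
    and open_U: "open U" and U_superset: "closure \<Omega> - K \<subseteq> U" and U_K: "U \<inter> K = {}"
    and smooth_G: "smooth_on G U" and smooth_B: "\<And>i j. smooth_on (\<lambda>x. B x $ i $ j) U"
    and G_pos: "\<And>x. x \<in> U \<Longrightarrow> G x > 0"
    and B_sym: "\<And>x. x \<in> \<Omega> - K \<Longrightarrow> transpose (B x) = B x"
    and c_pos: "c\<^sub>0 > 0" and c1_pos: "c\<^sub>1 > 0"
    and elliptic: "\<And>x \<xi>. x \<in> \<Omega> - K \<Longrightarrow> c\<^sub>0 * (norm \<xi>)\<^sup>2 \<le> sq_norm_wrt (B x) \<xi>"
    and B_bounded: "\<And>x \<xi>. x \<in> \<Omega> - K \<Longrightarrow> norm (B x *v \<xi>) \<le> c\<^sub>1 * norm \<xi>"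
    and G_integrable: "integrable (lebesgue_on (\<Omega> - K)) G"
    and equation: "\<And>\<phi>. \<phi> \<in> test_functions (\<Omega> - K) \<Longrightarrow>
      (\<integral>x. G x * (- divergence (\<lambda>y. B y *v grad \<phi> y) x) \<partial>lebesgue_on (\<Omega> - K)) +
      (\<integral>x. G x * \<phi> x \<partial>lebesgue_on (\<Omega> - K)) = 0"
    and blow_up: "\<And>m x. x \<in> K \<Longrightarrow> \<exists>V. open V \<and> x \<in> V \<and> (\<forall>y\<in>V \<inter> (\<Omega> - K). m < G y)"
    and Neumann: "\<And>x \<nu>. x \<in> frontier \<Omega> \<Longrightarrow> outward_normal \<Omega> x \<nu> \<Longrightarrow>
      ((\<lambda>y. (B y *v grad G y) \<bullet> \<nu>) \<longlongrightarrow> 0) (at x within \<Omega>)"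
begin

definition S where "S = \<Omega> - K"
text \<open>Integrals over \<Omega> are taken over \<open>S\<close>, which omits the null set
  \<open>K\<close>, so that weak gradients, \<open>G\<close> and \<open>B\<close> all live on one
  open set; the measure is finite since \<Omega> is bounded.\<close>

definition N where "N = lebesgue_on S"
definition F where "F x = B x *v grad G x"

lemma open_S: "open S" unfolding S_def using open_\<Omega> compact_K by (auto intro: compact_imp_closed)
lemma bounded_S: "bounded S" unfolding S_def using bounded_\<Omega> by (rule bounded_subset) auto
lemma S_lmeasurable: "S \<in> lmeasurable" using bounded_S open_S by (rule lmeasurable_open)
lemma S_lebesgue [measurable]: "S \<in> sets lebesgue" using S_lmeasurable by auto
lemma S_U: "S \<subseteq> U" unfolding S_def using U_superset closure_subset by fastforce
lemma space_N [simp]: "space N = S" by (simp add: N_def)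

sublocale finite_measure N unfolding N_def by (rule finite_measure_lebesgue_on[OF S_lmeasurable])

lemma measurable_N: "continuous_on S q \<Longrightarrow> q \<in> borel_measurable N"
  for q :: "real^'n \<Rightarrow> real"
  unfolding N_def by (rule continuous_imp_measurable_on_sets_lebesgue[OF _ S_lebesgue])

lemma measurable_N_UNIV: "continuous_on UNIV q \<Longrightarrow> q \<in> borel_measurable N"
  for q :: "real^'n \<Rightarrow> real"
  by (rule measurable_N) (rule continuous_on_subset, auto)

lemma AE_N_I: "(\<And>x. x \<in> S \<Longrightarrow> P x) \<Longrightarrow> AE x in N. P x"
  by (rule AE_I2) simp

lemma F_component: "F x $ i = (\<Sum>j\<in>UNIV. B x $ i $ j * grad G x $ j)"
  by (simp add: F_def matrix_vector_mult_def)

lemma smooth_F: "smooth_on (\<lambda>x. F x $ i) U"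
  unfolding F_component by (intro smooth_on_sum smooth_on_mult open_U smooth_B smooth_on_grad smooth_G)

lemma continuous_on_F: "continuous_on U F"
  by (subst continuous_on_componentwise)
     (auto simp: Basis_vec_def inner_axis intro: smooth_on_imp_continuous_on smooth_F)

lemma continuous_on_G: "continuous_on U G"
  by (rule smooth_on_imp_continuous_on[OF smooth_G])

lemma smooth_F_S: "smooth_on (\<lambda>x. F x $ i) S"
  by (rule smooth_on_subset[OF open_U open_S S_U smooth_F])

lemma smooth_G_S: "smooth_on G S"
  by (rule smooth_on_subset[OF open_U open_S S_U smooth_G])

lemma B_inner_commute: "x \<in> S \<Longrightarrow> (B x *v \<xi>) \<bullet> \<eta> = (B x *v \<eta>) \<bullet> \<xi>"
  using B_sym[of x] dot_lmul_matrix[of \<xi> "B x" \<eta>]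
  by (metis S_def inner_commute transpose_matrix_vector)

lemma divergence_F: "divergence F x = (\<Sum>i\<in>UNIV. grad (\<lambda>y. F y $ i) x $ i)"
  by (simp add: divergence_def grad_component)

text \<open>Both derivatives are moved off the test function: first by the weak gradient of
  \<open>G\<close> against the components \<psi> of B \<nabla>\<phi>, then, after the symmetry of
  \<open>B\<close> has been used, by the weak gradients of the components of \<open>F\<close>. The
  integral of \<phi> (div F - G) remains, and the fundamental lemma concludes.\<close>

lemma AE_divergence_F: "AE x in N. divergence F x = G x"
proof -
  have dc: "continuous_on S (\<lambda>x. grad (\<lambda>y. F y $ i) x $ i)" for i
    by (intro smooth_on_imp_continuous_on smooth_on_grad smooth_F_S)
  have gc: "continuous_on S G" by (rule smooth_on_imp_continuous_on[OF smooth_G_S])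
  have "AE x in lebesgue_on S. divergence F x - G x = 0"
  proof (rule fundamental_lemma_calculus_variations[OF open_S])
    show "integrable (lebesgue_on C) (\<lambda>x. divergence F x - G x)" if "compact C" "C \<subseteq> S" for C
    proof -
      have "continuous_on S (\<lambda>x. divergence F x - G x)"
        unfolding divergence_F by (intro continuous_intros dc gc)
      then show ?thesis
        using set_integrable_continuous_compact[OF that(1)] continuous_on_subset that
        by (auto simp: set_integrable_iff_lebesgue_on[symmetric] compact_sets_lebesgue)
    qed
    fix \<phi> assume \<phi>: "\<phi> \<in> test_functions S"
    obtain C where C: "smooth_on \<phi> UNIV" "compact C" "C \<subseteq> S" "\<And>x. x \<notin> C \<Longrightarrow> \<phi> x = 0"
      using test_functionsE[OF \<phi>] by metis
    note I = test_functions_integrable[OF open_S]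
    define \<psi> where "\<psi> i x = (B x *v grad \<phi> x) $ i" for i x
    have \<psi>: "\<psi> i \<in> test_functions S" for i
    proof (rule test_functionsI[OF _ C(2,3)])
      have g0: "grad \<phi> x = 0" if "x \<notin> C" for x
        using grad_eq_0[of C \<phi> x] compact_imp_closed[OF C(2)] C(4) that by blast
      have "smooth_on (\<lambda>x. grad \<phi> x $ j * B x $ i $ j) UNIV" for j
        using S_U C(3) by (intro smooth_on_mult_cutoff[OF open_U smooth_B smooth_on_grad[OF C(1)] compact_imp_closed[OF C(2)]])
          (auto simp: g0)
      then show "smooth_on (\<psi> i) UNIV"
        unfolding \<psi>_def[abs_def] matrix_vector_mult_def by (auto intro!: smooth_on_sum simp: mult.commute)
      show "\<psi> i x = 0" if "x \<notin> C" for x using g0[OF that] by (simp add: \<psi>_def)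
    qed
    have wG: "weak_gradient S G (grad G)" by (rule weak_gradient_smooth[OF open_S smooth_G_S])
    have wF: "weak_gradient S (\<lambda>x. F x $ i) (grad (\<lambda>x. F x $ i))" for i
      by (rule weak_gradient_smooth[OF open_S smooth_F_S])
    have gGc: "continuous_on S (\<lambda>x. grad G x $ i)" and Fc: "continuous_on S (\<lambda>x. F x $ i)" for i
      by (intro smooth_on_imp_continuous_on smooth_on_grad smooth_G_S smooth_F_S)+
    have "(\<integral>x. G x * (- divergence (\<lambda>y. B y *v grad \<phi> y) x) \<partial>N) =
        (\<integral>x. - (\<Sum>i\<in>UNIV. G x * grad (\<psi> i) x $ i) \<partial>N)"
      by (rule Bochner_Integration.integral_cong)
         (simp_all add: divergence_def grad_component \<psi>_def[abs_def] sum_distrib_left)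
    also have "\<dots> = - (\<Sum>i\<in>UNIV. \<integral>x. G x * grad (\<psi> i) x $ i \<partial>N)"
      using I(2)[OF \<psi> locally_integrable_continuous[OF gc]] unfolding N_def by simp
    also have "\<dots> = (\<Sum>i\<in>UNIV. \<integral>x. \<psi> i x * grad G x $ i \<partial>N)"
      using wG \<psi> unfolding weak_gradient_iff[OF open_S] N_def by (simp add: sum_negf)
    also have "\<dots> = (\<integral>x. (\<Sum>i\<in>UNIV. \<psi> i x * grad G x $ i) \<partial>N)"
      using I(1)[OF \<psi> locally_integrable_continuous[OF gGc]] unfolding N_def by simp
    also have "\<dots> = (\<integral>x. (\<Sum>i\<in>UNIV. F x $ i * grad \<phi> x $ i) \<partial>N)"
      using B_inner_commute
      by (intro Bochner_Integration.integral_cong) (auto simp: \<psi>_def F_def inner_vec_def)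
    also have "\<dots> = (\<Sum>i\<in>UNIV. \<integral>x. F x $ i * grad \<phi> x $ i \<partial>N)"
      using I(2)[OF \<phi> locally_integrable_continuous[OF Fc]] unfolding N_def by simp
    also have "\<dots> = (\<Sum>i\<in>UNIV. - (\<integral>x. \<phi> x * grad (\<lambda>x. F x $ i) x $ i \<partial>N))"
      using wF \<phi> unfolding weak_gradient_iff[OF open_S] N_def by simp
    also have "\<dots> = - (\<integral>x. \<phi> x * divergence F x \<partial>N)"
      using I(1)[OF \<phi> locally_integrable_continuous[OF dc]] unfolding N_def divergence_F by (simp add: sum_distrib_left sum_negf)
    finally have "- (\<integral>x. \<phi> x * divergence F x \<partial>N) + (\<integral>x. G x * \<phi> x \<partial>N) = 0"
      using equation \<phi> unfolding N_def S_def by simp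
    moreover have "integrable N (\<lambda>x. \<phi> x * divergence F x)"
      using I(1)[OF \<phi> locally_integrable_continuous[OF dc]] unfolding N_def divergence_F by (simp add: sum_distrib_left)
    moreover have "integrable N (\<lambda>x. \<phi> x * G x)"
      using I(1)[OF \<phi> locally_integrable_continuous[OF gc]] unfolding N_def by simp
    ultimately show "(\<integral>x. \<phi> x * (divergence F x - G x) \<partial>lebesgue_on S) = 0"
      unfolding N_def[symmetric] by (simp add: right_diff_distrib mult.commute)
  qed
  then show ?thesis unfolding N_def by simp
qed

text \<open>The integrand F . \<nabla>(\<psi> w) + G \<psi> w of the weak form of div F = G, with
  \<open>p\<close> in the place of the gradient of \<open>w\<close>. Keeping \<psi> separate makes
  it a linear object in \<psi>, which can be localised by cutoffs.\<close>

definition residual where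
  "residual w p \<psi> x = \<psi> x * (F x \<bullet> p x + G x * w x) + w x * (F x \<bullet> grad \<psi> x)"

text \<open>The definition of the weak gradient is applied to the test functions \<eta> F_i and
  summed over \<open>i\<close>; the divergence of \<eta> F is \<eta> G + F . \<nabla>\<eta> almost
  everywhere.\<close>

lemma residual_test:
  assumes w: "weak_gradient S w p" and \<eta>: "\<eta> \<in> test_functions S"
  shows "(\<integral>x. residual w p \<eta> x \<partial>N) = 0"
proof -
  note I = test_functions_integrable[OF open_S]
  have wl: "locally_integrable S w" and pl: "locally_integrable S (\<lambda>x. p x $ i)" for i
    using w by (auto simp: weak_gradient_iff[OF open_S])
  define \<phi> where "\<phi> i x = \<eta> x * F x $ i" for i x
  have \<phi>: "\<phi> i \<in> test_functions S" for i unfolding \<phi>_def[abs_def] by (rule test_functions_mult[OF open_S smooth_F_S \<eta>])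
  have \<eta>S: "smooth_on \<eta> S" using \<eta> unfolding test_functions_def by (auto intro: smooth_on_subset[OF open_UNIV open_S])
  have eq: "(\<integral>x. w x * grad (\<phi> i) x $ i \<partial>N) = - (\<integral>x. \<phi> i x * p x $ i \<partial>N)" for i
    using w \<phi>[of i] unfolding weak_gradient_iff[OF open_S] N_def by blast
  have i1: "integrable N (\<lambda>x. w x * grad (\<phi> i) x $ i)" and i2: "integrable N (\<lambda>x. \<phi> i x * p x $ i)" for i
    unfolding N_def by (rule I(2)[OF \<phi> wl] I(1)[OF \<phi> pl])+
  have "(\<integral>x. residual w p \<eta> x \<partial>N) = (\<integral>x. (\<Sum>i\<in>UNIV. w x * grad (\<phi> i) x $ i + \<phi> i x * p x $ i) \<partial>N)"
  proof (rule integral_cong_AE)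
    show *: "(\<lambda>x. \<Sum>i\<in>UNIV. w x * grad (\<phi> i) x $ i + \<phi> i x * p x $ i) \<in> borel_measurable N"
      using i1 i2 by (intro borel_measurable_sum borel_measurable_add) auto
    show AE: "AE x in N. residual w p \<eta> x = (\<Sum>i\<in>UNIV. w x * grad (\<phi> i) x $ i + \<phi> i x * p x $ i)"
      using AE_divergence_F AE_space
    proof eventually_elim
      case (elim x)
      then have x: "x \<in> S" by simp
      have "grad (\<phi> i) x $ i = \<eta> x * grad (\<lambda>y. F y $ i) x $ i + F x $ i * grad \<eta> x $ i" for i
        unfolding \<phi>_def[abs_def] using grad_mult[OF open_S \<eta>S smooth_F_S x] by simp
      then show ?case
        using elim(1)[symmetric] unfolding residual_def divergence_F
        by (simp add: inner_vec_def \<phi>_def sum.distrib sum_distrib_left algebra_simps)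
    qed
    show "residual w p \<eta> \<in> borel_measurable N"
    proof -
      have pm: "(\<lambda>x. \<eta> x * p x $ i) \<in> borel_measurable N" and wm: "(\<lambda>x. \<eta> x * w x) \<in> borel_measurable N"
        and gm: "(\<lambda>x. w x * grad \<eta> x $ i) \<in> borel_measurable N" for i
        unfolding N_def by (rule borel_measurable_integrable I[OF \<eta> pl] I[OF \<eta> wl])+
      have Fm: "(\<lambda>x. F x $ i) \<in> borel_measurable N" and Gm: "G \<in> borel_measurable N" for i
        by (rule measurable_N smooth_on_imp_continuous_on smooth_F_S smooth_G_S)+
      have "(\<lambda>x. (\<Sum>i\<in>UNIV. F x $ i * (\<eta> x * p x $ i)) + G x * (\<eta> x * w x) + (\<Sum>i\<in>UNIV. F x $ i * (w x * grad \<eta> x $ i)))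
        \<in> borel_measurable N"
        by (intro borel_measurable_sum borel_measurable_add borel_measurable_times pm wm gm Fm Gm)
      moreover have "residual w p \<eta> = (\<lambda>x. (\<Sum>i\<in>UNIV. F x $ i * (\<eta> x * p x $ i)) + G x * (\<eta> x * w x) + (\<Sum>i\<in>UNIV. F x $ i * (w x * grad \<eta> x $ i)))"
        by (rule ext) (simp add: residual_def inner_vec_def sum_distrib_left algebra_simps)
      ultimately show ?thesis by (simp only:)
    qed
  qed
  also have "\<dots> = 0" using i1 i2 by (simp add: eq)
  finally show ?thesis .
qed

lemma bounded_on_compact:
  fixes q :: "real^'n \<Rightarrow> real"
  assumes "continuous_on U q" "compact C" "C \<subseteq> U"
  obtains m where "m > 0" "\<And>x. x \<in> C \<Longrightarrow> \<bar>q x\<bar> \<le> m"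
proof -
  have "compact (q ` C)" using assms by (intro compact_continuous_image continuous_on_subset[OF assms(1)])
  then obtain m where "m > 0" "\<forall>y\<in>q ` C. norm y \<le> m" using compact_imp_bounded bounded_pos by blast
  then show thesis by (intro that[of m]) auto
qed

text \<open>\<open>q\<close> may be unbounded near \<open>K\<close>, but \<open>h\<close> lives on
  the compact set \<open>C\<close> inside \<open>U\<close>, where \<open>q\<close> is bounded. All
  integrability questions for compactly supported functions reduce to this.\<close>

lemma integrable_mult_bounded:
  fixes q h :: "real^'n \<Rightarrow> real"
  assumes q: "continuous_on U q" and C: "compact C" "C \<subseteq> U" and h: "integrable N h" "AE x in N. x \<notin> C \<longrightarrow> h x = 0"
  shows "integrable N (\<lambda>x. q x * h x)"
proof -
  obtain m where m: "m > 0" "\<And>x. x \<in> C \<Longrightarrow> \<bar>q x\<bar> \<le> m" using bounded_on_compact[OF q C] by metis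
  show ?thesis
  proof (rule Bochner_Integration.integrable_bound[OF integrable_mult_right[OF h(1), of m]])
    have "q \<in> borel_measurable N" by (rule measurable_N[OF continuous_on_subset[OF q S_U]])
    then show "(\<lambda>x. q x * h x) \<in> borel_measurable N" using h(1) by simp
    show "AE x in N. norm (q x * h x) \<le> norm (m * h x)"
      using h(2)
    proof eventually_elim
      case (elim x)
      then show ?case using m by (cases "x \<in> C") (auto simp: abs_mult intro!: mult_right_mono)
    qed
  qed
qed

section \<open>Testing the equation with functions that reach the boundary\<close>

context
  fixes w :: "real^'n \<Rightarrow> real" and p :: "real^'n \<Rightarrow> real^'n" and C :: "(real^'n) set" and m\<^sub>w :: real
  assumes w: "weak_gradient S w p" and w_meas: "w \<in> borel_measurable N" and w_bound: "\<And>x. x \<in> S \<Longrightarrow> \<bar>w x\<bar> \<le> m\<^sub>w"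
    and C: "compact C" "C \<subseteq> closure \<Omega> - K" and w_supp: "\<And>x. x \<in> S - C \<Longrightarrow> w x = 0"
    and p_int: "\<And>i. integrable N (\<lambda>x. p x $ i)"
begin

lemma C_U: "C \<subseteq> U" using C(2) U_superset by auto

lemma p_supp: "AE x in N. x \<notin> C \<longrightarrow> p x = 0"
  unfolding N_def by (rule weak_gradient_AE_0[OF open_S w compact_imp_closed[OF C(1)] w_supp])

lemma w_int: "integrable N w"
  by (rule integrable_const_bound[of _ m\<^sub>w]) (use w_bound w_meas in \<open>auto intro!: AE_N_I\<close>)

lemma residual_integrable:
  assumes \<psi>: "smooth_on \<psi> UNIV"
  shows "integrable N (residual w p \<psi>)"
proof -
  have \<psi>c: "continuous_on U \<psi>" "\<And>i. continuous_on U (\<lambda>x. grad \<psi> x $ i)"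
    using smooth_on_imp_continuous_on[OF \<psi>] smooth_on_imp_continuous_on[OF smooth_on_grad[OF \<psi>]]
    by (auto intro: continuous_on_subset)
  have Fc: "continuous_on U (\<lambda>x. F x $ i)" for i by (rule smooth_on_imp_continuous_on[OF smooth_F])
  have ws: "AE x in N. x \<notin> C \<longrightarrow> w x = 0" using w_supp by (intro AE_N_I) auto
  have ps: "AE x in N. x \<notin> C \<longrightarrow> p x $ i = 0" for i using p_supp by eventually_elim auto
  have i1: "integrable N (\<lambda>x. (\<psi> x * F x $ i) * p x $ i)" for i
    by (rule integrable_mult_bounded[OF _ C(1) C_U p_int ps]) (intro continuous_intros \<psi>c Fc)
  have i2: "integrable N (\<lambda>x. (\<psi> x * G x) * w x)"
    by (rule integrable_mult_bounded[OF _ C(1) C_U w_int ws]) (intro continuous_intros \<psi>c continuous_on_G)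
  have i3: "integrable N (\<lambda>x. (F x $ i * grad \<psi> x $ i) * w x)" for i
    by (rule integrable_mult_bounded[OF _ C(1) C_U w_int ws]) (intro continuous_intros \<psi>c Fc)
  have "integrable N (\<lambda>x. (\<Sum>i\<in>UNIV. (\<psi> x * F x $ i) * p x $ i) + (\<psi> x * G x) * w x + (\<Sum>i\<in>UNIV. (F x $ i * grad \<psi> x $ i) * w x))"
    by (intro Bochner_Integration.integrable_add Bochner_Integration.integrable_sum i1 i2 i3)
  moreover have "(\<lambda>x. (\<Sum>i\<in>UNIV. (\<psi> x * F x $ i) * p x $ i) + (\<psi> x * G x) * w x + (\<Sum>i\<in>UNIV. (F x $ i * grad \<psi> x $ i) * w x)) = residual w p \<psi>"
    by (auto simp: residual_def inner_vec_def sum_distrib_left sum_distrib_right algebra_simps fun_eq_iff)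
  ultimately show ?thesis by simp
qed

lemma residual_interior:
  assumes x: "x \<in> S"
  obtains \<theta> \<delta> where "smooth_on \<theta> UNIV" "\<delta> > 0" "\<And>y. y \<in> ball x \<delta> \<Longrightarrow> \<theta> y = 1"
    "\<And>\<psi>. smooth_on \<psi> UNIV \<Longrightarrow> (\<integral>y. residual w p (\<lambda>y. \<psi> y * \<theta> y) y \<partial>N) = 0"
proof -
  obtain r where r: "r > 0" "cball x r \<subseteq> S" using open_S x open_contains_cball by blast
  obtain \<theta> \<delta> where \<theta>: "smooth_on \<theta> UNIV" "\<And>y. y \<notin> cball x r \<Longrightarrow> \<theta> y = 0" "\<delta> > 0"
    "\<And>y. y \<in> ball x \<delta> \<Longrightarrow> \<theta> y = 1" "\<And>y. 0 \<le> \<theta> y" "\<And>y. \<theta> y \<le> (1::real)"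
    using smooth_cutoff[OF r(1)] by metis
  have "(\<integral>y. residual w p (\<lambda>y. \<psi> y * \<theta> y) y \<partial>N) = 0" if "smooth_on \<psi> UNIV" for \<psi>
    by (rule residual_test[OF w], rule test_functionsI[OF smooth_on_mult[OF open_UNIV that \<theta>(1)] compact_cball r(2)])
       (simp add: \<theta>(2))
  then show thesis using that \<theta> by blast
qed

text \<open>If the bound failed arbitrarily close to the boundary, compactness of \<open>Q\<close>
  would give a limit point \<open>l\<close> with \<phi>(l) >= 0, hence on the frontier. There F .
  \<nabla>\<phi> is continuous across the boundary, and the Neumann condition forces it to be
  zero.\<close>

lemma Neumann_uniform:
  assumes \<phi>: "local_defining_function \<Omega> V \<phi>" and Q: "compact Q" "Q \<subseteq> U \<inter> V" and e: "e > 0"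
  obtains \<delta> where "\<delta> > 0" "\<And>y. y \<in> \<Omega> \<inter> Q \<Longrightarrow> - \<delta> \<le> \<phi> y \<Longrightarrow> \<bar>F y \<bullet> grad \<phi> y\<bar> \<le> e"
proof (rule ccontr)
  assume contr: "\<not> thesis"
  have V: "open V" "smooth_on \<phi> V" "\<And>y. y \<in> V \<Longrightarrow> grad \<phi> y \<noteq> 0" "\<Omega> \<inter> V = {y \<in> V. \<phi> y < 0}"
    using \<phi> by (auto simp: local_defining_function_def)
  have "\<exists>y. y \<in> \<Omega> \<inter> Q \<and> - inverse (real (Suc k)) \<le> \<phi> y \<and> \<bar>F y \<bullet> grad \<phi> y\<bar> > e" for k
    using contr that[of "inverse (real (Suc k))"] by (force simp: not_le)
  then obtain y where y: "\<And>k. y k \<in> \<Omega> \<inter> Q" "\<And>k. - inverse (real (Suc k)) \<le> \<phi> (y k)" "\<And>k. \<bar>F (y k) \<bullet> grad \<phi> (y k)\<bar> > e"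
    by metis
  obtain l r where l: "l \<in> Q" "strict_mono r" "(y \<circ> r) \<longlonglongrightarrow> l"
    using Q(1) y(1) unfolding compact_def by (metis IntD2)
  have lUV: "l \<in> U" "l \<in> V" using l Q by auto
  have lcl: "l \<in> closure \<Omega>"
    using l(3) y(1) unfolding closure_sequential by (intro exI[of _ "y \<circ> r"]) auto
  have "isCont \<phi> l" using smooth_on_imp_continuous_on[OF V(2)] V(1) lUV by (simp add: continuous_on_eq_continuous_at)
  then have "(\<lambda>k. \<phi> ((y \<circ> r) k)) \<longlonglongrightarrow> \<phi> l" using l(3) by (rule isCont_tendsto_compose)
  moreover have "(\<lambda>k. - inverse (real (Suc (r k)))) \<longlonglongrightarrow> - 0"
    using LIMSEQ_subseq_LIMSEQ[OF LIMSEQ_inverse_real_of_nat l(2)] by (intro tendsto_minus) (simp add: o_def)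
  ultimately have "- 0 \<le> \<phi> l" using y(2) by (intro LIMSEQ_le[of "\<lambda>k. - inverse (real (Suc (r k)))"]) auto
  then have "l \<notin> {y \<in> V. \<phi> y < 0}" by simp
  then have ln: "l \<notin> \<Omega>" using lUV unfolding V(4)[symmetric] by blast
  then have lf: "l \<in> frontier \<Omega>" using lcl open_\<Omega> by (simp add: frontier_def interior_open)
  have hc: "continuous_on (U \<inter> V) (\<lambda>x. F x \<bullet> grad \<phi> x)"
  proof -
    have "continuous_on V (grad \<phi>)"
      by (subst continuous_on_componentwise)
         (auto simp: Basis_vec_def inner_axis intro: smooth_on_imp_continuous_on smooth_on_grad V)
    then show ?thesis using continuous_on_F by (intro continuous_intros) (auto intro: continuous_on_subset)
  qed
  have "isCont (\<lambda>x. F x \<bullet> grad \<phi> x) l"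
    using hc open_U V(1) lUV by (simp add: continuous_on_eq_continuous_at open_Int)
  then have "(\<lambda>k. F ((y \<circ> r) k) \<bullet> grad \<phi> ((y \<circ> r) k)) \<longlonglongrightarrow> F l \<bullet> grad \<phi> l" using l(3) by (rule isCont_tendsto_compose)
  then have "(\<lambda>k. \<bar>F ((y \<circ> r) k) \<bullet> grad \<phi> ((y \<circ> r) k)\<bar>) \<longlonglongrightarrow> \<bar>F l \<bullet> grad \<phi> l\<bar>" by (rule tendsto_rabs)
  then have ge: "e \<le> \<bar>F l \<bullet> grad \<phi> l\<bar>" using y(3) by (intro LIMSEQ_le_const) (auto simp: less_imp_le)
  define \<nu> where "\<nu> = grad \<phi> l /\<^sub>R norm (grad \<phi> l)"
  have "outward_normal \<Omega> l \<nu>" unfolding outward_normal_def \<nu>_def using \<phi> lUV by blast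
  from Neumann[OF lf this] have "((\<lambda>y. F y \<bullet> \<nu>) \<longlongrightarrow> 0) (at l within \<Omega>)" by (simp add: F_def)
  moreover have "((\<lambda>y. F y \<bullet> \<nu>) \<longlongrightarrow> F l \<bullet> \<nu>) (at l within \<Omega>)"
  proof -
    have "isCont F l" using continuous_on_F open_U lUV by (simp add: continuous_on_eq_continuous_at)
    then have "(F \<longlongrightarrow> F l) (at l within \<Omega>)" by (auto simp: isCont_def intro: tendsto_within_subset)
    then show ?thesis by (intro tendsto_intros)
  qed
  moreover have "at l within \<Omega> \<noteq> bot"
    using lcl ln by (simp add: trivial_limit_within islimpt_in_closure)
  ultimately have "F l \<bullet> \<nu> = 0" using tendsto_unique by blast
  then have "F l \<bullet> grad \<phi> l = 0" using V(3)[OF lUV(2)] by (simp add: \<nu>_def)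
  then show False using ge e by simp
qed

text \<open>Near the boundary, the cutoff \<open>smooth_step (- (k + 1) \<phi> - 1)\<close> vanishes close to \<open>\<partial>\<Omega>\<close>. The
  \<open>L\<^sup>1\<close> norm of its gradient stays bounded, which is seen from an integration by parts in a direction
  transversal to the boundary; multiplied by the normal component of \<open>F\<close> it tends to zero.\<close>

lemma residual_boundary:
  assumes x: "x \<in> frontier \<Omega>"
  obtains \<theta> \<delta> where "smooth_on \<theta> UNIV" "\<delta> > 0" "\<And>y. y \<in> ball x \<delta> \<Longrightarrow> \<theta> y = 1"
    "\<And>\<psi>. smooth_on \<psi> UNIV \<Longrightarrow> (\<integral>y. residual w p (\<lambda>y. \<psi> y * \<theta> y) y \<partial>N) = 0"
proof -
  obtain V \<phi> where V: "x \<in> V" and ldf: "local_defining_function \<Omega> V \<phi>"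
    using boundary x unfolding smooth_boundary_def by blast
  have oV: "open V" and \<phi>: "smooth_on \<phi> V" and \<phi>0: "\<And>y. y \<in> V \<Longrightarrow> grad \<phi> y \<noteq> 0" and \<Omega>V: "\<Omega> \<inter> V = {y \<in> V. \<phi> y < 0}"
    using ldf by (auto simp: local_defining_function_def)
  have xU: "x \<in> U" using x U_superset K_subset open_\<Omega> by (auto simp: frontier_def interior_open)
  \<comment> \<open>The i-th coordinate direction is transversal to the boundary near
    \<open>x\<close>: on the small ball \<open>Q\<close>, the sign \<open>s\<close> times the i-th
    derivative of \<phi> stays above \<open>c\<close>.\<close>
  obtain i where i: "grad \<phi> x $ i \<noteq> 0" using \<phi>0[OF V] by (auto simp: vec_eq_iff)
  define s where "s = sgn (grad \<phi> x $ i)"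
  define c where "c = \<bar>grad \<phi> x $ i\<bar> / 2"
  have c: "c > 0" using i by (simp add: c_def)
  have dc: "continuous_on V (\<lambda>y. s * grad \<phi> y $ i)"
    by (intro continuous_intros smooth_on_imp_continuous_on[OF smooth_on_grad[OF \<phi>]])
  have "open ((U \<inter> V) \<inter> (\<lambda>y. s * grad \<phi> y $ i) -` {c<..})"
    by (rule continuous_open_preimage[OF continuous_on_subset[OF dc]]) (auto simp: open_U oV)
  moreover have "x \<in> (U \<inter> V) \<inter> (\<lambda>y. s * grad \<phi> y $ i) -` {c<..}"
    using xU V i by (auto simp: s_def c_def sgn_mult_self_eq sgn_if)
  ultimately obtain r where r: "r > 0" "cball x r \<subseteq> (U \<inter> V) \<inter> (\<lambda>y. s * grad \<phi> y $ i) -` {c<..}"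
    using open_contains_cball by blast
  define Q where "Q = cball x r"
  have Q: "compact Q" "Q \<subseteq> U \<inter> V" "\<And>y. y \<in> Q \<Longrightarrow> c < s * grad \<phi> y $ i" using r by (auto simp: Q_def)
  have clQ: "closed Q" by (simp add: Q_def)
  obtain \<theta> \<delta> where \<theta>: "smooth_on \<theta> UNIV" "\<And>y. y \<notin> Q \<Longrightarrow> \<theta> y = 0" "\<delta> > 0"
    "\<And>y. y \<in> ball x \<delta> \<Longrightarrow> \<theta> y = 1" "\<And>y. 0 \<le> \<theta> y" "\<And>y. \<theta> y \<le> (1::real)"
    unfolding Q_def using smooth_cutoff[OF r(1)] by metis
  obtain \<Theta>' b where \<Theta>': "\<And>s. (smooth_step has_real_derivative \<Theta>' s) (at s)" "\<And>s. 0 \<le> \<Theta>' s" "\<And>s. \<Theta>' s \<le> b"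
    "\<And>s. s \<notin> {0..1} \<Longrightarrow> \<Theta>' s = 0" "b > 0"
    using smooth_step_deriv by metis
  define \<kappa> where "\<kappa> k y = smooth_step (- real (Suc k) * \<phi> y - 1)" for k y
  have \<kappa>s: "smooth_on (\<kappa> k) V" for k
    unfolding \<kappa>_def[abs_def]
    by (rule smooth_on_compose[OF oV open_UNIV UNIV_I smooth_on_smooth_step
          smooth_on_diff[OF oV smooth_on_mult[OF oV smooth_on_const[OF oV] \<phi>] smooth_on_const[OF oV]]])
  have \<kappa>01: "0 \<le> \<kappa> k y" "\<kappa> k y \<le> 1" for k y by (auto simp: \<kappa>_def smooth_step_nonneg smooth_step_le_1)
  \<comment> \<open>The factor of -\<nabla>\<phi> in the gradient of \<open>\<kappa> k\<close>. It
    is nonnegative and of order k + 1, and it lives in the transition layer -2/(k+1) <= \<phi> <=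
    -1/(k+1).\<close>
  define \<Lambda> where "\<Lambda> k y = real (Suc k) * \<Theta>' (- real (Suc k) * \<phi> y - 1)" for k y
  have \<kappa>g: "grad (\<kappa> k) y = (- \<Lambda> k y) *\<^sub>R grad \<phi> y" if "y \<in> V" for k y
  proof -
    have "((\<lambda>t. smooth_step (- real (Suc k) * t - 1)) has_real_derivative (\<Theta>' (- real (Suc k) * \<phi> y - 1) * - real (Suc k))) (at (\<phi> y))"
      by (rule DERIV_chain2[OF \<Theta>'(1)]) (auto intro!: derivative_eq_intros)
    from grad_compose[OF oV \<phi> that this] show ?thesis unfolding \<kappa>_def[abs_def] \<Lambda>_def
      by (simp add: mult.commute[of "real (Suc k)" "\<Theta>' _"] del: of_nat_Suc)
  qed
  have test: "(\<lambda>y. (\<psi> y * \<theta> y) * \<kappa> k y) \<in> test_functions S" if \<psi>: "smooth_on \<psi> UNIV" for \<psi> k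
  proof -
    define Q' where "Q' = {y \<in> Q. \<phi> y \<le> - inverse (real (Suc k))}"
    have \<phi>Q: "continuous_on Q \<phi>" using smooth_on_imp_continuous_on[OF \<phi>] Q(2) by (auto intro: continuous_on_subset)
    have "Q' = Q \<inter> \<phi> -` {.. - inverse (real (Suc k))}" by (auto simp: Q'_def)
    then have "closed Q'" using continuous_closed_preimage[OF \<phi>Q clQ, of "{.. - inverse (real (Suc k))}"] by simp
    then have cQ': "compact Q'" using Q(1) by (auto simp: Q'_def intro: compact_Int_closed[of Q Q', THEN back_subst[where P=compact]])
    have neg: "\<phi> y < 0" if "y \<in> Q'" for y
    proof -
      have "- inverse (real (Suc k)) < 0" by simp
      then show ?thesis using that unfolding Q'_def by (metis (mono_tags, lifting) le_less_trans mem_Collect_eq)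
    qed
    have sub: "Q' \<subseteq> S"
      using Q(2) \<Omega>V U_K neg by (auto simp: S_def Q'_def)
    show ?thesis
    proof (rule test_functionsI[OF _ cQ' sub])
      show "smooth_on (\<lambda>y. (\<psi> y * \<theta> y) * \<kappa> k y) UNIV"
        by (rule smooth_on_mult_cutoff[OF oV \<kappa>s smooth_on_mult[OF open_UNIV \<psi> \<theta>(1)] clQ])
           (use Q(2) \<theta>(2) in auto)
      show "\<psi> y * \<theta> y * \<kappa> k y = 0" if "y \<notin> Q'" for y
      proof (cases "y \<in> Q")
        case True
        then have "- inverse (real (Suc k)) < \<phi> y" using that by (simp add: Q'_def)
        then have "real (Suc k) * - inverse (real (Suc k)) \<le> real (Suc k) * \<phi> y"
          by (intro mult_left_mono) auto
        moreover have "real (Suc k) * - inverse (real (Suc k)) = - 1" by simp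
        ultimately have "- 1 \<le> real (Suc k) * \<phi> y" by (simp only:)
        then have "- real (Suc k) * \<phi> y - 1 \<le> 0" by (simp del: of_nat_Suc)
        then show ?thesis by (simp add: \<kappa>_def smooth_step_0)
      qed (simp add: \<theta>(2))
    qed
  qed
  have Qneg: "\<phi> y < 0" if "y \<in> Q" "y \<in> S" for y
    using that \<Omega>V Q(2) by (auto simp: S_def)
  have gc\<phi>: "continuous_on V (\<lambda>y. grad \<phi> y $ j)" for j
    by (rule smooth_on_imp_continuous_on[OF smooth_on_grad[OF \<phi>]])
  define m\<^sub>\<theta> where "m\<^sub>\<theta> = (\<integral>y. \<bar>grad \<theta> y $ i\<bar> \<partial>N)"
  have \<theta>c: "continuous_on UNIV \<theta>" "continuous_on UNIV (\<lambda>y. grad \<theta> y $ j)" for j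
    using \<theta>(1) by (auto intro: smooth_on_imp_continuous_on smooth_on_grad)
  have gr\<theta>0: "grad \<theta> y = 0" if "y \<notin> Q" for y using grad_eq_0[of Q \<theta> y] clQ \<theta>(2) that by blast
  have gr\<theta>int: "integrable N (\<lambda>y. grad \<theta> y $ i)"
  proof -
    obtain m where "\<And>y. \<bar>grad \<theta> y $ i\<bar> \<le> m" using compact_supp_bounded[OF \<theta>c(2)[of i] Q(1)] gr\<theta>0 by (metis zero_index)
    then show ?thesis using measurable_N_UNIV[OF \<theta>c(2)[of i]] by (intro integrable_const_bound[of _ m]) auto
  qed
  have \<kappa>cS: "(\<lambda>y. g y * \<kappa> k y) \<in> borel_measurable N" if "continuous_on UNIV g" "\<And>y. y \<notin> Q \<Longrightarrow> g y = 0" for g k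
  proof -
    have "continuous_on (V \<union> - Q) (\<lambda>y. g y * \<kappa> k y)"
    proof (rule continuous_on_open_Un)
      show "continuous_on V (\<lambda>y. g y * \<kappa> k y)"
        by (intro continuous_intros continuous_on_subset[OF that(1)] smooth_on_imp_continuous_on[OF \<kappa>s]) auto
      show "continuous_on (- Q) (\<lambda>y. g y * \<kappa> k y)"
        by (rule continuous_on_eq[of _ "\<lambda>_. 0"]) (auto simp: that(2))
    qed (use oV clQ in auto)
    moreover have "V \<union> - Q = UNIV" using Q(2) by auto
    ultimately show ?thesis by (intro measurable_N_UNIV) simp
  qed
  \<comment> \<open>The product of \<theta> and \<open>\<kappa> k\<close> is a test function, so its
    i-th derivative integrates to zero. This trades the integral of \<theta> \<Lambda> times the
    i-th derivative of \<phi> for that of \<open>\<kappa> k\<close> times the i-th derivative of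
    \<theta>, which is bounded uniformly in \<open>k\<close>.\<close>
  have \<Lambda>int: "integrable N (\<lambda>y. \<theta> y * \<Lambda> k y)" and \<Lambda>le: "(\<integral>y. \<theta> y * \<Lambda> k y \<partial>N) \<le> m\<^sub>\<theta> / c" for k
  proof -
    have t1: "(\<lambda>y. \<theta> y * \<kappa> k y) \<in> test_functions S" using test[of "\<lambda>_. 1" k] by simp
    have "weak_gradient S (\<lambda>_. 1) (grad (\<lambda>_. 1))" by (rule weak_gradient_smooth[OF open_S smooth_on_const[OF open_S]])
    moreover have "grad (\<lambda>_::real^'n. 1) = (\<lambda>_. 0)" by (intro ext grad_unique) auto
    ultimately have Z: "(\<integral>y. grad (\<lambda>y. \<theta> y * \<kappa> k y) y $ i \<partial>N) = 0"
      using t1 unfolding weak_gradient_iff[OF open_S] N_def by fastforce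
    have gp: "grad (\<lambda>y. \<theta> y * \<kappa> k y) y $ i = \<kappa> k y * grad \<theta> y $ i - \<theta> y * \<Lambda> k y * grad \<phi> y $ i" if "y \<in> Q" for y
    proof -
      have "y \<in> V" using that Q(2) by auto
      then show ?thesis using grad_mult[OF oV smooth_on_subset[OF open_UNIV oV _ \<theta>(1)] \<kappa>s, of y k] \<kappa>g[of y k] by simp
    qed
    have gp0: "grad (\<lambda>y. \<theta> y * \<kappa> k y) y = 0" if "y \<notin> Q" for y
      using grad_eq_0[of Q "\<lambda>y. \<theta> y * \<kappa> k y" y] clQ \<theta>(2) that by auto
    have ig: "integrable N (\<lambda>y. grad (\<lambda>y. \<theta> y * \<kappa> k y) y $ i)"
      using test_functions_integrable(2)[OF open_S t1 locally_integrable_continuous[OF continuous_on_const[of S 1]], of i] unfolding N_def by simp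
    have i\<kappa>: "integrable N (\<lambda>y. grad \<theta> y $ i * \<kappa> k y)"
    proof (rule Bochner_Integration.integrable_bound[OF gr\<theta>int])
      show "(\<lambda>y. grad \<theta> y $ i * \<kappa> k y) \<in> borel_measurable N" by (rule \<kappa>cS[OF \<theta>c(2)]) (simp add: gr\<theta>0)
      show "AE y in N. norm (grad \<theta> y $ i * \<kappa> k y) \<le> norm (grad \<theta> y $ i)"
        using \<kappa>01[of k] by (intro AE_I2) (simp add: abs_mult mult_right_le_one_le)
    qed
    define L where "L y = s * (grad \<theta> y $ i * \<kappa> k y) - s * grad (\<lambda>y. \<theta> y * \<kappa> k y) y $ i" for y
    have L: "L y = \<theta> y * \<Lambda> k y * (s * grad \<phi> y $ i)" if "y \<in> Q" for y
      unfolding L_def gp[OF that] by (simp add: algebra_simps)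
    have L0: "L y = 0" if "y \<notin> Q" for y unfolding L_def using gp0[OF that] gr\<theta>0[OF that] by simp
    have iL: "integrable N L" unfolding L_def[abs_def] using ig i\<kappa> by simp
    have \<Lambda>0: "0 \<le> \<Lambda> k y" for y using \<Theta>'(2) by (simp add: \<Lambda>_def)
    have cL: "c * (\<theta> y * \<Lambda> k y) \<le> L y" for y
    proof (cases "y \<in> Q")
      case True
      have "\<theta> y * \<Lambda> k y * c \<le> \<theta> y * \<Lambda> k y * (s * grad \<phi> y $ i)"
        using Q(3)[OF True] \<theta>(5) \<Lambda>0 by (intro mult_left_mono) auto
      then show ?thesis using L[OF True] by (simp add: mult_ac)
    qed (simp add: L0 \<theta>(2))
    \<comment> \<open>Of \<Theta>' only the bounds and the support are known here. Measurability is
      therefore recovered from \<open>L\<close>, divided by the transversal derivative, which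
      exceeds \<open>c\<close> on \<open>Q\<close>.\<close>
    have meas: "(\<lambda>y. \<theta> y * \<Lambda> k y) \<in> borel_measurable N"
    proof -
      have "(\<lambda>y. if y \<in> Q then L y / (s * grad \<phi> y $ i) else 0) \<in> borel_measurable N"
      proof -
        have 1: "indicator Q \<in> borel_measurable N"
          unfolding N_def using clQ by (intro measurable_restrict_space1 borel_measurable_indicator) simp
        have "(\<lambda>y. indicator Q y *\<^sub>R grad \<phi> y $ i) \<in> borel_measurable borel"
          using clQ Q(2) by (intro borel_measurable_continuous_on_indicator continuous_on_subset[OF gc\<phi>]) auto
        then have 2: "(\<lambda>y. indicator Q y * grad \<phi> y $ i) \<in> borel_measurable N"
          unfolding N_def by (intro measurable_restrict_space1 measurable_completion) simp
        have "(\<lambda>y. indicator Q y * (L y / (s * (indicator Q y * grad \<phi> y $ i)))) \<in> borel_measurable N"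
          by (rule borel_measurable_times[OF 1 borel_measurable_divide[OF borel_measurable_integrable[OF iL]
                borel_measurable_times[OF borel_measurable_const 2]]])
        moreover have "indicator Q y * (L y / (s * (indicator Q y * grad \<phi> y $ i))) = (if y \<in> Q then L y / (s * grad \<phi> y $ i) else 0)" for y
          by auto
        ultimately show ?thesis by (simp only:)
      qed
      moreover have "(if y \<in> Q then L y / (s * grad \<phi> y $ i) else 0) = \<theta> y * \<Lambda> k y" for y
        using L[of y] Q(3)[of y] c \<theta>(2)[of y] by (cases "y \<in> Q") auto
      ultimately show ?thesis by (simp only:)
    qed
    have bd: "\<theta> y * \<Lambda> k y \<le> real (Suc k) * b" for y
    proof -
      have "\<theta> y * \<Lambda> k y \<le> 1 * \<Lambda> k y" by (rule mult_right_mono[OF \<theta>(6) \<Lambda>0])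
      also have "\<dots> \<le> real (Suc k) * b" unfolding \<Lambda>_def mult_1 by (rule mult_left_mono[OF \<Theta>'(3)]) simp
      finally show ?thesis .
    qed
    show i1: "integrable N (\<lambda>y. \<theta> y * \<Lambda> k y)"
      using bd \<theta>(5) \<Lambda>0 meas by (intro integrable_const_bound[of _ "real (Suc k) * b"]) auto
    have "c * (\<integral>y. \<theta> y * \<Lambda> k y \<partial>N) \<le> (\<integral>y. L y \<partial>N)"
      using integral_mono[OF integrable_mult_right[OF i1, of c] iL cL] by simp
    also have "\<dots> = s * (\<integral>y. grad \<theta> y $ i * \<kappa> k y \<partial>N)"
      unfolding L_def using ig i\<kappa> Z by simp
    also have "\<dots> \<le> \<bar>s\<bar> * \<bar>\<integral>y. grad \<theta> y $ i * \<kappa> k y \<partial>N\<bar>" unfolding abs_mult[symmetric] by (rule abs_ge_self)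
    also have "\<dots> \<le> 1 * (\<integral>y. \<bar>grad \<theta> y $ i * \<kappa> k y\<bar> \<partial>N)"
      by (intro mult_mono integral_abs_bound) (auto simp: s_def abs_sgn_eq)
    also have "\<dots> \<le> m\<^sub>\<theta>"
      unfolding m\<^sub>\<theta>_def mult_1
    proof (rule integral_mono[OF integrable_abs[OF i\<kappa>] integrable_abs[OF gr\<theta>int]])
      show "\<bar>grad \<theta> y $ i * \<kappa> k y\<bar> \<le> \<bar>grad \<theta> y $ i\<bar>" for y
        using \<kappa>01[of k] by (simp add: abs_mult mult_right_le_one_le)
    qed
    finally show "(\<integral>y. \<theta> y * \<Lambda> k y \<partial>N) \<le> m\<^sub>\<theta> / c" using c by (simp add: field_simps)
  qed
  have "(\<integral>y. residual w p (\<lambda>y. \<psi> y * \<theta> y) y \<partial>N) = 0" if \<psi>: "smooth_on \<psi> UNIV" for \<psi>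
  proof -
    define \<rho> where "\<rho> = residual w p (\<lambda>y. \<psi> y * \<theta> y)"
    have \<psi>\<theta>: "smooth_on (\<lambda>y. \<psi> y * \<theta> y) UNIV" by (rule smooth_on_mult[OF open_UNIV \<psi> \<theta>(1)])
    have \<rho>i: "integrable N \<rho>" unfolding \<rho>_def by (rule residual_integrable[OF \<psi>\<theta>])
    have g0: "grad (\<lambda>y. \<psi> y * \<theta> y) y = 0" if "y \<notin> Q" for y
      using grad_eq_0[of Q "\<lambda>y. \<psi> y * \<theta> y" y] clQ \<theta>(2) that by auto
    have \<rho>0: "\<rho> y = 0" if "y \<notin> Q" for y unfolding \<rho>_def residual_def using \<theta>(2) g0 that by simp
    define T where "T k y = w y * \<psi> y * (\<theta> y * \<Lambda> k y) * (F y \<bullet> grad \<phi> y)" for k y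
    have split: "residual w p (\<lambda>y. (\<psi> y * \<theta> y) * \<kappa> k y) y = \<kappa> k y * \<rho> y - T k y" for k y
    proof (cases "y \<in> Q")
      case True
      then have "y \<in> V" using Q(2) by auto
      then have gr: "grad (\<lambda>y. (\<psi> y * \<theta> y) * \<kappa> k y) y = \<kappa> k y *\<^sub>R grad (\<lambda>y. \<psi> y * \<theta> y) y - (\<psi> y * \<theta> y * \<Lambda> k y) *\<^sub>R grad \<phi> y"
        using grad_mult[OF oV smooth_on_subset[OF open_UNIV oV _ \<psi>\<theta>] \<kappa>s, of y k] \<kappa>g[of y k] by simp
      show ?thesis
        unfolding residual_def \<rho>_def T_def gr by (simp add: inner_diff_right algebra_simps)
    next
      case False
      have "grad (\<lambda>y. (\<psi> y * \<theta> y) * \<kappa> k y) y = 0"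
        using grad_eq_0[of Q "\<lambda>y. (\<psi> y * \<theta> y) * \<kappa> k y" y] clQ \<theta>(2) False by auto
      then show ?thesis using \<rho>0[OF False] \<theta>(2)[OF False] by (simp add: residual_def T_def)
    qed
    have \<kappa>\<rho>m: "(\<lambda>y. \<kappa> k y * \<rho> y) \<in> borel_measurable N" for k
    proof -
      have "(\<lambda>y. indicator Q y * \<kappa> k y) \<in> borel_measurable N"
      proof -
        have "(\<lambda>y. indicator Q y *\<^sub>R \<kappa> k y) \<in> borel_measurable borel"
          using clQ Q(2) by (intro borel_measurable_continuous_on_indicator continuous_on_subset[OF smooth_on_imp_continuous_on[OF \<kappa>s]]) auto
        then show ?thesis unfolding N_def by (intro measurable_restrict_space1 measurable_completion) simp
      qed
      then have "(\<lambda>y. (indicator Q y * \<kappa> k y) * \<rho> y) \<in> borel_measurable N" using \<rho>i by simp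
      moreover have "(indicator Q y * \<kappa> k y) * \<rho> y = \<kappa> k y * \<rho> y" for y using \<rho>0[of y] by (cases "y \<in> Q") auto
      ultimately show ?thesis by (simp only:)
    qed
    have lim1: "(\<lambda>k. \<integral>y. \<kappa> k y * \<rho> y \<partial>N) \<longlonglongrightarrow> (\<integral>y. \<rho> y \<partial>N)"
    proof (rule integral_dominated_convergence[OF _ \<kappa>\<rho>m integrable_norm[OF \<rho>i]])
      show "\<rho> \<in> borel_measurable N" using \<rho>i by simp
      show "AE y in N. (\<lambda>k. \<kappa> k y * \<rho> y) \<longlonglongrightarrow> \<rho> y"
      proof (rule AE_N_I)
        fix y assume y: "y \<in> S"
        show "(\<lambda>k. \<kappa> k y * \<rho> y) \<longlonglongrightarrow> \<rho> y"
        proof (cases "y \<in> Q")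
          case True
          then have neg: "\<phi> y < 0" using Qneg y by blast
          obtain k0 where k0: "2 / - \<phi> y \<le> real k0" using real_arch_simple by blast
          have "\<kappa> k y = 1" if "k \<ge> k0" for k
          proof -
            have "2 / - \<phi> y \<le> real (Suc k)" using k0 that by linarith
            then have "2 \<le> real (Suc k) * - \<phi> y"
              using neg pos_divide_le_eq[of "- \<phi> y" 2 "real (Suc k)"] by (simp only: neg_0_less_iff_less)
            then show ?thesis unfolding \<kappa>_def by (intro smooth_step_1) (simp del: of_nat_Suc)
          qed
          then show ?thesis by (intro tendsto_eventually eventually_sequentiallyI[of k0]) simp
        qed (simp add: \<rho>0)
      qed
      show "AE y in N. norm (\<kappa> k y * \<rho> y) \<le> norm (\<rho> y)" for k
        using \<kappa>01[of k] by (intro AE_I2) (simp add: abs_mult mult_left_le_one_le)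
    qed
    have Ti: "integrable N (T k)" for k
    proof -
      have "integrable N (\<lambda>y. \<kappa> k y * \<rho> y)"
        using \<kappa>01[of k] by (intro Bochner_Integration.integrable_bound[OF \<rho>i \<kappa>\<rho>m] AE_I2) (simp add: abs_mult mult_left_le_one_le)
      moreover have "integrable N (residual w p (\<lambda>y. (\<psi> y * \<theta> y) * \<kappa> k y))"
        using test[OF \<psi>, of k] by (intro residual_integrable) (auto simp: test_functions_def)
      ultimately have "integrable N (\<lambda>y. \<kappa> k y * \<rho> y - residual w p (\<lambda>y. (\<psi> y * \<theta> y) * \<kappa> k y) y)" by simp
      then show ?thesis by (simp add: split)
    qed
    have eqT: "(\<integral>y. \<kappa> k y * \<rho> y \<partial>N) = (\<integral>y. T k y \<partial>N)" for k
    proof -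
      have i\<kappa>\<rho>: "integrable N (\<lambda>y. \<kappa> k y * \<rho> y)"
        using \<kappa>01[of k] by (intro Bochner_Integration.integrable_bound[OF \<rho>i \<kappa>\<rho>m] AE_I2) (simp add: abs_mult mult_left_le_one_le)
      have "0 = (\<integral>y. \<kappa> k y * \<rho> y - T k y \<partial>N)"
        using residual_test[OF w test[OF \<psi>, of k]] by (simp add: split)
      then show ?thesis using i\<kappa>\<rho> Ti[of k] by simp
    qed
    obtain m where m: "m > 0" "\<And>y. y \<in> Q \<Longrightarrow> \<bar>\<psi> y\<bar> \<le> m"
      using bounded_on_compact[OF continuous_on_subset[OF smooth_on_imp_continuous_on[OF \<psi>]] Q(1)] Q(2) by (metis Int_subset_iff subset_UNIV)
    have m\<^sub>\<theta>0: "0 \<le> m\<^sub>\<theta>" unfolding m\<^sub>\<theta>_def by simp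
    have "(\<lambda>k. \<integral>y. T k y \<partial>N) \<longlonglongrightarrow> 0"
    proof (rule LIMSEQ_I)
      fix e :: real assume "e > 0"
      \<comment> \<open>Chosen so that the final estimate gives e/2; the summands 1 keep the
        denominator positive.\<close>
      define e' where "e' = e / (2 * (\<bar>m\<^sub>w\<bar> + 1) * m * (m\<^sub>\<theta> / c + 1))"
      have den: "2 * (\<bar>m\<^sub>w\<bar> + 1) * m * (m\<^sub>\<theta> / c + 1) > 0"
        using m(1) m\<^sub>\<theta>0 c by (intro mult_pos_pos) (auto intro: add_nonneg_pos)
      then have e': "e' > 0" using \<open>e > 0\<close> by (simp add: e'_def)
      obtain d where d: "d > 0" "\<And>y. y \<in> \<Omega> \<inter> Q \<Longrightarrow> - d \<le> \<phi> y \<Longrightarrow> \<bar>F y \<bullet> grad \<phi> y\<bar> \<le> e'"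
        using Neumann_uniform[OF ldf Q(1,2) e'] by metis
      obtain k0 where k0: "2 / d \<le> real k0" using real_arch_simple by blast
      have bnd: "\<bar>T k y\<bar> \<le> (\<bar>m\<^sub>w\<bar> + 1) * m * e' * (\<theta> y * \<Lambda> k y)" if k: "k \<ge> k0" and y: "y \<in> S" for k y
      proof (cases "y \<in> Q \<and> \<Lambda> k y \<noteq> 0")
        case True
        \<comment> \<open>A nonzero \<Lambda> puts \<open>y\<close> into the transition layer, where
          \<phi> >= -2/(k+1); as k0 >= 2/d, this is at least -d, and the uniform Neumann bound
          applies.\<close>
        then have "\<Theta>' (- real (Suc k) * \<phi> y - 1) \<noteq> 0" by (auto simp: \<Lambda>_def)
        then have "- real (Suc k) * \<phi> y - 1 \<le> 1" using \<Theta>'(4)[of "- real (Suc k) * \<phi> y - 1"] by (metis atLeastAtMost_iff)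
        then have "real (Suc k) * - \<phi> y \<le> 2" by (simp del: of_nat_Suc)
        moreover have "2 \<le> d * real (Suc k)"
        proof -
          have "2 / d \<le> real (Suc k)" using k0 k by linarith
          then show ?thesis using d(1) by (simp add: divide_le_eq mult.commute)
        qed
        ultimately have "real (Suc k) * - \<phi> y \<le> real (Suc k) * d" by (simp add: mult.commute)
        then have "- d \<le> \<phi> y" by (simp only: mult_le_cancel_left_pos of_nat_0_less_iff zero_less_Suc)
        then have Fe: "\<bar>F y \<bullet> grad \<phi> y\<bar> \<le> e'" using d(2) True y by (auto simp: S_def)
        have "0 \<le> \<theta> y" "0 \<le> \<Lambda> k y" using \<theta>(5) \<Theta>'(2) by (simp_all add: \<Lambda>_def)
        then have "0 \<le> \<theta> y * \<Lambda> k y" by simp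
        moreover have "\<bar>w y\<bar> \<le> \<bar>m\<^sub>w\<bar> + 1" using w_bound[OF y] by linarith
        ultimately have "\<bar>w y\<bar> * \<bar>\<psi> y\<bar> * (\<theta> y * \<Lambda> k y) * \<bar>F y \<bullet> grad \<phi> y\<bar> \<le> (\<bar>m\<^sub>w\<bar> + 1) * m * (\<theta> y * \<Lambda> k y) * e'"
          using m(2)[of y] m(1) True Fe \<open>0 \<le> \<theta> y\<close> \<open>0 \<le> \<Lambda> k y\<close> by (intro mult_mono mult_nonneg_nonneg) auto
        moreover have "\<bar>T k y\<bar> = \<bar>w y\<bar> * \<bar>\<psi> y\<bar> * (\<theta> y * \<Lambda> k y) * \<bar>F y \<bullet> grad \<phi> y\<bar>"
          using \<open>0 \<le> \<theta> y\<close> \<open>0 \<le> \<Lambda> k y\<close> unfolding T_def by (simp add: abs_mult)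
        ultimately show ?thesis by (simp add: mult_ac)
      next
        case False
        then have z: "\<theta> y * \<Lambda> k y = 0" using \<theta>(2) by auto
        show ?thesis unfolding T_def z by simp
      qed
      have "norm ((\<integral>y. T k y \<partial>N) - 0) < e" if k: "k \<ge> k0" for k
      proof -
        have "\<bar>\<integral>y. T k y \<partial>N\<bar> \<le> (\<integral>y. \<bar>T k y\<bar> \<partial>N)" by (rule integral_abs_bound)
        also have "\<dots> \<le> (\<integral>y. (\<bar>m\<^sub>w\<bar> + 1) * m * e' * (\<theta> y * \<Lambda> k y) \<partial>N)"
          using Ti \<Lambda>int bnd[OF k] by (intro integral_mono) auto
        also have "\<dots> = (\<bar>m\<^sub>w\<bar> + 1) * m * e' * (\<integral>y. \<theta> y * \<Lambda> k y \<partial>N)" by simp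
        also have "\<dots> \<le> (\<bar>m\<^sub>w\<bar> + 1) * m * e' * (m\<^sub>\<theta> / c + 1)"
          using \<Lambda>le[of k] m(1) e' by (intro mult_left_mono) auto
        also have "\<dots> = e / 2" using den unfolding e'_def by (simp add: field_simps)
        finally show ?thesis using \<open>e > 0\<close> by simp
      qed
      then show "\<exists>k0. \<forall>k\<ge>k0. norm ((\<integral>y. T k y \<partial>N) - 0) < e" by blast
    qed
    from LIMSEQ_unique[OF lim1[unfolded eqT] this] show ?thesis by (simp add: \<rho>_def)
  qed
  note claim = this
  show thesis by (rule that[of \<theta> \<delta>]) (fact \<theta>(1) \<theta>(3) \<theta>(4) claim)+
qed

text \<open>Every point of \<open>C\<close>, inside \<Omega> or on its boundary, has a cutoff
  \<theta>_x equal to 1 near it with R(\<psi> \<theta>_x) = 0 for all smooth \<psi>. Finitely many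
  of these balls cover \<open>C\<close>. Multiplying the constant 1 by the factors 1 - \<theta>_x
  one after another leaves \<open>R\<close> unchanged, and the full product vanishes near
  \<open>C\<close>. The product takes the place of a partition of unity.\<close>

lemma weak_formulation: "integrable N (\<lambda>x. F x \<bullet> p x)" "integrable N (\<lambda>x. G x * w x)"
  "(\<integral>x. F x \<bullet> p x \<partial>N) + (\<integral>x. G x * w x \<partial>N) = 0"
proof -
  have Fc: "continuous_on U (\<lambda>x. F x $ i)" for i by (rule smooth_on_imp_continuous_on[OF smooth_F])
  have ws: "AE x in N. x \<notin> C \<longrightarrow> w x = 0" using w_supp by (intro AE_N_I) auto
  have ps: "AE x in N. x \<notin> C \<longrightarrow> p x $ i = 0" for i using p_supp by eventually_elim auto
  have "integrable N (\<lambda>x. F x $ i * p x $ i)" for i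
    by (rule integrable_mult_bounded[OF Fc C(1) C_U p_int ps])
  then show 1: "integrable N (\<lambda>x. F x \<bullet> p x)" by (simp add: inner_vec_def)
  show 2: "integrable N (\<lambda>x. G x * w x)"
    by (rule integrable_mult_bounded[OF continuous_on_G C(1) C_U w_int ws])
  define R where "R \<psi> = (\<integral>x. residual w p \<psi> x \<partial>N)" for \<psi>
  define L where "L x \<theta> \<delta> \<longleftrightarrow> smooth_on \<theta> UNIV \<and> \<delta> > 0 \<and> (\<forall>y\<in>ball x \<delta>. \<theta> y = 1) \<and>
      (\<forall>\<psi>. smooth_on \<psi> UNIV \<longrightarrow> R (\<lambda>y. \<psi> y * \<theta> y) = 0)" for x \<theta> and \<delta> :: real
  have "\<exists>\<theta> \<delta>. L x \<theta> \<delta>" if "x \<in> C" for x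
  proof (cases "x \<in> \<Omega>")
    case True
    then have "x \<in> S" using that C(2) by (auto simp: S_def)
    then show ?thesis
      by (rule residual_interior) (unfold L_def R_def, blast)
  next
    case False
    then have "x \<in> frontier \<Omega>" using that C(2) open_\<Omega> by (auto simp: frontier_def interior_open)
    then show ?thesis
      by (rule residual_boundary) (unfold L_def R_def, blast)
  qed
  then obtain \<theta> \<delta> where L: "\<And>x. x \<in> C \<Longrightarrow> L x (\<theta> x) (\<delta> x)" by metis
  have \<theta>: "\<And>x. x \<in> C \<Longrightarrow> smooth_on (\<theta> x) UNIV" "\<And>x. x \<in> C \<Longrightarrow> \<delta> x > 0"
    "\<And>x y. x \<in> C \<Longrightarrow> y \<in> ball x (\<delta> x) \<Longrightarrow> \<theta> x y = 1"
    "\<And>x \<psi>. x \<in> C \<Longrightarrow> smooth_on \<psi> UNIV \<Longrightarrow> R (\<lambda>y. \<psi> y * \<theta> x y) = 0"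
    using L unfolding L_def by blast+
  have "C \<subseteq> (\<Union>x\<in>C. ball x (\<delta> x))" using \<theta>(2) by force
  then obtain D where D: "D \<subseteq> C" "finite D" "C \<subseteq> (\<Union>x\<in>D. ball x (\<delta> x))"
    using compactE_image[OF C(1), of C "\<lambda>x. ball x (\<delta> x)"] by (metis open_ball)
  define P where "P D' y = (\<Prod>x\<in>D'. 1 - \<theta> x y)" for D' y
  have Ps: "smooth_on (P D') UNIV" if "D' \<subseteq> D" for D'
    unfolding P_def[abs_def] using that D(1) \<theta>(1) by (intro smooth_on_prod smooth_on_diff smooth_on_const) auto
  have "R (P D') = R (\<lambda>_. 1)" if "finite D'" "D' \<subseteq> D" for D'
    using that
  proof (induction D' rule: finite_induct)
    case empty
    then show ?case by (simp add: P_def[abs_def])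
  next
    case (insert x D')
    then have xC: "x \<in> C" using D(1) by auto
    have s: "smooth_on (P D') UNIV" by (rule Ps) (use insert in auto)
    have s': "smooth_on (\<lambda>y. P D' y * \<theta> x y) UNIV" by (rule smooth_on_mult[OF open_UNIV s \<theta>(1)[OF xC]])
    have eq: "P (insert x D') = (\<lambda>y. P D' y - P D' y * \<theta> x y)"
      using insert by (auto simp: P_def algebra_simps)
    have gP: "grad (P (insert x D')) y = grad (P D') y - grad (\<lambda>y. P D' y * \<theta> x y) y" for y
      unfolding eq
      using has_derivative_diff[OF has_derivative_grad[OF open_UNIV s UNIV_I] has_derivative_grad[OF open_UNIV s' UNIV_I]]
      by (intro grad_unique) (simp add: inner_diff_left)
    have vP: "P (insert x D') y = P D' y - P D' y * \<theta> x y" for y using eq by simp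
    have "residual w p (P (insert x D')) = (\<lambda>y. residual w p (P D') y - residual w p (\<lambda>y. P D' y * \<theta> x y) y)"
      unfolding residual_def gP unfolding vP by (simp add: inner_diff_right algebra_simps)
    then have "R (P (insert x D')) = R (P D') - R (\<lambda>y. P D' y * \<theta> x y)"
      unfolding R_def using residual_integrable[OF s] residual_integrable[OF s'] by simp
    then show ?case using insert \<theta>(4)[OF xC s] by simp
  qed
  from this[OF D(2)] have "R (\<lambda>_. 1) = R (P D)" by simp
  also have "\<dots> = (\<integral>x. 0 \<partial>N)"
    unfolding R_def
  proof (rule integral_cong_AE)
    show "residual w p (P D) \<in> borel_measurable N" using residual_integrable[OF Ps[of D]] by auto
    show "AE y in N. residual w p (P D) y = 0"
      using p_supp AE_space
    proof eventually_elim
      case (elim y)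
      show ?case
      proof (cases "y \<in> C")
        case True
        \<comment> \<open>The residual contains the gradient of the product as well, so vanishing is
          needed on an open set around \<open>y\<close> and not only on \<open>C\<close>.\<close>
        define Y where "Y = (\<Union>x\<in>D. ball x (\<delta> x))"
        have Z: "P D z = 0" if "z \<in> Y" for z
          using that D(1,2) \<theta>(3) unfolding P_def Y_def by (auto intro!: prod_zero)
        have "y \<in> Y" "open Y" using True D(3) unfolding Y_def by blast+
        moreover have "grad (\<lambda>_. 0 :: real) y = 0" by (rule grad_unique) auto
        ultimately have "grad (P D) y = 0" using grad_cong[of Y y "\<lambda>_. 0" "P D"] Z by simp
        then show ?thesis using Z[OF \<open>y \<in> Y\<close>] by (simp add: residual_def)
      next
        case False
        then have "w y = 0" "p y = 0" using elim w_supp by auto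
        then show ?thesis by (simp add: residual_def)
      qed
    qed
  qed simp
  finally have "R (\<lambda>_. 1) = 0" by simp
  moreover have "grad (\<lambda>_. 1 :: real) = (\<lambda>_::real^'n. 0)" by (intro ext grad_unique) auto
  ultimately show "(\<integral>x. F x \<bullet> p x \<partial>N) + (\<integral>x. G x * w x \<partial>N) = 0"
    using 1 2 by (simp add: R_def residual_def)
qed

end

end

section \<open>The weighted identity\<close>

text \<open>The hypothesis \<open>Q\<close> is the estimate satisfied by any quadratic form with
  bounded symmetric coefficients. It is kept abstract so as to cover both the square of a real
  number and \<open>sq_norm_wrt (B x)\<close>.\<close>

lemma L2_quadratic_tendsto:
  fixes f :: "nat \<Rightarrow> 'a \<Rightarrow> 'b::euclidean_space" and Q :: "'a \<Rightarrow> 'b \<Rightarrow> real"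
  assumes [measurable]: "\<And>k. f k \<in> borel_measurable M" "g \<in> borel_measurable M"
    and Qm: "\<And>k. (\<lambda>x. Q x (f k x)) \<in> borel_measurable M" "(\<lambda>x. Q x (g x)) \<in> borel_measurable M"
    and f: "\<And>k. integrable M (\<lambda>x. (norm (f k x))\<^sup>2)" and g: "integrable M (\<lambda>x. (norm (g x))\<^sup>2)"
    and lim: "(\<lambda>k. \<integral>x. (norm (f k x - g x))\<^sup>2 \<partial>M) \<longlonglongrightarrow> 0"
    and c: "c \<ge> 0" and Q0: "\<And>x. x \<in> space M \<Longrightarrow> Q x 0 = 0"
    and Q: "\<And>x \<xi> \<eta>. x \<in> space M \<Longrightarrow> \<bar>Q x \<xi> - Q x \<eta>\<bar> \<le> c * norm (\<xi> - \<eta>) * (norm \<xi> + norm \<eta>)"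
  shows "integrable M (\<lambda>x. Q x (g x))" "(\<lambda>k. \<integral>x. Q x (f k x) \<partial>M) \<longlonglongrightarrow> (\<integral>x. Q x (g x) \<partial>M)"
proof -
  have Qint: "integrable M (\<lambda>x. Q x (h x))"
    if "(\<lambda>x. Q x (h x)) \<in> borel_measurable M" "integrable M (\<lambda>x. (norm (h x))\<^sup>2)" for h
  proof (rule Bochner_Integration.integrable_bound[OF integrable_mult_right[OF that(2), of c] that(1)])
    have "\<bar>Q x (h x)\<bar> \<le> \<bar>c * (norm (h x))\<^sup>2\<bar>" if "x \<in> space M" for x
      using Q[OF that, of "h x" 0] Q0[OF that] c by (simp add: power2_eq_square mult.assoc)
    then show "AE x in M. norm (Q x (h x)) \<le> norm (c * (norm (h x))\<^sup>2)" by (intro AE_I2) simp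
  qed
  show gi: "integrable M (\<lambda>x. Q x (g x))" by (rule Qint[OF Qm(2) g])
  have fi: "integrable M (\<lambda>x. Q x (f k x))" for k by (rule Qint[OF Qm(1) f])
  define d where "d k = (\<integral>x. (norm (f k x - g x))\<^sup>2 \<partial>M)" for k
  have di: "integrable M (\<lambda>x. (norm (f k x - g x))\<^sup>2)" for k by (rule L2_diff_integrable) (use f g in auto)
  show "(\<lambda>k. \<integral>x. Q x (f k x) \<partial>M) \<longlonglongrightarrow> (\<integral>x. Q x (g x) \<partial>M)"
  proof (rule LIM_zero_cancel, rule Lim_null_comparison)
    show "\<forall>\<^sub>F k in sequentially. norm ((\<integral>x. Q x (f k x) \<partial>M) - (\<integral>x. Q x (g x) \<partial>M)) \<le>
        c * d k + 2 * c * (sqrt (d k) * sqrt (\<integral>x. (norm (g x))\<^sup>2 \<partial>M))"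
    proof (rule always_eventually, rule allI)
      fix k
      have mi: "integrable M (\<lambda>x. norm (f k x - g x) * norm (g x))"
        by (rule integrable_mult_square) (use di g in auto)
      have "norm ((\<integral>x. Q x (f k x) \<partial>M) - (\<integral>x. Q x (g x) \<partial>M)) = \<bar>\<integral>x. Q x (f k x) - Q x (g x) \<partial>M\<bar>"
        using fi gi by simp
      also have "\<dots> \<le> (\<integral>x. \<bar>Q x (f k x) - Q x (g x)\<bar> \<partial>M)" by (rule integral_abs_bound)
      also have "\<dots> \<le> (\<integral>x. c * (norm (f k x - g x))\<^sup>2 + 2 * c * (norm (f k x - g x) * norm (g x)) \<partial>M)"
      proof (rule integral_mono)
        fix x assume x: "x \<in> space M"
        have "norm (f k x) \<le> norm (f k x - g x) + norm (g x)" by (metis diff_add_cancel norm_triangle_ineq)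
        then have "c * norm (f k x - g x) * (norm (f k x) + norm (g x)) \<le>
            c * norm (f k x - g x) * ((norm (f k x - g x) + norm (g x)) + norm (g x))"
          using c by (intro mult_left_mono) auto
        with Q[OF x, of "f k x" "g x"]
        show "\<bar>Q x (f k x) - Q x (g x)\<bar> \<le> c * (norm (f k x - g x))\<^sup>2 + 2 * c * (norm (f k x - g x) * norm (g x))"
          by (simp add: power2_eq_square algebra_simps)
      qed (use fi gi di mi in auto)
      also have "\<dots> = c * d k + 2 * c * (\<integral>x. norm (f k x - g x) * norm (g x) \<partial>M)"
        using di mi by (simp add: d_def)
      also have "\<dots> \<le> c * d k + 2 * c * (sqrt (d k) * sqrt (\<integral>x. (norm (g x))\<^sup>2 \<partial>M))"
        using integral_Cauchy_Schwarz[of "\<lambda>x. norm (f k x - g x)" M "\<lambda>x. norm (g x)"] di g c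
        by (intro add_left_mono mult_left_mono) (auto simp: d_def)
      finally show "norm ((\<integral>x. Q x (f k x) \<partial>M) - (\<integral>x. Q x (g x) \<partial>M)) \<le>
        c * d k + 2 * c * (sqrt (d k) * sqrt (\<integral>x. (norm (g x))\<^sup>2 \<partial>M))" .
    qed
    have d0: "d \<longlonglongrightarrow> 0" using lim by (simp add: d_def[abs_def])
    have "(\<lambda>k. c * d k + 2 * c * (sqrt (d k) * sqrt (\<integral>x. (norm (g x))\<^sup>2 \<partial>M))) \<longlonglongrightarrow>
        c * 0 + 2 * c * (sqrt 0 * sqrt (\<integral>x. (norm (g x))\<^sup>2 \<partial>M))"
      by (intro tendsto_intros d0)
    then show "(\<lambda>k. c * d k + 2 * c * (sqrt (d k) * sqrt (\<integral>x. (norm (g x))\<^sup>2 \<partial>M))) \<longlonglongrightarrow> 0" by simp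
  qed
qed

text \<open>Lebesgue measure is complete. This is what makes chosen weak gradients and almost
  everywhere limits measurable, as both are known only up to null sets.\<close>

lemma lebesgue_on_measurable_AE:
  fixes f g :: "'a::euclidean_space \<Rightarrow> real"
  assumes S: "S \<in> sets lebesgue" and f: "f \<in> borel_measurable (lebesgue_on S)" and AE: "AE x in lebesgue_on S. f x = g x"
  shows "g \<in> borel_measurable (lebesgue_on S)"
proof -
  have "(\<lambda>x. if x \<in> S then f x else 0) \<in> borel_measurable lebesgue" using f S by (simp add: borel_measurable_if)
  moreover have "AE x in lebesgue. (if x \<in> S then f x else 0) = (if x \<in> S then g x else 0)"
    using AE S by (auto simp: AE_restrict_space_iff elim!: eventually_mono)
  ultimately have "(\<lambda>x. if x \<in> S then g x else 0) \<in> borel_measurable lebesgue" by (rule borel_measurable_AE)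
  then show ?thesis using S by (simp add: borel_measurable_if)
qed

lemma sq_norm_wrt_scale: "sq_norm_wrt M (s *\<^sub>R \<xi>) = s\<^sup>2 * sq_norm_wrt M \<xi>"
  by (simp add: sq_norm_wrt_def matrix_vector_mult_scaleR power2_eq_square)

lemma sq_norm_wrt_sum: "sq_norm_wrt M \<xi> = (\<Sum>i\<in>UNIV. \<Sum>j\<in>UNIV. M $ i $ j * (\<xi> $ i * \<xi> $ j))"
  by (simp add: sq_norm_wrt_def inner_vec_def matrix_vector_mult_def sum_distrib_left sum_distrib_right mult_ac)

context weight
begin

abbreviation D where "D v \<equiv> wgrad S v"
abbreviation LC where "LC \<equiv> lipschitz_compact_support \<Omega> K"

definition h where "h x = sq_norm_wrt (B x) (grad G x)"

lemma G_pos_S: "x \<in> S \<Longrightarrow> G x > 0" using S_U G_pos by auto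

lemma sq_nonneg: "x \<in> S \<Longrightarrow> 0 \<le> sq_norm_wrt (B x) \<xi>"
  using elliptic[of x \<xi>] c_pos by (auto simp: S_def intro: order_trans[rotated])

lemma sq_add: "x \<in> S \<Longrightarrow> sq_norm_wrt (B x) (\<xi> + \<eta>) = sq_norm_wrt (B x) \<xi> + 2 * ((B x *v \<xi>) \<bullet> \<eta>) + sq_norm_wrt (B x) \<eta>"
  using B_inner_commute[of x \<xi> \<eta>] by (simp add: sq_norm_wrt_def matrix_vector_right_distrib inner_add_left inner_add_right)

lemma sq_diff:
  assumes x: "x \<in> S"
  shows "\<bar>sq_norm_wrt (B x) \<xi> - sq_norm_wrt (B x) \<eta>\<bar> \<le> c\<^sub>1 * norm (\<xi> - \<eta>) * (norm \<xi> + norm \<eta>)"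
proof -
  have "sq_norm_wrt (B x) \<xi> - sq_norm_wrt (B x) \<eta> = (B x *v (\<xi> - \<eta>)) \<bullet> (\<xi> + \<eta>)"
    using B_inner_commute[OF x, of \<xi> \<eta>]
    by (simp add: sq_norm_wrt_def matrix_vector_mult_diff_distrib inner_diff_left inner_add_right)
  also have "\<bar>\<dots>\<bar> \<le> norm (B x *v (\<xi> - \<eta>)) * norm (\<xi> + \<eta>)" by (rule Cauchy_Schwarz_ineq2)
  also have "\<dots> \<le> (c\<^sub>1 * norm (\<xi> - \<eta>)) * (norm \<xi> + norm \<eta>)"
    using B_bounded[of x "\<xi> - \<eta>"] x c1_pos by (intro mult_mono norm_triangle_ineq) (auto simp: S_def)
  finally show ?thesis .
qed

lemma sq_le: "x \<in> S \<Longrightarrow> sq_norm_wrt (B x) \<xi> \<le> c\<^sub>1 * (norm \<xi>)\<^sup>2"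
  using sq_diff[of x \<xi> 0] by (auto simp: sq_norm_wrt_def power2_eq_square mult.assoc)

lemma continuous_on_gradG: "continuous_on U (\<lambda>x. grad G x $ i)"
  by (rule smooth_on_imp_continuous_on[OF smooth_on_grad[OF smooth_G]])

lemma continuous_on_B: "continuous_on U (\<lambda>x. B x $ i $ j)"
  by (rule smooth_on_imp_continuous_on[OF smooth_B])

lemma continuous_on_h: "continuous_on U h"
  unfolding h_def sq_norm_wrt_sum by (intro continuous_intros continuous_on_gradG continuous_on_B)

lemma continuous_on_G_powr: "continuous_on U (\<lambda>x. G x powr a)"
  using G_pos by (intro continuous_on_powr continuous_on_G continuous_on_const) fastforce

lemma continuous_on_compose_G: "continuous_on {0<..} \<gamma> \<Longrightarrow> continuous_on U (\<lambda>x. \<gamma> (G x))"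
  using G_pos by (intro continuous_on_compose2[OF _ continuous_on_G]) auto

lemma h_eq: "h x = F x \<bullet> grad G x"
  by (simp add: h_def sq_norm_wrt_def F_def)

lemma h_nonneg: "x \<in> S \<Longrightarrow> 0 \<le> h x"
  unfolding h_def by (rule sq_nonneg)

lemma meas_U: "continuous_on U q \<Longrightarrow> q \<in> borel_measurable N" for q :: "real^'n \<Rightarrow> real"
  by (rule measurable_N[OF continuous_on_subset[OF _ S_U]])

lemma LC_support:
  assumes "v \<in> LC"
  obtains C m where "compact C" "C \<subseteq> closure \<Omega> - K" "C \<subseteq> U" "\<And>x. x \<in> S - C \<Longrightarrow> v x = 0" "\<And>x. x \<in> S \<Longrightarrow> \<bar>v x\<bar> \<le> m"
proof -
  obtain L C where L: "L-lipschitz_on (closure \<Omega>) v" and C: "compact C" "C \<subseteq> closure \<Omega> - K" "\<And>x. x \<in> closure \<Omega> - C \<Longrightarrow> v x = 0"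
    using assms unfolding lipschitz_compact_support_def by blast
  have "compact (v ` closure \<Omega>)"
    using bounded_\<Omega> by (intro compact_continuous_image lipschitz_on_continuous_on[OF L]) (simp add: compact_closure)
  then obtain m where "\<forall>y\<in>v ` closure \<Omega>. norm y \<le> m" using compact_imp_bounded bounded_iff by blast
  moreover have Scl: "S \<subseteq> closure \<Omega>" using closure_subset[of \<Omega>] by (auto simp: S_def)
  ultimately have m: "\<bar>v x\<bar> \<le> m" if "x \<in> S" for x using that by auto
  have z: "v x = 0" if "x \<in> S - C" for x using C(3) that Scl by auto
  have "C \<subseteq> U" using C(2) U_superset by (rule subset_trans)
  show thesis by (rule that[of C m]) (fact C(1) C(2) \<open>C \<subseteq> U\<close> z m)+
qed

lemma LC_continuous: "v \<in> LC \<Longrightarrow> continuous_on S v"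
  unfolding lipschitz_compact_support_def S_def
  using closure_subset[of \<Omega>] by (auto intro!: continuous_on_subset[OF lipschitz_on_continuous_on])

lemma LC_diff:
  assumes "v \<in> LC" "w \<in> LC"
  shows "(\<lambda>x. v x - w x) \<in> LC"
proof -
  obtain L C where 1: "L-lipschitz_on (closure \<Omega>) v" "compact C" "C \<subseteq> closure \<Omega> - K" "\<forall>x\<in>closure \<Omega> - C. v x = 0"
    using assms(1) unfolding lipschitz_compact_support_def by blast
  obtain L' C' where 2: "L'-lipschitz_on (closure \<Omega>) w" "compact C'" "C' \<subseteq> closure \<Omega> - K" "\<forall>x\<in>closure \<Omega> - C'. w x = 0"
    using assms(2) unfolding lipschitz_compact_support_def by blast
  have "compact (C \<union> C')" "C \<union> C' \<subseteq> closure \<Omega> - K" "\<forall>x\<in>closure \<Omega> - (C \<union> C'). v x - w x = 0"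
    using 1 2 by auto
  then have "\<exists>C. compact C \<and> C \<subseteq> closure \<Omega> - K \<and> (\<forall>x\<in>closure \<Omega> - C. v x - w x = 0)"
    by (intro exI[of _ "C \<union> C'"] conjI)
  moreover have "\<exists>L. L-lipschitz_on (closure \<Omega>) (\<lambda>x. v x - w x)"
    by (rule exI, rule lipschitz_on_diff[OF 1(1) 2(1)])
  ultimately show ?thesis unfolding lipschitz_compact_support_def mem_Collect_eq by (rule conjI[rotated])
qed

text \<open>The weak gradient \<open>D v\<close> is an arbitrary choice, so measurability, square
  integrability and the rule for the square are transferred from the gradient constructed by
  difference quotients, with which it agrees almost everywhere.\<close>

lemma LC_gradient:
  assumes v: "v \<in> LC"
  shows "weak_gradient S v (D v)" "\<And>i. (\<lambda>x. D v x $ i) \<in> borel_measurable N"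
    "\<And>i. integrable N (\<lambda>x. (D v x $ i)\<^sup>2)" "weak_gradient S (\<lambda>x. (v x)\<^sup>2) (\<lambda>x. (2 * v x) *\<^sub>R D v x)"
proof -
  obtain L where L: "L-lipschitz_on (closure \<Omega>) v" using v unfolding lipschitz_compact_support_def by blast
  have "S \<subseteq> closure \<Omega>" using closure_subset[of \<Omega>] by (auto simp: S_def)
  then obtain p where p: "weak_gradient S v p" "weak_gradient S (\<lambda>x. (v x)\<^sup>2) (\<lambda>x. (2 * v x) *\<^sub>R p x)"
    "\<And>i. (\<lambda>x. p x $ i) \<in> borel_measurable N" "\<And>i. integrable N (\<lambda>x. (p x $ i)\<^sup>2)"
    using weak_gradient_lipschitz[OF open_S bounded_S L] unfolding N_def by blast
  show 1: "weak_gradient S v (D v)" by (rule weak_gradient_wgrad[OF p(1)])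
  have "AE x in N. D v x = p x" unfolding N_def by (rule wgrad_AE_eq[OF open_S p(1)])
  then have eqi: "AE x in N. p x $ i = D v x $ i" for i by eventually_elim simp
  show 2: "(\<lambda>x. D v x $ i) \<in> borel_measurable N" for i
    using lebesgue_on_measurable_AE[OF S_lebesgue p(3)[unfolded N_def, of i] eqi[unfolded N_def, of i]] by (simp add: N_def)
  show "integrable N (\<lambda>x. (D v x $ i)\<^sup>2)" for i
    by (rule integrable_cong_AE_imp[OF p(4)[of i]]) (use 2 eqi[of i] in \<open>auto elim!: eventually_mono\<close>)
  show "weak_gradient S (\<lambda>x. (v x)\<^sup>2) (\<lambda>x. (2 * v x) *\<^sub>R D v x)"
    unfolding weak_gradient_iff[OF open_S]
  proof (intro conjI allI ballI)
    show "locally_integrable S (\<lambda>x. (v x)\<^sup>2)" using p(2) by (simp add: weak_gradient_iff[OF open_S])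
    show "locally_integrable S (\<lambda>x. ((2 * v x) *\<^sub>R D v x) $ i)" for i
    proof -
      have "locally_integrable S (\<lambda>x. D v x $ i)" using 1 by (simp add: weak_gradient_iff[OF open_S])
      from locally_integrable_mult[OF this continuous_on_mult[OF continuous_on_const LC_continuous[OF v], of 2]]
      show ?thesis by simp
    qed
    show "(\<integral>x. (v x)\<^sup>2 * grad \<phi> x $ i \<partial>lebesgue_on S) = - (\<integral>x. \<phi> x * ((2 * v x) *\<^sub>R D v x) $ i \<partial>lebesgue_on S)"
      if \<phi>: "\<phi> \<in> test_functions S" for \<phi> i
    proof -
      have \<phi>m: "\<phi> \<in> borel_measurable N"
        using \<phi> unfolding test_functions_def by (auto intro: measurable_N_UNIV smooth_on_imp_continuous_on)
      have vm: "v \<in> borel_measurable N" by (rule measurable_N[OF LC_continuous[OF v]])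
      have "(\<integral>x. \<phi> x * ((2 * v x) *\<^sub>R D v x) $ i \<partial>N) = (\<integral>x. \<phi> x * ((2 * v x) *\<^sub>R p x) $ i \<partial>N)"
        by (rule integral_cong_AE) (use \<phi>m vm 2 p(3) eqi[of i] in \<open>auto elim!: eventually_mono\<close>)
      then show ?thesis using p(2) \<phi> unfolding weak_gradient_iff[OF open_S] N_def by simp
    qed
  qed
qed

lemma LC_measurable: "v \<in> LC \<Longrightarrow> v \<in> borel_measurable N"
  by (rule measurable_N[OF LC_continuous])

lemma LC_integrable:
  assumes v: "v \<in> LC" and q: "continuous_on U q"
  shows "integrable N (\<lambda>x. q x * (v x)\<^sup>2)" "integrable N (\<lambda>x. q x * (v x * D v x $ i))"
    "integrable N (\<lambda>x. q x * (D v x $ i * D v x $ j))" "integrable N (\<lambda>x. v x * D v x $ i)"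
proof -
  obtain C m where C: "compact C" "C \<subseteq> closure \<Omega> - K" "C \<subseteq> U" "\<And>x. x \<in> S - C \<Longrightarrow> v x = 0" "\<And>x. x \<in> S \<Longrightarrow> \<bar>v x\<bar> \<le> m"
    using LC_support[OF v] by metis
  note vm[measurable] = LC_measurable[OF v] and Dm[measurable] = LC_gradient(2)[OF v]
  have v2: "integrable N (\<lambda>x. (v x)\<^sup>2)"
  proof (rule integrable_const_bound[of _ "m\<^sup>2"])
    show "AE x in N. norm ((v x)\<^sup>2) \<le> m\<^sup>2" using C(5) power_mono[of "\<bar>v _\<bar>" m 2] by (intro AE_N_I) auto
  qed measurable
  have 0: "AE x in N. x \<notin> C \<longrightarrow> v x = 0" using C(4) by (intro AE_N_I) auto
  have D0: "AE x in N. x \<notin> C \<longrightarrow> D v x = 0"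
    unfolding N_def by (rule weak_gradient_AE_0[OF open_S LC_gradient(1)[OF v] compact_imp_closed[OF C(1)] C(4)])
  show "integrable N (\<lambda>x. q x * (v x)\<^sup>2)"
    by (rule integrable_mult_bounded[OF q C(1,3) v2]) (use 0 in \<open>auto elim!: eventually_mono\<close>)
  show vD: "integrable N (\<lambda>x. v x * D v x $ i)"
    by (rule integrable_mult_square) (use v2 LC_gradient(3)[OF v] in auto)
  show "integrable N (\<lambda>x. q x * (v x * D v x $ i))"
    by (rule integrable_mult_bounded[OF q C(1,3) vD]) (use 0 in \<open>auto elim!: eventually_mono\<close>)
  have DD: "integrable N (\<lambda>x. D v x $ i * D v x $ j)"
    by (rule integrable_mult_square) (use LC_gradient(3)[OF v] in auto)
  show "integrable N (\<lambda>x. q x * (D v x $ i * D v x $ j))"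
    by (rule integrable_mult_bounded[OF q C(1,3) DD]) (use D0 in \<open>auto elim!: eventually_mono\<close>)
qed

text \<open>The weak formulation for \<gamma>(G) v^2, expanded. Two choices of \<gamma> matter: the
  power s^(2t-1) gives the weighted identity, and its product with a logarithmic cutoff gives the
  estimate in the case of equality.\<close>

lemma weak_formulation_square:
  assumes v: "v \<in> LC" and \<gamma>: "smooth_on \<gamma> {0<..}" and \<gamma>': "\<And>s. s > 0 \<Longrightarrow> (\<gamma> has_real_derivative \<gamma>' s) (at s)"
  defines "J \<equiv> \<lambda>x. 2 * \<gamma> (G x) * (v x * (F x \<bullet> D v x)) + \<gamma>' (G x) * h x * (v x)\<^sup>2 + G x * \<gamma> (G x) * (v x)\<^sup>2"
  shows "integrable N J" "(\<integral>x. J x \<partial>N) = 0"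
proof -
  obtain C m where C: "compact C" "C \<subseteq> closure \<Omega> - K" "C \<subseteq> U" "\<And>x. x \<in> S - C \<Longrightarrow> v x = 0" "\<And>x. x \<in> S \<Longrightarrow> \<bar>v x\<bar> \<le> m"
    using LC_support[OF v] by metis
  have \<gamma>G: "smooth_on (\<lambda>x. \<gamma> (G x)) U"
    by (rule smooth_on_compose[OF open_U open_greaterThan _ \<gamma> smooth_G]) (simp add: G_pos)
  have \<gamma>GS: "smooth_on (\<lambda>x. \<gamma> (G x)) S" by (rule smooth_on_subset[OF open_U open_S S_U \<gamma>G])
  have \<gamma>c: "continuous_on U (\<lambda>x. \<gamma> (G x))" by (rule smooth_on_imp_continuous_on[OF \<gamma>G])
  define w where "w x = \<gamma> (G x) * (v x)\<^sup>2" for x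
  define p where "p x = \<gamma> (G x) *\<^sub>R ((2 * v x) *\<^sub>R D v x) + (v x)\<^sup>2 *\<^sub>R grad (\<lambda>x. \<gamma> (G x)) x" for x
  have wp: "weak_gradient S w p"
    unfolding w_def[abs_def] p_def[abs_def] by (rule weak_gradient_mult_smooth[OF open_S \<gamma>GS LC_gradient(4)[OF v]])
  have gr: "grad (\<lambda>x. \<gamma> (G x)) x = \<gamma>' (G x) *\<^sub>R grad G x" if "x \<in> U" for x
    by (rule grad_compose[OF open_U smooth_G that \<gamma>'[OF G_pos[OF that]]])
  obtain b where b: "b > 0" "\<And>x. x \<in> C \<Longrightarrow> \<bar>\<gamma> (G x)\<bar> \<le> b" using bounded_on_compact[OF \<gamma>c C(1,3)] by metis
  have wb: "\<bar>w x\<bar> \<le> b * m\<^sup>2" if "x \<in> S" for x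
  proof (cases "x \<in> C")
    case True
    have "(v x)\<^sup>2 \<le> m\<^sup>2" using C(5)[OF that] power_mono[of "\<bar>v x\<bar>" m 2] by simp
    then show ?thesis unfolding w_def abs_mult using b(2)[OF True] b(1) by (intro mult_mono) auto
  next
    case False
    then show ?thesis using C(4)[of x] that b(1) by (simp add: w_def)
  qed
  have wm: "w \<in> borel_measurable N"
    unfolding w_def[abs_def] using meas_U[OF \<gamma>c] LC_measurable[OF v] by simp
  have w0: "w x = 0" if "x \<in> S - C" for x using C(4)[OF that] by (simp add: w_def)
  have gc: "continuous_on U (\<lambda>x. grad (\<lambda>x. \<gamma> (G x)) x $ i)" for i
    by (rule smooth_on_imp_continuous_on[OF smooth_on_grad[OF \<gamma>G]])
  have pint: "integrable N (\<lambda>x. p x $ i)" for i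
  proof -
    have "integrable N (\<lambda>x. (2 * \<gamma> (G x)) * (v x * D v x $ i) + grad (\<lambda>x. \<gamma> (G x)) x $ i * (v x)\<^sup>2)"
      by (intro Bochner_Integration.integrable_add LC_integrable[OF v] gc continuous_intros \<gamma>c)
    then show ?thesis by (simp add: p_def mult_ac)
  qed
  note W = weak_formulation[OF wp wm wb C(1,2) w0 pint]
  have eq: "F x \<bullet> p x + G x * w x = J x" if "x \<in> S" for x
  proof -
    have "x \<in> U" using that S_U by auto
    then show ?thesis unfolding J_def p_def w_def gr[OF \<open>x \<in> U\<close>] h_eq
      by (simp add: inner_add_right algebra_simps)
  qed
  have "integrable N (\<lambda>x. F x \<bullet> p x + G x * w x)" using W by simp
  then show "integrable N J" by (rule Bochner_Integration.integrable_cong[THEN iffD1, rotated -1]) (auto simp: eq)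
  have "(\<integral>x. F x \<bullet> p x + G x * w x \<partial>N) = 0" using W by simp
  moreover have "(\<integral>x. F x \<bullet> p x + G x * w x \<partial>N) = (\<integral>x. J x \<partial>N)"
    by (rule Bochner_Integration.integral_cong) (auto simp: eq)
  ultimately show "(\<integral>x. J x \<partial>N) = 0" by simp
qed

section \<open>The integrands and the weighted identity\<close>

definition Gr where "Gr t q x = G x powr (2 * t) * sq_norm_wrt (B x) (q x)"
definition Ms where "Ms t u x = G x powr (2 * t) * (u x)\<^sup>2"
definition Hd where "Hd t u x = G x powr (2 * t - 2) * h x * (u x)\<^sup>2"
text \<open>With z = G^(t-1/2) u and with \<open>q\<close> as the gradient of \<open>u\<close>, this
  is the energy density G |\<nabla>z|^2, the norm being taken with respect to \<open>B\<close>; the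
  factor G G^(2t-1) has been collected in front.\<close>

definition Qd where "Qd t u q x = G x powr (2 * t) * sq_norm_wrt (B x) (q x + ((t - 1/2) * u x / G x) *\<^sub>R grad G x)"
text \<open>The square of the norm of Y_t, transported to the measure \<open>N\<close>.\<close>

definition nrm where "nrm t v = (\<integral>x. G x powr (2 * t) * (norm (D v x))\<^sup>2 \<partial>N) + (if t < 1/2 then \<integral>x. Ms t v x \<partial>N else 0)"

lemma powr_expand:
  assumes "x \<in> S"
  shows "G x powr (2 * t) = (G x)\<^sup>2 * G x powr (2 * t - 2)" "G x powr (2 * t - 1) = G x * G x powr (2 * t - 2)"
    "G x powr (2 * t) = (G x powr t)\<^sup>2" "G x powr (2 * t - 2) = (G x powr (t - 1))\<^sup>2"
  using G_pos_S[OF assms] powr_add[of "G x" 2 "2 * t - 2"] powr_add[of "G x" 1 "2 * t - 2"]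
    powr_add[of "G x" t t] powr_add[of "G x" "t - 1" "t - 1"]
  by (simp_all add: power2_eq_square)

lemma LC_terms_integrable:
  assumes v: "v \<in> LC"
  shows "integrable N (Gr t (D v))" "integrable N (Ms t v)" "integrable N (Hd t v)"
    "integrable N (\<lambda>x. G x powr (2 * t) * (norm (D v x))\<^sup>2)"
proof -
  show "integrable N (Ms t v)" unfolding Ms_def[abs_def] by (rule LC_integrable(1)[OF v continuous_on_G_powr])
  show "integrable N (Hd t v)" unfolding Hd_def[abs_def]
    by (rule LC_integrable(1)[OF v]) (intro continuous_intros continuous_on_G_powr continuous_on_h)
  have "integrable N (\<lambda>x. \<Sum>i\<in>UNIV. \<Sum>j\<in>UNIV. (G x powr (2 * t) * B x $ i $ j) * (D v x $ i * D v x $ j))"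
    by (intro Bochner_Integration.integrable_sum LC_integrable(3)[OF v] continuous_intros continuous_on_G_powr continuous_on_B)
  then show "integrable N (Gr t (D v))"
    unfolding Gr_def[abs_def] sq_norm_wrt_sum by (simp add: sum_distrib_left mult.assoc)
  have "integrable N (\<lambda>x. \<Sum>i\<in>UNIV. G x powr (2 * t) * (D v x $ i * D v x $ i))"
    by (intro Bochner_Integration.integrable_sum LC_integrable(3)[OF v] continuous_on_G_powr)
  then show "integrable N (\<lambda>x. G x powr (2 * t) * (norm (D v x))\<^sup>2)"
    by (simp add: power2_norm_eq_inner inner_vec_def sum_distrib_left)
qed

lemma Qd_expand:
  assumes x: "x \<in> S"
  shows "Qd t u q x = Gr t q x + (2 * t - 1) * (G x powr (2 * t - 1) * (u x * (F x \<bullet> q x))) + (t - 1/2)\<^sup>2 * Hd t u x"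
proof -
  have eq: "sq_norm_wrt (B x) (q x + ((t - 1/2) * u x / G x) *\<^sub>R grad G x) =
      sq_norm_wrt (B x) (q x) + 2 * ((t - 1/2) * u x / G x) * (F x \<bullet> q x) + ((t - 1/2) * u x / G x)\<^sup>2 * h x"
    unfolding sq_add[OF x] sq_norm_wrt_scale h_def[symmetric]
    using B_inner_commute[OF x, of "q x" "grad G x"] by (simp add: F_def)
  define X where "X = G x powr (2 * t - 2)"
  show ?thesis
    unfolding Qd_def Gr_def Hd_def powr_expand(1)[OF x, of t] powr_expand(2)[OF x, of t] eq X_def[symmetric]
    using G_pos_S[OF x] by (simp add: field_simps power2_eq_square)
qed

lemma Qd_nonneg: "x \<in> S \<Longrightarrow> 0 \<le> Qd t u q x"
  unfolding Qd_def by (intro mult_nonneg_nonneg sq_nonneg) auto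

lemma Ms_nonneg: "0 \<le> Ms t u x" by (simp add: Ms_def)
lemma Hd_nonneg: "x \<in> S \<Longrightarrow> 0 \<le> Hd t u x" by (simp add: Hd_def h_nonneg)

text \<open>Expanding \<open>Qd\<close> leaves a mixed term in \<open>v\<close> and its gradient.
  Adding a multiple of the vanishing integral of \<open>J\<close>, that is, testing the equation
  with G^(2t-1) v^2, exchanges it for mass and Hardy terms; the Hardy term changes from +(t-1/2)^2
  to -(t-1/2)^2.\<close>

lemma weighted_identity:
  assumes v: "v \<in> LC"
  shows "integrable N (Qd t v (D v))"
    "(\<integral>x. Qd t v (D v) x \<partial>N) = (\<integral>x. Gr t (D v) x \<partial>N) + (1/2 - t) * (\<integral>x. Ms t v x \<partial>N) - (t - 1/2)\<^sup>2 * (\<integral>x. Hd t v x \<partial>N)"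
proof -
  define J where "J x = 2 * G x powr (2 * t - 1) * (v x * (F x \<bullet> D v x)) + (2 * t - 1) * G x powr (2 * t - 2) * h x * (v x)\<^sup>2
      + G x * G x powr (2 * t - 1) * (v x)\<^sup>2" for x
  have d: "((\<lambda>s. s powr (2 * t - 1)) has_real_derivative (2 * t - 1) * s powr (2 * t - 2)) (at s)" if "s > 0" for s
    using has_real_derivative_powr[OF that, of "2 * t - 1"] by simp
  have J: "integrable N J" "(\<integral>x. J x \<partial>N) = 0"
    unfolding J_def[abs_def] by (rule weak_formulation_square[OF v smooth_on_powr], erule d)+
  have eq: "Qd t v (D v) x = Gr t (D v) x + (1/2 - t) * Ms t v x - (t - 1/2)\<^sup>2 * Hd t v x + (t - 1/2) * J x" if x: "x \<in> S" for x
    unfolding Qd_expand[OF x] J_def Ms_def Hd_def powr_expand(1)[OF x, of t] powr_expand(2)[OF x, of t]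
    by (simp add: field_simps power2_eq_square)
  have "integrable N (\<lambda>x. Gr t (D v) x + (1/2 - t) * Ms t v x - (t - 1/2)\<^sup>2 * Hd t v x + (t - 1/2) * J x)"
    using LC_terms_integrable[OF v] J by simp
  then show "integrable N (Qd t v (D v))" by (rule Bochner_Integration.integrable_cong[THEN iffD1, rotated -1]) (auto simp: eq)
  have "(\<integral>x. Qd t v (D v) x \<partial>N) = (\<integral>x. Gr t (D v) x + (1/2 - t) * Ms t v x - (t - 1/2)\<^sup>2 * Hd t v x + (t - 1/2) * J x \<partial>N)"
    by (rule Bochner_Integration.integral_cong) (auto simp: eq)
  also have "\<dots> = (\<integral>x. Gr t (D v) x \<partial>N) + (1/2 - t) * (\<integral>x. Ms t v x \<partial>N) - (t - 1/2)\<^sup>2 * (\<integral>x. Hd t v x \<partial>N)"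
    using LC_terms_integrable[OF v, of t] J by simp
  finally show "(\<integral>x. Qd t v (D v) x \<partial>N) = (\<integral>x. Gr t (D v) x \<partial>N) + (1/2 - t) * (\<integral>x. Ms t v x \<partial>N) - (t - 1/2)\<^sup>2 * (\<integral>x. Hd t v x \<partial>N)" .
qed

text \<open>As \<open>Qd\<close> is nonnegative, the identity gives a^2 H <= c_1 P + (1/2 - t) M,
  with a = |t - 1/2| and P, M, H the integrals of gradient, mass and Hardy terms. For t < 1/2 the
  mass is part of the norm. For t > 1/2 its coefficient is negative, so it moves to the left side
  and is controlled by P alone. The constant \<kappa> is the sum of the constants of these
  cases.\<close>

lemma nrm_control:
  assumes t: "t \<noteq> 1/2"
  shows "\<exists>\<kappa>>0. \<forall>v\<in>LC. (\<integral>x. Ms t v x \<partial>N) \<le> \<kappa> * nrm t v \<and> (\<integral>x. Hd t v x \<partial>N) \<le> \<kappa> * nrm t v \<and>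
    (\<integral>x. G x powr (2 * t) * (norm (D v x))\<^sup>2 \<partial>N) \<le> nrm t v"
proof -
  define a where "a = \<bar>t - 1/2\<bar>"
  have a: "a > 0" using t by (simp add: a_def)
  define \<kappa> where "\<kappa> = 1 + c\<^sub>1 / a + (c\<^sub>1 + a) / a\<^sup>2"
  have \<kappa>: "\<kappa> > 0" "1 \<le> \<kappa>" "c\<^sub>1 / a \<le> \<kappa>" "(c\<^sub>1 + a) / a\<^sup>2 \<le> \<kappa>"
    using a c1_pos by (auto simp: \<kappa>_def intro!: add_pos_nonneg)
  have M: "(\<integral>x. Ms t v x \<partial>N) \<le> \<kappa> * nrm t v" and H: "(\<integral>x. Hd t v x \<partial>N) \<le> \<kappa> * nrm t v"
    and P: "(\<integral>x. G x powr (2 * t) * (norm (D v x))\<^sup>2 \<partial>N) \<le> nrm t v" if v: "v \<in> LC" for v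
  proof -
    note I = LC_terms_integrable[OF v, of t]
    define P where "P = (\<integral>x. G x powr (2 * t) * (norm (D v x))\<^sup>2 \<partial>N)"
    define M where "M = (\<integral>x. Ms t v x \<partial>N)"
    define H where "H = (\<integral>x. Hd t v x \<partial>N)"
    have P0: "0 \<le> P" unfolding P_def by (intro integral_nonneg_AE AE_I2) simp
    have M0: "0 \<le> M" unfolding M_def by (intro integral_nonneg_AE AE_I2 Ms_nonneg)
    have H0: "0 \<le> H" unfolding H_def by (intro integral_nonneg_AE AE_N_I Hd_nonneg)
    have "(\<integral>x. Gr t (D v) x \<partial>N) \<le> (\<integral>x. c\<^sub>1 * (G x powr (2 * t) * (norm (D v x))\<^sup>2) \<partial>N)"
    proof (rule integral_mono[OF I(1) integrable_mult_right[OF I(4)]])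
      fix x assume "x \<in> space N"
      then show "Gr t (D v) x \<le> c\<^sub>1 * (G x powr (2 * t) * (norm (D v x))\<^sup>2)"
        using mult_left_mono[OF sq_le[of x "D v x"], of "G x powr (2 * t)"] by (simp add: Gr_def mult_ac)
    qed
    then have "(\<integral>x. Gr t (D v) x \<partial>N) \<le> c\<^sub>1 * P" by (simp add: P_def)
    moreover have "0 \<le> (\<integral>x. Qd t v (D v) x \<partial>N)" by (intro integral_nonneg_AE AE_N_I Qd_nonneg)
    ultimately have main: "a\<^sup>2 * H \<le> c\<^sub>1 * P + (1/2 - t) * M"
      unfolding weighted_identity(2)[OF v] a_def H_def M_def by simp
    have n: "nrm t v = P + (if t < 1/2 then M else 0)" by (simp add: nrm_def P_def M_def)
    show "(\<integral>x. G x powr (2 * t) * (norm (D v x))\<^sup>2 \<partial>N) \<le> nrm t v" using M0 by (simp add: n P_def[symmetric])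
    have n0: "0 \<le> nrm t v" using P0 M0 by (simp add: n)
    show "(\<integral>x. Ms t v x \<partial>N) \<le> \<kappa> * nrm t v"
    proof (cases "t < 1/2")
      case True
      then have "M \<le> 1 * nrm t v" using P0 by (simp add: n)
      also have "\<dots> \<le> \<kappa> * nrm t v" using \<kappa> n0 by (intro mult_right_mono) auto
      finally show ?thesis by (simp add: M_def)
    next
      case False
      then have "t - 1/2 = a" using t by (simp add: a_def)
      then have "a * M \<le> c\<^sub>1 * P"
        using main mult_nonneg_nonneg[OF zero_le_power2[of a] H0] by (simp add: algebra_simps)
      then have "M \<le> c\<^sub>1 / a * nrm t v" using a False by (simp add: n field_simps)
      also have "\<dots> \<le> \<kappa> * nrm t v" using \<kappa> n0 by (intro mult_right_mono) auto
      finally show ?thesis by (simp add: M_def)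
    qed
    have "a\<^sup>2 * H \<le> (c\<^sub>1 + a) * nrm t v"
    proof (cases "t < 1/2")
      case True
      then have "1/2 - t = a" by (simp add: a_def)
      then have "a\<^sup>2 * H \<le> c\<^sub>1 * P + a * M" using main by simp
      also have "\<dots> \<le> (c\<^sub>1 + a) * nrm t v" using True P0 M0 a c1_pos by (simp add: n algebra_simps)
      finally show ?thesis .
    next
      case False
      then have "(1/2 - t) * M \<le> 0" using M0 by (simp add: mult_nonpos_nonneg)
      then have "a\<^sup>2 * H \<le> c\<^sub>1 * P" using main by simp
      also have "\<dots> \<le> (c\<^sub>1 + a) * nrm t v" using False P0 a by (simp add: n algebra_simps)
      finally show ?thesis .
    qed
    then have "H \<le> (c\<^sub>1 + a) / a\<^sup>2 * nrm t v" using a by (simp add: field_simps)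
    also have "\<dots> \<le> \<kappa> * nrm t v" using \<kappa> n0 by (intro mult_right_mono) auto
    finally show "(\<integral>x. Hd t v x \<partial>N) \<le> \<kappa> * nrm t v" by (simp add: H_def)
  qed
  show ?thesis using \<kappa>(1) M H P by blast
qed

end

section \<open>The completion\<close>

text \<open>In the variable ln s it descends from 1 to 0 between k and 2k. A step of length k in ln
  s means that s times the derivative is of order 1/k.\<close>

definition log_cutoff :: "real \<Rightarrow> real \<Rightarrow> real" where
  "log_cutoff k s = smooth_step (2 - ln s / k)"

lemma log_cutoff_bounds: "0 \<le> log_cutoff k s" "log_cutoff k s \<le> 1"
  by (simp_all add: log_cutoff_def smooth_step_nonneg smooth_step_le_1)

lemma log_cutoff_eq_1: "k > 0 \<Longrightarrow> ln s \<le> k \<Longrightarrow> log_cutoff k s = 1"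
  unfolding log_cutoff_def by (rule smooth_step_1) (simp add: field_simps)

lemma log_cutoff_eq_0: "k > 0 \<Longrightarrow> 2 * k \<le> ln s \<Longrightarrow> log_cutoff k s = 0"
  unfolding log_cutoff_def by (rule smooth_step_0) (simp add: field_simps)

lemma smooth_on_log_cutoff: "smooth_on (log_cutoff k) {0<..}"
proof -
  have "smooth_on (\<lambda>s. 2 - inverse k * ln s) {0<..}"
    by (rule smooth_on_diff[OF open_greaterThan smooth_on_const[OF open_greaterThan]
          smooth_on_mult[OF open_greaterThan smooth_on_const[OF open_greaterThan] smooth_on_ln]])
  from smooth_on_compose[OF open_greaterThan open_UNIV UNIV_I smooth_on_smooth_step this]
  show ?thesis unfolding log_cutoff_def[abs_def] by (simp add: divide_inverse mult.commute)
qed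

text \<open>The bound with \<open>log_cutoff (2 * k)\<close> holds because that function equals 1
  for ln s <= 2k, while the derivative vanishes beyond. It lets the Hardy integral of an almost
  extremal function at level 2k dominate the integral of -\<chi>'(G) |\<nabla>G|^2 at level
  k.\<close>

lemma log_cutoff_deriv:
  obtains b and \<chi>' :: "real \<Rightarrow> real \<Rightarrow> real" where "b > 0"
    "\<And>k s. k > 0 \<Longrightarrow> s > 0 \<Longrightarrow> (log_cutoff k has_real_derivative \<chi>' k s) (at s)"
    "\<And>k s. k > 0 \<Longrightarrow> s > 0 \<Longrightarrow> \<chi>' k s \<le> 0"
    "\<And>k s. k > 0 \<Longrightarrow> s > 0 \<Longrightarrow> - \<chi>' k s \<le> b / k * (inverse s * (log_cutoff (2 * k) s)\<^sup>2)"
    "\<And>k s. k > 0 \<Longrightarrow> s > 0 \<Longrightarrow> - \<chi>' k s * s \<le> b / k"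
    "\<And>k. k > 0 \<Longrightarrow> continuous_on {0<..} (\<chi>' k)"
proof -
  obtain \<theta> b where \<theta>: "\<And>s. (smooth_step has_real_derivative \<theta> s) (at s)" "\<And>s. 0 \<le> \<theta> s" "\<And>s. \<theta> s \<le> b"
    "\<And>s. s \<notin> {0..1} \<Longrightarrow> \<theta> s = 0" "b > 0"
    using smooth_step_deriv by metis
  define \<chi>' where "\<chi>' k s = - (\<theta> (2 - ln s / k) * (inverse s / k))" for k s :: real
  have der: "(log_cutoff k has_real_derivative \<chi>' k s) (at s)" if "k > 0" "s > 0" for k s
  proof -
    have "((\<lambda>s. smooth_step (2 - ln s / k)) has_real_derivative (\<theta> (2 - ln s / k) * (- (inverse s / k)))) (at s)"
      by (rule DERIV_chain2[OF \<theta>(1)]) (use that in \<open>auto intro!: derivative_eq_intros simp: field_simps\<close>)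
    then show ?thesis by (simp add: \<chi>'_def log_cutoff_def[abs_def])
  qed
  show thesis
  proof (rule that[of b \<chi>'])
    show "b > 0" by fact
    fix k :: real assume k: "k > 0"
    show "(log_cutoff k has_real_derivative \<chi>' k s) (at s)" if "s > 0" for s by (rule der[OF k that])
    show "\<chi>' k s \<le> 0" if "s > 0" for s using that k \<theta>(2) by (simp add: \<chi>'_def)
    show 1: "- \<chi>' k s * s \<le> b / k" if "s > 0" for s
      using that k \<theta>(3)[of "2 - ln s / k"] by (simp add: \<chi>'_def field_simps)
    show "- \<chi>' k s \<le> b / k * (inverse s * (log_cutoff (2 * k) s)\<^sup>2)" if s: "s > 0" for s
    proof (cases "ln s \<le> 2 * k")
      case True
      then have "log_cutoff (2 * k) s = 1" using k by (intro log_cutoff_eq_1) auto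
      then show ?thesis using 1[OF s] s k by (simp add: field_simps)
    next
      case False
      then have "2 - ln s / k < 0" using k by (simp add: field_simps)
      then have "\<theta> (2 - ln s / k) = 0" using \<theta>(4) by simp
      then show ?thesis using s k \<theta>(5) by (simp add: \<chi>'_def)
    qed
    show "continuous_on {0<..} (\<chi>' k)"
    proof -
      have "continuous_on {0<..} (\<lambda>s. frechet_derivative (log_cutoff k) (at s) 1)"
        by (rule smooth_on_imp_continuous_on[OF smooth_on_partial[OF smooth_on_log_cutoff]]) simp
      moreover have "frechet_derivative (log_cutoff k) (at s) 1 = \<chi>' k s" if "s \<in> {0<..}" for s
        using frechet_derivative_at[of "log_cutoff k" "\<lambda>h. \<chi>' k s * h" s] der[OF k, of s] that
        by (simp add: has_field_derivative_def flip: fun_eq_iff) (metis mult.right_neutral)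
      ultimately show ?thesis by (rule continuous_on_eq)
    qed
  qed
qed

context weight
begin

section \<open>Limits of Cauchy sequences in the norm\<close>

definition Yseq where
  "Yseq t v u \<longleftrightarrow> (\<forall>k::nat. v k \<in> LC) \<and> (\<forall>e>0. \<exists>n. \<forall>j\<ge>n. \<forall>k\<ge>n. nrm t (\<lambda>x. v j x - v k x) < e) \<and>
     (AE x in N. (\<lambda>k. v k x) \<longlonglongrightarrow> u x)"

lemma measurable_sq:
  assumes "\<And>i. (\<lambda>x. \<xi> x $ i) \<in> borel_measurable N"
  shows "(\<lambda>x. sq_norm_wrt (B x) (\<xi> x)) \<in> borel_measurable N"
  unfolding sq_norm_wrt_sum
  by (intro borel_measurable_sum borel_measurable_times assms meas_U continuous_on_B)

lemma measurable_vec: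
  fixes \<xi> :: "'b \<Rightarrow> real^'m"
  assumes "\<And>i. (\<lambda>x. \<xi> x $ i) \<in> borel_measurable M"
  shows "\<xi> \<in> borel_measurable M"
  by (subst borel_measurable_euclidean_space) (use assms in \<open>auto simp: Basis_vec_def inner_axis\<close>)

text \<open>\<open>D\<close> selects one weak gradient for each function, so it is additive only
  almost everywhere, by uniqueness.\<close>

lemma D_diff:
  assumes v: "v \<in> LC" "w \<in> LC"
  shows "AE x in N. D (\<lambda>x. v x - w x) x = D v x - D w x"
  unfolding N_def
  by (rule weak_gradient_unique[OF open_S LC_gradient(1)[OF LC_diff[OF v]]
        weak_gradient_diff[OF open_S LC_gradient(1)[OF v(1)] LC_gradient(1)[OF v(2)]]])

lemma square_diff_le: "\<bar>\<xi>\<^sup>2 - \<eta>\<^sup>2\<bar> \<le> 1 * norm (\<xi> - \<eta>) * (norm \<xi> + norm \<eta>)" for \<xi> \<eta> :: real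
proof -
  have "\<xi>\<^sup>2 - \<eta>\<^sup>2 = (\<xi> - \<eta>) * (\<xi> + \<eta>)" by (simp add: power2_eq_square algebra_simps)
  then show ?thesis by (simp add: abs_mult mult_left_mono abs_triangle_ineq)
qed

text \<open>Multiplication by \<open>q\<close> is bounded from the norm to L^2, so a Cauchy sequence
  stays Cauchy and its almost everywhere limit is the L^2 limit. It is used with G^t for the mass
  and with G^(t-1) times the square root of \<open>h\<close> for the Hardy term;
  \<open>nrm_control\<close> supplies both bounds.\<close>

lemma scalar_limit:
  assumes t: "t \<noteq> 1/2" and Y: "Yseq t v u" and q: "continuous_on U q"
    and \<kappa>: "\<And>w. w \<in> LC \<Longrightarrow> (\<integral>x. (q x * w x)\<^sup>2 \<partial>N) \<le> \<kappa> * nrm t w" "\<kappa> > 0"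
    and u: "u \<in> borel_measurable N"
  shows "integrable N (\<lambda>x. (q x * u x)\<^sup>2)" "(\<lambda>k. \<integral>x. (q x * v k x - q x * u x)\<^sup>2 \<partial>N) \<longlonglongrightarrow> 0"
    "(\<lambda>k. \<integral>x. (q x * v k x)\<^sup>2 \<partial>N) \<longlonglongrightarrow> (\<integral>x. (q x * u x)\<^sup>2 \<partial>N)"
proof -
  have v: "\<And>k. v k \<in> LC" and lim: "AE x in N. (\<lambda>k. v k x) \<longlonglongrightarrow> u x" using Y by (auto simp: Yseq_def)
  have m: "(\<lambda>x. q x * v k x) \<in> borel_measurable N" for k using meas_U[OF q] LC_measurable[OF v] by simp
  have mu: "(\<lambda>x. q x * u x) \<in> borel_measurable N" using meas_U[OF q] u by simp
  have int: "integrable N (\<lambda>x. (norm (q x * v k x))\<^sup>2)" for k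
  proof -
    have "integrable N (\<lambda>x. (q x)\<^sup>2 * (v k x)\<^sup>2)" by (intro LC_integrable(1)[OF v] continuous_intros q)
    then show ?thesis by (simp add: power_mult_distrib)
  qed
  have Cauchy: "\<exists>n. \<forall>j\<ge>n. \<forall>k\<ge>n. (\<integral>x. (norm (q x * v j x - q x * v k x))\<^sup>2 \<partial>N) < e" if "e > 0" for e
  proof -
    have "e / \<kappa> > 0" using that \<kappa>(2) by simp
    then obtain n where n: "\<And>j k. j \<ge> n \<Longrightarrow> k \<ge> n \<Longrightarrow> nrm t (\<lambda>x. v j x - v k x) < e / \<kappa>"
      using Y unfolding Yseq_def by blast
    have "(\<integral>x. (norm (q x * v j x - q x * v k x))\<^sup>2 \<partial>N) < e" if "j \<ge> n" "k \<ge> n" for j k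
    proof -
      have "(\<integral>x. (norm (q x * v j x - q x * v k x))\<^sup>2 \<partial>N) = (\<integral>x. (q x * (v j x - v k x))\<^sup>2 \<partial>N)"
        by (simp add: right_diff_distrib)
      also have "\<dots> \<le> \<kappa> * nrm t (\<lambda>x. v j x - v k x)" by (rule \<kappa>(1)[OF LC_diff[OF v v]])
      also have "\<dots> < e" using n[OF that] \<kappa>(2) by (simp add: field_simps)
      finally show ?thesis .
    qed
    then show ?thesis by blast
  qed
  have id: "strict_mono (\<lambda>k::nat. k)" by (simp add: strict_mono_def)
  have lim': "AE x in N. (\<lambda>k. q x * v k x) \<longlonglongrightarrow> q x * u x" using lim by eventually_elim (intro tendsto_intros)
  note L = L2_Cauchy_AE_limit[OF m mu int Cauchy id lim']
  show 1: "integrable N (\<lambda>x. (q x * u x)\<^sup>2)" using L(1) by simp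
  show 2: "(\<lambda>k. \<integral>x. (q x * v k x - q x * u x)\<^sup>2 \<partial>N) \<longlonglongrightarrow> 0" using L(2) by simp
  show "(\<lambda>k. \<integral>x. (q x * v k x)\<^sup>2 \<partial>N) \<longlonglongrightarrow> (\<integral>x. (q x * u x)\<^sup>2 \<partial>N)"
  proof (rule L2_quadratic_tendsto(2)[where f="\<lambda>k x. q x * v k x" and g="\<lambda>x. q x * u x" and Q="\<lambda>x \<xi>. \<xi>\<^sup>2" and c=1 and M=N])
    show "\<bar>\<xi>\<^sup>2 - \<eta>\<^sup>2\<bar> \<le> 1 * norm (\<xi> - \<eta>) * (norm \<xi> + norm \<eta>)" for \<xi> \<eta> :: real by (rule square_diff_le)
    show "integrable N (\<lambda>x. (norm (q x * v k x))\<^sup>2)" for k by (rule int)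
    show "(\<lambda>x. q x * v k x) \<in> borel_measurable N" for k by (rule m)
    show "(\<lambda>x. (q x * v k x)\<^sup>2) \<in> borel_measurable N" for k using m by simp
    show "(\<lambda>x. q x * u x) \<in> borel_measurable N" by (rule mu)
    show "(\<lambda>x. (q x * u x)\<^sup>2) \<in> borel_measurable N" using mu by simp
    show "integrable N (\<lambda>x. (norm (q x * u x))\<^sup>2)" using 1 by simp
    show "(\<lambda>k. \<integral>x. (norm (q x * v k x - q x * u x))\<^sup>2 \<partial>N) \<longlonglongrightarrow> 0" using 2 by simp
  qed auto
qed

text \<open>Every term of the inequality is a quadratic expression that is continuous in the norm.
  For mass and Hardy terms this is \<open>scalar_limit\<close>; for the gradient the L^2 limit must
  also be recognised as a weak gradient of \<open>u\<close>.\<close>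

lemma Y_limit:
  assumes t: "t \<noteq> 1/2" and Y: "Yseq t v u"
  shows "weak_gradient S u (D u)" "u \<in> borel_measurable N"
    "integrable N (Gr t (D u))" "integrable N (Ms t u)" "integrable N (Hd t u)"
    "(\<lambda>k. \<integral>x. Gr t (D (v k)) x \<partial>N) \<longlonglongrightarrow> (\<integral>x. Gr t (D u) x \<partial>N)"
    "(\<lambda>k. \<integral>x. Ms t (v k) x \<partial>N) \<longlonglongrightarrow> (\<integral>x. Ms t u x \<partial>N)"
    "(\<lambda>k. \<integral>x. Hd t (v k) x \<partial>N) \<longlonglongrightarrow> (\<integral>x. Hd t u x \<partial>N)"
    "(\<lambda>k. \<integral>x. Ms t (\<lambda>x. v k x - u x) x \<partial>N) \<longlonglongrightarrow> 0"
proof -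
  have v: "\<And>k. v k \<in> LC" and lim: "AE x in N. (\<lambda>k. v k x) \<longlonglongrightarrow> u x" using Y by (auto simp: Yseq_def)
  obtain \<kappa> where \<kappa>: "\<kappa> > 0" "\<And>v. v \<in> LC \<Longrightarrow> (\<integral>x. Ms t v x \<partial>N) \<le> \<kappa> * nrm t v"
    "\<And>v. v \<in> LC \<Longrightarrow> (\<integral>x. Hd t v x \<partial>N) \<le> \<kappa> * nrm t v"
    "\<And>v. v \<in> LC \<Longrightarrow> (\<integral>x. G x powr (2 * t) * (norm (D v x))\<^sup>2 \<partial>N) \<le> nrm t v"
    using nrm_control[OF t] by blast
  show um: "u \<in> borel_measurable N"
  proof -
    have m: "(\<lambda>x. lim (\<lambda>k. v k x)) \<in> borel_measurable (lebesgue_on S)"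
      using LC_measurable[OF v] unfolding N_def by (rule borel_measurable_lim_metric)
    have "AE x in lebesgue_on S. lim (\<lambda>k. v k x) = u x" using lim unfolding N_def by eventually_elim (rule limI)
    from lebesgue_on_measurable_AE[OF S_lebesgue m this] show ?thesis by (simp add: N_def)
  qed
  have Ms_eq: "(\<integral>x. Ms t w x \<partial>N) = (\<integral>x. (G x powr t * w x)\<^sup>2 \<partial>N)" for w
    by (rule Bochner_Integration.integral_cong) (auto simp: Ms_def powr_expand(3) power_mult_distrib)
  have Hd_eq': "Hd t w x = ((G x powr (t - 1) * sqrt (h x)) * w x)\<^sup>2" if "x \<in> S" for w x
    using that h_nonneg[OF that] by (simp add: Hd_def powr_expand(4) power_mult_distrib)
  have Hd_eq: "(\<integral>x. Hd t w x \<partial>N) = (\<integral>x. ((G x powr (t - 1) * sqrt (h x)) * w x)\<^sup>2 \<partial>N)" for w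
    by (rule Bochner_Integration.integral_cong) (auto simp: Hd_eq')
  have M: "integrable N (\<lambda>x. (G x powr t * u x)\<^sup>2)" "(\<lambda>k. \<integral>x. (G x powr t * v k x - G x powr t * u x)\<^sup>2 \<partial>N) \<longlonglongrightarrow> 0"
    "(\<lambda>k. \<integral>x. (G x powr t * v k x)\<^sup>2 \<partial>N) \<longlonglongrightarrow> (\<integral>x. (G x powr t * u x)\<^sup>2 \<partial>N)"
    by (rule scalar_limit[OF t Y continuous_on_G_powr _ \<kappa>(1) um], simp add: Ms_eq[symmetric] \<kappa>)+
  have H: "integrable N (\<lambda>x. ((G x powr (t - 1) * sqrt (h x)) * u x)\<^sup>2)"
    "(\<lambda>k. \<integral>x. ((G x powr (t - 1) * sqrt (h x)) * v k x)\<^sup>2 \<partial>N) \<longlonglongrightarrow> (\<integral>x. ((G x powr (t - 1) * sqrt (h x)) * u x)\<^sup>2 \<partial>N)"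
    by (rule scalar_limit[OF t Y _ _ \<kappa>(1) um], intro continuous_intros continuous_on_G_powr continuous_on_h, simp add: Hd_eq[symmetric] \<kappa>)+
  show "integrable N (Ms t u)"
    by (rule Bochner_Integration.integrable_cong[THEN iffD1, OF refl _ M(1)]) (auto simp: Ms_def powr_expand(3) power_mult_distrib)
  show "integrable N (Hd t u)"
    by (rule Bochner_Integration.integrable_cong[THEN iffD1, OF refl _ H(1)]) (auto simp: Hd_eq')
  show "(\<lambda>k. \<integral>x. Ms t (v k) x \<partial>N) \<longlonglongrightarrow> (\<integral>x. Ms t u x \<partial>N)" unfolding Ms_eq by (rule M(3))
  show "(\<lambda>k. \<integral>x. Hd t (v k) x \<partial>N) \<longlonglongrightarrow> (\<integral>x. Hd t u x \<partial>N)" unfolding Hd_eq by (rule H(2))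
  show "(\<lambda>k. \<integral>x. Ms t (\<lambda>x. v k x - u x) x \<partial>N) \<longlonglongrightarrow> 0" unfolding Ms_eq using M(2) by (simp add: right_diff_distrib)

  \<comment> \<open>The weight is put into the gradients, so that the norm controls them in the
    unweighted L^2 space of vector fields.\<close>
  define f where "f k x = G x powr t *\<^sub>R D (v k) x" for k x
  have fi: "(\<lambda>x. f k x $ i) \<in> borel_measurable N" for k i
    unfolding f_def using meas_U[OF continuous_on_G_powr] LC_gradient(2)[OF v] by simp
  have fm: "f k \<in> borel_measurable N" for k by (rule measurable_vec[OF fi])
  have fint: "integrable N (\<lambda>x. (norm (f k x))\<^sup>2)" for k
    by (rule Bochner_Integration.integrable_cong[THEN iffD1, OF refl _ LC_terms_integrable(4)[OF v, of t k]])
       (simp add: f_def powr_expand(3) power_mult_distrib)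
  have fC: "\<exists>n. \<forall>j\<ge>n. \<forall>k\<ge>n. (\<integral>x. (norm (f j x - f k x))\<^sup>2 \<partial>N) < e" if "e > 0" for e
  proof -
    obtain n where n: "\<And>j k. j \<ge> n \<Longrightarrow> k \<ge> n \<Longrightarrow> nrm t (\<lambda>x. v j x - v k x) < e"
      using Y \<open>e > 0\<close> unfolding Yseq_def by blast
    have "(\<integral>x. (norm (f j x - f k x))\<^sup>2 \<partial>N) < e" if "j \<ge> n" "k \<ge> n" for j k
    proof -
      have "(\<integral>x. (norm (f j x - f k x))\<^sup>2 \<partial>N) = (\<integral>x. G x powr (2 * t) * (norm (D (\<lambda>x. v j x - v k x) x))\<^sup>2 \<partial>N)"
      proof (rule integral_cong_AE)
        show "(\<lambda>x. (norm (f j x - f k x))\<^sup>2) \<in> borel_measurable N" using fm by simp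
        show "(\<lambda>x. G x powr (2 * t) * (norm (D (\<lambda>x. v j x - v k x) x))\<^sup>2) \<in> borel_measurable N"
          using LC_terms_integrable(4)[OF LC_diff[OF v[of j] v[of k]], of t] by (rule borel_measurable_integrable)
        show "AE x in N. (norm (f j x - f k x))\<^sup>2 = G x powr (2 * t) * (norm (D (\<lambda>x. v j x - v k x) x))\<^sup>2"
          using D_diff[OF v[of j] v[of k]] AE_space
          by eventually_elim (simp add: f_def powr_expand(3) power_mult_distrib flip: scaleR_right_diff_distrib)
      qed
      also have "\<dots> \<le> nrm t (\<lambda>x. v j x - v k x)" by (rule \<kappa>(4)[OF LC_diff[OF v v]])
      also have "\<dots> < e" by (rule n[OF that])
      finally show ?thesis .
    qed
    then show ?thesis by blast
  qed
  have "\<exists>P. P \<in> borel_measurable N \<and> integrable N (\<lambda>x. (norm (P x))\<^sup>2) \<and>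
      (\<lambda>k. \<integral>x. (norm (f k x - P x))\<^sup>2 \<partial>N) \<longlonglongrightarrow> 0"
    by (rule L2_complete[OF fm fint]) (fact fC)
  then obtain P where P: "P \<in> borel_measurable N" "integrable N (\<lambda>x. (norm (P x))\<^sup>2)"
    "(\<lambda>k. \<integral>x. (norm (f k x - P x))\<^sup>2 \<partial>N) \<longlonglongrightarrow> 0" by blast
  have Pi[measurable]: "(\<lambda>x. P x $ i) \<in> borel_measurable N" for i
  proof -
    have "(\<lambda>y::real^'n. y $ i) \<in> borel_measurable borel"
      by (intro borel_measurable_continuous_onI continuous_on_component continuous_on_id)
    from measurable_compose[OF P(1) this] show ?thesis .
  qed
  have comp: "(a $ i)\<^sup>2 \<le> (norm a)\<^sup>2" for a :: "real^'n" and i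
    using component_le_norm_cart[of a i] power_mono[of "\<bar>a $ i\<bar>" "norm a" 2] by simp
  have P2: "integrable N (\<lambda>x. (P x $ i)\<^sup>2)" for i
    by (rule Bochner_Integration.integrable_bound[OF P(2)]) (use comp in auto)
  have fi2: "integrable N (\<lambda>x. (f k x $ i)\<^sup>2)" for k i
    by (rule Bochner_Integration.integrable_bound[OF fint[of k]]) (use comp fi in auto)
  have fPi: "(\<lambda>k. \<integral>x. (f k x $ i - P x $ i)\<^sup>2 \<partial>N) \<longlonglongrightarrow> 0" for i
  proof (rule Lim_null_comparison[OF _ P(3)], rule always_eventually, rule allI)
    fix k
    have "(\<integral>x. (f k x $ i - P x $ i)\<^sup>2 \<partial>N) \<le> (\<integral>x. (norm (f k x - P x))\<^sup>2 \<partial>N)"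
    proof (rule integral_mono)
      show "integrable N (\<lambda>x. (f k x $ i - P x $ i)\<^sup>2)"
        using L2_diff_integrable[OF fi Pi, of k i i] fi2 P2 by simp
      show "integrable N (\<lambda>x. (norm (f k x - P x))\<^sup>2)" by (rule L2_diff_integrable[OF fm P(1) fint P(2)])
      show "(f k x $ i - P x $ i)\<^sup>2 \<le> (norm (f k x - P x))\<^sup>2" for x using comp[of "f k x - P x" i] by simp
    qed
    then show "norm (\<integral>x. (f k x $ i - P x $ i)\<^sup>2 \<partial>N) \<le> (\<integral>x. (norm (f k x - P x))\<^sup>2 \<partial>N)" by simp
  qed
  \<comment> \<open>Removing the weight from the limit gives the candidate for the gradient. The
    identity of integration by parts is passed to the limit with G^t on the sequence and G^(-t) on
    the test function, which is square integrable since its support is compact in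
    \<open>S\<close>.\<close>
  define q where "q x = G x powr (- t) *\<^sub>R P x" for x
  have Gt: "G x powr (- t) * (G x powr t * y) = y" if "x \<in> S" for x y
    using G_pos_S[OF that] by (simp add: powr_minus field_simps)
  have wq: "weak_gradient S u q"
    unfolding weak_gradient_iff[OF open_S]
  proof (intro conjI allI ballI)
    have Gc: "continuous_on S (\<lambda>x. G x powr (- t))" by (rule continuous_on_subset[OF continuous_on_G_powr S_U])
    have "(\<lambda>x. G x powr t * u x) \<in> borel_measurable N" using meas_U[OF continuous_on_G_powr] um by simp
    then have "locally_integrable S (\<lambda>x. G x powr t * u x)"
      using locally_integrable_square_integrable[OF S_lmeasurable] M(1) unfolding N_def by blast
    from locally_integrable_mult[OF this Gc] show "locally_integrable S u"
      by (rule locally_integrable_cong[rotated]) (rule Gt)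
    show "locally_integrable S (\<lambda>x. q x $ i)" for i
    proof -
      have "locally_integrable S (\<lambda>x. P x $ i)"
        using locally_integrable_square_integrable[OF S_lmeasurable] Pi P2 unfolding N_def by blast
      from locally_integrable_mult[OF this Gc] show ?thesis by (simp add: q_def)
    qed
    fix \<phi> :: "real^'n \<Rightarrow> real" and i assume \<phi>: "\<phi> \<in> test_functions S"
    obtain C where C: "smooth_on \<phi> UNIV" "compact C" "C \<subseteq> S" "\<And>x. x \<notin> C \<Longrightarrow> \<phi> x = 0"
      using test_functionsE[OF \<phi>] by metis
    have sq: "\<psi> \<in> borel_measurable N" "integrable N (\<lambda>x. (\<psi> x)\<^sup>2)"
      if "continuous_on S \<psi>" "\<And>x. x \<in> S \<Longrightarrow> x \<notin> C \<Longrightarrow> \<psi> x = 0" for \<psi> :: "real^'n \<Rightarrow> real"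
    proof -
      show "\<psi> \<in> borel_measurable N" by (rule measurable_N[OF that(1)])
      have "integrable N (\<lambda>x. (\<psi> x)\<^sup>2 * 1)" unfolding N_def
        by (rule compact_supp_lebesgue_on_integrable[OF S_lebesgue locally_integrable_continuous[OF continuous_on_const] _ C(2,3)])
           (use that in \<open>auto intro!: continuous_intros\<close>)
      then show "integrable N (\<lambda>x. (\<psi> x)\<^sup>2)" by simp
    qed
    have gr0: "grad \<phi> x = 0" if "x \<notin> C" for x using grad_eq_0[of C \<phi> x] compact_imp_closed[OF C(2)] C(4) that by blast
    have gc: "continuous_on S (\<lambda>x. G x powr (- t) * grad \<phi> x $ i)"
      by (intro continuous_intros Gc continuous_on_subset[OF smooth_on_imp_continuous_on[OF smooth_on_grad[OF C(1)]]]) auto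
    have pc: "continuous_on S (\<lambda>x. G x powr (- t) * \<phi> x)"
      by (intro continuous_intros Gc continuous_on_subset[OF smooth_on_imp_continuous_on[OF C(1)]]) auto
    have g: "(\<lambda>x. G x powr (- t) * grad \<phi> x $ i) \<in> borel_measurable N" "integrable N (\<lambda>x. (G x powr (- t) * grad \<phi> x $ i)\<^sup>2)"
      by (rule sq[OF gc], simp add: gr0)+
    have p: "(\<lambda>x. G x powr (- t) * \<phi> x) \<in> borel_measurable N" "integrable N (\<lambda>x. (G x powr (- t) * \<phi> x)\<^sup>2)"
      by (rule sq[OF pc], simp add: C(4))+
    have vm: "(\<lambda>x. G x powr t * v k x) \<in> borel_measurable N" for k using meas_U[OF continuous_on_G_powr] LC_measurable[OF v] by simp
    have v2: "integrable N (\<lambda>x. (G x powr t * v k x)\<^sup>2)" for k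
      by (rule Bochner_Integration.integrable_cong[THEN iffD1, OF refl _ LC_terms_integrable(2)[OF v, of t k]])
         (simp add: Ms_def powr_expand(3) power_mult_distrib)
    have um': "(\<lambda>x. G x powr t * u x) \<in> borel_measurable N" using meas_U[OF continuous_on_G_powr] um by simp
    have l1: "(\<lambda>k. \<integral>x. (G x powr t * v k x) * (G x powr (- t) * grad \<phi> x $ i) \<partial>N) \<longlonglongrightarrow>
        (\<integral>x. (G x powr t * u x) * (G x powr (- t) * grad \<phi> x $ i) \<partial>N)"
      by (rule L2_inner_tendsto[OF vm um' g(1) v2 M(1) g(2) M(2)])
    have l2: "(\<lambda>k. \<integral>x. f k x $ i * (G x powr (- t) * \<phi> x) \<partial>N) \<longlonglongrightarrow> (\<integral>x. P x $ i * (G x powr (- t) * \<phi> x) \<partial>N)"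
      by (rule L2_inner_tendsto[OF fi Pi p(1) fi2 P2 p(2) fPi])
    have e1: "(\<integral>x. (G x powr t * w x) * (G x powr (- t) * grad \<phi> x $ i) \<partial>N) = (\<integral>x. w x * grad \<phi> x $ i \<partial>N)" for w
      using Gt by (intro Bochner_Integration.integral_cong) (auto simp: mult_ac)
    have e2: "(\<integral>x. f k x $ i * (G x powr (- t) * \<phi> x) \<partial>N) = (\<integral>x. \<phi> x * D (v k) x $ i \<partial>N)" for k
      using Gt by (intro Bochner_Integration.integral_cong) (auto simp: f_def mult_ac)
    have e3: "(\<integral>x. P x $ i * (G x powr (- t) * \<phi> x) \<partial>N) = (\<integral>x. \<phi> x * q x $ i \<partial>N)"
      by (intro Bochner_Integration.integral_cong) (auto simp: q_def mult_ac)
    have e4: "(\<integral>x. v k x * grad \<phi> x $ i \<partial>N) = - (\<integral>x. \<phi> x * D (v k) x $ i \<partial>N)" for k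
      using LC_gradient(1)[OF v] \<phi> unfolding weak_gradient_iff[OF open_S] N_def by blast
    have "(\<lambda>k. \<integral>x. v k x * grad \<phi> x $ i \<partial>N) \<longlonglongrightarrow> (\<integral>x. u x * grad \<phi> x $ i \<partial>N)" using l1 unfolding e1 .
    moreover have "(\<lambda>k. \<integral>x. v k x * grad \<phi> x $ i \<partial>N) \<longlonglongrightarrow> - (\<integral>x. \<phi> x * q x $ i \<partial>N)"
      unfolding e4 using tendsto_minus[OF l2] unfolding e2 e3 .
    ultimately show "(\<integral>x. u x * grad \<phi> x $ i \<partial>lebesgue_on S) = - (\<integral>x. \<phi> x * q x $ i \<partial>lebesgue_on S)"
      unfolding N_def by (rule LIMSEQ_unique)
  qed
  show "weak_gradient S u (D u)" by (rule weak_gradient_wgrad[OF wq])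
  have Dq: "AE x in N. D u x = q x" unfolding N_def by (rule wgrad_AE_eq[OF open_S wq])
  have Dum: "(\<lambda>x. D u x $ i) \<in> borel_measurable N" for i
  proof -
    have "(\<lambda>x. q x $ i) \<in> borel_measurable (lebesgue_on S)"
      unfolding q_def N_def[symmetric] using meas_U[OF continuous_on_G_powr[of "- t"]] by simp
    moreover have "AE x in lebesgue_on S. q x $ i = D u x $ i" using Dq unfolding N_def by eventually_elim simp
    ultimately show ?thesis unfolding N_def by (rule lebesgue_on_measurable_AE[OF S_lebesgue])
  qed
  have sqP: "AE x in N. sq_norm_wrt (B x) (P x) = Gr t (D u) x"
    using Dq AE_space
  proof eventually_elim
    case (elim x)
    then have "G x powr (2 * t) * (G x powr (- t))\<^sup>2 = 1"
      using G_pos_S[of x] by (simp add: powr_expand(3) powr_minus flip: power_mult_distrib)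
    then show ?case using elim by (simp add: Gr_def q_def sq_norm_wrt_scale flip: mult.assoc)
  qed
  have Grm: "Gr t (D u) \<in> borel_measurable N"
    unfolding Gr_def[abs_def] using meas_U[OF continuous_on_G_powr] measurable_sq[OF Dum] by simp
  have sqf: "sq_norm_wrt (B x) (f k x) = Gr t (D (v k)) x" if "x \<in> S" for k x
    using that by (simp add: Gr_def f_def sq_norm_wrt_scale powr_expand(3))
  have Q: "integrable N (\<lambda>x. sq_norm_wrt (B x) (P x))"
    "(\<lambda>k. \<integral>x. sq_norm_wrt (B x) (f k x) \<partial>N) \<longlonglongrightarrow> (\<integral>x. sq_norm_wrt (B x) (P x) \<partial>N)"
  proof -
    note quad = L2_quadratic_tendsto[where Q="\<lambda>x. sq_norm_wrt (B x)" and c=c\<^sub>1 and f=f and g=P and M=N,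
        OF fm P(1) measurable_sq[OF fi] measurable_sq[OF Pi] fint P(2,3)]
    show "integrable N (\<lambda>x. sq_norm_wrt (B x) (P x))"
      by (rule quad(1)) (use c1_pos sq_diff in \<open>auto simp: sq_norm_wrt_def\<close>)
    show "(\<lambda>k. \<integral>x. sq_norm_wrt (B x) (f k x) \<partial>N) \<longlonglongrightarrow> (\<integral>x. sq_norm_wrt (B x) (P x) \<partial>N)"
      by (rule quad(2)) (use c1_pos sq_diff in \<open>auto simp: sq_norm_wrt_def\<close>)
  qed
  show "integrable N (Gr t (D u))" by (rule integrable_cong_AE_imp[OF Q(1) Grm]) (use sqP in \<open>auto elim!: eventually_mono\<close>)
  have "(\<integral>x. sq_norm_wrt (B x) (P x) \<partial>N) = (\<integral>x. Gr t (D u) x \<partial>N)"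
    by (rule integral_cong_AE[OF _ Grm sqP]) (rule measurable_sq[OF Pi])
  moreover have "(\<integral>x. sq_norm_wrt (B x) (f k x) \<partial>N) = (\<integral>x. Gr t (D (v k)) x \<partial>N)" for k
    by (rule Bochner_Integration.integral_cong) (auto simp: sqf)
  ultimately show "(\<lambda>k. \<integral>x. Gr t (D (v k)) x \<partial>N) \<longlonglongrightarrow> (\<integral>x. Gr t (D u) x \<partial>N)" using Q(2) by simp
qed

text \<open>The limit of the energies is exactly the difference of the two sides of the inequality
  at \<open>u\<close>. Its sign gives the inequality, and its vanishing in the case of equality
  makes the energies tend to 0.\<close>

lemma Qd_limit:
  assumes t: "t \<noteq> 1/2" and Y: "Yseq t v u"
  shows "(\<lambda>k. \<integral>x. Qd t (v k) (D (v k)) x \<partial>N) \<longlonglongrightarrow>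
    (\<integral>x. Gr t (D u) x \<partial>N) + (1/2 - t) * (\<integral>x. Ms t u x \<partial>N) - (t - 1/2)\<^sup>2 * (\<integral>x. Hd t u x \<partial>N)"
proof -
  have v: "\<And>k. v k \<in> LC" using Y by (auto simp: Yseq_def)
  show ?thesis unfolding weighted_identity(2)[OF v]
    by (intro tendsto_intros Y_limit[OF t Y])
qed

lemma Y_inequality:
  assumes t: "t \<noteq> 1/2" and Y: "Yseq t v u"
  shows "(t - 1/2)\<^sup>2 * (\<integral>x. Hd t u x \<partial>N) \<le> (\<integral>x. Gr t (D u) x \<partial>N) + (1/2 - t) * (\<integral>x. Ms t u x \<partial>N)"
proof -
  have "0 \<le> (\<integral>x. Gr t (D u) x \<partial>N) + (1/2 - t) * (\<integral>x. Ms t u x \<partial>N) - (t - 1/2)\<^sup>2 * (\<integral>x. Hd t u x \<partial>N)"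
    by (rule LIMSEQ_le_const[OF Qd_limit[OF t Y]]) (auto intro!: integral_nonneg_AE AE_N_I Qd_nonneg)
  then show ?thesis by simp
qed

end

section \<open>Optimality\<close>

text \<open>On a compact ball the sum of the absolute values of the partial derivatives is bounded,
  and it dominates the operator norm of the derivative.\<close>

lemma smooth_on_locally_lipschitz:
  fixes f :: "'a::euclidean_space \<Rightarrow> real"
  assumes U: "open U" and f: "smooth_on f U" and x: "x \<in> U"
  obtains r L where "r > 0" "L-lipschitz_on (cball x r) f" "cball x r \<subseteq> U"
proof -
  obtain r where r: "r > 0" "cball x r \<subseteq> U" using U x open_contains_cball by blast
  have c: "continuous_on (cball x r) (\<lambda>y. \<Sum>i\<in>Basis. \<bar>frechet_derivative f (at y) i\<bar>)"
    by (intro continuous_intros continuous_on_subset[OF smooth_on_imp_continuous_on[OF smooth_on_partial[OF f]] r(2)])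
  have "compact ((\<lambda>y. \<Sum>i\<in>Basis. \<bar>frechet_derivative f (at y) i\<bar>) ` cball x r)"
    by (rule compact_continuous_image[OF c compact_cball])
  then obtain L where "L > 0" and L': "\<forall>z\<in>(\<lambda>y. \<Sum>i\<in>Basis. \<bar>frechet_derivative f (at y) i\<bar>) ` cball x r. norm z \<le> L"
    using bounded_pos compact_imp_bounded by blast
  have L: "L > 0" "\<And>y. y \<in> cball x r \<Longrightarrow> (\<Sum>i\<in>Basis. \<bar>frechet_derivative f (at y) i\<bar>) \<le> L"
    using \<open>L > 0\<close> L' by (auto simp: abs_le_iff)
  have "L-lipschitz_on (cball x r) f"
  proof (rule lipschitz_onI)
    show "dist (f y) (f z) \<le> L * dist y z" if yz: "y \<in> cball x r" "z \<in> cball x r" for y z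
      unfolding dist_norm
    proof (rule differentiable_bound[OF convex_cball _ _ yz])
      fix y assume y: "y \<in> cball x r"
      then have d: "(f has_derivative frechet_derivative f (at y)) (at y)" using smooth_on_has_derivative[OF U f] r(2) by blast
      then show "(f has_derivative frechet_derivative f (at y)) (at y within cball x r)" by (rule has_derivative_at_withinI)
      show "onorm (frechet_derivative f (at y)) \<le> L"
      proof (rule onorm_le)
        fix v
        interpret linear "frechet_derivative f (at y)" by (rule has_derivative_linear[OF d])
        have "frechet_derivative f (at y) v = frechet_derivative f (at y) (\<Sum>i\<in>Basis. (v \<bullet> i) *\<^sub>R i)"
          by (simp add: euclidean_representation)
        also have "\<dots> = (\<Sum>i\<in>Basis. (v \<bullet> i) * frechet_derivative f (at y) i)" by (simp add: sum scale)
        finally have "norm (frechet_derivative f (at y) v) \<le> (\<Sum>i\<in>Basis. \<bar>(v \<bullet> i) * frechet_derivative f (at y) i\<bar>)"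
          by (simp add: sum_abs)
        also have "\<dots> \<le> (\<Sum>i\<in>Basis. norm v * \<bar>frechet_derivative f (at y) i\<bar>)"
          unfolding abs_mult by (intro sum_mono mult_right_mono Basis_le_norm) auto
        also have "\<dots> \<le> L * norm v"
          using mult_left_mono[OF L(2)[OF y] norm_ge_zero[of v]] by (simp add: mult.commute[of L] flip: sum_distrib_left)
        finally show "norm (frechet_derivative f (at y) v) \<le> L * norm v" .
      qed
    qed
  qed (use L in simp)
  then show thesis using that r by blast
qed

context weight
begin

section \<open>Equality is not attained\<close>

text \<open>The truncated mass is bounded by (l + b/k) times the Hardy integral plus 1/l times the
  energy, for every l > 0. For fixed l the energy disappears along the sequence; afterwards l and
  1/k tend to 0, and the full mass is zero. The truncation is what makes the factor b/k appear in
  front of the derivative of the cutoff.\<close>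

lemma Y_not_attained:
  assumes t: "t \<noteq> 1/2" and Y: "Yseq t v u"
    and eq: "(\<integral>x. Gr t (D u) x \<partial>N) + (1/2 - t) * (\<integral>x. Ms t u x \<partial>N) = (t - 1/2)\<^sup>2 * (\<integral>x. Hd t u x \<partial>N)"
  shows "AE x in N. u x = 0"
proof -
  have v: "\<And>k. v k \<in> LC" using Y by (auto simp: Yseq_def)
  note YL = Y_limit[OF t Y]
  obtain b and \<chi>' :: "real \<Rightarrow> real \<Rightarrow> real" where b: "b > 0"
    and \<chi>'d: "\<And>k s. k > 0 \<Longrightarrow> s > 0 \<Longrightarrow> (log_cutoff k has_real_derivative \<chi>' k s) (at s)"
    and \<chi>'neg: "\<And>k s. k > 0 \<Longrightarrow> s > 0 \<Longrightarrow> \<chi>' k s \<le> 0"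
    and \<chi>'b: "\<And>k s. k > 0 \<Longrightarrow> s > 0 \<Longrightarrow> - \<chi>' k s * s \<le> b / k"
    by (rule log_cutoff_deriv) blast
  define H where "H = (\<integral>x. Hd t u x \<partial>N)"
  have Q0: "(\<lambda>k. \<integral>x. Qd t (v k) (D (v k)) x \<partial>N) \<longlonglongrightarrow> 0" using Qd_limit[OF t Y] eq by simp
  have \<chi>m: "(\<lambda>x. log_cutoff k (G x)) \<in> borel_measurable N" for k
    by (intro meas_U continuous_on_compose_G smooth_on_imp_continuous_on[OF smooth_on_log_cutoff])
  have \<chi>Ms: "integrable N (\<lambda>x. log_cutoff k (G x) * Ms t w x)" if "integrable N (Ms t w)" for k w
    using \<chi>m log_cutoff_bounds that
    by (intro Bochner_Integration.integrable_bound[OF that] AE_I2) (auto simp: abs_mult mult_left_le_one_le)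
  have step: "(\<integral>x. log_cutoff k (G x) * Ms t (v j) x \<partial>N) \<le> (l + b / k) * (\<integral>x. Hd t (v j) x \<partial>N) + 1 / l * (\<integral>x. Qd t (v j) (D (v j)) x \<partial>N)"
    if k: "k > 0" and l: "l > 0" for k l :: real and j
  proof -
    define \<gamma> where "\<gamma> s = s powr (2 * t - 1) * log_cutoff k s" for s
    define \<gamma>' where "\<gamma>' s = (2 * t - 1) * s powr (2 * t - 2) * log_cutoff k s + s powr (2 * t - 1) * \<chi>' k s" for s
    have \<gamma>s: "smooth_on \<gamma> {0<..}" unfolding \<gamma>_def[abs_def] by (intro smooth_on_mult smooth_on_powr smooth_on_log_cutoff) auto
    have \<gamma>d: "(\<gamma> has_real_derivative \<gamma>' s) (at s)" if "s > 0" for s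
      unfolding \<gamma>_def[abs_def] \<gamma>'_def
      using DERIV_mult[OF has_real_derivative_powr[OF that, of "2 * t - 1"] \<chi>'d[OF k that]]
      by (simp add: algebra_simps)
    define J where "J = (\<lambda>x. 2 * \<gamma> (G x) * (v j x * (F x \<bullet> D (v j) x)) + \<gamma>' (G x) * h x * (v j x)\<^sup>2 + G x * \<gamma> (G x) * (v j x)\<^sup>2)"
    have Ji: "integrable N J" and J0: "(\<integral>x. J x \<partial>N) = 0"
      using weak_formulation_square[OF v[of j] \<gamma>s \<gamma>d] unfolding J_def by auto
    have pw: "log_cutoff k (G x) * Ms t (v j) x \<le> J x + ((l + b / k) * Hd t (v j) x + 1 / l * Qd t (v j) (D (v j)) x)" if x: "x \<in> S" for x
    proof -
      define X where "X = G x powr (2 * t - 2)"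
      define \<zeta> where "\<zeta> = log_cutoff k (G x)"
      define q where "q = D (v j) x + ((t - 1/2) * v j x / G x) *\<^sub>R grad G x"
      have g: "G x > 0" by (rule G_pos_S[OF x])
      have X: "X \<ge> 0" by (simp add: X_def)
      have \<zeta>01: "0 \<le> \<zeta>" "\<zeta> \<le> 1" by (auto simp: \<zeta>_def log_cutoff_bounds)
      have Fq: "F x \<bullet> q = F x \<bullet> D (v j) x + (t - 1/2) * v j x / G x * h x"
        by (simp add: q_def inner_add_right h_eq)
      \<comment> \<open>Replacing the gradient of \<open>v j\<close> by \<open>q\<close> absorbs
        exactly the term of \<open>\<gamma>'\<close> with the factor 2t - 1, so the only derivative
        left is that of the cutoff.\<close>
      have Jx: "J x = 2 * (G x * X) * \<zeta> * (v j x * (F x \<bullet> q)) + (G x * X) * \<chi>' k (G x) * h x * (v j x)\<^sup>2 + \<zeta> * Ms t (v j) x"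
        unfolding J_def \<gamma>_def \<gamma>'_def Fq Ms_def powr_expand(1)[OF x, of t] powr_expand(2)[OF x, of t]
          X_def[symmetric] \<zeta>_def[symmetric]
        using g by (simp add: field_simps power2_eq_square)
      \<comment> \<open>Young's inequality with parameter \<open>l\<close>: the square of (l v/G)
        \<nabla>G + q is nonnegative, and after scaling by G^2 X \<zeta> / l its three terms are a
        Hardy term, the mixed term of \<open>Jx\<close> and an energy term.\<close>
      have "0 \<le> sq_norm_wrt (B x) ((l * v j x / G x) *\<^sub>R grad G x + q)" by (rule sq_nonneg[OF x])
      then have "0 \<le> (l * v j x / G x)\<^sup>2 * h x + 2 * (l * v j x / G x) * (F x \<bullet> q) + sq_norm_wrt (B x) q"
        unfolding sq_add[OF x] sq_norm_wrt_scale h_def[symmetric] by (simp add: matrix_vector_mult_scaleR F_def)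
      then have "0 \<le> (G x)\<^sup>2 * X * \<zeta> / l * ((l * v j x / G x)\<^sup>2 * h x + 2 * (l * v j x / G x) * (F x \<bullet> q) + sq_norm_wrt (B x) q)"
        using X \<zeta>01 l by (intro mult_nonneg_nonneg divide_nonneg_pos) auto
      also have "\<dots> = \<zeta> * (l * Hd t (v j) x) + 2 * (G x * X) * \<zeta> * (v j x * (F x \<bullet> q)) + \<zeta> * (1 / l * Qd t (v j) (D (v j)) x)"
        unfolding Hd_def Qd_def q_def[symmetric] powr_expand(1)[OF x, of t] X_def[symmetric]
        using g l by (simp add: field_simps power2_eq_square)
      also have "\<dots> \<le> l * Hd t (v j) x + 2 * (G x * X) * \<zeta> * (v j x * (F x \<bullet> q)) + 1 / l * Qd t (v j) (D (v j)) x"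
        using \<zeta>01 l Hd_nonneg[OF x, of t "v j"] Qd_nonneg[OF x, of t "v j" "D (v j)"]
        by (intro add_mono order_refl mult_left_le_one_le mult_nonneg_nonneg) auto
      finally have A: "0 \<le> l * Hd t (v j) x + 2 * (G x * X) * \<zeta> * (v j x * (F x \<bullet> q)) + 1 / l * Qd t (v j) (D (v j)) x" .
      have "- \<chi>' k (G x) * G x * Hd t (v j) x \<le> b / k * Hd t (v j) x"
        by (rule mult_right_mono[OF \<chi>'b[OF k g] Hd_nonneg[OF x]])
      moreover have "(G x * X) * \<chi>' k (G x) * h x * (v j x)\<^sup>2 = \<chi>' k (G x) * G x * Hd t (v j) x"
        unfolding Hd_def X_def by (simp add: mult_ac)
      ultimately have Bb: "0 \<le> b / k * Hd t (v j) x + (G x * X) * \<chi>' k (G x) * h x * (v j x)\<^sup>2"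
        by (simp only:)
      show ?thesis unfolding \<zeta>_def[symmetric] Jx using A Bb by (simp add: distrib_right)
    qed
    note I = LC_terms_integrable[OF v[of j], of t] and W = weighted_identity(1)[OF v[of j], of t]
    have "(\<integral>x. log_cutoff k (G x) * Ms t (v j) x \<partial>N) \<le>
        (\<integral>x. J x + ((l + b / k) * Hd t (v j) x + 1 / l * Qd t (v j) (D (v j)) x) \<partial>N)"
    proof (rule integral_mono[OF \<chi>Ms[OF I(2)]])
      show "integrable N (\<lambda>x. J x + ((l + b / k) * Hd t (v j) x + 1 / l * Qd t (v j) (D (v j)) x))"
        by (intro Bochner_Integration.integrable_add integrable_mult_right Ji I W)
      show "log_cutoff k (G x) * Ms t (v j) x \<le> J x + ((l + b / k) * Hd t (v j) x + 1 / l * Qd t (v j) (D (v j)) x)"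
        if "x \<in> space N" for x
        using pw[of x] that unfolding space_N .
    qed
    also have "\<dots> = (\<integral>x. J x \<partial>N) + ((l + b / k) * (\<integral>x. Hd t (v j) x \<partial>N) + 1 / l * (\<integral>x. Qd t (v j) (D (v j)) x \<partial>N))"
      by (simp only: Bochner_Integration.integral_add Bochner_Integration.integrable_add integrable_mult_right Ji I W integral_mult_right_zero)
    finally show ?thesis using J0 by simp
  qed
  have Msm: "integrable N (Ms t (\<lambda>x. v j x - u x))" for j
  proof (rule Bochner_Integration.integrable_bound[OF Bochner_Integration.integrable_add[OF
          integrable_mult_right[OF LC_terms_integrable(2)[OF v[of j], of t], of 2] integrable_mult_right[OF YL(4), of 2]]])
    show "Ms t (\<lambda>x. v j x - u x) \<in> borel_measurable N"
      unfolding Ms_def[abs_def] using meas_U[OF continuous_on_G_powr] LC_measurable[OF v] YL(2) by simp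
    have "Ms t (\<lambda>x. v j x - u x) x \<le> 2 * Ms t (v j) x + 2 * Ms t u x" for x
      using mult_left_mono[OF norm_diff_square_le[of "v j x" "u x"], of "G x powr (2 * t)"]
      by (simp add: Ms_def algebra_simps)
    then show "AE x in N. norm (Ms t (\<lambda>x. v j x - u x) x) \<le> norm (2 * Ms t (v j) x + 2 * Ms t u x)"
      using Ms_nonneg by (intro AE_I2) (simp add: abs_of_nonneg)
  qed
  have lim_step: "(\<integral>x. log_cutoff k (G x) * Ms t u x \<partial>N) \<le> 2 * (l + b / k) * H" if k: "k > 0" and l: "l > 0" for k l :: real
  proof -
    \<comment> \<open>The passage from \<open>v j\<close> to \<open>u\<close> uses |u|^2 <= 2 |v|^2
      + 2 |v - u|^2; the factor 2 is harmless, because the right side is going to vanish.\<close>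
    have "(\<integral>x. log_cutoff k (G x) * Ms t u x \<partial>N) \<le>
        2 * ((l + b / k) * (\<integral>x. Hd t (v j) x \<partial>N) + 1 / l * (\<integral>x. Qd t (v j) (D (v j)) x \<partial>N)) + 2 * (\<integral>x. Ms t (\<lambda>x. v j x - u x) x \<partial>N)" for j
    proof -
      have "(\<integral>x. log_cutoff k (G x) * Ms t u x \<partial>N) \<le>
          (\<integral>x. 2 * (log_cutoff k (G x) * Ms t (v j) x) + 2 * Ms t (\<lambda>x. v j x - u x) x \<partial>N)"
      proof (rule integral_mono[OF \<chi>Ms[OF YL(4)]])
        show "integrable N (\<lambda>x. 2 * (log_cutoff k (G x) * Ms t (v j) x) + 2 * Ms t (\<lambda>x. v j x - u x) x)"
          using \<chi>Ms[OF LC_terms_integrable(2)[OF v]] Msm by simp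
        fix x
        have "Ms t u x \<le> 2 * Ms t (v j) x + 2 * Ms t (\<lambda>x. v j x - u x) x"
          using mult_left_mono[OF norm_diff_square_le[of "v j x" "v j x - u x"], of "G x powr (2 * t)"]
          by (simp add: Ms_def algebra_simps)
        then have "log_cutoff k (G x) * Ms t u x \<le> log_cutoff k (G x) * (2 * Ms t (v j) x + 2 * Ms t (\<lambda>x. v j x - u x) x)"
          by (intro mult_left_mono log_cutoff_bounds)
        also have "\<dots> \<le> 2 * (log_cutoff k (G x) * Ms t (v j) x) + 2 * Ms t (\<lambda>x. v j x - u x) x"
          using mult_right_mono[OF log_cutoff_bounds(2)[of k "G x"] Ms_nonneg[of t "\<lambda>x. v j x - u x" x]]
          by (simp add: algebra_simps)
        finally show "log_cutoff k (G x) * Ms t u x \<le> 2 * (log_cutoff k (G x) * Ms t (v j) x) + 2 * Ms t (\<lambda>x. v j x - u x) x" .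
      qed
      also have "\<dots> = 2 * (\<integral>x. log_cutoff k (G x) * Ms t (v j) x \<partial>N) + 2 * (\<integral>x. Ms t (\<lambda>x. v j x - u x) x \<partial>N)"
        using \<chi>Ms[OF LC_terms_integrable(2)[OF v]] Msm by simp
      finally show ?thesis using step[OF k l, of j] by simp
    qed
    moreover have "(\<lambda>j. 2 * ((l + b / k) * (\<integral>x. Hd t (v j) x \<partial>N) + 1 / l * (\<integral>x. Qd t (v j) (D (v j)) x \<partial>N)) + 2 * (\<integral>x. Ms t (\<lambda>x. v j x - u x) x \<partial>N))
        \<longlonglongrightarrow> 2 * ((l + b / k) * H + 1 / l * 0) + 2 * 0"
      unfolding H_def by (intro tendsto_intros YL Q0)
    ultimately have "(\<integral>x. log_cutoff k (G x) * Ms t u x \<partial>N) \<le> 2 * ((l + b / k) * H + 1 / l * 0) + 2 * 0"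
      by (intro LIMSEQ_le_const) auto
    then show ?thesis by (simp only: mult_zero_right add_0_right mult.assoc)
  qed
  have "(\<lambda>n. \<integral>x. log_cutoff (real (Suc n)) (G x) * Ms t u x \<partial>N) \<longlonglongrightarrow> (\<integral>x. Ms t u x \<partial>N)"
  proof (rule integral_dominated_convergence[OF _ _ YL(4)])
    show "Ms t u \<in> borel_measurable N" using YL(4) by simp
    show "(\<lambda>x. log_cutoff (real (Suc n)) (G x) * Ms t u x) \<in> borel_measurable N" for n using \<chi>Ms[OF YL(4)] by (rule borel_measurable_integrable)
    show "AE x in N. (\<lambda>n. log_cutoff (real (Suc n)) (G x) * Ms t u x) \<longlonglongrightarrow> Ms t u x"
    proof (rule AE_I2)
      fix x
      obtain n0 where n0: "ln (G x) \<le> real n0" using real_arch_simple by blast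
      have "log_cutoff (real (Suc n)) (G x) = 1" if "n \<ge> n0" for n using n0 that by (intro log_cutoff_eq_1) auto
      then show "(\<lambda>n. log_cutoff (real (Suc n)) (G x) * Ms t u x) \<longlonglongrightarrow> Ms t u x"
        by (intro tendsto_eventually eventually_sequentiallyI[of n0]) simp
    qed
    show "AE x in N. norm (log_cutoff (real (Suc n)) (G x) * Ms t u x) \<le> Ms t u x" for n
      using log_cutoff_bounds Ms_nonneg by (intro AE_I2) (simp add: abs_mult mult_left_le_one_le)
  qed
  \<comment> \<open>With k = n + 1 and l = 1/(n + 1) the factor l + b/k tends to 0.\<close>
  moreover have "(\<lambda>n. 2 * (inverse (real (Suc n)) + b * inverse (real (Suc n))) * H) \<longlonglongrightarrow> 2 * (0 + b * 0) * H"
    by (intro tendsto_intros LIMSEQ_inverse_real_of_nat)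
  moreover have "(\<integral>x. log_cutoff (real (Suc n)) (G x) * Ms t u x \<partial>N) \<le> 2 * (inverse (real (Suc n)) + b * inverse (real (Suc n))) * H" for n
    using lim_step[of "real (Suc n)" "inverse (real (Suc n))"] by (simp add: divide_inverse)
  ultimately have "(\<integral>x. Ms t u x \<partial>N) \<le> 2 * (0 + b * 0) * H"
    by (intro LIMSEQ_le) auto
  moreover have "0 \<le> (\<integral>x. Ms t u x \<partial>N)" by (intro integral_nonneg_AE AE_I2 Ms_nonneg)
  ultimately have "(\<integral>x. Ms t u x \<partial>N) = 0" by simp
  then have "AE x in N. Ms t u x = 0"
    using YL(4) by (subst (asm) integral_nonneg_eq_0_iff_AE) (auto simp: Ms_nonneg)
  then show ?thesis
    using AE_space
  proof eventually_elim
    case (elim x)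
    then show ?case using G_pos_S[of x] by (simp add: Ms_def)
  qed
qed

section \<open>Almost extremal functions\<close>

text \<open>Near \<open>K\<close> the values of \<open>G\<close> exceed \<open>m\<close>, so the
  sublevel set stays away from \<open>K\<close>; elsewhere it is closed by continuity up to the
  boundary. This is what provides compact supports for functions of \<open>G\<close>.\<close>

lemma compact_sublevel: "compact {x \<in> closure \<Omega> - K. G x \<le> m}"
proof -
  obtain V where V: "\<And>x. x \<in> K \<Longrightarrow> open (V x)" "\<And>x. x \<in> K \<Longrightarrow> x \<in> V x" "\<And>x y. x \<in> K \<Longrightarrow> y \<in> V x \<inter> S \<Longrightarrow> m < G y"
    using blow_up[of _ m] unfolding S_def by metis
  define W where "W = - closure \<Omega> \<union> (\<Union>x\<in>K. V x \<inter> \<Omega>) \<union> (U \<inter> G -` {m<..})"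
  have "open (U \<inter> G -` {m<..})" by (rule continuous_open_preimage[OF continuous_on_G open_U open_greaterThan])
  moreover have "open (V x \<inter> \<Omega>)" if "x \<in> K" for x using V(1)[OF that] open_\<Omega> by (rule open_Int)
  ultimately have "open W" unfolding W_def by (intro open_Un open_UN ballI) auto
  moreover have "{x \<in> closure \<Omega> - K. G x \<le> m} = closure \<Omega> \<inter> - W"
  proof (intro set_eqI iffI)
    fix x assume x: "x \<in> {x \<in> closure \<Omega> - K. G x \<le> m}"
    have "x \<notin> V y \<inter> \<Omega>" if "y \<in> K" for y using V(3)[OF that, of x] x by (auto simp: S_def)
    then show "x \<in> closure \<Omega> \<inter> - W" using x by (auto simp: W_def)
  next
    fix x assume x: "x \<in> closure \<Omega> \<inter> - W"
    then have "x \<notin> K" using V(2) K_subset by (auto simp: W_def)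
    moreover from this have "x \<in> U" using x U_superset by auto
    ultimately show "x \<in> {x \<in> closure \<Omega> - K. G x \<le> m}" using x by (auto simp: W_def not_less)
  qed
  ultimately show ?thesis
    using bounded_\<Omega> by (simp add: compact_closure compact_Int_closed closed_Compl)
qed

text \<open>\<sigma>(G) vanishes where G is at least exp(2k), hence near \<open>K\<close>, so its
  extension by zero is locally Lipschitz on the whole closure of \<Omega>. Compactness makes it
  globally Lipschitz; a bound on the gradient alone would not do so, as \<Omega> need not be
  convex.\<close>

lemma LC_composition:
  assumes \<sigma>: "smooth_on \<sigma> {0<..}" and k: "k > 0" and \<sigma>0: "\<And>s. 2 * k \<le> ln s \<Longrightarrow> \<sigma> s = 0"
  shows "(\<lambda>x. if x \<in> K then 0 else \<sigma> (G x)) \<in> LC"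
proof -
  define u where "u x = (if x \<in> K then 0 else \<sigma> (G x))" for x
  define C where "C = {x \<in> closure \<Omega> - K. G x \<le> exp (2 * k)}"
  have C: "compact C" "C \<subseteq> closure \<Omega> - K" unfolding C_def by (rule compact_sublevel) auto
  have big: "\<sigma> (G x) = 0" if "x \<in> U" "exp (2 * k) < G x" for x
    using \<sigma>0[of "G x"] that G_pos[OF that(1)] by (simp add: ln_ge_iff)
  have u0: "u x = 0" if "x \<in> closure \<Omega> - C" for x
    using that big[of x] U_superset by (auto simp: u_def C_def not_le)
  have \<sigma>G: "smooth_on (\<lambda>x. \<sigma> (G x)) U"
    by (rule smooth_on_compose[OF open_U open_greaterThan _ \<sigma> smooth_G]) (simp add: G_pos)
  \<comment> \<open>\<open>local_lipschitz\<close> concerns families indexed by a time set; the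
    constant family over \<open>{0}\<close> stands for the single function \<open>u\<close>.\<close>
  have "local_lipschitz {0::real} (closure \<Omega>) (\<lambda>_. u)"
  proof (rule local_lipschitzI)
    fix s :: real and x assume x: "x \<in> closure \<Omega>"
    show "\<exists>r>0. \<exists>L. \<forall>s\<in>cball s r \<inter> {0}. L-lipschitz_on (cball x r \<inter> closure \<Omega>) u"
    proof (cases "x \<in> K")
      case True
      obtain V where V: "open V" "x \<in> V" "\<And>y. y \<in> V \<inter> S \<Longrightarrow> exp (2 * k) < G y"
        using blow_up[OF True, of "exp (2 * k)"] unfolding S_def by blast
      have "open (V \<inter> \<Omega>)" "x \<in> V \<inter> \<Omega>" using V open_\<Omega> True K_subset by auto
      then obtain r where r: "r > 0" "cball x r \<subseteq> V \<inter> \<Omega>" using open_contains_cball by blast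
      have "u y = 0" if "y \<in> cball x r" for y
      proof (cases "y \<in> K")
        case False
        then have "y \<in> V \<inter> S" using that r(2) by (auto simp: S_def)
        then show ?thesis using big[of y] V(3)[of y] S_U by (auto simp: u_def)
      qed (simp add: u_def)
      then have "0-lipschitz_on (cball x r \<inter> closure \<Omega>) u" by (intro lipschitz_onI) auto
      then show ?thesis using r(1) by blast
    next
      case False
      then have "x \<in> U" using x U_superset by auto
      then obtain r L where r: "r > 0" "L-lipschitz_on (cball x r) (\<lambda>x. \<sigma> (G x))" "cball x r \<subseteq> U"
        by (rule smooth_on_locally_lipschitz[OF open_U \<sigma>G])
      have "L-lipschitz_on (cball x r \<inter> closure \<Omega>) u"
      proof (rule lipschitz_on_transform[OF lipschitz_on_subset[OF r(2)]])
        fix y assume "y \<in> cball x r \<inter> closure \<Omega>"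
        then have "y \<notin> K" using r(3) U_K by auto
        then show "u y = \<sigma> (G y)" by (simp add: u_def)
      qed auto
      then show ?thesis using r(1) by blast
    qed
  qed
  note LL = this
  have "\<exists>L. L-lipschitz_on (closure \<Omega>) u"
  proof (rule local_lipschitz_compact_implies_lipschitz[where X="closure \<Omega>" and T="{0::real}" and f="\<lambda>_. u"])
    show "compact (closure \<Omega>)" using bounded_\<Omega> by (simp add: compact_closure)
    show "\<exists>L. L-lipschitz_on (closure \<Omega>) u" if "\<And>s. s \<in> {0::real} \<Longrightarrow> L-lipschitz_on (closure \<Omega>) u" for L
      using that[of 0] by auto
  qed (use LL in auto)
  then have "u \<in> LC" unfolding lipschitz_compact_support_def using C u0 by blast
  then show ?thesis by (simp add: u_def[abs_def])
qed

text \<open>The weak formulation for \<chi>(G) itself. Its right side stays below the integral of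
  \<open>G\<close> for every \<open>k\<close>, which yields a bound on the integral of -\<chi>'(G)
  |\<nabla>G|^2 uniform in \<open>k\<close>.\<close>

lemma cutoff_equation:
  assumes k: "k > 0" and \<chi>': "\<And>s. s > 0 \<Longrightarrow> (log_cutoff k has_real_derivative \<chi>' s) (at s)"
  shows "integrable N (\<lambda>x. \<chi>' (G x) * h x)" "integrable N (\<lambda>x. G x * log_cutoff k (G x))"
    "(\<integral>x. - \<chi>' (G x) * h x \<partial>N) = (\<integral>x. G x * log_cutoff k (G x) \<partial>N)"
proof -
  define w where "w x = log_cutoff k (G x)" for x
  define C where "C = {x \<in> closure \<Omega> - K. G x \<le> exp (2 * k)}"
  have C: "compact C" "C \<subseteq> closure \<Omega> - K" unfolding C_def by (rule compact_sublevel) auto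
  have CU: "C \<subseteq> U" using C(2) U_superset by auto
  have ws: "smooth_on w U" unfolding w_def[abs_def]
    by (rule smooth_on_compose[OF open_U open_greaterThan _ smooth_on_log_cutoff smooth_G]) (simp add: G_pos)
  have wS: "smooth_on w S" by (rule smooth_on_subset[OF open_U open_S S_U ws])
  have w0: "w x = 0" if "x \<in> S - C" for x
  proof -
    have "exp (2 * k) < G x" using that closure_subset[of \<Omega>] by (auto simp: C_def S_def not_le)
    then have "2 * k \<le> ln (G x)" using that G_pos_S[of x] by (simp add: ln_ge_iff)
    then show ?thesis unfolding w_def by (rule log_cutoff_eq_0[OF k])
  qed
  have wg: "weak_gradient S w (grad w)" by (rule weak_gradient_smooth[OF open_S wS])
  have gr: "grad w x = \<chi>' (G x) *\<^sub>R grad G x" if "x \<in> S" for x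
    using that S_U unfolding w_def[abs_def] by (intro grad_compose[OF open_U smooth_G _ \<chi>'[OF G_pos_S]]) auto
  have wm: "w \<in> borel_measurable N" by (rule meas_U[OF smooth_on_imp_continuous_on[OF ws]])
  have gc: "continuous_on U (\<lambda>x. grad w x $ i)" for i by (rule smooth_on_imp_continuous_on[OF smooth_on_grad[OF ws]])
  have gi: "integrable N (\<lambda>x. grad w x $ i)" for i
  proof -
    obtain m where m: "m > 0" "\<And>x. x \<in> C \<Longrightarrow> \<bar>grad w x $ i\<bar> \<le> m" using bounded_on_compact[OF gc C(1) CU] by metis
    have "AE x in N. x \<notin> C \<longrightarrow> grad w x = 0"
      unfolding N_def by (rule weak_gradient_AE_0[OF open_S wg compact_imp_closed[OF C(1)] w0])
    then have "AE x in N. norm (grad w x $ i) \<le> m"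
      by eventually_elim (use m in force)
    then show ?thesis using meas_U[OF gc] by (intro integrable_const_bound[of _ m])
  qed
  have wb: "\<bar>w x\<bar> \<le> 1" if "x \<in> S" for x using log_cutoff_bounds[of k "G x"] by (simp add: w_def)
  note W = weak_formulation[OF wg wm wb C w0 gi]
  have eq: "F x \<bullet> grad w x = \<chi>' (G x) * h x" if "x \<in> S" for x
    using gr[OF that] by (simp add: h_eq)
  show "integrable N (\<lambda>x. \<chi>' (G x) * h x)"
    by (rule Bochner_Integration.integrable_cong[THEN iffD1, OF refl _ W(1)]) (simp add: eq)
  show "integrable N (\<lambda>x. G x * log_cutoff k (G x))" using W(2) by (simp add: w_def)
  have "(\<integral>x. F x \<bullet> grad w x \<partial>N) = (\<integral>x. \<chi>' (G x) * h x \<partial>N)"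
    by (rule Bochner_Integration.integral_cong) (simp_all add: eq)
  then show "(\<integral>x. - \<chi>' (G x) * h x \<partial>N) = (\<integral>x. G x * log_cutoff k (G x) \<partial>N)"
    using W(3) by (simp add: w_def)
qed

text \<open>Otherwise \<open>S\<close> would be a null set, since \<open>G\<close> is positive on
  it, and so would be the nonempty open set \<Omega>.\<close>

lemma G_integral_pos: "0 < (\<integral>x. G x \<partial>N)"
proof -
  have G: "integrable N G" using G_integrable by (simp add: N_def S_def)
  have nn: "AE x in N. 0 \<le> G x" using G_pos_S by (intro AE_N_I) (simp add: less_imp_le)
  have "(\<integral>x. G x \<partial>N) \<noteq> 0"
  proof
    assume "(\<integral>x. G x \<partial>N) = 0"
    then have "AE x in N. G x = 0" using integral_nonneg_eq_0_iff_AE[OF G nn] by simp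
    then have "AE x in N. False" using AE_space by eventually_elim (use G_pos_S in fastforce)
    then have "AE x in lebesgue. x \<notin> S" unfolding N_def by (simp add: AE_restrict_space_iff)
    then have "S \<in> null_sets lebesgue" by (simp add: AE_iff_null_sets)
    then have "S \<union> K \<in> null_sets lebesgue" using K_null by auto
    moreover have "S \<union> K = \<Omega>" using K_subset by (auto simp: S_def)
    ultimately show False using open_not_negligible[OF open_\<Omega> nonempty] by (simp add: negligible_iff_null_sets)
  qed
  moreover have "0 \<le> (\<integral>x. G x \<partial>N)" by (rule integral_nonneg_AE[OF nn])
  ultimately show ?thesis by simp
qed

text \<open>Dominated convergence with majorant \<open>G\<close>: at each point the cutoff equals 1
  eventually. The scale \<open>c\<close> allows for the two levels k and k/2.\<close>

lemma cutoff_mass_tendsto: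
  assumes c: "c > 0"
  shows "(\<lambda>n. \<integral>x. G x * log_cutoff (c * real (Suc n)) (G x) \<partial>N) \<longlonglongrightarrow> (\<integral>x. G x \<partial>N)"
    "(\<lambda>n. \<integral>x. G x * (log_cutoff (c * real (Suc n)) (G x))\<^sup>2 \<partial>N) \<longlonglongrightarrow> (\<integral>x. G x \<partial>N)"
proof -
  have G: "integrable N G" using G_integrable by (simp add: N_def S_def)
  have \<chi>m: "(\<lambda>x. log_cutoff k (G x)) \<in> borel_measurable N" for k
    by (intro meas_U continuous_on_compose_G smooth_on_imp_continuous_on[OF smooth_on_log_cutoff])
  have ev: "eventually (\<lambda>n. log_cutoff (c * real (Suc n)) (G x) = 1) sequentially" for x
  proof -
    obtain n0 where n0: "ln (G x) / c \<le> real n0" using real_arch_simple by blast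
    have "log_cutoff (c * real (Suc n)) (G x) = 1" if "n \<ge> n0" for n
    proof (rule log_cutoff_eq_1)
      have "ln (G x) / c \<le> real (Suc n)" using n0 that by linarith
      then show "ln (G x) \<le> c * real (Suc n)" using c by (simp add: divide_le_eq mult.commute)
    qed (use c in simp)
    then show ?thesis by (rule eventually_sequentiallyI)
  qed
  show "(\<lambda>n. \<integral>x. G x * log_cutoff (c * real (Suc n)) (G x) \<partial>N) \<longlonglongrightarrow> (\<integral>x. G x \<partial>N)"
  proof (rule integral_dominated_convergence[OF _ _ integrable_norm[OF G]])
    show "AE x in N. (\<lambda>n. G x * log_cutoff (c * real (Suc n)) (G x)) \<longlonglongrightarrow> G x"
    proof (rule AE_I2, rule tendsto_eventually)
      fix x
      show "\<forall>\<^sub>F n in sequentially. G x * log_cutoff (c * real (Suc n)) (G x) = G x" by (rule eventually_mono[OF ev[of x]]) simp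
    qed
    show "AE x in N. norm (G x * log_cutoff (c * real (Suc n)) (G x)) \<le> norm (G x)" for n
      using log_cutoff_bounds by (intro AE_I2) (simp add: abs_mult mult_right_le_one_le)
  qed (use G \<chi>m in auto)
  show "(\<lambda>n. \<integral>x. G x * (log_cutoff (c * real (Suc n)) (G x))\<^sup>2 \<partial>N) \<longlonglongrightarrow> (\<integral>x. G x \<partial>N)"
  proof (rule integral_dominated_convergence[OF _ _ integrable_norm[OF G]])
    show "AE x in N. (\<lambda>n. G x * (log_cutoff (c * real (Suc n)) (G x))\<^sup>2) \<longlonglongrightarrow> G x"
    proof (rule AE_I2, rule tendsto_eventually)
      fix x
      show "\<forall>\<^sub>F n in sequentially. G x * (log_cutoff (c * real (Suc n)) (G x))\<^sup>2 = G x" by (rule eventually_mono[OF ev[of x]]) simp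
    qed
    show "AE x in N. norm (G x * (log_cutoff (c * real (Suc n)) (G x))\<^sup>2) \<le> norm (G x)" for n
      using log_cutoff_bounds by (intro AE_I2) (simp add: abs_mult mult_right_le_one_le power_le_one)
  qed (use G \<chi>m in auto)
qed

text \<open>The function is u = G^(1/2-t) \<chi>_k(G), so z is the cutoff itself and its energy is
  the integral of G \<chi>'^2 |\<nabla>G|^2. One factor -\<chi>' is bounded by b/(k G), the other is
  integrated by \<open>cutoff_equation\<close>. The last conjunct bounds the Hardy integral from
  below. As \<open>b\<close> comes from the step function alone, it does not depend on
  \<open>k\<close> or \<open>t\<close>.\<close>

lemma almost_extremal:
  "\<exists>b>0. \<forall>k>0. \<forall>t. \<exists>u\<in>LC. (\<integral>x. Qd t u (D u) x \<partial>N) \<le> b / k * (\<integral>x. G x \<partial>N) \<and>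
    (\<integral>x. Ms t u x \<partial>N) = (\<integral>x. G x * (log_cutoff k (G x))\<^sup>2 \<partial>N) \<and>
    (\<integral>x. G x * log_cutoff (k / 2) (G x) \<partial>N) \<le> b / (k / 2) * (\<integral>x. Hd t u x \<partial>N)"
proof -
  obtain b and \<chi>' :: "real \<Rightarrow> real \<Rightarrow> real" where b: "b > 0"
    and d: "\<And>k s. k > 0 \<Longrightarrow> s > 0 \<Longrightarrow> (log_cutoff k has_real_derivative \<chi>' k s) (at s)"
    and neg: "\<And>k s. k > 0 \<Longrightarrow> s > 0 \<Longrightarrow> \<chi>' k s \<le> 0"
    and b2: "\<And>k s. k > 0 \<Longrightarrow> s > 0 \<Longrightarrow> - \<chi>' k s \<le> b / k * (inverse s * (log_cutoff (2 * k) s)\<^sup>2)"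
    and b1: "\<And>k s. k > 0 \<Longrightarrow> s > 0 \<Longrightarrow> - \<chi>' k s * s \<le> b / k"
    by (rule log_cutoff_deriv) blast
  have G: "integrable N G" using G_integrable by (simp add: N_def S_def)
  have "\<exists>u\<in>LC. (\<integral>x. Qd t u (D u) x \<partial>N) \<le> b / k * (\<integral>x. G x \<partial>N) \<and>
    (\<integral>x. Ms t u x \<partial>N) = (\<integral>x. G x * (log_cutoff k (G x))\<^sup>2 \<partial>N) \<and>
    (\<integral>x. G x * log_cutoff (k / 2) (G x) \<partial>N) \<le> b / (k / 2) * (\<integral>x. Hd t u x \<partial>N)" if k: "k > 0" for k t :: real
  proof -
    define \<sigma> where "\<sigma> s = s powr (1/2 - t) * log_cutoff k s" for s
    define \<sigma>' where "\<sigma>' s = (1/2 - t) * s powr (1/2 - t - 1) * log_cutoff k s + s powr (1/2 - t) * \<chi>' k s" for s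
    define u where "u = (\<lambda>x. if x \<in> K then 0 else \<sigma> (G x))"
    have \<sigma>s: "smooth_on \<sigma> {0<..}" unfolding \<sigma>_def[abs_def] by (intro smooth_on_mult smooth_on_powr smooth_on_log_cutoff) auto
    have \<sigma>d: "(\<sigma> has_real_derivative \<sigma>' s) (at s)" if "s > 0" for s
      unfolding \<sigma>_def[abs_def] \<sigma>'_def
      using DERIV_mult[OF has_real_derivative_powr[OF that, of "1/2 - t"] d[OF k that]]
      by (simp add: algebra_simps)
    have u: "u \<in> LC" unfolding u_def
      by (rule LC_composition[OF \<sigma>s k]) (simp add: \<sigma>_def log_cutoff_eq_0[OF k])
    have uS: "u x = \<sigma> (G x)" if "x \<in> S" for x using that by (simp add: u_def S_def)
    have \<sigma>GS: "smooth_on (\<lambda>x. \<sigma> (G x)) S"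
      by (rule smooth_on_compose[OF open_S open_greaterThan _ \<sigma>s smooth_G_S]) (simp add: G_pos_S)
    have "weak_gradient S u (grad (\<lambda>x. \<sigma> (G x)))"
      by (rule weak_gradient_cong[OF open_S _ weak_gradient_smooth[OF open_S \<sigma>GS]]) (simp add: uS)
    from wgrad_AE_eq[OF open_S this] have "AE x in N. D u x = grad (\<lambda>x. \<sigma> (G x)) x" unfolding N_def .
    then have Du: "AE x in N. D u x = \<sigma>' (G x) *\<^sub>R grad G x"
      using AE_space by eventually_elim (simp add: grad_compose[OF open_S smooth_G_S _ \<sigma>d[OF G_pos_S]])
    have pw: "G x powr (2 * t) * (G x powr (1/2 - t))\<^sup>2 = G x" if "x \<in> S" for x
      using G_pos_S[OF that] powr_add[of "G x" "1/2 - t" "1/2 - t"] powr_add[of "G x" "2 * t" "1 - 2 * t"]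
      by (simp add: power2_eq_square)
    have pw2: "G x powr (2 * t - 2) * (G x powr (1/2 - t))\<^sup>2 = inverse (G x)" if "x \<in> S" for x
      using pw[OF that] powr_expand(1)[OF that, of t] G_pos_S[OF that] by (simp add: field_simps power2_eq_square)
    have Q: "AE x in N. Qd t u (D u) x = G x * (\<chi>' k (G x))\<^sup>2 * h x"
      using Du AE_space
    proof eventually_elim
      case (elim x)
      then have x: "x \<in> S" by simp
      have g: "G x > 0" by (rule G_pos_S[OF x])
      have "\<sigma>' (G x) + (t - 1/2) * u x / G x = G x powr (1/2 - t) * \<chi>' k (G x)"
      proof -
        define Z where "Z = G x powr (1/2 - t - 1)"
        have "G x powr (1/2 - t) = G x * Z" unfolding Z_def using g by (simp add: powr_mult_base)
        then show ?thesis
          unfolding uS[OF x] \<sigma>_def \<sigma>'_def Z_def[symmetric] using g by (simp add: field_simps)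
      qed
      then have "D u x + ((t - 1/2) * u x / G x) *\<^sub>R grad G x = (G x powr (1/2 - t) * \<chi>' k (G x)) *\<^sub>R grad G x"
        unfolding elim(1) by (simp flip: scaleR_left_distrib)
      then have "Qd t u (D u) x = (G x powr (2 * t) * (G x powr (1/2 - t))\<^sup>2) * (\<chi>' k (G x))\<^sup>2 * h x"
        unfolding Qd_def by (simp add: sq_norm_wrt_scale h_def power_mult_distrib)
      then show ?case unfolding pw[OF x] .
    qed
    have CE: "integrable N (\<lambda>x. \<chi>' k (G x) * h x)" "integrable N (\<lambda>x. G x * log_cutoff k (G x))"
      "(\<integral>x. - \<chi>' k (G x) * h x \<partial>N) = (\<integral>x. G x * log_cutoff k (G x) \<partial>N)"
      by (rule cutoff_equation[OF k], erule d[OF k])+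
    have "(\<integral>x. Qd t u (D u) x \<partial>N) \<le> (\<integral>x. b / k * (- \<chi>' k (G x) * h x) \<partial>N)"
    proof (rule integral_mono_AE[OF weighted_identity(1)[OF u]])
      show "integrable N (\<lambda>x. b / k * (- \<chi>' k (G x) * h x))" using CE(1) by simp
      show "AE x in N. Qd t u (D u) x \<le> b / k * (- \<chi>' k (G x) * h x)"
        using Q AE_space
      proof eventually_elim
        case (elim x)
        then have x: "x \<in> S" by simp
        have "(- \<chi>' k (G x) * G x) * (- \<chi>' k (G x) * h x) \<le> b / k * (- \<chi>' k (G x) * h x)"
          using neg[OF k G_pos_S[OF x]] h_nonneg[OF x]
          by (intro mult_right_mono b1[OF k G_pos_S[OF x]]) (simp add: mult_nonpos_nonneg)
        then show ?case unfolding elim(1) by (simp add: power2_eq_square mult_ac)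
      qed
    qed
    also have "\<dots> = b / k * (\<integral>x. G x * log_cutoff k (G x) \<partial>N)"
      unfolding CE(3)[symmetric] by (rule integral_mult_right_zero)
    also have "\<dots> \<le> b / k * (\<integral>x. G x \<partial>N)"
    proof (intro mult_left_mono integral_mono[OF CE(2) G])
      show "G x * log_cutoff k (G x) \<le> G x" if "x \<in> space N" for x
        using G_pos_S[of x] that log_cutoff_bounds[of k "G x"] by (simp add: mult_right_le_one_le)
    qed (use b k in simp)
    finally have 1: "(\<integral>x. Qd t u (D u) x \<partial>N) \<le> b / k * (\<integral>x. G x \<partial>N)" .
    have 2: "(\<integral>x. Ms t u x \<partial>N) = (\<integral>x. G x * (log_cutoff k (G x))\<^sup>2 \<partial>N)"
    proof (rule Bochner_Integration.integral_cong[OF refl])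
      fix x assume "x \<in> space N"
      then have x: "x \<in> S" by simp
      have "Ms t u x = (G x powr (2 * t) * (G x powr (1/2 - t))\<^sup>2) * (log_cutoff k (G x))\<^sup>2"
        unfolding Ms_def uS[OF x] \<sigma>_def by (simp add: power_mult_distrib)
      then show "Ms t u x = G x * (log_cutoff k (G x))\<^sup>2" unfolding pw[OF x] .
    qed
    \<comment> \<open>At half the level, the derivative of the cutoff is supported where \<chi>_k =
      1; hence it is dominated by the density of the Hardy integral of \<open>u\<close>.\<close>
    have k2: "k / 2 > 0" using k by simp
    have CE2: "integrable N (\<lambda>x. \<chi>' (k / 2) (G x) * h x)"
      "(\<integral>x. - \<chi>' (k / 2) (G x) * h x \<partial>N) = (\<integral>x. G x * log_cutoff (k / 2) (G x) \<partial>N)"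
      by (rule cutoff_equation[OF k2], erule d[OF k2])+
    have "(\<integral>x. - \<chi>' (k / 2) (G x) * h x \<partial>N) \<le> (\<integral>x. b / (k / 2) * Hd t u x \<partial>N)"
    proof (rule integral_mono)
      show "integrable N (\<lambda>x. - \<chi>' (k / 2) (G x) * h x)" using CE2(1) by simp
      show "integrable N (\<lambda>x. b / (k / 2) * Hd t u x)" by (rule integrable_mult_right[OF LC_terms_integrable(3)[OF u]])
      fix x assume "x \<in> space N"
      then have x: "x \<in> S" by simp
      have "Hd t u x = (G x powr (2 * t - 2) * (G x powr (1/2 - t))\<^sup>2) * h x * (log_cutoff k (G x))\<^sup>2"
        unfolding Hd_def uS[OF x] \<sigma>_def by (simp add: power_mult_distrib)
      then have H: "Hd t u x = inverse (G x) * h x * (log_cutoff k (G x))\<^sup>2" unfolding pw2[OF x] .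
      have "- \<chi>' (k / 2) (G x) * h x \<le> (b / (k / 2) * (inverse (G x) * (log_cutoff (2 * (k / 2)) (G x))\<^sup>2)) * h x"
        by (rule mult_right_mono[OF b2[OF k2 G_pos_S[OF x]] h_nonneg[OF x]])
      then show "- \<chi>' (k / 2) (G x) * h x \<le> b / (k / 2) * Hd t u x" unfolding H by (simp add: mult_ac)
    qed
    then have 3: "(\<integral>x. G x * log_cutoff (k / 2) (G x) \<partial>N) \<le> b / (k / 2) * (\<integral>x. Hd t u x \<partial>N)"
      unfolding CE2(2) by simp
    from 1 2 3 u show ?thesis by blast
  qed
  with b show ?thesis by blast
qed

text \<open>By the weighted identity the energy is the difference of the two sides of the
  inequality, so a function with energy below \<delta> times its mass refutes the inequality with
  mass constant lowered by \<delta>. For the almost extremal functions the energy is O(1/k), while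
  the mass tends to the positive integral of \<open>G\<close>.\<close>

lemma mass_constant_optimal:
  assumes "\<delta> > 0"
  shows "\<exists>u\<in>LC. (\<integral>x. Qd t u (D u) x \<partial>N) < \<delta> * (\<integral>x. Ms t u x \<partial>N)"
proof -
  obtain b where b: "b > 0" and ex: "\<And>k t. k > 0 \<Longrightarrow> \<exists>u\<in>LC. (\<integral>x. Qd t u (D u) x \<partial>N) \<le> b / k * (\<integral>x. G x \<partial>N) \<and>
    (\<integral>x. Ms t u x \<partial>N) = (\<integral>x. G x * (log_cutoff k (G x))\<^sup>2 \<partial>N) \<and>
    (\<integral>x. G x * log_cutoff (k / 2) (G x) \<partial>N) \<le> b / (k / 2) * (\<integral>x. Hd t u x \<partial>N)"
    using almost_extremal by blast
  define I where "I = (\<integral>x. G x \<partial>N)"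
  have I: "I > 0" unfolding I_def by (rule G_integral_pos)
  have "(\<lambda>n. \<delta> * (\<integral>x. G x * (log_cutoff (1 * real (Suc n)) (G x))\<^sup>2 \<partial>N) - b * inverse (real (Suc n)) * I) \<longlonglongrightarrow> \<delta> * I - b * 0 * I"
    unfolding I_def by (intro tendsto_intros cutoff_mass_tendsto LIMSEQ_inverse_real_of_nat) simp
  then have "eventually (\<lambda>n. 0 < \<delta> * (\<integral>x. G x * (log_cutoff (1 * real (Suc n)) (G x))\<^sup>2 \<partial>N) - b * inverse (real (Suc n)) * I) sequentially"
    by (rule order_tendstoD(1)) (use assms I in simp)
  from eventually_happens'[OF sequentially_bot this] obtain n
    where n: "0 < \<delta> * (\<integral>x. G x * (log_cutoff (1 * real (Suc n)) (G x))\<^sup>2 \<partial>N) - b * inverse (real (Suc n)) * I" ..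
  have "real (Suc n) > 0" by simp
  from ex[OF this, of t] obtain u where u: "u \<in> LC" "(\<integral>x. Qd t u (D u) x \<partial>N) \<le> b / real (Suc n) * I"
    "(\<integral>x. Ms t u x \<partial>N) = (\<integral>x. G x * (log_cutoff (real (Suc n)) (G x))\<^sup>2 \<partial>N)"
    unfolding I_def by blast
  have "(\<integral>x. Qd t u (D u) x \<partial>N) < \<delta> * (\<integral>x. Ms t u x \<partial>N)"
    using u(2) n unfolding u(3) by (simp only: divide_inverse mult_1 diff_gt_0_iff_gt)
  then show ?thesis using u(1) by blast
qed

text \<open>The truncated mass at level k/2 tends to the positive integral of \<open>G\<close> and
  is at most 2b/k times the Hardy integral. With k >= 1 this keeps the Hardy integral away from
  zero, while the energy tends to 0.\<close>

lemma hardy_constant_optimal: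
  assumes \<delta>: "\<delta> > 0"
  shows "\<exists>u\<in>LC. (\<integral>x. Qd t u (D u) x \<partial>N) < \<delta> * (\<integral>x. Hd t u x \<partial>N)"
proof -
  obtain b where b: "b > 0" and ex: "\<And>k t. k > 0 \<Longrightarrow> \<exists>u\<in>LC. (\<integral>x. Qd t u (D u) x \<partial>N) \<le> b / k * (\<integral>x. G x \<partial>N) \<and>
    (\<integral>x. Ms t u x \<partial>N) = (\<integral>x. G x * (log_cutoff k (G x))\<^sup>2 \<partial>N) \<and>
    (\<integral>x. G x * log_cutoff (k / 2) (G x) \<partial>N) \<le> b / (k / 2) * (\<integral>x. Hd t u x \<partial>N)"
    using almost_extremal by blast
  define I where "I = (\<integral>x. G x \<partial>N)"
  have I: "I > 0" unfolding I_def by (rule G_integral_pos)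
  have "(\<lambda>n. \<delta> * (\<integral>x. G x * log_cutoff (1/2 * real (Suc n)) (G x) \<partial>N) / (2 * b) - b * inverse (real (Suc n)) * I) \<longlonglongrightarrow> \<delta> * I / (2 * b) - b * 0 * I"
    unfolding I_def using b by (intro tendsto_intros cutoff_mass_tendsto LIMSEQ_inverse_real_of_nat) auto
  then have "eventually (\<lambda>n. 0 < \<delta> * (\<integral>x. G x * log_cutoff (1/2 * real (Suc n)) (G x) \<partial>N) / (2 * b) - b * inverse (real (Suc n)) * I) sequentially"
    by (rule order_tendstoD(1)) (use assms I b in simp)
  from eventually_happens'[OF sequentially_bot this] obtain n
    where n: "0 < \<delta> * (\<integral>x. G x * log_cutoff (1/2 * real (Suc n)) (G x) \<partial>N) / (2 * b) - b * inverse (real (Suc n)) * I" ..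
  define k where "k = real (Suc n)"
  have k: "k > 0" "k \<ge> 1" by (simp_all add: k_def)
  obtain u where u: "u \<in> LC" "(\<integral>x. Qd t u (D u) x \<partial>N) \<le> b / k * I"
    "(\<integral>x. G x * log_cutoff (k / 2) (G x) \<partial>N) \<le> b / (k / 2) * (\<integral>x. Hd t u x \<partial>N)"
    using ex[OF k(1), of t] unfolding I_def by blast
  define M where "M = (\<integral>x. G x * log_cutoff (k / 2) (G x) \<partial>N)"
  define H where "H = (\<integral>x. Hd t u x \<partial>N)"
  have H0: "0 \<le> H" unfolding H_def by (intro integral_nonneg_AE AE_N_I Hd_nonneg)
  have "M \<le> 2 * b / k * H" using u(3) by (simp add: M_def H_def mult.commute[of b 2])
  also have "\<dots> \<le> 2 * b * H"
  proof (rule mult_right_mono[OF _ H0])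
    show "2 * b / k \<le> 2 * b" using b k by (simp add: divide_le_eq)
  qed
  finally have "M / (2 * b) \<le> H" using b by (simp add: field_simps)
  then have "\<delta> * (M / (2 * b)) \<le> \<delta> * H" using \<delta> by (intro mult_left_mono) auto
  moreover have "b / k * I < \<delta> * (M / (2 * b))"
  proof -
    have "1/2 * k = k / 2" by simp
    from n[folded k_def, unfolded this, folded M_def] have "b * inverse k * I < \<delta> * M / (2 * b)" by simp
    moreover have "b / k * I = b * inverse k * I" by (simp only: divide_inverse)
    moreover have "\<delta> * (M / (2 * b)) = \<delta> * M / (2 * b)" by simp
    ultimately show ?thesis by (simp only:)
  qed
  ultimately have "(\<integral>x. Qd t u (D u) x \<partial>N) < \<delta> * H" using u(2) by linarith
  then show ?thesis using u(1) unfolding H_def by blast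
qed

end

section \<open>Neumann interior weights\<close>

text \<open>No measurability is assumed: by completeness \<open>f\<close> and \<open>g\<close> are
  measurable together, and if they are not, both integrals take the default value 0.\<close>

lemma lebesgue_integral_AE_eq:
  fixes f g :: "'a::euclidean_space \<Rightarrow> real"
  assumes AE: "AE x in lebesgue. f x = g x"
  shows "integrable lebesgue f \<longleftrightarrow> integrable lebesgue g" "integral\<^sup>L lebesgue f = integral\<^sup>L lebesgue g"
proof -
  have AE': "AE x in lebesgue. g x = f x" using AE by eventually_elim simp
  have m: "f \<in> borel_measurable lebesgue \<longleftrightarrow> g \<in> borel_measurable lebesgue"
    using borel_measurable_AE[OF _ AE] borel_measurable_AE[OF _ AE'] by blast
  show i: "integrable lebesgue f \<longleftrightarrow> integrable lebesgue g"
  proof (cases "f \<in> borel_measurable lebesgue")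
    case True
    then show ?thesis using m by (intro integrable_cong_AE[OF _ _ AE]) auto
  next
    case False
    then show ?thesis using m borel_measurable_integrable by blast
  qed
  show "integral\<^sup>L lebesgue f = integral\<^sup>L lebesgue g"
  proof (cases "f \<in> borel_measurable lebesgue")
    case True
    then show ?thesis using m by (intro integral_cong_AE[OF _ _ AE]) auto
  next
    case False
    then have "\<not> integrable lebesgue f" "\<not> integrable lebesgue g" using m borel_measurable_integrable by blast+
    then show ?thesis by (simp add: not_integrable_integral_eq)
  qed
qed

lemma set_integral_minus_null:
  fixes f g :: "'a::euclidean_space \<Rightarrow> real"
  assumes S: "\<Omega> - K \<in> sets lebesgue" and K: "K \<in> null_sets lebesgue" and eq: "\<And>x. x \<in> \<Omega> - K \<Longrightarrow> f x = g x"
  shows "set_integrable lebesgue \<Omega> f \<longleftrightarrow> integrable (lebesgue_on (\<Omega> - K)) g"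
    "set_lebesgue_integral lebesgue \<Omega> f = integral\<^sup>L (lebesgue_on (\<Omega> - K)) g"
proof -
  have "AE x in lebesgue. x \<notin> K" using K by (rule AE_not_in)
  then have AE: "AE x in lebesgue. indicator \<Omega> x *\<^sub>R f x = indicator (\<Omega> - K) x *\<^sub>R g x"
    by eventually_elim (use eq in \<open>auto simp: indicator_def\<close>)
  show "set_integrable lebesgue \<Omega> f \<longleftrightarrow> integrable (lebesgue_on (\<Omega> - K)) g"
    using lebesgue_integral_AE_eq(1)[OF AE] set_integrable_iff_lebesgue_on[OF S, of g] by (simp add: set_integrable_def)
  show "set_lebesgue_integral lebesgue \<Omega> f = integral\<^sup>L (lebesgue_on (\<Omega> - K)) g"
    using lebesgue_integral_AE_eq(2)[OF AE] set_integral_eq_lebesgue_on[OF S, of g] by (simp add: set_lebesgue_integral_def)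
qed

text \<open>For small \<open>r\<close> the quotient in the definition of the box dimension exceeds \<open>1\<close>, so that the
  \<open>r\<close>-neighbourhood of \<open>K\<close> has measure less than \<open>r\<close>. If this measure is \<open>0\<close>, the quotient is \<open>0\<close>,
  because \<open>ln 0 = 0\<close>.\<close>

lemma box_dim_null:
  fixes K :: "(real^'n) set"
  assumes d: "has_box_dim \<Omega> K d" "d < real CARD('n) - 2"
    and \<Omega>: "open \<Omega>" "bounded \<Omega>" and K: "compact K" "K \<subseteq> \<Omega>"
  shows "K \<in> null_sets lebesgue"
proof -
  define m where "m r = measure lebesgue {x \<in> \<Omega>. infdist x K < r}" for r
  have "eventually (\<lambda>r. ln (m r) / ln r > 1) (at_right 0)"
    using d unfolding has_box_dim_def m_def by (intro order_tendstoD(1)) auto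
  then obtain \<delta> where \<delta>: "\<delta> > 0" "\<And>r. 0 < r \<Longrightarrow> r < \<delta> \<Longrightarrow> ln (m r) / ln r > 1"
    unfolding eventually_at_right_field by blast
  have le: "measure lebesgue K \<le> r" if "0 < r" "r < min \<delta> 1" for r
  proof -
    have "ln r < 0" using that by simp
    then have *: "ln (m r) < ln r" using \<delta>(2)[of r] that by (simp add: less_divide_eq)
    have "m r > 0"
    proof (rule ccontr)
      assume "\<not> m r > 0"
      then have "m r = 0" by (simp add: m_def less_le)
      then show False using * \<open>ln r < 0\<close> by simp
    qed
    then have "m r < r" using * that by simp
    moreover have "measure lebesgue K \<le> m r"
      unfolding m_def
    proof (rule measure_mono_fmeasurable)
      show "K \<subseteq> {x \<in> \<Omega>. infdist x K < r}" using K that by auto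
      show "K \<in> sets lebesgue" by (rule compact_sets_lebesgue[OF K(1)])
      have "open (\<Omega> \<inter> (\<lambda>x. infdist x K) -` {..<r})"
        by (intro continuous_open_preimage \<Omega> continuous_intros open_lessThan)
      moreover have "\<Omega> \<inter> (\<lambda>x. infdist x K) -` {..<r} = {x \<in> \<Omega>. infdist x K < r}" by auto
      ultimately show "{x \<in> \<Omega>. infdist x K < r} \<in> lmeasurable"
        using \<Omega>(2) by (intro lmeasurable_open) (auto intro: bounded_subset)
    qed
    ultimately show ?thesis by simp
  qed
  have "measure lebesgue K \<le> 0"
  proof (rule field_le_epsilon)
    fix e :: real assume "e > 0"
    then have "measure lebesgue K \<le> min (min \<delta> 1 / 2) e" using \<delta>(1) by (intro le) auto
    then show "measure lebesgue K \<le> 0 + e" by simp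
  qed
  then have "measure lebesgue K = 0" by (simp add: measure_le_0_iff)
  then show ?thesis
    using lmeasurable_compact[OF K(1)] by (metis negligible_iff_measure0 negligible_iff_null_sets)
qed

text \<open>The complement of the support is a union of open null sets, and Lindelof's theorem makes
  this union countable.\<close>

lemma measure_support_null:
  fixes \<mu> :: "'a::second_countable_topology measure"
  assumes \<mu>: "sets \<mu> = sets borel"
  shows "- measure_support \<mu> \<in> null_sets \<mu>"
proof -
  define F where "F = {V. open V \<and> emeasure \<mu> V = 0}"
  have "open V" if "V \<in> F" for V using that by (simp add: F_def)
  then obtain F' where F': "F' \<subseteq> F" "countable F'" "\<Union>F' = \<Union>F" using Lindelof[of F] by blast
  have "V \<in> null_sets \<mu>" if "V \<in> F'" for V using that F'(1) \<mu> by (auto simp: F_def null_sets_def)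
  then have "\<Union>F' \<in> null_sets \<mu>" using null_sets_UN'[OF F'(2), of "\<lambda>V. V" \<mu>] by simp
  moreover have "- measure_support \<mu> = \<Union>F" unfolding measure_support_def F_def by auto
  ultimately show ?thesis using F'(3) by simp
qed

text \<open>The weight and each entry of the matrix come with their own smooth extension on their
  own neighbourhood; all are restricted to one set \<open>U\<close>. The equation, the blow-up and
  the Neumann condition concern points of \<Omega> - K, where the extensions agree with the given
  data together with their derivatives.\<close>

lemma neumann_weight_extension:
  fixes \<Omega> K :: "(real^'n) set"
  assumes dom: "smooth_bounded_domain \<Omega>" and ell: "smooth_elliptic_matrix \<Omega> A" and niw: "neumann_interior_weight \<Omega> A K E"
  obtains U B G c\<^sub>0 c\<^sub>1 where "weight \<Omega> K U B G c\<^sub>0 c\<^sub>1"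
    "\<And>x. x \<in> \<Omega> - K \<Longrightarrow> G x = E x" "\<And>x. x \<in> \<Omega> - K \<Longrightarrow> B x = A x" "\<And>x. x \<in> \<Omega> - K \<Longrightarrow> grad E x = grad G x"
proof -
  have \<Omega>: "open \<Omega>" "\<Omega> \<noteq> {}" "bounded \<Omega>" "smooth_boundary \<Omega>" using dom by (auto simp: smooth_bounded_domain_def)
  note niw' = niw[unfolded neumann_interior_weight_def]
  have K: "compact K" "K \<subseteq> \<Omega>" using niw' by simp_all
  have Kc: "closed K" by (rule compact_imp_closed[OF K(1)])
  define S where "S = \<Omega> - K"
  have oS: "open S" using \<Omega> Kc by (auto simp: S_def)
  have K0: "K \<in> null_sets lebesgue"
  proof -
    obtain d where "has_box_dim \<Omega> K d" "d < real CARD('n) - 2" using niw' by (elim conjE exE)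
    then show ?thesis by (rule box_dim_null[OF _ _ \<Omega>(1,3) K])
  qed
  obtain U0 G where U0: "open U0" "closure \<Omega> - K \<subseteq> U0" "smooth_on G U0" and GE: "\<And>x. x \<in> closure \<Omega> - K \<Longrightarrow> G x = E x"
  proof -
    have "smooth_upto E (closure \<Omega> - K)" using niw' by simp
    then show thesis unfolding smooth_upto_def using that by (elim exE conjE) (simp add: that)
  qed
  have "\<forall>i j. \<exists>V a. open V \<and> closure \<Omega> \<subseteq> V \<and> smooth_on a V \<and> (\<forall>x\<in>closure \<Omega>. a x = A x $ i $ j)"
    using ell unfolding smooth_elliptic_matrix_def smooth_upto_def by blast
  then obtain V a where V: "\<And>i j. open (V i j)" "\<And>i j. closure \<Omega> \<subseteq> V i j" "\<And>i j. smooth_on (a i j) (V i j)"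
    and aA: "\<And>i j x. x \<in> closure \<Omega> \<Longrightarrow> a i j x = A x $ i $ j"
    by metis
  define B :: "real^'n \<Rightarrow> real^'n^'n" where "B x = (\<chi> i j. a i j x)" for x
  have BA: "B x = A x" if "x \<in> closure \<Omega>" for x using aA[OF that] by (simp add: B_def vec_eq_iff)
  define V' where "V' = (\<Inter>i. \<Inter>j. V i j)"
  have V': "open V'" "closure \<Omega> \<subseteq> V'" unfolding V'_def using V(1) by (auto intro!: open_INT) (use V(2) in blast)
  obtain e where e: "e > 0" "\<And>x. x \<in> S \<Longrightarrow> e \<le> E x" using niw' unfolding S_def by (elim conjE exE) simp
  have Gc: "continuous_on U0 G" by (rule smooth_on_imp_continuous_on[OF U0(3)])
  \<comment> \<open>At a boundary point positivity is inherited from the lower bound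
    \<open>e\<close> at nearby points of \<Omega> - K, by continuity of the extension.\<close>
  have Gpos: "G x > 0" if x: "x \<in> closure \<Omega> - K" for x
  proof (rule ccontr)
    assume "\<not> G x > 0"
    then have "x \<in> U0 \<inter> G -` {..<e}" using x U0(2) e(1) by auto
    moreover have "open (U0 \<inter> G -` {..<e})" by (rule continuous_open_preimage[OF Gc U0(1) open_lessThan])
    ultimately have "open (U0 \<inter> G -` {..<e} - K)" "x \<in> U0 \<inter> G -` {..<e} - K" using Kc x by auto
    then obtain y where "y \<in> \<Omega>" "y \<in> U0 \<inter> G -` {..<e} - K"
      using x closure_iff_nhds_not_empty[of x \<Omega>] by blast
    then show False using e(2)[of y] GE[of y] closure_subset[of \<Omega>] by (auto simp: S_def)
  qed
  \<comment> \<open>The domain of the extended weight is cut down to where it is positive, so that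
    real powers of \<open>G\<close> are smooth on \<open>U\<close>, and to the common domain of the
    entries.\<close>
  define U where "U = (U0 \<inter> G -` {0<..}) \<inter> V' - K"
  have U: "open U" unfolding U_def using continuous_open_preimage[OF Gc U0(1) open_greaterThan[of 0]] V'(1) Kc by auto
  have U2: "closure \<Omega> - K \<subseteq> U" using U0(2) Gpos V'(2) by (auto simp: U_def)
  have SU: "S \<subseteq> U" using U2 closure_subset[of \<Omega>] by (auto simp: S_def)
  have Scl: "S \<subseteq> closure \<Omega> - K" using closure_subset[of \<Omega>] by (auto simp: S_def)
  have smG: "smooth_on G U" by (rule smooth_on_subset[OF U0(1) U _ U0(3)]) (auto simp: U_def)
  have smB: "smooth_on (\<lambda>x. B x $ i $ j) U" for i j
    using smooth_on_subset[OF V(1) U _ V(3), of i j] by (auto simp: U_def V'_def B_def)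
  have GS: "smooth_on G S" by (rule smooth_on_subset[OF U oS SU smG])
  have gradE: "grad E x = grad G x" if "x \<in> S" for x
    using Scl GE by (intro grad_cong[OF oS that _ GS]) auto
  have BS: "B x = A x" if "x \<in> S" for x using Scl that by (intro BA) auto
  obtain c\<^sub>0 where c0: "c\<^sub>0 > 0" "\<And>x \<xi>. x \<in> closure \<Omega> \<Longrightarrow> sq_norm_wrt (A x) \<xi> \<ge> c\<^sub>0 * (norm \<xi>)\<^sup>2"
    using ell unfolding smooth_elliptic_matrix_def by blast
  have clc: "compact (closure \<Omega>)" using \<Omega>(3) by (simp add: compact_closure)
  have "\<exists>m. \<forall>x\<in>closure \<Omega>. \<bar>B x $ i $ j\<bar> \<le> m" for i j
  proof -
    have "continuous_on (closure \<Omega>) (\<lambda>x. B x $ i $ j)"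
      using continuous_on_subset[OF smooth_on_imp_continuous_on[OF V(3)[of i j]] V(2)] by (simp add: B_def)
    then have "bounded ((\<lambda>x. B x $ i $ j) ` closure \<Omega>)" by (intro compact_imp_bounded compact_continuous_image clc)
    then show ?thesis unfolding bounded_iff by auto
  qed
  then obtain m where m: "\<And>i j x. x \<in> closure \<Omega> \<Longrightarrow> \<bar>B x $ i $ j\<bar> \<le> m i j" by metis
  \<comment> \<open>Bounds of all entries add up to a bound of the operator norm; the summand 1
    ensures that the constant is positive.\<close>
  define c\<^sub>1 where "c\<^sub>1 = 1 + (\<Sum>i\<in>UNIV. \<Sum>j\<in>UNIV. \<bar>m i j\<bar>)"
  have c1: "c\<^sub>1 > 0" unfolding c\<^sub>1_def by (intro add_pos_nonneg sum_nonneg) auto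
  have Bb: "norm (B x *v \<xi>) \<le> c\<^sub>1 * norm \<xi>" if "x \<in> S" for x \<xi>
  proof -
    have x: "x \<in> closure \<Omega>" using that Scl by auto
    have "norm (B x *v \<xi>) \<le> (\<Sum>i\<in>UNIV. \<bar>(B x *v \<xi>) $ i\<bar>)" by (rule norm_le_l1_cart)
    also have "\<dots> \<le> (\<Sum>i\<in>UNIV. \<Sum>j\<in>UNIV. \<bar>m i j\<bar> * norm \<xi>)"
    proof (rule sum_mono)
      fix i
      have "\<bar>(B x *v \<xi>) $ i\<bar> \<le> (\<Sum>j\<in>UNIV. \<bar>B x $ i $ j * \<xi> $ j\<bar>)" by (simp add: matrix_vector_mult_def sum_abs)
      also have "\<dots> \<le> (\<Sum>j\<in>UNIV. \<bar>m i j\<bar> * norm \<xi>)"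
        unfolding abs_mult using m[OF x] component_le_norm_cart
        by (intro sum_mono mult_mono) (auto intro: order_trans[OF m[OF x]])
      finally show "\<bar>(B x *v \<xi>) $ i\<bar> \<le> (\<Sum>j\<in>UNIV. \<bar>m i j\<bar> * norm \<xi>)" .
    qed
    also have "\<dots> = (\<Sum>i\<in>UNIV. \<Sum>j\<in>UNIV. \<bar>m i j\<bar>) * norm \<xi>" by (simp add: sum_distrib_right)
    also have "\<dots> \<le> c\<^sub>1 * norm \<xi>" unfolding c\<^sub>1_def by (intro mult_right_mono) auto
    finally show ?thesis .
  qed
  obtain \<mu> where \<mu>: "sets \<mu> = sets borel" "measure_support \<mu> = K" "distributional_equation \<Omega> A E \<mu>"
    using niw' by (elim conjE exE)
  have Ss: "\<Omega> - K \<in> sets lebesgue" using oS by (simp add: S_def)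
  have Eloc: "\<And>C. compact C \<Longrightarrow> C \<subseteq> \<Omega> \<Longrightarrow> set_integrable lebesgue C E"
    using \<mu>(3) by (auto simp: distributional_equation_def locally_integrable_def)
  have GU: "continuous_on U G" by (rule smooth_on_imp_continuous_on[OF smG])
  \<comment> \<open>Local integrability in \<Omega> covers a compact neighbourhood \<open>Q\<close>
    of \<open>K\<close> inside \<Omega>. The remaining part \<open>R\<close> reaches the boundary,
    but it is compact and avoids \<open>K\<close>, so continuity of the extension suffices
    there.\<close>
  have Gint: "set_integrable lebesgue S G"
  proof (cases "K = {}")
    case True
    then have "set_integrable lebesgue (closure \<Omega>) G"
      using U2 by (intro set_integrable_continuous_compact clc continuous_on_subset[OF GU]) auto
    then show ?thesis using oS Scl by (intro set_integrable_subset[of lebesgue "closure \<Omega>" G S]) auto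
  next
    case False
    obtain d where d: "d > 0" "{x. infdist x K \<le> d} \<subseteq> \<Omega>"
      using compact_in_open_separated[OF False K(1) \<Omega>(1) K(2)] by metis
    define Q where "Q = {x. infdist x K \<le> d}"
    define R where "R = closure \<Omega> \<inter> {x. d \<le> infdist x K}"
    have Q: "compact Q" unfolding Q_def using compact_infdist_le[OF False K(1) d(1)] .
    have "closed {x. d \<le> infdist x K}" by (intro closed_Collect_le continuous_intros)
    then have R: "compact R" unfolding R_def using clc by (rule compact_Int_closed[rotated])
    have RK: "R \<subseteq> closure \<Omega> - K" unfolding R_def using d(1) by auto
    have "set_integrable lebesgue R G"
      using RK U2 by (intro set_integrable_continuous_compact R continuous_on_subset[OF GU]) auto
    moreover have "set_integrable lebesgue (Q \<inter> S) G"
    proof -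
      have "set_integrable lebesgue (Q \<inter> S) E"
        by (rule set_integrable_subset[OF Eloc[OF Q]]) (use d oS compact_sets_lebesgue[OF Q] in \<open>auto simp: Q_def\<close>)
      moreover have "indicator (Q \<inter> S) x *\<^sub>R E x = indicator (Q \<inter> S) x *\<^sub>R G x" for x
        using GE[of x] Scl by (auto simp: indicator_def)
      ultimately show ?thesis unfolding set_integrable_def by (simp only:)
    qed
    ultimately have "set_integrable lebesgue (R \<union> Q \<inter> S) G"
      using compact_sets_lebesgue[OF R] compact_sets_lebesgue[OF Q] oS by (intro set_integrable_Un) auto
    moreover have "S \<subseteq> R \<union> Q \<inter> S" using Scl by (auto simp: R_def Q_def)
    ultimately show ?thesis using oS by (intro set_integrable_subset[of lebesgue "R \<union> Q \<inter> S" G S]) auto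
  qed
  have "weight \<Omega> K U B G c\<^sub>0 c\<^sub>1"
  proof
    show "open \<Omega>" "bounded \<Omega>" "\<Omega> \<noteq> {}" "smooth_boundary \<Omega>" "compact K" "K \<subseteq> \<Omega>" "K \<in> null_sets lebesgue"
      "open U" "closure \<Omega> - K \<subseteq> U" "smooth_on G U" "c\<^sub>0 > 0" "c\<^sub>1 > 0"
      by fact+
    show "U \<inter> K = {}" by (auto simp: U_def)
    show "smooth_on (\<lambda>x. B x $ i $ j) U" for i j by (rule smB)
    show "G x > 0" if "x \<in> U" for x using that by (auto simp: U_def)
    show "transpose (B x) = B x" if "x \<in> \<Omega> - K" for x
      using ell BS[of x] that closure_subset[of \<Omega>] by (auto simp: smooth_elliptic_matrix_def S_def)
    show "c\<^sub>0 * (norm \<xi>)\<^sup>2 \<le> sq_norm_wrt (B x) \<xi>" if "x \<in> \<Omega> - K" for x \<xi>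
      using c0(2)[of x \<xi>] BS[of x] that closure_subset[of \<Omega>] by (auto simp: S_def)
    show "norm (B x *v \<xi>) \<le> c\<^sub>1 * norm \<xi>" if "x \<in> \<Omega> - K" for x \<xi> using Bb[of x \<xi>] that by (simp add: S_def)
    show "integrable (lebesgue_on (\<Omega> - K)) G"
      using Gint Ss by (simp add: S_def set_integrable_iff_lebesgue_on)
    show "\<exists>V. open V \<and> x \<in> V \<and> (\<forall>y\<in>V \<inter> (\<Omega> - K). l < G y)" if x: "x \<in> K" for l x
    proof -
      have "filterlim E at_top (at x within \<Omega> - K)" using niw' x by simp
      then have "eventually (\<lambda>y. l < E y) (at x within \<Omega> - K)" by (simp add: filterlim_at_top_dense)
      then obtain V where "open V" "x \<in> V" "\<And>y. y \<in> V \<Longrightarrow> y \<noteq> x \<Longrightarrow> y \<in> \<Omega> - K \<Longrightarrow> l < E y"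
        unfolding eventually_at_topological by blast
      then show ?thesis using x GE Scl unfolding S_def by (intro exI[of _ V]) (metis DiffD2 IntE subsetD)
    qed
    show "((\<lambda>y. (B y *v grad G y) \<bullet> \<nu>) \<longlongrightarrow> 0) (at x within \<Omega>)" if x: "x \<in> frontier \<Omega>" and \<nu>: "outward_normal \<Omega> x \<nu>" for x \<nu>
    proof (rule Lim_transform_eventually)
      show "((\<lambda>y. (A y *v grad E y) \<bullet> \<nu>) \<longlongrightarrow> 0) (at x within \<Omega>)"
        using niw' x \<nu> by simp
      have "x \<in> - K" using x K(2) \<Omega>(1) by (auto simp: frontier_def interior_open)
      then show "\<forall>\<^sub>F y in at x within \<Omega>. (A y *v grad E y) \<bullet> \<nu> = (B y *v grad G y) \<bullet> \<nu>"
        unfolding eventually_at_topological using Kc gradE BS by (intro exI[of _ "- K"]) (auto simp: S_def)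
    qed
    fix \<phi> assume \<phi>: "\<phi> \<in> test_functions (\<Omega> - K)"
    then have \<phi>\<Omega>: "\<phi> \<in> test_functions \<Omega>" using test_functions_mono[of "\<Omega> - K" \<Omega>] by auto
    have eq: "(LINT x:\<Omega>|lebesgue. E x * (- divergence (\<lambda>y. A y *v grad \<phi> y) x)) + (LINT x:\<Omega>|lebesgue. E x * \<phi> x) = (LINT x|\<mu>. \<phi> x)"
      using \<mu>(3) \<phi>\<Omega> by (auto simp: distributional_equation_def)
    \<comment> \<open>The measure is carried by \<open>K\<close>, where test functions of \<Omega> -
      K vanish; so the right side of the equation drops out.\<close>
    have "AE x in \<mu>. x \<in> K"
      using AE_not_in[OF measure_support_null[OF \<mu>(1)]] \<mu>(2) by simp
    then have "AE x in \<mu>. \<phi> x = 0"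
      by eventually_elim (use \<phi> in \<open>auto simp: test_functions_def\<close>)
    then have z: "(LINT x|\<mu>. \<phi> x) = 0" by (rule integral_eq_zero_AE)
    have sm\<phi>: "smooth_on \<phi> UNIV" using \<phi> by (auto simp: test_functions_def)
    \<comment> \<open>Derivatives at a point of the open set \<open>S\<close> depend only on values
      in \<open>S\<close>, where \<open>A\<close> and \<open>B\<close> coincide.\<close>
    have dv: "divergence (\<lambda>y. A y *v grad \<phi> y) x = divergence (\<lambda>y. B y *v grad \<phi> y) x" if x: "x \<in> S" for x
    proof -
      have 1: "smooth_on (\<lambda>y. B y $ i $ j) S" for i j by (rule smooth_on_subset[OF U oS SU smB])
      have 2: "smooth_on (\<lambda>y. grad \<phi> y $ j) S" for j
        by (rule smooth_on_subset[OF open_UNIV oS subset_UNIV smooth_on_grad[OF sm\<phi>]])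
      have "smooth_on (\<lambda>y. \<Sum>j\<in>UNIV. B y $ i $ j * grad \<phi> y $ j) S" for i
        by (rule smooth_on_sum[OF oS], rule smooth_on_mult[OF oS 1 2])
      then have 3: "smooth_on (\<lambda>y. (B y *v grad \<phi> y) $ i) S" for i by (simp add: matrix_vector_mult_def)
      have "grad (\<lambda>y. (A y *v grad \<phi> y) $ i) x = grad (\<lambda>y. (B y *v grad \<phi> y) $ i) x" for i
        by (rule grad_cong[OF oS x _ 3]) (simp add: BS)
      then have "grad (\<lambda>y. (A y *v grad \<phi> y) $ i) x $ i = grad (\<lambda>y. (B y *v grad \<phi> y) $ i) x $ i" for i
        by simp
      then show ?thesis unfolding divergence_def grad_component by simp
    qed
    have "(LINT x:\<Omega>|lebesgue. E x * (- divergence (\<lambda>y. A y *v grad \<phi> y) x)) =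
        (\<integral>x. G x * (- divergence (\<lambda>y. B y *v grad \<phi> y) x) \<partial>lebesgue_on (\<Omega> - K))"
      by (rule set_integral_minus_null(2)[OF Ss K0]) (use dv GE Scl in \<open>auto simp: S_def\<close>)
    moreover have "(LINT x:\<Omega>|lebesgue. E x * \<phi> x) = (\<integral>x. G x * \<phi> x \<partial>lebesgue_on (\<Omega> - K))"
      by (rule set_integral_minus_null(2)[OF Ss K0]) (use GE Scl in \<open>auto simp: S_def\<close>)
    ultimately show "(\<integral>x. G x * (- divergence (\<lambda>y. B y *v grad \<phi> y) x) \<partial>lebesgue_on (\<Omega> - K)) +
        (\<integral>x. G x * \<phi> x \<partial>lebesgue_on (\<Omega> - K)) = 0"
      using eq z by simp
  qed
  then show thesis
    by (rule that) (use GE BS gradE Scl in \<open>auto simp: S_def\<close>)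
qed

context weight
begin

section \<open>Transfer between the given weight and its extension\<close>

lemma Omega_integral:
  fixes f g :: "real^'n \<Rightarrow> real"
  assumes "\<And>x. x \<in> S \<Longrightarrow> f x = g x"
  shows "set_integrable lebesgue \<Omega> f \<longleftrightarrow> integrable N g" "(LINT x:\<Omega>|lebesgue. f x) = (\<integral>x. g x \<partial>N)"
  using set_integral_minus_null[of \<Omega> K f g] assms S_lebesgue K_null unfolding N_def S_def by auto

lemma AE_Omega_iff: "(AE x in lebesgue_on \<Omega>. P x) \<longleftrightarrow> (AE x in N. P x)"
proof -
  have \<Omega>s: "\<Omega> \<in> sets lebesgue" using open_\<Omega> by simp
  have K: "AE x in lebesgue. x \<notin> K" using K_null by (rule AE_not_in)
  have "(AE x in lebesgue. x \<in> \<Omega> \<longrightarrow> P x) \<longleftrightarrow> (AE x in lebesgue. x \<in> S \<longrightarrow> P x)"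
  proof
    assume "AE x in lebesgue. x \<in> \<Omega> \<longrightarrow> P x"
    then show "AE x in lebesgue. x \<in> S \<longrightarrow> P x" by eventually_elim (auto simp: S_def)
  next
    assume "AE x in lebesgue. x \<in> S \<longrightarrow> P x"
    with K show "AE x in lebesgue. x \<in> \<Omega> \<longrightarrow> P x" by eventually_elim (auto simp: S_def)
  qed
  then show ?thesis using \<Omega>s S_lebesgue unfolding N_def by (simp add: AE_restrict_space_iff)
qed

lemma Y_norm_eq:
  assumes E: "\<And>x. x \<in> S \<Longrightarrow> G x = E x"
  shows "Y_norm \<Omega> K E t w = sqrt (nrm t w)"
proof -
  have 1: "(LINT x:\<Omega>|lebesgue. E x powr (2 * t) * (norm (wgrad (\<Omega> - K) w x))\<^sup>2) = (\<integral>x. G x powr (2 * t) * (norm (D w x))\<^sup>2 \<partial>N)"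
    by (rule Omega_integral(2)) (simp add: E, simp add: S_def)
  have 2: "(LINT x:\<Omega>|lebesgue. E x powr (2 * t) * (w x)\<^sup>2) = (\<integral>x. Ms t w x \<partial>N)"
    by (rule Omega_integral(2)) (simp add: E Ms_def)
  show ?thesis unfolding Y_norm_def nrm_def 1 2 ..
qed

lemma Y_spaceD:
  assumes E: "\<And>x. x \<in> S \<Longrightarrow> G x = E x" and u: "u \<in> Y_space \<Omega> K E t"
  obtains v where "Yseq t v u"
proof -
  obtain v where v: "\<And>k. v k \<in> LC" and C: "\<And>e. e > 0 \<Longrightarrow> \<exists>n. \<forall>j\<ge>n. \<forall>k\<ge>n. Y_norm \<Omega> K E t (\<lambda>x. v j x - v k x) < e"
    and lim: "AE x in lebesgue_on \<Omega>. (\<lambda>k. v k x) \<longlonglongrightarrow> u x"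
    using u unfolding Y_space_def by blast
  have "\<exists>n. \<forall>j\<ge>n. \<forall>k\<ge>n. nrm t (\<lambda>x. v j x - v k x) < e" if "e > 0" for e
    using C[of "sqrt e"] that by (simp add: Y_norm_eq[OF E])
  then have "Yseq t v u" using v lim unfolding Yseq_def AE_Omega_iff by blast
  then show thesis by (rule that)
qed

text \<open>The constant sequence represents \<open>u\<close>. That it is Cauchy still requires an
  argument, since the chosen weak gradient of the zero function is 0 only almost everywhere.\<close>

lemma LC_subset_Y_space:
  assumes E: "\<And>x. x \<in> S \<Longrightarrow> G x = E x" and u: "u \<in> LC"
  shows "u \<in> Y_space \<Omega> K E t"
proof -
  have D0: "AE x in N. D (\<lambda>x. u x - u x) x = 0" using D_diff[OF u u] by simp
  have "(\<integral>x. G x powr (2 * t) * (norm (D (\<lambda>x. u x - u x) x))\<^sup>2 \<partial>N) = 0"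
    by (rule integral_eq_zero_AE) (use D0 in \<open>eventually_elim, simp\<close>)
  moreover have "Ms t (\<lambda>x. u x - u x) = (\<lambda>x. 0)" by (rule ext) (simp add: Ms_def)
  ultimately have "nrm t (\<lambda>x. u x - u x) = 0" by (simp add: nrm_def)
  then have "Y_norm \<Omega> K E t (\<lambda>x. u x - u x) = 0" by (simp only: Y_norm_eq[OF E] real_sqrt_zero)
  then show ?thesis unfolding Y_space_def using u by (auto intro!: exI[of _ "\<lambda>_. u"])
qed

end

text \<open>The integral of a function that is not integrable is 0 by convention, and
  \<open>wgrad\<close> is meaningless without a weak gradient; for this reason existence and
  integrability are asserted together with the inequality.\<close>

theorem theorem2p14:
  fixes \<Omega> K :: "(real^'n) set"
    and A :: "real^'n \<Rightarrow> real^'n^'n"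
    and E :: "real^'n \<Rightarrow> real"
    and t :: real
  assumes "smooth_bounded_domain \<Omega>"
    and "smooth_elliptic_matrix \<Omega> A"
    and "neumann_interior_weight \<Omega> A K E"
    and "t \<noteq> 1/2"
  shows "(\<forall>u\<in>Y_space \<Omega> K E t.
           weak_gradient (\<Omega> - K) u (wgrad (\<Omega> - K) u) \<and>
           set_integrable lebesgue \<Omega> (gradient_term \<Omega> A K E t u) \<and>
           set_integrable lebesgue \<Omega> (mass_term E t u) \<and>
           set_integrable lebesgue \<Omega> (hardy_term A E t u) \<and>
           (LINT x:\<Omega>|lebesgue. gradient_term \<Omega> A K E t u x)
             + (1/2 - t) * (LINT x:\<Omega>|lebesgue. mass_term E t u x)
           \<ge> (t - 1/2)\<^sup>2 * (LINT x:\<Omega>|lebesgue. hardy_term A E t u x)) \<and>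
         (\<forall>c < 1/2 - t. \<not> (\<forall>u\<in>Y_space \<Omega> K E t.
           (LINT x:\<Omega>|lebesgue. gradient_term \<Omega> A K E t u x)
             + c * (LINT x:\<Omega>|lebesgue. mass_term E t u x)
           \<ge> (t - 1/2)\<^sup>2 * (LINT x:\<Omega>|lebesgue. hardy_term A E t u x))) \<and>
         (\<forall>c > (t - 1/2)\<^sup>2. \<not> (\<forall>u\<in>Y_space \<Omega> K E t.
           (LINT x:\<Omega>|lebesgue. gradient_term \<Omega> A K E t u x)
             + (1/2 - t) * (LINT x:\<Omega>|lebesgue. mass_term E t u x)
           \<ge> c * (LINT x:\<Omega>|lebesgue. hardy_term A E t u x))) \<and>
         (\<forall>u\<in>Y_space \<Omega> K E t. \<not> (AE x in lebesgue_on \<Omega>. u x = 0) \<longrightarrow>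
           (LINT x:\<Omega>|lebesgue. gradient_term \<Omega> A K E t u x)
             + (1/2 - t) * (LINT x:\<Omega>|lebesgue. mass_term E t u x)
           \<noteq> (t - 1/2)\<^sup>2 * (LINT x:\<Omega>|lebesgue. hardy_term A E t u x))"
proof -
  obtain U B G c\<^sub>0 c\<^sub>1 where W: "weight \<Omega> K U B G c\<^sub>0 c\<^sub>1"
    and GE: "\<And>x. x \<in> \<Omega> - K \<Longrightarrow> G x = E x" and BA: "\<And>x. x \<in> \<Omega> - K \<Longrightarrow> B x = A x"
    and gradE: "\<And>x. x \<in> \<Omega> - K \<Longrightarrow> grad E x = grad G x"
    by (rule neumann_weight_extension[OF assms(1-3)]) blast
  interpret weight \<Omega> K U B G c\<^sub>0 c\<^sub>1 by (rule W)
  have E: "G x = E x" if "x \<in> S" for x using GE that by (simp add: S_def)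
  have grad_eq: "gradient_term \<Omega> A K E t u x = Gr t (D u) x" if "x \<in> S" for u x
    using that GE BA unfolding gradient_term_def Gr_def by (simp add: S_def)
  have mass_eq: "mass_term E t u x = Ms t u x" if "x \<in> S" for u x
    using that GE unfolding mass_term_def Ms_def by (simp add: S_def)
  have hardy_eq: "hardy_term A E t u x = Hd t u x" if "x \<in> S" for u x
    using that GE BA gradE unfolding hardy_term_def Hd_def h_def by (simp add: S_def)
  have conv: "(LINT x:\<Omega>|lebesgue. gradient_term \<Omega> A K E t u x) = (\<integral>x. Gr t (D u) x \<partial>N)"
    "(LINT x:\<Omega>|lebesgue. mass_term E t u x) = (\<integral>x. Ms t u x \<partial>N)"
    "(LINT x:\<Omega>|lebesgue. hardy_term A E t u x) = (\<integral>x. Hd t u x \<partial>N)"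
    "set_integrable lebesgue \<Omega> (gradient_term \<Omega> A K E t u) \<longleftrightarrow> integrable N (Gr t (D u))"
    "set_integrable lebesgue \<Omega> (mass_term E t u) \<longleftrightarrow> integrable N (Ms t u)"
    "set_integrable lebesgue \<Omega> (hardy_term A E t u) \<longleftrightarrow> integrable N (Hd t u)" for u
    by (rule Omega_integral, rule grad_eq mass_eq hardy_eq, assumption)+
  have 1: "weak_gradient (\<Omega> - K) u (wgrad (\<Omega> - K) u) \<and> integrable N (Gr t (D u)) \<and> integrable N (Ms t u) \<and> integrable N (Hd t u) \<and>
      (t - 1/2)\<^sup>2 * (\<integral>x. Hd t u x \<partial>N) \<le> (\<integral>x. Gr t (D u) x \<partial>N) + (1/2 - t) * (\<integral>x. Ms t u x \<partial>N)"
    if u: "u \<in> Y_space \<Omega> K E t" for u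
  proof -
    obtain v where Y: "Yseq t v u" by (rule Y_spaceD[OF E u])
    show ?thesis using Y_limit(1,3-5)[OF assms(4) Y] Y_inequality[OF assms(4) Y] by (simp add: S_def)
  qed
  have 2: "\<exists>u\<in>Y_space \<Omega> K E t. (\<integral>x. Gr t (D u) x \<partial>N) + c * (\<integral>x. Ms t u x \<partial>N) < (t - 1/2)\<^sup>2 * (\<integral>x. Hd t u x \<partial>N)"
    if "c < 1/2 - t" for c
  proof -
    have "0 < 1/2 - t - c" using that by simp
    from mass_constant_optimal[OF this]
    obtain u where u: "u \<in> LC" "(\<integral>x. Qd t u (D u) x \<partial>N) < (1/2 - t - c) * (\<integral>x. Ms t u x \<partial>N)"
      by blast
    then have "(\<integral>x. Gr t (D u) x \<partial>N) + c * (\<integral>x. Ms t u x \<partial>N) < (t - 1/2)\<^sup>2 * (\<integral>x. Hd t u x \<partial>N)"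
      unfolding weighted_identity(2)[OF u(1)] by (simp add: algebra_simps)
    then show ?thesis using LC_subset_Y_space[OF E u(1)] by blast
  qed
  have 3: "\<exists>u\<in>Y_space \<Omega> K E t. (\<integral>x. Gr t (D u) x \<partial>N) + (1/2 - t) * (\<integral>x. Ms t u x \<partial>N) < c * (\<integral>x. Hd t u x \<partial>N)"
    if "c > (t - 1/2)\<^sup>2" for c
  proof -
    have "0 < c - (t - 1/2)\<^sup>2" using that by simp
    from hardy_constant_optimal[OF this]
    obtain u where u: "u \<in> LC" "(\<integral>x. Qd t u (D u) x \<partial>N) < (c - (t - 1/2)\<^sup>2) * (\<integral>x. Hd t u x \<partial>N)"
      by blast
    then have "(\<integral>x. Gr t (D u) x \<partial>N) + (1/2 - t) * (\<integral>x. Ms t u x \<partial>N) < c * (\<integral>x. Hd t u x \<partial>N)"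
      unfolding weighted_identity(2)[OF u(1)] by (simp add: left_diff_distrib)
    then show ?thesis using LC_subset_Y_space[OF E u(1)] by blast
  qed
  have 4: "(\<integral>x. Gr t (D u) x \<partial>N) + (1/2 - t) * (\<integral>x. Ms t u x \<partial>N) \<noteq> (t - 1/2)\<^sup>2 * (\<integral>x. Hd t u x \<partial>N)"
    if u: "u \<in> Y_space \<Omega> K E t" "\<not> (AE x in lebesgue_on \<Omega>. u x = 0)" for u
  proof -
    obtain v where Y: "Yseq t v u" by (rule Y_spaceD[OF E u(1)])
    then show ?thesis using Y_not_attained[OF assms(4) Y] u(2) unfolding AE_Omega_iff by blast
  qed
  show ?thesis
    unfolding conv
  proof (intro conjI ballI allI impI notI)
    fix u assume u: "u \<in> Y_space \<Omega> K E t"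
    from 1[OF u] show "weak_gradient (\<Omega> - K) u (wgrad (\<Omega> - K) u)" "integrable N (Gr t (D u))" "integrable N (Ms t u)"
      "integrable N (Hd t u)"
      "(t - 1/2)\<^sup>2 * (\<integral>x. Hd t u x \<partial>N) \<le> (\<integral>x. Gr t (D u) x \<partial>N) + (1/2 - t) * (\<integral>x. Ms t u x \<partial>N)"
      by blast+
  next
    fix c
    assume c: "c < 1/2 - t"
      and ge: "\<forall>u\<in>Y_space \<Omega> K E t. (t - 1/2)\<^sup>2 * (\<integral>x. Hd t u x \<partial>N) \<le> (\<integral>x. Gr t (D u) x \<partial>N) + c * (\<integral>x. Ms t u x \<partial>N)"
    from 2[OF c] ge show False by (meson not_le)
  next
    fix c
    assume c: "(t - 1/2)\<^sup>2 < c"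
      and ge: "\<forall>u\<in>Y_space \<Omega> K E t. c * (\<integral>x. Hd t u x \<partial>N) \<le> (\<integral>x. Gr t (D u) x \<partial>N) + (1/2 - t) * (\<integral>x. Ms t u x \<partial>N)"
    from 3[OF c] ge show False by (meson not_le)
  next
    fix u
    assume "u \<in> Y_space \<Omega> K E t" "\<not> (AE x in lebesgue_on \<Omega>. u x = 0)"
      "(\<integral>x. Gr t (D u) x \<partial>N) + (1/2 - t) * (\<integral>x. Ms t u x \<partial>N) = (t - 1/2)\<^sup>2 * (\<integral>x. Hd t u x \<partial>N)"
    with 4 show False by blast
  qed
qed

end
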